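(* Let $N,M\ge0$ be integers and $\mu,\nu\in\mathbb{C}$ with $|\Re(\nu)|<M+\frac12$ and $\Re(\mu)<2N-M+\frac12$. Define $R_{N,M}(z,\mu,\nu)$ by $$R_N(z,\mu,\nu)=\frac{2^{\mu+1}}{\Gamma\left(\frac{\nu-\mu+1}{2}\right)\Gamma\left(\frac{1-\mu-\nu}{2}\right)}\Bigg(\pi e^{\frac{\pi}{2}i\mu}\left(\frac{\pi}{-2iz}\right)^{\frac12}e^{iz}\sum_{m=0}^{M-1}\frac{a_m(\nu)}{(-iz)^m}\widehat T_{2N-m-\mu+\frac12}(iz)$$ $$+\pi e^{-\frac{\pi}{2}i\mu}\left(\frac{\pi}{2iz}\right)^{\frac12}e^{-iz}\sum_{m=0}^{M-1}\frac{a_m(\nu)}{(iz)^m}e^{2\pi i\mu}\widehat T_{2N-m-\mu+\frac12}(-iz)+R_{N,M}(z,\mu,\nu)\Bigg).$$ Then for $|\arg z|\le\frac{\pi}{2}$, writing $C=\frac{|\cos(\pi\nu)|}{|\cos(\pi\Re(\nu))|}$, $$|R_{N,M}(z,\mu,\nu)|\le \pi\left|e^{\frac{\pi}{2}i\mu}\right|\left(\frac{\pi}{2|z|}\right)^{\frac12}C\frac{|a_M(\Re\nu)|}{|z|^M}\left|e^{iz}\widehat T_{2N-M-\mu+\frac12}(iz)\right|$$ $$+\pi\left|e^{-\frac{\pi}{2}i\mu}\right|\left(\frac{\pi}{2|z|}\right)^{\frac12}C\frac{|a_M(\Re\nu)|}{|z|^M}\left|e^{2\pi i\mu}e^{-iz}\widehat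 T_{2N-M-\mu+\frac12}(-iz)\right|+\left(\frac{\pi}{2}\right)^{\frac12}|z^\mu|\,C\,\frac{|a_M(\Re\nu)|\,\Gamma\left(2N-M-\Re(\mu)+\frac12\right)}{|z|^{2N+1}}.$$ When $2\Re(\nu)$ is an odd integer, the limiting value of the right-hand side is to be taken.
   Context: $S_{\mu,\nu}$ is the Lommel function (NIST DLMF 11.9); $R_N(z,\mu,\nu)$ is defined by $S_{\mu,\nu}(z)=z^{\mu-1}\sum_{n=0}^{N-1}(-1)^n a_n(-\mu,\nu)z^{-2n}+R_N(z,\mu,\nu)$ with $a_n(\mu,\nu)=2^{2n}\left(\frac{\mu-\nu+1}{2}\right)_n\left(\frac{\mu+\nu+1}{2}\right)_n$. $a_m(\nu)=(-1)^m\frac{(\frac12+\nu)_m(\frac12-\nu)_m}{2^m m!}$. The scaled Terminant function is $\widehat T_p(w)=\frac{e^{\pi ip}\Gamma(p)}{2\pi i}\Gamma(1-p,w)=\frac{e^{\pi ip}w^{1-p}e^{-w}}{2\pi i}\int_0^{\infty}\frac{t^{p-1}e^{-t}}{w+t}dt$ ($\Re p>0$, $|\arg w|<\pi$), extended by analytic continuation. Principal branches throughout. *)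

theory Defs
  imports "HOL-Analysis.Analysis"
begin

section \<open>Bessel functions (DLMF 10.2.2, 10.2.3), principal branches\<close>

definition besselJ :: "complex \<Rightarrow> complex \<Rightarrow> complex" where
  "besselJ \<nu> z = (z / 2) powr \<nu> *
     (\<Sum>k. (- (z^2 / 4)) ^ k / fact k * rGamma (\<nu> + of_nat k + 1))"

definition besselY_gen :: "complex \<Rightarrow> complex \<Rightarrow> complex" where
  "besselY_gen \<nu> z =
     (besselJ \<nu> z * cos (\<nu> * pi) - besselJ (- \<nu>) z) / sin (\<nu> * pi)"

definition besselY :: "complex \<Rightarrow> complex \<Rightarrow> complex" where
  "besselY \<nu> z = (if sin (\<nu> * pi) \<noteq> 0 then besselY_gen \<nu> z
                   else Lim (at \<nu>) (\<lambda>\<nu>'. besselY_gen \<nu>' z))"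

section \<open>Lommel functions (DLMF 11.9.3, 11.9.5)\<close>

definition lommel_ak :: "nat \<Rightarrow> complex \<Rightarrow> complex \<Rightarrow> complex" where
  "lommel_ak k \<mu> \<nu> = (\<Prod>m=1..k. (\<mu> + 2 * of_nat m - 1)^2 - \<nu>^2)"

definition lommel_s :: "complex \<Rightarrow> complex \<Rightarrow> complex \<Rightarrow> complex" where
  "lommel_s \<mu> \<nu> z = z powr (\<mu> + 1) * (\<Sum>k. (- (z ^ 2)) ^ k / lommel_ak (k + 1) \<mu> \<nu>)"

definition lommel_S_gen :: "complex \<Rightarrow> complex \<Rightarrow> complex \<Rightarrow> complex" where
  "lommel_S_gen \<mu> \<nu> z = lommel_s \<mu> \<nu> z
     + 2 powr (\<mu> - 1) * Gamma ((\<mu> + \<nu> + 1) / 2) * Gamma ((\<mu> - \<nu> + 1) / 2)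
       * (sin ((\<mu> - \<nu>) * pi / 2) * besselJ \<nu> z - cos ((\<mu> - \<nu>) * pi / 2) * besselY \<nu> z)"

definition lommel_S :: "complex \<Rightarrow> complex \<Rightarrow> complex \<Rightarrow> complex" where
  "lommel_S \<mu> \<nu> z =
     (if \<exists>k::nat. \<mu> + \<nu> = - (2 * of_nat k + 1) \<or> \<mu> - \<nu> = - (2 * of_nat k + 1)
      then Lim (at \<mu>) (\<lambda>\<mu>'. lommel_S_gen \<mu>' \<nu> z)
      else lommel_S_gen \<mu> \<nu> z)"

definition lommel_an :: "nat \<Rightarrow> complex \<Rightarrow> complex \<Rightarrow> complex" where
  "lommel_an n \<mu> \<nu> = 2 ^ (2 * n) * pochhammer ((\<mu> - \<nu> + 1) / 2) n
                                    * pochhammer ((\<mu> + \<nu> + 1) / 2) n"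

definition hankel_a :: "nat \<Rightarrow> complex \<Rightarrow> complex" where
  "hankel_a m \<nu> = (-1) ^ m * pochhammer (1/2 + \<nu>) m * pochhammer (1/2 - \<nu>) m
                   / (2 ^ m * fact m)"

definition lommel_RN :: "nat \<Rightarrow> complex \<Rightarrow> complex \<Rightarrow> complex \<Rightarrow> complex" where
  "lommel_RN N z \<mu> \<nu> = lommel_S \<mu> \<nu> z
     - z powr (\<mu> - 1) * (\<Sum>n<N. (-1) ^ n * lommel_an n (- \<mu>) \<nu> / z ^ (2 * n))"

text \<open>Integral representation, valid for \<open>Re p > 0\<close>, \<open>|arg w| < pi\<close>.\<close>
definition terminant :: "complex \<Rightarrow> complex \<Rightarrow> complex" where
  "terminant p w = exp (pi * \<i> * p) * w powr (1 - p) * exp (- w) / (2 * pi * \<i>)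
     * (LBINT t:{0<..}. of_real t powr (p - 1) * exp (- of_real t) / (w + of_real t))"

text \<open>Value at \<open>w = r e^{i\<phi>}\<close>, \<open>r > 0\<close>, \<open>-pi \<le> \<phi> \<le> pi\<close>, where \<open>\<phi>\<close> is the (continuously
  varying) argument; on the rays \<open>\<phi> = \<plusminus>pi\<close> the continuous extension (analytic continuation)
  from the open sector is taken.\<close>
definition terminant_polar :: "complex \<Rightarrow> real \<Rightarrow> real \<Rightarrow> complex" where
  "terminant_polar p r \<phi> =
     (if \<bar>\<phi>\<bar> < pi then terminant p (of_real r * cis \<phi>)
      else Lim (at \<phi> within {-pi<..<pi}) (\<lambda>\<psi>. terminant p (of_real r * cis \<psi>)))"

text \<open>Here \<open>z = r e^{i\<theta>}\<close> with \<open>|\<theta>| \<le> pi/2\<close>; \<open>arg(iz) = \<theta> + pi/2\<close>, \<open>arg(-iz) = \<theta> - pi/2\<close>.\<close>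

definition RNM_prefactor :: "complex \<Rightarrow> complex \<Rightarrow> complex" where
  "RNM_prefactor \<mu> \<nu> = 2 powr (\<mu> + 1) * rGamma ((\<nu> - \<mu> + 1) / 2) * rGamma ((1 - \<mu> - \<nu>) / 2)"

definition RNM_gen :: "nat \<Rightarrow> nat \<Rightarrow> complex \<Rightarrow> complex \<Rightarrow> real \<Rightarrow> real \<Rightarrow> complex" where
  "RNM_gen N M \<mu> \<nu> r \<theta> =
    (let z = of_real r * cis \<theta>;
         sq1 = of_real (sqrt (pi / (2 * r))) * cis (- (\<theta> - pi / 2) / 2);
         sq2 = of_real (sqrt (pi / (2 * r))) * cis (- (\<theta> + pi / 2) / 2);
         A = pi * exp (pi / 2 * \<i> * \<mu>) * sq1 * exp (\<i> * z) *
               (\<Sum>m<M. hankel_a m \<nu> / (- \<i> * z) ^ m *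
                  terminant_polar (of_nat (2 * N) - of_nat m - \<mu> + 1/2) r (\<theta> + pi / 2));
         B = pi * exp (- pi / 2 * \<i> * \<mu>) * sq2 * exp (- \<i> * z) *
               (\<Sum>m<M. hankel_a m \<nu> / (\<i> * z) ^ m * exp (2 * pi * \<i> * \<mu>) *
                  terminant_polar (of_nat (2 * N) - of_nat m - \<mu> + 1/2) r (\<theta> - pi / 2))
     in lommel_RN N z \<mu> \<nu> / RNM_prefactor \<mu> \<nu> - A - B)"

text \<open>Where the prefactor vanishes, the defining relation does not determine \<open>R_{N,M}\<close>;
  we take the limiting value in \<open>\<mu>\<close>.\<close>
definition lommel_RNM :: "nat \<Rightarrow> nat \<Rightarrow> complex \<Rightarrow> complex \<Rightarrow> real \<Rightarrow> real \<Rightarrow> complex" where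
  "lommel_RNM N M \<mu> \<nu> r \<theta> =
     (if RNM_prefactor \<mu> \<nu> \<noteq> 0 then RNM_gen N M \<mu> \<nu> r \<theta>
      else Lim (at \<mu>) (\<lambda>\<mu>'. RNM_gen N M \<mu>' \<nu> r \<theta>))"

definition aM_over_cos :: "nat \<Rightarrow> real \<Rightarrow> real" where
  "aM_over_cos M x =
     (if cos (pi * x) \<noteq> 0 then norm (hankel_a M (of_real x)) / \<bar>cos (pi * x)\<bar>
      else Lim (at x) (\<lambda>y. norm (hankel_a M (of_real y)) / \<bar>cos (pi * y)\<bar>))"

end

theory Submission
  imports Defs "HOL-Complex_Analysis.Complex_Analysis" "HOL-Real_Asymp.Real_Asymp"
begin

text \<open>
  The starting point is the representation of \<open>R\<^sub>N\<close> as the prefactor times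
  \<open>(-1)\<^sup>N z\<^sup>\<mu>\<^sup>-\<^sup>1\<^sup>-\<^sup>2\<^sup>N\<close> times the integral of \<open>t\<^sup>2\<^sup>N\<^sup>-\<^sup>\<mu> K\<^sub>\<nu>(t) / (1 + (t/z)\<^sup>2)\<close> over \<open>t > 0\<close>.
  For \<open>N = 0\<close> the difference of the integral and the Lommel series solves Bessel's equation, and
  its coefficients with respect to \<open>J\<^sub>\<nu>\<close>, \<open>J\<^sub>-\<^sub>\<nu>\<close> are Wronskians, which are read off as \<open>z\<close> tends to zero; the
  moments of \<open>K\<^sub>\<nu>\<close> and analytic continuation give all \<open>N\<close>, \<open>\<mu>\<close>, \<open>\<nu>\<close>.

  A Stieltjes representation of \<open>K\<^sub>\<nu>\<close> yields
  \<open>(2t/\<pi>)\<^sup>1\<^sup>/\<^sup>2 e\<^sup>t K\<^sub>\<nu>(t) = (\<Sum>m<M. a\<^sub>m(\<nu>) t\<^sup>-\<^sup>m) + (-1)\<^sup>M t\<^sup>-\<^sup>M G(t)\<close> with \<open>|G| \<le> B\<close> and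
  \<open>|G(t) - G(r)| \<le> |t/r - 1| B\<close>, where \<open>B = |cos (\<pi> \<nu>)| |a\<^sub>M(Re \<nu>)| / |cos (\<pi> Re \<nu>)|\<close>.
  After partial fractions, every \<open>t\<^sup>-\<^sup>m\<close> integrates to a pair of terminants. Writing
  \<open>G(t) = G(r) + (G(t) - G(r))\<close> with \<open>r = |z|\<close>, the constant \<open>G(r)\<close> gives the two terminant terms of the bound,
  and the difference gives the Gamma term because \<open>|t/r - 1| \<le> |1 + (t/z)\<^sup>2|\<close>. The rays
  \<open>arg z = \<plusminus>\<pi>/2\<close> and the exceptional parameters follow by continuity.
\<close>

section \<open>Holomorphic parameter integrals\<close>

text \<open>The rays arg z = \<plusminus>\<pi>/2 shape the bound: there the kernel has a pole on the
  path of integration, at t = |z|, so no estimate through the absolute value of the kernel is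
  uniform in the angle. Evaluating G at exactly that point leaves a difference that vanishes at the
  pole, so the quotient stays bounded; the third term of the bound is the price. The Stieltjes
  representation itself needs |Re \<nu>| < 1/2. Splitting off powers of 1/t one at a time improves
  the convergence of the remaining integral to |Re \<nu>| < M + 1/2, and the identity is continued
  to that strip. The constant B arises by replacing K of order \<nu> with K of order Re \<nu> under
  the integral; the result is a product of Gamma functions, regular where 2 Re \<nu> is an odd
  integer, so it is also the limiting value there. Integrals over t > 0 are taken in x = ln t over
  the whole line: powers become exponentials free of branch choices, and scalings become
  translations. Identities are kept in product form with \<open>rGamma\<close> and sin(\<pi>\<nu>)
  as long as possible, since a quotient form would break down at the parameters that continuation
  has to cross.\<close>

definition locally_dominated :: "'a measure \<Rightarrow> complex set \<Rightarrow> (complex \<Rightarrow> 'a \<Rightarrow> complex) \<Rightarrow> bool" where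
  "locally_dominated M U f \<longleftrightarrow>
     (\<forall>z\<in>U. \<exists>e>0. \<exists>g. ball z e \<subseteq> U \<and> integrable M g \<and>
        (\<forall>w\<in>ball z e. \<forall>t\<in>space M. norm (f w t) \<le> g t))"

text \<open>Cauchy's inequality on the circle of radius \<open>e/4\<close> about \<open>w\<close>,
  which stays inside \<open>ball z e\<close> because \<open>w\<close> is within \<open>e/2\<close>
  of \<open>z\<close>. A bound on the function alone thus controls its derivative, so
  differentiation under the integral needs no separate majorant.\<close>

lemma deriv_bound_ball:
  assumes "f holomorphic_on ball z e" "\<And>w. w \<in> ball z e \<Longrightarrow> norm (f w) \<le> B"
    and "w \<in> ball z (e/2)"
  shows "norm (deriv f w) \<le> B / (e/4)"
proof -
  have e: "e > 0" using assms(3) zero_le_dist[of z w] by (simp del: zero_le_dist)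
  have sub: "cball w (e/4) \<subseteq> ball z e"
  proof
    fix x assume "x \<in> cball w (e/4)"
    then have "dist z x \<le> dist z w + e/4"
      using dist_triangle[of z x w] by simp
    then show "x \<in> ball z e" using assms(3) e by simp
  qed
  have "norm ((deriv ^^ 1) f w) \<le> fact 1 * B / (e/4) ^ 1"
  proof (rule Cauchy_inequality)
    show "f holomorphic_on ball w (e/4)"
      using assms(1) sub by (meson ball_subset_cball holomorphic_on_subset order_trans)
    show "continuous_on (cball w (e/4)) f"
      using assms(1) sub continuous_on_subset holomorphic_on_imp_continuous_on by blast
    show "0 < e/4" using e by simp
    show "norm (f x) \<le> B" if "norm (w - x) = e/4" for x
      by (rule assms(2)) (use sub that in \<open>auto simp: dist_norm subset_iff\<close>)
  qed
  then show ?thesis by simp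
qed

text \<open>By the mean value inequality and \<open>deriv_bound_ball\<close> the difference
  quotients near \<open>z\<close> have the majorant \<open>g t / (e/4)\<close>, so dominated
  convergence applies to them.\<close>

lemma has_field_derivative_integral:
  fixes f :: "complex \<Rightarrow> 'a \<Rightarrow> complex"
  assumes U: "open U" and z: "z \<in> U"
    and meas: "\<And>z. z \<in> U \<Longrightarrow> f z \<in> borel_measurable M"
    and hol: "\<And>t. t \<in> space M \<Longrightarrow> (\<lambda>z. f z t) holomorphic_on U"
    and dom: "locally_dominated M U f"
  shows "((\<lambda>z. \<integral>t. f z t \<partial>M) has_field_derivative (\<integral>t. deriv (\<lambda>z. f z t) z \<partial>M)) (at z)"
    and "integrable M (\<lambda>t. deriv (\<lambda>z. f z t) z)"
proof -
  obtain e g where e: "e > 0" and sub: "ball z e \<subseteq> U" and g: "integrable M g"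
    and fg: "\<And>w t. w \<in> ball z e \<Longrightarrow> t \<in> space M \<Longrightarrow> norm (f w t) \<le> g t"
    using dom z unfolding locally_dominated_def by meson
  have hol': "(\<lambda>z. f z t) holomorphic_on ball z e" if "t \<in> space M" for t
    using hol[OF that] sub by (rule holomorphic_on_subset)
  have bd: "norm (deriv (\<lambda>z. f z t) w) \<le> g t / (e/4)" if "w \<in> ball z (e/2)" "t \<in> space M" for w t
    by (rule deriv_bound_ball[OF hol']) (use that fg in auto)
  have intf: "integrable M (f w)" if "w \<in> ball z e" for w
  proof (rule Bochner_Integration.integrable_bound)
    show "integrable M g" by (rule g)
    show "f w \<in> borel_measurable M" using that sub by (intro meas) blast
    show "AE t in M. norm (f w t) \<le> norm (g t)"
      using fg[OF that] by (intro AE_I2) fastforce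
  qed
  have lip: "norm ((f w t - f z t) / (w - z)) \<le> g t / (e/4)" if "w \<in> ball z (e/2)" "w \<noteq> z" "t \<in> space M" for w t
  proof -
    have "norm (f w t - f z t) \<le> g t / (e/4) * norm (w - z)"
    proof (rule field_differentiable_bound[of "ball z (e/2)" "\<lambda>z. f z t" "\<lambda>w. deriv (\<lambda>z. f z t) w"])
      show "((\<lambda>z. f z t) has_field_derivative deriv (\<lambda>z. f z t) x) (at x within ball z (e/2))"
        if "x \<in> ball z (e/2)" for x
        using that e by (intro holomorphic_derivI[OF hol'[OF \<open>t \<in> space M\<close>]]) auto
    qed (use that bd e in auto)
    then show ?thesis using that e by (simp add: norm_divide field_simps)
  qed
  have lim: "((\<lambda>w. (f w t - f z t) / (w - z)) \<longlongrightarrow> deriv (\<lambda>z. f z t) z) (at z)" if "t \<in> space M" for t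
    using holomorphic_derivI[OF hol'[OF that], of z] e by (simp add: has_field_derivative_iff)
  \<comment> \<open>Dominated convergence is a statement about sequences, so the limit in
    \<open>w\<close> is reduced to arbitrary sequences tending to \<open>z\<close>. The derivative
    is measurable as a pointwise limit of the quotients.\<close>
  have seq: "integrable M (\<lambda>t. deriv (\<lambda>z. f z t) z) \<and>
      (\<lambda>n. \<integral>t. (f (X n) t - f z t) / (X n - z) \<partial>M) \<longlonglongrightarrow> (\<integral>t. deriv (\<lambda>z. f z t) z \<partial>M)"
    if X: "\<And>n. X n \<in> ball z (e/2) - {z}" "X \<longlonglongrightarrow> z" for X :: "nat \<Rightarrow> complex"
  proof -
    have Xl: "(\<lambda>n. (f (X n) t - f z t) / (X n - z)) \<longlonglongrightarrow> deriv (\<lambda>z. f z t) z" if "t \<in> space M" for t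
      using lim[OF that] X unfolding tendsto_at_iff_sequentially by (auto simp: o_def)
    have XB: "X n \<in> ball z e" for n using X(1)[of n] e by auto
    have XU: "X n \<in> U" for n using XB sub by blast
    have m1: "(\<lambda>t. (f (X n) t - f z t) / (X n - z)) \<in> borel_measurable M" for n
      using meas[OF XU[of n]] meas[OF z] by measurable
    have m2: "(\<lambda>t. deriv (\<lambda>z. f z t) z) \<in> borel_measurable M"
      by (rule borel_measurable_LIMSEQ_metric[OF m1 Xl])
    have gi: "integrable M (\<lambda>t. g t / (e/4))" using g by (rule integrable_divide)
    have l: "AE t in M. norm ((f (X n) t - f z t) / (X n - z)) \<le> g t / (e/4)" for n
      using X(1)[of n] by (intro AE_I2 lip) auto
    show ?thesis
      using integral_dominated_convergence[OF m2 m1 gi AE_I2[OF Xl] l]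
        integrable_dominated_convergence[OF m2 m1 gi AE_I2[OF Xl] l] by simp
  qed
  \<comment> \<open>One concrete sequence that avoids \<open>z\<close>, needed to extract from
    \<open>seq\<close> the integrability of the derivative.\<close>
  define X0 where "X0 = (\<lambda>n. z + of_real (e / 4 / real (Suc n)))"
  have "X0 \<longlonglongrightarrow> z + of_real 0"
    unfolding X0_def by (intro tendsto_intros) (real_asymp)
  moreover have "X0 n \<in> ball z (e/2) - {z}" for n
  proof -
    have "e / 4 / real (Suc n) \<le> e/4" using e by (simp add: field_simps)
    then have "e / 4 / real (Suc n) < e/2" using e by linarith
    moreover have "e / 4 / real (Suc n) > 0" using e by simp
    ultimately show ?thesis unfolding X0_def using e
      by (simp add: dist_norm norm_divide del: of_nat_Suc of_real_divide)
  qed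
  ultimately show "integrable M (\<lambda>t. deriv (\<lambda>z. f z t) z)"
    using seq[of X0] by simp
  have "((\<lambda>w. \<integral>t. (f w t - f z t) / (w - z) \<partial>M) \<longlongrightarrow> (\<integral>t. deriv (\<lambda>z. f z t) z \<partial>M)) (at z within ball z (e/2))"
    unfolding tendsto_at_iff_sequentially o_def using seq by blast
  then have "((\<lambda>w. \<integral>t. (f w t - f z t) / (w - z) \<partial>M) \<longlongrightarrow> (\<integral>t. deriv (\<lambda>z. f z t) z \<partial>M)) (at z)"
    by (rule subst[OF at_within_open[of z "ball z (e/2)"], rotated 2, where P = "\<lambda>F. (_ \<longlongrightarrow> _) F"]) (use e in auto)
  moreover have "eventually (\<lambda>w. (\<integral>t. (f w t - f z t) / (w - z) \<partial>M) =
      ((\<integral>t. f w t \<partial>M) - (\<integral>t. f z t \<partial>M)) / (w - z)) (at z)"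
    using eventually_at_ball[OF e, of z UNIV]
  proof eventually_elim
    case (elim w)
    then have "(\<integral>t. f w t - f z t \<partial>M) = (\<integral>t. f w t \<partial>M) - (\<integral>t. f z t \<partial>M)"
      using e by (intro Bochner_Integration.integral_diff intf) auto
    then show ?case by simp
  qed
  ultimately show "((\<lambda>z. \<integral>t. f z t \<partial>M) has_field_derivative (\<integral>t. deriv (\<lambda>z. f z t) z \<partial>M)) (at z)"
    unfolding has_field_derivative_iff by (rule Lim_transform_eventually)
qed

lemma holomorphic_on_integral:
  fixes f :: "complex \<Rightarrow> 'a \<Rightarrow> complex"
  assumes "open U"
    and "\<And>z. z \<in> U \<Longrightarrow> f z \<in> borel_measurable M"
    and "\<And>t. t \<in> space M \<Longrightarrow> (\<lambda>z. f z t) holomorphic_on U"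
    and "locally_dominated M U f"
  shows "(\<lambda>z. \<integral>t. f z t \<partial>M) holomorphic_on U"
  using has_field_derivative_integral(1)[OF assms(1) _ assms(2-4)] assms(1)
  by (auto simp: holomorphic_on_open)

text \<open>Cauchy's inequality again: domination is inherited by derivatives and can therefore be
  iterated to any order.\<close>

lemma locally_dominated_deriv:
  assumes "locally_dominated M U f" and hol: "\<And>t. t \<in> space M \<Longrightarrow> (\<lambda>z. f z t) holomorphic_on U"
  shows "locally_dominated M U (\<lambda>z t. deriv (\<lambda>z. f z t) z)"
  unfolding locally_dominated_def
proof
  fix z assume "z \<in> U"
  then obtain e g where e: "e > 0" and sub: "ball z e \<subseteq> U" and g: "integrable M g"
    and fg: "\<And>w t. w \<in> ball z e \<Longrightarrow> t \<in> space M \<Longrightarrow> norm (f w t) \<le> g t"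
    using assms(1) unfolding locally_dominated_def by meson
  have "norm (deriv (\<lambda>z. f z t) w) \<le> g t / (e/4)" if "w \<in> ball z (e/2)" "t \<in> space M" for w t
    by (rule deriv_bound_ball[of _ z]) (use that fg holomorphic_on_subset[OF hol sub] in auto)
  then show "\<exists>e>0. \<exists>g. ball z e \<subseteq> U \<and> integrable M g \<and>
      (\<forall>w\<in>ball z e. \<forall>t\<in>space M. norm (deriv (\<lambda>z. f z t) w) \<le> g t)"
    using e sub integrable_divide[OF g, of "e/4"]
    by (intro exI[of _ "e/2"] conjI exI[of _ "\<lambda>t. g t / (e/4)"]) auto
qed

lemma locally_dominatedI:
  assumes "\<And>z. z \<in> U \<Longrightarrow> \<exists>e>0. \<exists>g. ball z e \<subseteq> U \<and> integrable M g \<and>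
        (\<forall>w\<in>ball z e. \<forall>t\<in>space M. norm (f w t) \<le> g t)"
  shows "locally_dominated M U f"
  using assms unfolding locally_dominated_def by blast

lemma integrable_locally_dominated:
  assumes "locally_dominated M U f" "z \<in> U" "f z \<in> borel_measurable M"
  shows "integrable M (f z)"
proof -
  obtain e g where e: "e > 0" and g: "integrable M g"
    and fg: "\<And>w t. w \<in> ball z e \<Longrightarrow> t \<in> space M \<Longrightarrow> norm (f w t) \<le> g t"
    using assms(1,2) unfolding locally_dominated_def by meson
  show ?thesis
  proof (rule Bochner_Integration.integrable_bound)
    show "integrable M g" by (rule g)
    show "f z \<in> borel_measurable M" by (rule assms(3))
    show "AE t in M. norm (f z t) \<le> norm (g t)"
      using fg[of z] e by (intro AE_I2) fastforce
  qed
qed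

section \<open>Fubini and change of variables on the real line\<close>

lemma Fubini_lborel:
  fixes f :: "real \<Rightarrow> real \<Rightarrow> complex"
  assumes "case_prod f \<in> borel_measurable (borel \<Otimes>\<^sub>M borel)"
    and "\<And>x. integrable lborel (f x)"
    and "integrable lborel (\<lambda>x. \<integral>y. norm (f x y) \<partial>lborel)"
  shows "(\<integral>x. (\<integral>y. f x y \<partial>lborel) \<partial>lborel) = (\<integral>y. (\<integral>x. f x y \<partial>lborel) \<partial>lborel)"
    and "integrable lborel (\<lambda>y. \<integral>x. f x y \<partial>lborel)"
    and "AE y in lborel. integrable lborel (\<lambda>x. f x y)"
    and "integrable lborel (\<lambda>y. \<integral>x. norm (f x y) \<partial>lborel)"
proof -
  have m: "case_prod f \<in> borel_measurable (lborel \<Otimes>\<^sub>M lborel)"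
    using assms(1) by (simp add: measurable_cong_sets[OF sets_pair_measure_cong[OF sets_lborel sets_lborel] refl])
  have i: "integrable (lborel \<Otimes>\<^sub>M lborel) (case_prod f)"
    by (rule lborel_pair.Fubini_integrable[OF m]) (use assms in auto)
  show "(\<integral>x. (\<integral>y. f x y \<partial>lborel) \<partial>lborel) = (\<integral>y. (\<integral>x. f x y \<partial>lborel) \<partial>lborel)"
    using lborel_pair.Fubini_integral[OF i] by simp
  show "integrable lborel (\<lambda>y. \<integral>x. f x y \<partial>lborel)" 
    using lborel_pair.integrable_snd[OF i] .
  show "AE y in lborel. integrable lborel (\<lambda>x. f x y)"
    using lborel_pair.AE_integrable_snd[OF i] by simp
  have i': "integrable (lborel \<Otimes>\<^sub>M lborel) (case_prod (\<lambda>x y. norm (f x y)))"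
    using integrable_norm[OF i] by (simp add: case_prod_unfold)
  show "integrable lborel (\<lambda>y. \<integral>x. norm (f x y) \<partial>lborel)"
    using lborel_pair.integrable_snd[OF i'] .
qed

text \<open>The change of variables is available for absolutely integrable functions in the gauge
  sense, so both sides are translated there. A function that is not integrable has Lebesgue integral
  0 by convention; integrability transfers in both directions, so the equation of the integrals
  holds in every case.\<close>

lemma lborel_substitution:
  fixes f :: "real \<Rightarrow> complex" and g :: "real \<Rightarrow> real"
  assumes S: "S \<in> sets borel" "g ` S \<in> sets borel"
    and g: "\<And>x. x \<in> S \<Longrightarrow> (g has_field_derivative g' x) (at x)" "inj_on g S"
    and m: "g \<in> borel_measurable borel" "g' \<in> borel_measurable borel" "f \<in> borel_measurable borel"
  shows "set_integrable lborel (g ` S) f \<longleftrightarrow> set_integrable lborel S (\<lambda>x. of_real \<bar>g' x\<bar> * f (g x))"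
    and "(LBINT x:g ` S. f x) = (LBINT x:S. of_real \<bar>g' x\<bar> * f (g x))"
proof -
  have conv: "set_integrable lborel A h \<longleftrightarrow> h absolutely_integrable_on A"
    "(LBINT x:A. h x) = (if h absolutely_integrable_on A then integral A h else 0)"
    if "A \<in> sets borel" "h \<in> borel_measurable borel" for A and h :: "real \<Rightarrow> complex"
  proof -
    have hm: "(\<lambda>x. indicator A x *\<^sub>R h x) \<in> borel_measurable lborel"
      using that by measurable
    show 1: "set_integrable lborel A h \<longleftrightarrow> h absolutely_integrable_on A"
      unfolding set_integrable_def using integrable_completion[OF hm] by blast
    show "(LBINT x:A. h x) = (if h absolutely_integrable_on A then integral A h else 0)"
    proof (cases "set_integrable lborel A h")
      case True
      then have "h absolutely_integrable_on A" using 1 by blast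
      then show ?thesis using set_borel_integral_eq_integral(2)[OF True] by (simp only: if_True)
    next
      case False
      then have "\<not> h absolutely_integrable_on A" using 1 by blast
      moreover have "(LBINT x:A. h x) = 0"
        using False unfolding set_integrable_def set_lebesgue_integral_def
        by (rule not_integrable_integral_eq)
      ultimately show ?thesis by (simp only: if_False)
    qed
  qed
  have m': "(\<lambda>x. of_real \<bar>g' x\<bar> * f (g x)) \<in> borel_measurable borel"
    using m by measurable
  have cv: "(\<lambda>x. \<bar>g' x\<bar> *\<^sub>R f (g x)) absolutely_integrable_on S \<and>
           integral S (\<lambda>x. \<bar>g' x\<bar> *\<^sub>R f (g x)) = b
     \<longleftrightarrow> f absolutely_integrable_on (g ` S) \<and> integral (g ` S) f = b" for b
    by (rule has_absolute_integral_change_of_variables_real)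
       (use S(1) g in \<open>auto intro: has_field_derivative_at_within\<close>)
  have 1: "f absolutely_integrable_on (g ` S) \<longleftrightarrow> (\<lambda>x. of_real \<bar>g' x\<bar> * f (g x)) absolutely_integrable_on S"
    using cv unfolding scaleR_conv_of_real by blast
  have 2: "integral (g ` S) f = integral S (\<lambda>x. of_real \<bar>g' x\<bar> * f (g x))"
    if "f absolutely_integrable_on (g ` S)"
    using cv[of "integral (g ` S) f"] that unfolding scaleR_conv_of_real by metis
  show "set_integrable lborel (g ` S) f \<longleftrightarrow> set_integrable lborel S (\<lambda>x. of_real \<bar>g' x\<bar> * f (g x))"
    by (rule trans[OF conv(1)[OF S(2) m(3)] trans[OF 1 conv(1)[OF S(1) m', symmetric]]])
  show "(LBINT x:g ` S. f x) = (LBINT x:S. of_real \<bar>g' x\<bar> * f (g x))"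
  proof (cases "f absolutely_integrable_on (g ` S)")
    case True
    show ?thesis
      by (subst conv(2)[OF S(2) m(3)], subst conv(2)[OF S(1) m'], subst 2[OF True])
         (simp only: True 1[THEN iffD1, OF True] if_True)
  next
    case False
    then have "\<not> (\<lambda>x. of_real \<bar>g' x\<bar> * f (g x)) absolutely_integrable_on S"
      using 1 by blast
    then show ?thesis
      by (subst conv(2)[OF S(2) m(3)], subst conv(2)[OF S(1) m']) (simp only: False if_False)
  qed
qed

section \<open>Gamma and Beta integrals in the variable x = ln t\<close>

lemma range_exp_real: "range (exp :: real \<Rightarrow> real) = {0<..}"
  by (auto simp: image_iff) (metis exp_ln)

lemma inj_exp_real: "inj (exp :: real \<Rightarrow> real)"
  by (auto intro: injI)

text \<open>Euler's integral after t = e^x gives the case c = 1; a translation of x by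
  \<open>ln c\<close> produces general \<open>c\<close>. The factor c^(-a) is written with
  \<open>exp\<close> and the real logarithm to stay clear of branches.\<close>

lemma Gamma_exp_integral:
  fixes a :: complex and c :: real
  assumes a: "Re a > 0" and c: "c > 0"
  shows "integrable lborel (\<lambda>x. exp (a * of_real x - of_real (c * exp x)))"
    and "(\<integral>x. exp (a * of_real x - of_real (c * exp x)) \<partial>lborel) = Gamma a * exp (- a * of_real (ln c))"
proof -
  define f :: "real \<Rightarrow> complex" where "f = (\<lambda>t. if t > 0 then of_real t powr (a - 1) / of_real (exp t) else 0)"
  define h :: "real \<Rightarrow> complex" where "h = (\<lambda>x. exp (a * of_real x - of_real (exp x)))"
  have f_eq: "f t = exp ((a - 1) * of_real (ln t)) / of_real (exp t)" if "t > 0" for t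
    using that by (simp add: f_def powr_def Ln_of_real)
  have fm [measurable]: "f \<in> borel_measurable borel"
  proof -
    have "f = (\<lambda>t. if t > 0 then exp ((a - 1) * of_real (ln t)) / of_real (exp t) else 0)"
      using f_eq by (auto simp: f_def)
    then show ?thesis by simp
  qed
  have A: "f absolutely_integrable_on {0<..}"
    using absolutely_integrable_Gamma_integral'[OF a]
    by (rule set_integrable_cong[THEN iffD1, rotated -1]) (auto simp: f_def)
  have "(\<lambda>t. indicator {0<..} t *\<^sub>R f t) \<in> borel_measurable lborel" by measurable
  then have B: "set_integrable lborel {0<..} f"
    using A integrable_completion unfolding set_integrable_def by blast
  have "(f has_integral Gamma a) {0<..}"
    using Gamma_integral_complex'[OF a] by (rule has_integral_eq[rotated]) (auto simp: f_def)
  then have C: "(LBINT t:{0<..}. f t) = Gamma a"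
    using set_borel_integral_eq_integral(2)[OF B] by (simp add: integral_unique)
  have h_eq: "of_real \<bar>exp x\<bar> * f (exp x) = h x" for x
    unfolding f_eq[OF exp_gt_zero] h_def
    by (simp add: exp_of_real[symmetric] exp_add[symmetric] exp_diff[symmetric] algebra_simps)
  note sub = lborel_substitution[of UNIV exp exp f, simplified range_exp_real h_eq]
  have "set_integrable lborel UNIV h" using sub(1) B inj_exp_real by (auto intro: DERIV_exp)
  then have h1: "integrable lborel h" by (simp add: set_integrable_def)
  have "(LBINT x:UNIV. h x) = Gamma a" using sub(2) C inj_exp_real by (auto intro: DERIV_exp)
  then have h2: "integral\<^sup>L lborel h = Gamma a" by (simp add: set_lebesgue_integral_def)
  have sh: "h (ln c + 1 * x) = exp (a * of_real (ln c)) * exp (a * of_real x - of_real (c * exp x))" for x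
    using c unfolding h_def by (simp add: exp_add[symmetric] exp_add algebra_simps)
  have "integrable lborel (\<lambda>x. h (ln c + 1 * x))"
    by (rule lborel_integrable_real_affine[OF h1]) simp
  then have "integrable lborel (\<lambda>x. exp (- (a * of_real (ln c))) * h (ln c + 1 * x))"
    by (rule integrable_mult_right)
  then show 1: "integrable lborel (\<lambda>x. exp (a * of_real x - of_real (c * exp x)))"
    unfolding sh mult.assoc[symmetric] by (simp add: exp_minus)
  have "exp (a * of_real (ln c)) * (\<integral>x. exp (a * of_real x - of_real (c * exp x)) \<partial>lborel) = Gamma a"
    using lborel_integral_real_affine[of 1 h "ln c"] h2 unfolding sh by simp
  then show "(\<integral>x. exp (a * of_real x - of_real (c * exp x)) \<partial>lborel) = Gamma a * exp (- a * of_real (ln c))"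
    by (simp add: exp_minus field_simps)
qed

lemma Gamma_exp_integral_real:
  fixes s c :: real
  assumes s: "s > 0" and c: "c > 0"
  shows "integrable lborel (\<lambda>x. exp (s * x - c * exp x))"
    and "(\<integral>x. exp (s * x - c * exp x) \<partial>lborel) = Gamma s * exp (- s * ln c)"
proof -
  have eq: "exp (of_real s * of_real x - of_real (c * exp x)) = complex_of_real (exp (s * x - c * exp x))" for x
    by (simp add: exp_of_real[symmetric])
  have i: "integrable lborel (\<lambda>x. complex_of_real (exp (s * x - c * exp x)))"
    using Gamma_exp_integral(1)[of "of_real s" c] s c unfolding eq by simp
  then show "integrable lborel (\<lambda>x. exp (s * x - c * exp x))" by (rule complex_of_real_integrable_eq[THEN iffD1])
  have "complex_of_real (\<integral>x. exp (s * x - c * exp x) \<partial>lborel) = of_real (Gamma s * exp (- s * ln c))"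
    using Gamma_exp_integral(2)[of "of_real s" c] s c unfolding eq
    by (simp add: Gamma_complex_of_real exp_of_real[symmetric] del: of_real_exp of_real_mult of_real_diff)
       (simp add: exp_of_real[symmetric])
  then show "(\<integral>x. exp (s * x - c * exp x) \<partial>lborel) = Gamma s * exp (- s * ln c)"
    using of_real_eq_iff by blast
qed

lemma Gamma_nonzero_Re_pos:
  fixes z :: complex
  assumes "Re z > 0"
  shows "Gamma z \<noteq> 0"
proof -
  have "z \<notin> \<int>\<^sub>\<le>\<^sub>0" using assms by (auto elim!: nonpos_Ints_cases)
  then show ?thesis by (simp add: Gamma_eq_zero_iff)
qed

lemma integrable_cmult_cancel:
  fixes c :: complex
  assumes "integrable M (\<lambda>x. c * f x)" "c \<noteq> 0"
  shows "integrable M f"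
  using integrable_mult_right[OF assms(1), of "inverse c"] assms(2) by (simp add: mult.assoc[symmetric])

text \<open>Two orders of integration of exp((a+b)y - e^y(1+e^x) + ax): over x first, two Gamma
  integrals give \<Gamma>(a)\<Gamma>(b); over y first, one gives \<Gamma>(a+b) times the integrand
  below. Up to the variable e^x/(1+e^x) this is Euler's Beta integral.\<close>

lemma Beta_exp_integral:
  fixes a b :: complex
  assumes a: "Re a > 0" and b: "Re b > 0"
  shows "integrable lborel (\<lambda>x. exp (a * of_real x - (a + b) * of_real (ln (1 + exp x))))"
    and "(\<integral>x. exp (a * of_real x - (a + b) * of_real (ln (1 + exp x))) \<partial>lborel) = Gamma a * Gamma b / Gamma (a + b)"
proof -
  define f :: "real \<Rightarrow> real \<Rightarrow> complex" where
    "f = (\<lambda>y x. exp ((a + b) * of_real y - of_real (exp y * (1 + exp x)) + a * of_real x))"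
  have fy: "f y x = exp ((a + b) * of_real y - of_real (exp y)) * exp (a * of_real x - of_real (exp y * exp x))" for y x
    by (simp add: f_def exp_add[symmetric] algebra_simps)
  have fx: "f y x = exp (a * of_real x) * exp ((a + b) * of_real y - of_real ((1 + exp x) * exp y))" for y x
    by (simp add: f_def exp_add[symmetric] algebra_simps)
  have m: "case_prod f \<in> borel_measurable (borel \<Otimes>\<^sub>M borel)"
    unfolding f_def by measurable
  have i1: "integrable lborel (f y)" for y
    unfolding fy using Gamma_exp_integral(1)[OF a, of "exp y"] by simp
  have inx: "(\<integral>x. f y x \<partial>lborel) = Gamma a * exp (b * of_real y - of_real (1 * exp y))" for y
  proof -
    have "(\<integral>x. f y x \<partial>lborel) = exp ((a + b) * of_real y - of_real (exp y)) * (Gamma a * exp (- a * of_real y))"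
      unfolding fy using Gamma_exp_integral(2)[OF a, of "exp y"] by simp
    also have "\<dots> = Gamma a * (exp ((a + b) * of_real y - of_real (exp y)) * exp (- a * of_real y))"
      by (simp add: mult_ac)
    finally show ?thesis unfolding exp_add[symmetric] by (simp add: algebra_simps)
  qed
  have nf: "norm (f y x) = exp (Re (a + b) * y - exp y) * exp (Re a * x - exp y * exp x)" for x y
    by (simp add: fy norm_mult)
  have inn: "(\<integral>x. norm (f y x) \<partial>lborel) = Gamma (Re a) * exp (Re b * y - 1 * exp y)" for y
  proof -
    have "(\<integral>x. norm (f y x) \<partial>lborel) = exp (Re (a + b) * y - exp y) * (Gamma (Re a) * exp (- Re a * y))"
      unfolding nf using Gamma_exp_integral_real(2)[OF a, of "exp y"] by simp
    also have "\<dots> = Gamma (Re a) * (exp (Re (a + b) * y - exp y) * exp (- Re a * y))"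
      by (simp add: mult_ac)
    finally show ?thesis unfolding exp_add[symmetric] by (simp add: algebra_simps)
  qed
  have i2: "integrable lborel (\<lambda>y. \<integral>x. norm (f y x) \<partial>lborel)"
    unfolding inn using Gamma_exp_integral_real(1)[OF b, of 1] by simp
  have iny: "(\<integral>y. f y x \<partial>lborel) = Gamma (a + b) * exp (a * of_real x - (a + b) * of_real (ln (1 + exp x)))" for x
  proof -
    have "(\<integral>y. f y x \<partial>lborel) = exp (a * of_real x) * (Gamma (a + b) * exp (- (a + b) * of_real (ln (1 + exp x))))"
      unfolding fx using Gamma_exp_integral(2)[of "a + b" "1 + exp x"] a b add_pos_pos[of 1 "exp x"]
      by (simp only: integral_mult_right_zero plus_complex.sel) simp
    also have "\<dots> = Gamma (a + b) * (exp (a * of_real x) * exp (- (a + b) * of_real (ln (1 + exp x))))"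
      by (simp add: mult_ac)
    finally show ?thesis unfolding exp_add[symmetric] by (simp add: algebra_simps)
  qed
  have G: "Gamma (a + b) \<noteq> 0"
    using a b by (intro Gamma_nonzero_Re_pos) simp
  note F = Fubini_lborel[OF m i1 i2]
  show "integrable lborel (\<lambda>x. exp (a * of_real x - (a + b) * of_real (ln (1 + exp x))))"
    using F(2) unfolding iny by (rule integrable_cmult_cancel[OF _ G])
  have "Gamma a * Gamma b = Gamma (a + b) * (\<integral>x. exp (a * of_real x - (a + b) * of_real (ln (1 + exp x))) \<partial>lborel)"
    using F(1) Gamma_exp_integral(2)[OF b, of 1] unfolding inx iny by simp
  then show "(\<integral>x. exp (a * of_real x - (a + b) * of_real (ln (1 + exp x))) \<partial>lborel) = Gamma a * Gamma b / Gamma (a + b)"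
    using G by (simp add: field_simps)
qed

section \<open>The modified Bessel function \<open>K\<close>\<close>

lemma cosh_ge_half_exp_abs: "exp \<bar>y\<bar> / 2 \<le> cosh (y::real)"
  by (cases "y \<ge> 0") (simp_all add: cosh_field_def)

lemma cosh_le_exp_abs: "cosh (y::real) \<le> exp \<bar>y\<bar>"
  by (cases "y \<ge> 0") (simp_all add: cosh_field_def)

lemma abs_sinh_le_exp_abs: "\<bar>sinh (y::real)\<bar> \<le> exp \<bar>y\<bar>"
  using sinh_less_cosh_real[of y] sinh_less_cosh_real[of "-y"] cosh_le_exp_abs[of y] by simp

text \<open>Since cosh y is at least e^|y|/2, the integrand is below a Gamma integrand plus its
  mirror image. It serves as the common majorant for the integrals defining K.\<close>

lemma integrable_exp_abs_cosh:
  fixes \<sigma> \<delta> :: real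
  assumes "\<delta> > 0"
  shows "integrable lborel (\<lambda>y. exp (\<sigma> * \<bar>y\<bar> - \<delta> * cosh y))"
proof -
  \<comment> \<open>The Gamma integral needs a positive exponent, whereas \<open>\<sigma>\<close>
    may have any sign.\<close>
  define s where "s = \<bar>\<sigma>\<bar> + 1"
  have s: "s > 0" "s \<ge> \<sigma>" by (auto simp: s_def)
  have 1: "integrable lborel (\<lambda>x. exp (s * x - \<delta> / 2 * exp x))"
    using Gamma_exp_integral_real(1)[of s "\<delta> / 2"] s assms by simp
  then have 2: "integrable lborel (\<lambda>x. exp (s * (0 + (-1) * x) - \<delta> / 2 * exp (0 + (-1) * x)))"
    by (rule lborel_integrable_real_affine) simp
  have le: "\<sigma> * \<bar>y\<bar> - \<delta> * cosh y \<le> s * \<bar>y\<bar> - \<delta> / 2 * exp \<bar>y\<bar>" for y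
  proof -
    have "\<sigma> * \<bar>y\<bar> \<le> s * \<bar>y\<bar>" using s(2) by (intro mult_right_mono) auto
    moreover have "\<delta> * (exp \<bar>y\<bar> / 2) \<le> \<delta> * cosh y"
      using assms by (intro mult_left_mono cosh_ge_half_exp_abs) auto
    ultimately show ?thesis by simp
  qed
  show ?thesis
  proof (rule Bochner_Integration.integrable_bound)
    show "integrable lborel (\<lambda>x. exp (s * x - \<delta> / 2 * exp x) + exp (s * (0 + (-1) * x) - \<delta> / 2 * exp (0 + (-1) * x)))"
      using 1 2 by (rule Bochner_Integration.integrable_add)
    show "AE y in lborel. norm (exp (\<sigma> * \<bar>y\<bar> - \<delta> * cosh y)) \<le>
        norm (exp (s * y - \<delta> / 2 * exp y) + exp (s * (0 + (-1) * y) - \<delta> / 2 * exp (0 + (-1) * y)))"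
    proof (intro AE_I2)
      fix y
      have "exp (\<sigma> * \<bar>y\<bar> - \<delta> * cosh y) \<le> exp (s * \<bar>y\<bar> - \<delta> / 2 * exp \<bar>y\<bar>)" using le by simp
      also have "\<dots> \<le> exp (s * y - \<delta> / 2 * exp y) + exp (s * (0 + (-1) * y) - \<delta> / 2 * exp (0 + (-1) * y))"
        by (cases "y \<ge> 0") simp_all
      finally show "norm (exp (\<sigma> * \<bar>y\<bar> - \<delta> * cosh y)) \<le>
        norm (exp (s * y - \<delta> / 2 * exp y) + exp (s * (0 + (-1) * y) - \<delta> / 2 * exp (0 + (-1) * y)))"
        by (smt (verit) exp_gt_zero real_norm_def)
    qed
    have "(\<lambda>y. exp (\<sigma> * \<bar>y\<bar> - \<delta> * cosh y)) \<in> borel_measurable borel"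
      by (intro borel_measurable_continuous_onI continuous_intros)
    then show "(\<lambda>y. exp (\<sigma> * \<bar>y\<bar> - \<delta> * cosh y)) \<in> borel_measurable lborel" by simp
  qed
qed

definition besselK_int :: "nat \<Rightarrow> complex \<Rightarrow> complex \<Rightarrow> real \<Rightarrow> complex" where
  "besselK_int n \<nu> z y = of_real (cosh y) ^ n * exp (\<nu> * of_real y - z * of_real (cosh y))"

text \<open>Each differentiation in \<open>z\<close> brings down a factor -cosh y, so for Re z > 0
  this is (-1)^n times the n-th derivative of K in \<open>z\<close>. The factor 1/2 is due to
  integrating over the whole line instead of y > 0.\<close>

definition besselK_mom :: "nat \<Rightarrow> complex \<Rightarrow> complex \<Rightarrow> complex" where
  "besselK_mom n \<nu> z = (\<integral>y. besselK_int n \<nu> z y \<partial>lborel) / 2"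

abbreviation besselK :: "complex \<Rightarrow> complex \<Rightarrow> complex" where
  "besselK \<equiv> besselK_mom 0"

text \<open>K at real order and argument, as a real number. It bounds K at any order with real part
  \<open>\<sigma>\<close> and any argument with real part \<open>x\<close>, and is decreasing in
  \<open>x\<close>, which makes it the natural majorant.\<close>

definition besselKr :: "real \<Rightarrow> real \<Rightarrow> real" where
  "besselKr \<sigma> x = (\<integral>y. exp (\<sigma> * y - x * cosh y) \<partial>lborel) / 2"

lemma besselK_int_measurable [measurable]: "besselK_int n \<nu> z \<in> borel_measurable borel"
  unfolding besselK_int_def [abs_def]
  by (intro borel_measurable_continuous_onI continuous_intros)

lemma norm_besselK_int_le:
  "norm (besselK_int n \<nu> z y) \<le> exp ((\<bar>Re \<nu>\<bar> + real n) * \<bar>y\<bar> - Re z * cosh y)"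
proof -
  have "norm (besselK_int n \<nu> z y) = cosh y ^ n * exp (Re \<nu> * y - Re z * cosh y)"
    by (simp add: besselK_int_def norm_mult norm_power)
  also have "\<dots> \<le> exp \<bar>y\<bar> ^ n * exp (\<bar>Re \<nu>\<bar> * \<bar>y\<bar> - Re z * cosh y)"
    using cosh_le_exp_abs[of y] abs_ge_self[of "Re \<nu> * y"]
    by (intro mult_mono power_mono) (auto simp: abs_mult)
  also have "\<dots> = exp ((\<bar>Re \<nu>\<bar> + real n) * \<bar>y\<bar> - Re z * cosh y)"
    by (simp add: exp_of_nat_mult[symmetric] exp_add[symmetric] algebra_simps)
  finally show ?thesis .
qed

lemma integrable_besselK_int:
  assumes "Re z > 0"
  shows "integrable lborel (besselK_int n \<nu> z)"
proof (rule Bochner_Integration.integrable_bound)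
  show "integrable lborel (\<lambda>y. exp ((\<bar>Re \<nu>\<bar> + real n) * \<bar>y\<bar> - Re z * cosh y))"
    by (rule integrable_exp_abs_cosh[OF assms])
  show "AE y in lborel. norm (besselK_int n \<nu> z y) \<le> norm (exp ((\<bar>Re \<nu>\<bar> + real n) * \<bar>y\<bar> - Re z * cosh y))"
    using norm_besselK_int_le by simp
qed simp

lemma open_Re_pos: "open {z::complex. Re z > 0}"
  by (simp add: open_halfspace_Re_gt)

lemma locally_dominated_besselK_int: "locally_dominated lborel {z. Re z > 0} (besselK_int n \<nu>)"
proof (rule locally_dominatedI)
  fix z :: complex assume "z \<in> {z. Re z > 0}"
  then have z: "Re z > 0" by simp
  have le: "Re w \<ge> Re z / 2" if "w \<in> ball z (Re z / 2)" for w
    using that abs_Re_le_cmod[of "z - w"] by (simp add: dist_norm)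
  show "\<exists>e>0. \<exists>g. ball z e \<subseteq> {z. Re z > 0} \<and> integrable lborel g \<and>
        (\<forall>w\<in>ball z e. \<forall>t\<in>space lborel. norm (besselK_int n \<nu> w t) \<le> g t)"
  proof (intro exI[of _ "Re z / 2"] exI[of _ "\<lambda>y. exp ((\<bar>Re \<nu>\<bar> + real n) * \<bar>y\<bar> - Re z / 2 * cosh y)"] conjI ballI)
    show "ball z (Re z / 2) \<subseteq> {z. Re z > 0}" using le z by force
    show "norm (besselK_int n \<nu> w t) \<le> exp ((\<bar>Re \<nu>\<bar> + real n) * \<bar>t\<bar> - Re z / 2 * cosh t)"
      if "w \<in> ball z (Re z / 2)" for w t
      using norm_besselK_int_le[of n \<nu> w t] mult_right_mono[OF le[OF that], of "cosh t"]
      by (smt (verit) cosh_real_nonneg exp_le_cancel_iff)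
  qed (use z integrable_exp_abs_cosh[of "Re z / 2"] in auto)
qed

lemma has_field_derivative_besselK_mom:
  assumes "Re z > 0"
  shows "(besselK_mom n \<nu> has_field_derivative - besselK_mom (Suc n) \<nu> z) (at z)"
proof -
  have d: "((\<lambda>z. besselK_int n \<nu> z y) has_field_derivative - besselK_int (Suc n) \<nu> w y) (at w)" for y w
    unfolding besselK_int_def by (auto intro!: derivative_eq_intros)
  have "((\<lambda>z. \<integral>y. besselK_int n \<nu> z y \<partial>lborel) has_field_derivative (\<integral>y. deriv (\<lambda>z. besselK_int n \<nu> z y) z \<partial>lborel)) (at z)"
    by (rule has_field_derivative_integral(1)[OF open_Re_pos _ _ _ locally_dominated_besselK_int])
       (use assms d in \<open>auto simp: holomorphic_on_open[OF open_Re_pos]\<close>)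
  from DERIV_cdivide[OF this, of 2] show ?thesis
    unfolding besselK_mom_def[abs_def] DERIV_imp_deriv[OF d] by simp
qed

lemma besselK_mom_holomorphic: "besselK_mom n \<nu> holomorphic_on {z. Re z > 0}"
  using has_field_derivative_besselK_mom by (auto simp: holomorphic_on_open[OF open_Re_pos])

lemma besselK_order_holomorphic:
  assumes z: "Re z > 0"
  shows "(\<lambda>\<nu>. besselK_mom n \<nu> z) holomorphic_on UNIV"
  unfolding besselK_mom_def
proof (intro holomorphic_on_divide holomorphic_on_integral locally_dominatedI)
  fix \<nu> :: complex
  have le: "\<bar>Re w\<bar> \<le> \<bar>Re \<nu>\<bar> + 1" if "w \<in> ball \<nu> 1" for w
    using that abs_Re_le_cmod[of "\<nu> - w"] by (simp add: dist_norm)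
  show "\<exists>e>0. \<exists>g. ball \<nu> e \<subseteq> UNIV \<and> integrable lborel g \<and>
        (\<forall>w\<in>ball \<nu> e. \<forall>t\<in>space lborel. norm (besselK_int n w z t) \<le> g t)"
  proof (intro exI[of _ 1] exI[of _ "\<lambda>y. exp ((\<bar>Re \<nu>\<bar> + 1 + real n) * \<bar>y\<bar> - Re z * cosh y)"] conjI ballI)
    show "norm (besselK_int n w z t) \<le> exp ((\<bar>Re \<nu>\<bar> + 1 + real n) * \<bar>t\<bar> - Re z * cosh t)"
      if "w \<in> ball \<nu> 1" for w t
      using norm_besselK_int_le[of n w z t] mult_right_mono[OF le[OF that], of "\<bar>t\<bar>"]
      by (smt (verit) exp_le_cancel_iff distrib_right)
  qed (use z integrable_exp_abs_cosh in auto)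
qed (auto simp: besselK_int_def[symmetric] simp flip: besselK_int_def, (auto simp: besselK_int_def intro!: holomorphic_intros)?)

lemma besselK_of_real:
  fixes \<sigma> x :: real
  shows "besselK (of_real \<sigma>) (of_real x) = of_real (besselKr \<sigma> x)"
proof -
  have "besselK_int 0 (of_real \<sigma>) (of_real x) y = of_real (exp (\<sigma> * y - x * cosh y))" for y
    by (simp add: besselK_int_def exp_of_real[symmetric])
  then show ?thesis by (simp add: besselK_mom_def besselKr_def)
qed

lemma integrable_besselKr:
  fixes \<sigma> x :: real
  assumes "x > 0"
  shows "integrable lborel (\<lambda>y. exp (\<sigma> * y - x * cosh y))"
  using integrable_norm[OF integrable_besselK_int[of "of_real x" 0 "of_real \<sigma>"]] assms
  by (simp add: besselK_int_def norm_mult)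

lemma norm_besselK_le:
  assumes "Re z > 0"
  shows "norm (besselK \<nu> z) \<le> besselKr (Re \<nu>) (Re z)"
proof -
  have "norm (\<integral>y. besselK_int 0 \<nu> z y \<partial>lborel) \<le> (\<integral>y. norm (besselK_int 0 \<nu> z y) \<partial>lborel)"
    by (rule integral_norm_bound)
  also have "\<dots> = (\<integral>y. exp (Re \<nu> * y - Re z * cosh y) \<partial>lborel)"
    by (simp add: besselK_int_def norm_mult)
  finally show ?thesis by (simp add: besselK_mom_def besselKr_def norm_divide)
qed

lemma besselKr_nonneg: "besselKr \<sigma> x \<ge> 0"
  unfolding besselKr_def by simp

lemma besselKr_antimono:
  assumes "0 < x" "x \<le> y"
  shows "besselKr \<sigma> y \<le> besselKr \<sigma> x"
  unfolding besselKr_def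
  using assms by (intro divide_right_mono integral_mono integrable_besselKr) (auto intro: mult_right_mono)

lemma besselK_minus_order: "besselK (- \<nu>) z = besselK \<nu> z"
  unfolding besselK_mom_def
  by (subst lborel_integral_real_affine[of "-1" _ 0]) (simp_all add: besselK_int_def[abs_def])

text \<open>With sinh^2 = cosh^2 - 1, the combination of integrands is the exact y-derivative of (-z
  sinh y - \<nu>) exp(\<nu>y - z cosh y), which vanishes at both ends. The three moments stand for
  K, -K' and K'', so this is the modified Bessel equation.\<close>

lemma besselK_ode:
  assumes z: "Re z > 0"
  shows "z\<^sup>2 * besselK_mom 2 \<nu> z - z * besselK_mom 1 \<nu> z - (z\<^sup>2 + \<nu>\<^sup>2) * besselK \<nu> z = 0"
proof -
  define G where "G = (\<lambda>y::real. (- z * of_real (sinh y) - \<nu>) * exp (\<nu> * of_real y - z * of_real (cosh y)))"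
  define g where "g = (\<lambda>y. z\<^sup>2 * besselK_int 2 \<nu> z y - z * besselK_int 1 \<nu> z y - (z\<^sup>2 + \<nu>\<^sup>2) * besselK_int 0 \<nu> z y)"
  have der: "(G has_vector_derivative g y) (at y)" for y
  proof -
    have sq: "(complex_of_real (sinh y))\<^sup>2 = (of_real (cosh y))\<^sup>2 - 1"
      by (simp add: sinh_square_eq flip: of_real_power)
    have "(G has_vector_derivative (- z * of_real (cosh y)) * exp (\<nu> * of_real y - z * of_real (cosh y)) +
        (- z * of_real (sinh y) - \<nu>) * ((\<nu> - z * of_real (sinh y)) * exp (\<nu> * of_real y - z * of_real (cosh y)))) (at y)"
    proof -
      have e: "((\<lambda>y. exp (\<nu> * of_real y - z * of_real (cosh y))) has_vector_derivative
          (\<nu> - z * of_real (sinh y)) * exp (\<nu> * of_real y - z * of_real (cosh y))) (at y)"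
      proof -
        have "((\<lambda>y. \<nu> * of_real y - z * of_real (cosh y)) has_vector_derivative \<nu> - z * of_real (sinh y)) (at y)"
          by (auto intro!: derivative_eq_intros)
        from field_vector_diff_chain_at[OF this DERIV_exp] show ?thesis by (simp add: o_def)
      qed
      have s: "((\<lambda>y. - z * of_real (sinh y) - \<nu>) has_vector_derivative - z * of_real (cosh y)) (at y)"
        by (auto intro!: derivative_eq_intros)
      show ?thesis
        using has_vector_derivative_mult[OF s e] unfolding G_def by (simp add: algebra_simps)
    qed
    also have "(- z * of_real (cosh y)) * exp (\<nu> * of_real y - z * of_real (cosh y)) +
        (- z * of_real (sinh y) - \<nu>) * ((\<nu> - z * of_real (sinh y)) * exp (\<nu> * of_real y - z * of_real (cosh y)))
       = (z\<^sup>2 * (of_real (sinh y))\<^sup>2 - z * of_real (cosh y) - \<nu>\<^sup>2) * exp (\<nu> * of_real y - z * of_real (cosh y))"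
      by (simp add: algebra_simps power2_eq_square)
    also have "\<dots> = g y"
      unfolding sq g_def besselK_int_def by (simp add: algebra_simps power2_eq_square)
    finally show ?thesis .
  qed
  have int: "integrable lborel g"
    unfolding g_def using integrable_besselK_int[OF z] by (intro Bochner_Integration.integrable_diff integrable_mult_right) auto
  have cont: "isCont g y" for y
  proof -
    have "continuous_on UNIV g" unfolding g_def besselK_int_def by (intro continuous_intros)
    then show ?thesis by (simp add: continuous_on_eq_continuous_at)
  qed
  define \<phi> where "\<phi> = (\<lambda>x::real. (norm z + norm \<nu>) * exp ((\<bar>Re \<nu>\<bar> + 1) * x - Re z / 2 * exp x))"
  have bd: "norm (G y) \<le> \<phi> \<bar>y\<bar>" for y
  proof -
    have "norm (- z * of_real (sinh y) - \<nu>) \<le> norm z * \<bar>sinh y\<bar> + norm \<nu>"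
      by (rule order_trans[OF norm_triangle_ineq4]) (simp add: norm_mult)
    also have "\<dots> \<le> norm z * exp \<bar>y\<bar> + norm \<nu> * exp \<bar>y\<bar>"
      using mult_left_mono[OF abs_sinh_le_exp_abs[of y], of "norm z"] mult_left_mono[of 1 "exp \<bar>y\<bar>" "norm \<nu>"] by simp
    finally have 1: "norm (- z * of_real (sinh y) - \<nu>) \<le> (norm z + norm \<nu>) * exp \<bar>y\<bar>" by (simp add: algebra_simps)
    have "Re \<nu> * y \<le> \<bar>Re \<nu>\<bar> * \<bar>y\<bar>" by (metis abs_ge_self abs_mult)
    moreover have "Re z * (exp \<bar>y\<bar> / 2) \<le> Re z * cosh y"
      using z by (intro mult_left_mono cosh_ge_half_exp_abs) auto
    ultimately have 2: "norm (exp (\<nu> * of_real y - z * of_real (cosh y))) \<le> exp (\<bar>Re \<nu>\<bar> * \<bar>y\<bar> - Re z / 2 * exp \<bar>y\<bar>)"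
      by simp
    have "norm (G y) \<le> ((norm z + norm \<nu>) * exp \<bar>y\<bar>) * exp (\<bar>Re \<nu>\<bar> * \<bar>y\<bar> - Re z / 2 * exp \<bar>y\<bar>)"
      unfolding G_def norm_mult by (intro mult_mono 1[unfolded norm_mult] 1 2) auto
    also have "\<dots> = \<phi> \<bar>y\<bar>" by (simp add: \<phi>_def exp_add[symmetric] algebra_simps)
    finally show ?thesis .
  qed
  have lim\<phi>: "(\<phi> \<longlongrightarrow> 0) at_top"
  proof -
    define \<delta> where "\<delta> = Re z / 2"
    have "\<delta> > 0" using z by (simp add: \<delta>_def)
    then have "((\<lambda>x. (norm z + norm \<nu>) * exp ((\<bar>Re \<nu>\<bar> + 1) * x - \<delta> * exp x)) \<longlongrightarrow> 0) at_top" by real_asymp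
    then show ?thesis by (simp add: \<phi>_def \<delta>_def)
  qed
  have T: "(G \<longlongrightarrow> 0) at_top"
    by (rule Lim_null_comparison[OF always_eventually[OF allI[OF bd]]])
       (rule filterlim_compose[OF lim\<phi> filterlim_abs_real])
  have B: "(G \<longlongrightarrow> 0) at_bot"
  proof (rule Lim_null_comparison[OF always_eventually[OF allI[OF bd]]])
    have "filterlim (\<lambda>y::real. \<bar>y\<bar>) at_top at_bot"
      unfolding filterlim_at_top by (auto intro!: eventually_mono[OF eventually_le_at_bot] simp: eventually_at_bot_linorder) (metis abs_ge_minus_self dual_order.trans le_minus_iff)
    then show "((\<lambda>x. \<phi> \<bar>x\<bar>) \<longlongrightarrow> 0) at_bot" by (rule filterlim_compose[OF lim\<phi>])
  qed
  have "(LBINT y=-\<infinity>..\<infinity>. g y) = 0 - 0"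
    by (rule interval_integral_FTC_integrable[where F=G])
       (use der cont int T B in \<open>auto simp: ereal_tendsto_simps set_integrable_def\<close>)
  then have "integral\<^sup>L lborel g = 0"
    by (simp add: interval_lebesgue_integral_def set_lebesgue_integral_def)
  then show ?thesis
    using integrable_besselK_int[OF z] unfolding g_def besselK_mom_def
    by (simp add: field_simps)
qed

section \<open>Moments of K\<close>

lemma besselK_exp_arg:
  "besselK \<nu> (of_real (exp x)) =
     exp (\<nu> * of_real (ln 2 - x)) / 2 * (\<integral>u. exp (\<nu> * of_real u - of_real (exp u + exp (2 * x - u) / 4)) \<partial>lborel)"
proof -
  have e: "besselK_int 0 \<nu> (of_real (exp x)) ((ln 2 - x) + 1 * u) =
      exp (\<nu> * of_real (ln 2 - x)) * exp (\<nu> * of_real u - of_real (exp u + exp (2 * x - u) / 4))" for u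
  proof -
    \<comment> \<open>The translation by ln 2 - x is chosen so that only the second exponential
      depends on \<open>x\<close>. It vanishes as \<open>x\<close> tends to minus infinity, which
      exposes the behaviour of K at zero, and it is integrable against e^(sx) as a Gamma
      integral.\<close>
    have "exp x * cosh ((ln 2 - x) + u) = exp u + exp (2 * x - u) / 4"
      by (simp add: cosh_field_def exp_add exp_diff exp_minus field_simps power2_eq_square flip: exp_double)
        (simp add: mult_exp_exp mult_2_right)
    then have "complex_of_real (exp x) * of_real (cosh ((ln 2 - x) + u)) = of_real (exp u + exp (2 * x - u) / 4)"
      by (metis of_real_mult)
    then show ?thesis
      unfolding besselK_int_def by (simp add: exp_add[symmetric] algebra_simps)
  qed
  have "(\<integral>y. besselK_int 0 \<nu> (of_real (exp x)) y \<partial>lborel) =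
      (\<integral>u. exp (\<nu> * of_real (ln 2 - x)) * exp (\<nu> * of_real u - of_real (exp u + exp (2 * x - u) / 4)) \<partial>lborel)"
    by (subst lborel_integral_real_affine[of 1 _ "ln 2 - x"]) (simp_all only: e, simp_all)
  then show ?thesis by (simp add: besselK_mom_def)
qed

lemma Gamma_exp2_integral:
  fixes a :: complex and c :: real
  assumes a: "Re a > 0" and c: "c > 0"
  shows "integrable lborel (\<lambda>x. exp (a * of_real x - of_real (c * exp (2 * x))))"
    and "(\<integral>x. exp (a * of_real x - of_real (c * exp (2 * x))) \<partial>lborel) = Gamma (a / 2) * exp (- (a / 2) * of_real (ln c)) / 2"
proof -
  define h where "h = (\<lambda>x. exp (a / 2 * of_real x - of_real (c * exp x)))"
  have h: "integrable lborel h" "integral\<^sup>L lborel h = Gamma (a / 2) * exp (- (a / 2) * of_real (ln c))"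
    using Gamma_exp_integral[of "a/2" c] a c unfolding h_def by simp_all
  have e: "h (0 + 2 * x) = exp (a * of_real x - of_real (c * exp (2 * x)))" for x
    by (simp add: h_def)
  show "integrable lborel (\<lambda>x. exp (a * of_real x - of_real (c * exp (2 * x))))"
    using lborel_integrable_real_affine[OF h(1), of 2 0] unfolding e by simp
  show "(\<integral>x. exp (a * of_real x - of_real (c * exp (2 * x))) \<partial>lborel) = Gamma (a / 2) * exp (- (a / 2) * of_real (ln c)) / 2"
    using lborel_integral_real_affine[of 2 h 0] h(2) unfolding e by (simp add: scaleR_conv_of_real)
qed

lemma Gamma_exp2_integral_real:
  fixes s c :: real
  assumes s: "s > 0" and c: "c > 0"
  shows "integrable lborel (\<lambda>x. exp (s * x - c * exp (2 * x)))"
    and "(\<integral>x. exp (s * x - c * exp (2 * x)) \<partial>lborel) = Gamma (s / 2) * exp (- (s / 2) * ln c) / 2"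
proof -
  define h where "h = (\<lambda>x. exp (s / 2 * x - c * exp x))"
  have h: "integrable lborel h" "integral\<^sup>L lborel h = Gamma (s / 2) * exp (- (s / 2) * ln c)"
    using Gamma_exp_integral_real[of "s/2" c] s c unfolding h_def by simp_all
  have e: "h (0 + 2 * x) = exp (s * x - c * exp (2 * x))" for x
    by (simp add: h_def)
  show "integrable lborel (\<lambda>x. exp (s * x - c * exp (2 * x)))"
    using lborel_integrable_real_affine[OF h(1), of 2 0] unfolding e by simp
  show "(\<integral>x. exp (s * x - c * exp (2 * x)) \<partial>lborel) = Gamma (s / 2) * exp (- (s / 2) * ln c) / 2"
    using lborel_integral_real_affine[of 2 h 0] h(2) unfolding e by simp
qed

lemma exp_minus_2_ln_2:
  "exp (- 2 * ln 2 :: real) = 1 / 4" "exp (- 2 * complex_of_real (ln 2)) = 1 / 4"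
proof -
  have "exp (2 * ln 2 :: real) = exp (ln 2) ^ 2" by (rule exp_double)
  then show 1: "exp (- 2 * ln 2 :: real) = 1 / 4" by (simp add: exp_minus)
  have "exp (- 2 * complex_of_real (ln 2)) = of_real (exp (- 2 * ln 2 :: real))"
    by (simp add: exp_of_real[symmetric])
  then show "exp (- 2 * complex_of_real (ln 2)) = 1 / 4" unfolding 1 by simp
qed

text \<open>The Mellin transform of K. In the representation \<open>besselK_exp_arg\<close>,
  integrating over x first is a Gamma integral in e^(2x), and what remains in u is another one. The
  condition on \<open>s\<close> is positivity of both Gamma arguments.\<close>

lemma besselK_moment:
  assumes s: "Re s > \<bar>Re \<nu>\<bar>"
  shows "integrable lborel (\<lambda>x. exp (s * of_real x) * besselK \<nu> (of_real (exp x)))"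
    and "(\<integral>x. exp (s * of_real x) * besselK \<nu> (of_real (exp x)) \<partial>lborel) =
         exp ((s - 2) * of_real (ln 2)) * Gamma ((s - \<nu>) / 2) * Gamma ((s + \<nu>) / 2)"
proof -
  define f :: "real \<Rightarrow> real \<Rightarrow> complex" where
    "f = (\<lambda>u x. exp (s * of_real x + \<nu> * of_real (u + ln 2 - x) - of_real (exp u + exp (2 * x - u) / 4)) / 2)"
  define C where "C = (\<lambda>u. exp (\<nu> * of_real (u + ln 2) - of_real (exp u)) / 2)"
  have fu: "f u x = C u * exp ((s - \<nu>) * of_real x - of_real (exp (- u) / 4 * exp (2 * x)))" for u x
  proof -
    have "exp (2 * x - u) / 4 = exp (- u) / 4 * exp (2 * x)" by (simp add: exp_diff exp_minus field_simps)
    then show ?thesis by (simp add: f_def C_def exp_add[symmetric] algebra_simps)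
  qed
  have nf: "norm (f u x) = norm (C u) * exp ((Re s - Re \<nu>) * x - exp (- u) / 4 * exp (2 * x))" for u x
    unfolding fu by (simp add: norm_mult)
  have pos: "Re (s - \<nu>) > 0" "Re (s + \<nu>) > 0" "exp (- u) / 4 > (0::real)" for u using s by auto
  have lnc: "ln (exp (- u) / 4) = - u - 2 * ln (2::real)" for u :: real
    using ln_realpow[of 2 2] by (simp add: ln_div)
  have m: "case_prod f \<in> borel_measurable (borel \<Otimes>\<^sub>M borel)"
    unfolding f_def by measurable
  have i1: "integrable lborel (f u)" for u
    unfolding fu using Gamma_exp2_integral(1)[OF pos(1,3)] by (intro integrable_mult_right) auto
  have inx: "(\<integral>x. f u x \<partial>lborel) = exp ((s - 2) * of_real (ln 2)) * Gamma ((s - \<nu>) / 2) * exp ((s + \<nu>) / 2 * of_real u - of_real (1 * exp u))" for u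
  proof -
    have "(\<integral>x. f u x \<partial>lborel) = C u * (Gamma ((s - \<nu>) / 2) * exp (- ((s - \<nu>) / 2) * of_real (- u - 2 * ln 2)) / 2)"
      unfolding fu using Gamma_exp2_integral(2)[OF pos(1,3)] unfolding lnc by (simp only: integral_mult_right_zero)
    also have "\<dots> = Gamma ((s - \<nu>) / 2) * ((exp (\<nu> * of_real (u + ln 2) - of_real (exp u)) * exp (- ((s - \<nu>) / 2) * of_real (- u - 2 * ln 2))) / 4)"
      by (simp add: C_def)
    also have "exp (\<nu> * of_real (u + ln 2) - of_real (exp u)) * exp (- ((s - \<nu>) / 2) * of_real (- u - 2 * ln 2)) / 4
       = exp (\<nu> * of_real (u + ln 2) - of_real (exp u)) * exp (- ((s - \<nu>) / 2) * of_real (- u - 2 * ln 2)) * exp (- 2 * of_real (ln 2))"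
      unfolding exp_minus_2_ln_2 by simp
    also have "\<dots> = exp ((s - 2) * of_real (ln 2)) * exp ((s + \<nu>) / 2 * of_real u - of_real (1 * exp u))"
      unfolding exp_add[symmetric] by (rule arg_cong[where f = exp]) (simp add: field_simps)
    finally show ?thesis by (simp add: mult_ac)
  qed
  have inn: "(\<integral>x. norm (f u x) \<partial>lborel) = exp ((Re s - 2) * ln 2) * Gamma ((Re s - Re \<nu>) / 2) * exp ((Re s + Re \<nu>) / 2 * u - 1 * exp u)" for u
  proof -
    have "(\<integral>x. norm (f u x) \<partial>lborel) = norm (C u) * (Gamma ((Re s - Re \<nu>) / 2) * exp (- ((Re s - Re \<nu>) / 2) * (- u - 2 * ln 2)) / 2)"
      unfolding nf using Gamma_exp2_integral_real(2)[of "Re s - Re \<nu>", OF _ pos(3)] pos(1) unfolding lnc by simp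
    also have "\<dots> = Gamma ((Re s - Re \<nu>) / 2) * ((exp (Re \<nu> * (u + ln 2) - exp u) * exp (- ((Re s - Re \<nu>) / 2) * (- u - 2 * ln 2))) * (1 / 4))"
      by (simp add: C_def norm_divide)
    also have "(1::real) / 4 = exp (- 2 * ln 2)"
      unfolding exp_minus_2_ln_2 by simp
    also have "exp (Re \<nu> * (u + ln 2) - exp u) * exp (- ((Re s - Re \<nu>) / 2) * (- u - 2 * ln 2)) * exp (- 2 * ln 2)
       = exp ((Re s - 2) * ln 2) * exp ((Re s + Re \<nu>) / 2 * u - 1 * exp u)"
      unfolding exp_add[symmetric] by (rule arg_cong[where f = exp]) (simp add: field_simps)
    finally show ?thesis by (simp add: mult_ac)
  qed
  have i2: "integrable lborel (\<lambda>u. \<integral>x. norm (f u x) \<partial>lborel)"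
    unfolding inn using Gamma_exp_integral_real(1)[of "(Re s + Re \<nu>) / 2" 1] pos by (intro integrable_mult_right) auto
  have inu: "(\<integral>u. f u x \<partial>lborel) = exp (s * of_real x) * besselK \<nu> (of_real (exp x))" for x
  proof -
    have "f u x = exp (s * of_real x) * (exp (\<nu> * of_real (ln 2 - x)) / 2) * exp (\<nu> * of_real u - of_real (exp u + exp (2 * x - u) / 4))" for u
      by (simp add: f_def exp_add[symmetric] algebra_simps)
    then show ?thesis unfolding besselK_exp_arg by (simp only: integral_mult_right_zero mult.assoc)
  qed
  note F = Fubini_lborel[OF m i1 i2]
  show "integrable lborel (\<lambda>x. exp (s * of_real x) * besselK \<nu> (of_real (exp x)))"
    using F(2) unfolding inu .
  show "(\<integral>x. exp (s * of_real x) * besselK \<nu> (of_real (exp x)) \<partial>lborel) =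
         exp ((s - 2) * of_real (ln 2)) * Gamma ((s - \<nu>) / 2) * Gamma ((s + \<nu>) / 2)"
    using F(1) Gamma_exp_integral(2)[of "(s + \<nu>) / 2" 1] pos unfolding inu inx by simp
qed

lemma integrable_besselKr_moment:
  fixes s \<sigma> d :: real
  assumes "s > \<bar>\<sigma>\<bar>" "d > 0"
  shows "integrable lborel (\<lambda>x. exp (s * x) * besselKr \<sigma> (d * exp x))"
proof -
  define h where "h = (\<lambda>x. exp (s * x) * besselKr \<sigma> (exp x))"
  have eq: "exp (of_real s * of_real x) * besselK (of_real \<sigma>) (of_real (exp x)) = complex_of_real (h x)" for x
    unfolding besselK_of_real h_def by (simp add: exp_of_real[symmetric])
  have "integrable lborel (\<lambda>x. complex_of_real (h x))"
    using besselK_moment(1)[of "of_real \<sigma>" "of_real s"] assms unfolding eq by simp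
  then have "integrable lborel h" by (rule complex_of_real_integrable_eq[THEN iffD1])
  then have "integrable lborel (\<lambda>x. h (ln d + 1 * x))"
    by (rule lborel_integrable_real_affine) simp
  then have "integrable lborel (\<lambda>x. exp (- s * ln d) * h (ln d + 1 * x))" by (rule integrable_mult_right)
  moreover have "exp (- s * ln d) * h (ln d + 1 * x) = exp (s * x) * besselKr \<sigma> (d * exp x)" for x
  proof -
    have "exp (ln d + x) = d * exp x" using assms by (simp add: exp_add)
    moreover have "exp (- s * ln d) * exp (s * (ln d + x)) = exp (s * x)"
      unfolding exp_add[symmetric] by (simp add: algebra_simps)
    ultimately show ?thesis unfolding h_def by (simp add: mult.assoc[symmetric])
  qed
  ultimately show ?thesis by (simp only:)
qed

lemma borel_measurable_cosh [measurable (raw)]: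
  fixes f :: "'a \<Rightarrow> real"
  assumes "f \<in> borel_measurable M"
  shows "(\<lambda>x. cosh (f x)) \<in> borel_measurable M"
  by (rule measurable_compose[OF assms]) (intro borel_measurable_continuous_onI continuous_intros)

text \<open>After integration over x the factor (1 + cosh y)^(-q) remains; since 1 + cosh y = (1 +
  e^y)^2 / (2 e^y), the integral over y is a Beta integral with parameters q + \<nu> and q - \<nu>.
  At q = M + 1/2 this yields both the coefficients of the expansion of K and the constant of its
  error bound.\<close>

lemma besselK_exp_moment:
  fixes q :: real and \<nu> :: complex
  assumes q: "q > \<bar>Re \<nu>\<bar>"
  shows "integrable lborel (\<lambda>x. exp (of_real (q * x - exp x)) * besselK \<nu> (of_real (exp x)))"
    and "(\<integral>x. exp (of_real (q * x - exp x)) * besselK \<nu> (of_real (exp x)) \<partial>lborel) =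
         of_real (Gamma q * exp (q * ln 2) / 2) * (Gamma (q + \<nu>) * Gamma (q - \<nu>) / of_real (Gamma (2 * q)))"
proof -
  define f :: "real \<Rightarrow> real \<Rightarrow> complex" where
    "f = (\<lambda>y x. exp (\<nu> * of_real y + of_real (q * x) - of_real (exp x * (1 + cosh y))) / 2)"
  have fy: "f y x = exp (\<nu> * of_real y) / 2 * exp (of_real q * of_real x - of_real ((1 + cosh y) * exp x))" for y x
    by (simp add: f_def exp_add[symmetric] algebra_simps)
  have nf: "norm (f y x) = exp (Re \<nu> * y) / 2 * exp (q * x - (1 + cosh y) * exp x)" for y x
    unfolding fy by (simp add: norm_mult norm_divide)
  have fx: "f y x = exp (of_real (q * x - exp x)) / 2 * besselK_int 0 \<nu> (of_real (exp x)) y" for y x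
    by (simp add: f_def besselK_int_def exp_add[symmetric] algebra_simps)
  have q0: "q > 0" and c0: "1 + cosh y > 0" for y :: real
    using q cosh_real_pos[of y] by (auto simp del: cosh_real_pos)
  have lnc: "ln (1 + cosh y) = 2 * ln (1 + exp y) - ln 2 - y" for y :: real
  proof -
    have "1 + cosh y = (1 + exp y)\<^sup>2 / (2 * exp y)"
      by (simp add: cosh_field_def exp_minus field_simps power2_eq_square)
    moreover have "ln ((1 + exp y)\<^sup>2 / (2 * exp y)) = 2 * ln (1 + exp y) - ln 2 - y"
      using add_pos_pos[of 1 "exp y"] by (simp add: ln_div ln_mult ln_realpow)
    ultimately show ?thesis by simp
  qed
  have m: "case_prod f \<in> borel_measurable (borel \<Otimes>\<^sub>M borel)"
    unfolding f_def by measurable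
  have i1: "integrable lborel (f y)" for y
    unfolding fy using Gamma_exp_integral(1)[of "of_real q", OF _ c0] q0 by (intro integrable_mult_right) auto
  define B where "B = (\<lambda>y::real. exp ((q + \<nu>) * of_real y - ((q + \<nu>) + (q - \<nu>)) * of_real (ln (1 + exp y))))"
  have inx: "(\<integral>x. f y x \<partial>lborel) = complex_of_real (Gamma q * exp (q * ln 2) / 2) * B y" for y
  proof -
    have "(\<integral>x. f y x \<partial>lborel) = exp (\<nu> * of_real y) / 2 * (Gamma (of_real q) * exp (- of_real q * of_real (ln (1 + cosh y))))"
      unfolding fy using Gamma_exp_integral(2)[of "of_real q", OF _ c0] q0 by (simp only: integral_mult_right_zero) simp
    also have "\<dots> = of_real (Gamma q) / 2 * (exp (\<nu> * of_real y) * exp (- of_real q * of_real (ln (1 + cosh y))))"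
      by (simp add: Gamma_complex_of_real)
    also have "exp (\<nu> * of_real y) * exp (- of_real q * of_real (ln (1 + cosh y))) = of_real (exp (q * ln 2)) * B y"
      unfolding lnc B_def exp_of_real[symmetric] exp_add[symmetric]
      by (rule arg_cong[where f = exp]) (simp add: algebra_simps)
    finally show ?thesis by simp
  qed
  have inn: "(\<integral>x. norm (f y x) \<partial>lborel) = Gamma q * exp (q * ln 2) / 2 * norm (B y)" for y
  proof -
    have "(\<integral>x. norm (f y x) \<partial>lborel) = exp (Re \<nu> * y) / 2 * (Gamma q * exp (- q * ln (1 + cosh y)))"
      unfolding nf using Gamma_exp_integral_real(2)[of q, OF _ c0] q0 by simp
    also have "\<dots> = Gamma q / 2 * (exp (Re \<nu> * y) * exp (- q * ln (1 + cosh y)))" by simp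
    also have "exp (Re \<nu> * y) * exp (- q * ln (1 + cosh y)) = exp (q * ln 2) * norm (B y)"
      unfolding lnc B_def norm_exp_eq_Re exp_add[symmetric]
      by (rule arg_cong[where f = exp]) (simp add: algebra_simps)
    finally show ?thesis by simp
  qed
  have p: "Re (of_real q + \<nu>) > 0" "Re (of_real q - \<nu>) > 0" using q by auto
  have iB: "integrable lborel (B)" "integral\<^sup>L lborel (B) = Gamma (q + \<nu>) * Gamma (q - \<nu>) / of_real (Gamma (2 * q))"
    using Beta_exp_integral[OF p] by (simp_all add: B_def flip: Gamma_complex_of_real mult_2)
  have i2: "integrable lborel (\<lambda>y. \<integral>x. norm (f y x) \<partial>lborel)"
    unfolding inn using iB by (intro integrable_mult_right integrable_norm)
  have inu: "(\<integral>y. f y x \<partial>lborel) = exp (of_real (q * x - exp x)) * besselK \<nu> (of_real (exp x))" for x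
    unfolding fx besselK_mom_def by simp
  note F = Fubini_lborel[OF m i1 i2]
  show "integrable lborel (\<lambda>x. exp (of_real (q * x - exp x)) * besselK \<nu> (of_real (exp x)))"
    using F(2) unfolding inu .
  show "(\<integral>x. exp (of_real (q * x - exp x)) * besselK \<nu> (of_real (exp x)) \<partial>lborel) =
         of_real (Gamma q * exp (q * ln 2) / 2) * (Gamma (q + \<nu>) * Gamma (q - \<nu>) / of_real (Gamma (2 * q)))"
    using F(1) unfolding inu inx integral_mult_right_zero iB(2) by (rule sym)
qed

section \<open>The Lommel integral\<close>

text \<open>With u = e^x, the case n = 0 is the integral of u^(-\<mu>) K(zu) / (1 + u^2) over u > 0.
  In this scaling \<open>z\<close> occurs only inside K, so differentiating in \<open>z\<close>
  affects K alone; \<open>n\<close> counts these derivatives up to the sign (-1)^n.\<close>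

definition lommelW :: "nat \<Rightarrow> complex \<Rightarrow> complex \<Rightarrow> complex \<Rightarrow> complex" where
  "lommelW n \<mu> \<nu> z = (\<integral>x. exp ((1 - \<mu> + of_nat n) * of_real x) / of_real (1 + exp (2 * x))
      * besselK_mom n \<nu> (z * of_real (exp x)) \<partial>lborel)"

lemma besselK_mom_continuous_exp:
  assumes "Re z > 0"
  shows "continuous_on UNIV (\<lambda>x::real. besselK_mom n \<nu> (z * of_real (exp x)))"
  by (rule continuous_on_compose2[OF holomorphic_on_imp_continuous_on[OF besselK_mom_holomorphic]])
     (use assms in \<open>auto intro!: continuous_intros\<close>)

lemma one_plus_exp_nonzero: "1 + exp (complex_of_real x) \<noteq> 0" "complex_of_real (1 + exp x) \<noteq> 0"
proof -
  have "1 + exp x > 0" by (simp add: add_pos_pos)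
  then show "complex_of_real (1 + exp x) \<noteq> 0" by (metis less_irrefl of_real_eq_0_iff)
  then show "1 + exp (complex_of_real x) \<noteq> 0" by (simp add: exp_of_real)
qed

lemma one_plus_exp_nonzero_real: "1 + exp (x::real) \<noteq> 0"
  by (metis add_pos_pos exp_gt_zero less_irrefl zero_less_one)

lemma Re_ball_half:
  assumes "w \<in> ball z (Re z / 2)"
  shows "Re w \<ge> Re z / 2"
  using assms abs_Re_le_cmod[of "z - w"] by (simp add: dist_norm)

lemma lommelW_measurable:
  assumes "Re z > 0"
  shows "(\<lambda>x. exp ((1 - \<mu> + of_nat n) * of_real x) / of_real (1 + exp (2 * x)) * besselK_mom n \<nu> (z * of_real (exp x))) \<in> borel_measurable borel"
  by (intro borel_measurable_continuous_onI continuous_intros besselK_mom_continuous_exp assms)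
     (simp_all del: of_real_add of_real_exp add: one_plus_exp_nonzero_real)

text \<open>The kernel 1/(1 + e^(2x)) is bounded by 1, and near \<open>z\<close> the real part of
  the argument stays above half of Re z, where \<open>besselKr\<close> is a majorant with a finite
  moment. The hypothesis is convergence at u = 0, where K grows like u^(-|Re \<nu>|), up to a
  logarithm if Re \<nu> = 0.\<close>

lemma locally_dominated_lommelW0:
  assumes "Re \<mu> + \<bar>Re \<nu>\<bar> < 1"
  shows "locally_dominated lborel {z. Re z > 0} (\<lambda>z x. exp ((1 - \<mu> + of_nat 0) * of_real x) / of_real (1 + exp (2 * x)) * besselK_mom 0 \<nu> (z * of_real (exp x)))"
proof (rule locally_dominatedI)
  fix z :: complex assume "z \<in> {z. Re z > 0}"
  then have z: "Re z > 0" by simp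
  show "\<exists>e>0. \<exists>g. ball z e \<subseteq> {z. Re z > 0} \<and> integrable lborel g \<and>
        (\<forall>w\<in>ball z e. \<forall>x\<in>space lborel. norm (exp ((1 - \<mu> + of_nat 0) * of_real x) / of_real (1 + exp (2 * x)) * besselK_mom 0 \<nu> (w * of_real (exp x))) \<le> g x)"
  proof (intro exI[of _ "Re z / 2"] exI[of _ "\<lambda>x. exp ((1 - Re \<mu>) * x) * besselKr (Re \<nu>) (Re z / 2 * exp x)"] conjI ballI)
    show "ball z (Re z / 2) \<subseteq> {z. Re z > 0}" using Re_ball_half z by fastforce
    show "integrable lborel (\<lambda>x. exp ((1 - Re \<mu>) * x) * besselKr (Re \<nu>) (Re z / 2 * exp x))"
      using assms z by (intro integrable_besselKr_moment) auto
    fix w x assume "w \<in> ball z (Re z / 2)"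
    then have w: "Re w \<ge> Re z / 2" by (rule Re_ball_half)
    have "norm (exp ((1 - \<mu> + of_nat 0) * of_real x) / of_real (1 + exp (2 * x)) * besselK_mom 0 \<nu> (w * of_real (exp x)))
       = exp ((1 - Re \<mu>) * x) / (1 + exp (2 * x)) * norm (besselK \<nu> (w * of_real (exp x)))"
      using add_pos_pos[OF zero_less_one exp_gt_zero, of "2 * x"]
      by (simp add: norm_mult norm_divide del: of_real_add)
    also have "\<dots> \<le> exp ((1 - Re \<mu>) * x) / 1 * besselKr (Re \<nu>) (Re z / 2 * exp x)"
    proof (intro mult_mono frac_le)
      have "norm (besselK \<nu> (w * of_real (exp x))) \<le> besselKr (Re \<nu>) (Re w * exp x)"
        using norm_besselK_le[of "w * of_real (exp x)" \<nu>] w z by simp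
      also have "\<dots> \<le> besselKr (Re \<nu>) (Re z / 2 * exp x)"
        using w z by (intro besselKr_antimono mult_right_mono) auto
      finally show "norm (besselK \<nu> (w * of_real (exp x))) \<le> besselKr (Re \<nu>) (Re z / 2 * exp x)" .
    qed (auto simp: besselKr_nonneg)
    finally show "norm (exp ((1 - \<mu> + of_nat 0) * of_real x) / of_real (1 + exp (2 * x)) * besselK_mom 0 \<nu> (w * of_real (exp x)))
      \<le> exp ((1 - Re \<mu>) * x) * besselKr (Re \<nu>) (Re z / 2 * exp x)" by simp
  qed (use z in auto)
qed

lemma lommelW_integrand_deriv:
  assumes "Re z > 0"
  shows "((\<lambda>z. exp ((1 - \<mu> + of_nat n) * of_real x) / of_real (1 + exp (2 * x)) * besselK_mom n \<nu> (z * of_real (exp x)))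
    has_field_derivative - (exp ((1 - \<mu> + of_nat (Suc n)) * of_real x) / of_real (1 + exp (2 * x)) * besselK_mom (Suc n) \<nu> (z * of_real (exp x)))) (at z)"
proof -
  have 1: "((\<lambda>z. besselK_mom n \<nu> (z * of_real (exp x))) has_field_derivative - besselK_mom (Suc n) \<nu> (z * of_real (exp x)) * of_real (exp x)) (at z)"
    by (rule DERIV_chain2[OF has_field_derivative_besselK_mom]) (use assms in \<open>auto intro!: derivative_eq_intros\<close>)
  have 2: "exp ((1 - \<mu> + of_nat (Suc n)) * of_real x) = exp ((1 - \<mu> + of_nat n) * of_real x) * of_real (exp x)"
    by (simp add: exp_of_real[symmetric] exp_add[symmetric] algebra_simps)
  show ?thesis
    unfolding 2 by (rule DERIV_cong[OF DERIV_cmult[OF 1]]) simp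
qed

lemma lommelW_integrand_holomorphic:
  "(\<lambda>z. exp ((1 - \<mu> + of_nat n) * of_real x) / of_real (1 + exp (2 * x)) * besselK_mom n \<nu> (z * of_real (exp x))) holomorphic_on {z. Re z > 0}"
  unfolding holomorphic_on_open[OF open_Re_pos] using lommelW_integrand_deriv by blast

lemma locally_dominated_cong:
  assumes "locally_dominated M U f" "\<And>z t. z \<in> U \<Longrightarrow> t \<in> space M \<Longrightarrow> norm (g z t) = norm (f z t)"
  shows "locally_dominated M U g"
  unfolding locally_dominated_def
proof
  fix z assume "z \<in> U"
  then obtain e h where *: "e > 0" "ball z e \<subseteq> U" "integrable M h"
    "\<And>w t. w \<in> ball z e \<Longrightarrow> t \<in> space M \<Longrightarrow> norm (f w t) \<le> h t"
    using assms(1) unfolding locally_dominated_def by meson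
  show "\<exists>e>0. \<exists>h. ball z e \<subseteq> U \<and> integrable M h \<and> (\<forall>w\<in>ball z e. \<forall>t\<in>space M. norm (g w t) \<le> h t)"
  proof (intro exI[of _ e] exI[of _ h] conjI ballI)
    fix w t assume "w \<in> ball z e" "t \<in> space M"
    then show "norm (g w t) \<le> h t" using *(2) *(4)[of w t] assms(2)[of w t] by auto
  qed (use * in auto)
qed

text \<open>Only n = 0 is estimated directly; higher derivatives inherit their domination through
  Cauchy's inequality.\<close>

lemma locally_dominated_lommelW:
  assumes "Re \<mu> + \<bar>Re \<nu>\<bar> < 1"
  shows "locally_dominated lborel {z. Re z > 0} (\<lambda>z x. exp ((1 - \<mu> + of_nat n) * of_real x) / of_real (1 + exp (2 * x)) * besselK_mom n \<nu> (z * of_real (exp x)))"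
proof (induction n)
  case 0
  show ?case by (rule locally_dominated_lommelW0[OF assms])
next
  case (Suc n)
  show ?case
    by (rule locally_dominated_cong[OF locally_dominated_deriv[OF Suc lommelW_integrand_holomorphic]])
       (simp only: DERIV_imp_deriv[OF lommelW_integrand_deriv] norm_minus_cancel mem_Collect_eq)
qed

lemma has_field_derivative_lommelW:
  assumes "Re \<mu> + \<bar>Re \<nu>\<bar> < 1" "Re z > 0"
  shows "(lommelW n \<mu> \<nu> has_field_derivative - lommelW (Suc n) \<mu> \<nu> z) (at z)"
proof -
  have d: "deriv (\<lambda>z. exp ((1 - \<mu> + of_nat n) * of_real x) / of_real (1 + exp (2 * x)) * besselK_mom n \<nu> (z * of_real (exp x))) z
     = - (exp ((1 - \<mu> + of_nat (Suc n)) * of_real x) / of_real (1 + exp (2 * x)) * besselK_mom (Suc n) \<nu> (z * of_real (exp x)))" for x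
    by (rule DERIV_imp_deriv[OF lommelW_integrand_deriv[OF assms(2)]])
  have m: "(\<lambda>x. exp ((1 - \<mu> + of_nat n) * of_real x) / of_real (1 + exp (2 * x)) * besselK_mom n \<nu> (z * of_real (exp x))) \<in> borel_measurable lborel"
    if "z \<in> {z. Re z > 0}" for z
    using lommelW_measurable that by simp
  have z: "z \<in> {z. Re z > 0}" using assms(2) by simp
  have "(lommelW n \<mu> \<nu> has_field_derivative (\<integral>x. - (exp ((1 - \<mu> + of_nat (Suc n)) * of_real x) / of_real (1 + exp (2 * x)) * besselK_mom (Suc n) \<nu> (z * of_real (exp x))) \<partial>lborel)) (at z)"
    using has_field_derivative_integral(1)[OF open_Re_pos z m lommelW_integrand_holomorphic locally_dominated_lommelW[OF assms(1)]]
    unfolding d lommelW_def[abs_def] .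
  then show ?thesis unfolding lommelW_def[abs_def] by simp
qed

lemma integrable_lommelW:
  assumes "Re \<mu> + \<bar>Re \<nu>\<bar> < 1" "Re z > 0"
  shows "integrable lborel (\<lambda>x. exp ((1 - \<mu> + of_nat n) * of_real x) / of_real (1 + exp (2 * x)) * besselK_mom n \<nu> (z * of_real (exp x)))"
  by (rule integrable_locally_dominated[OF locally_dominated_lommelW[OF assms(1)]])
     (use assms lommelW_measurable in auto)

lemma besselK_moment_scaled:
  fixes t :: real
  assumes "Re s > \<bar>Re \<nu>\<bar>" "t > 0"
  shows "(\<integral>x. exp (s * of_real x) * besselK \<nu> (of_real t * of_real (exp x)) \<partial>lborel) =
     exp (- s * of_real (ln t)) * (exp ((s - 2) * of_real (ln 2)) * Gamma ((s - \<nu>) / 2) * Gamma ((s + \<nu>) / 2))"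
proof -
  define h where "h = (\<lambda>x. exp (s * of_real x) * besselK \<nu> (of_real (exp x)))"
  have h: "integral\<^sup>L lborel h = exp ((s - 2) * of_real (ln 2)) * Gamma ((s - \<nu>) / 2) * Gamma ((s + \<nu>) / 2)"
    unfolding h_def by (rule besselK_moment(2)[OF assms(1)])
  have e: "h (ln t + 1 * x) = exp (s * of_real (ln t)) * (exp (s * of_real x) * besselK \<nu> (of_real t * of_real (exp x)))" for x
  proof -
    have "exp (ln t + x) = t * exp x" using assms by (simp add: exp_add)
    then show ?thesis
      unfolding h_def by (simp add: distrib_left exp_add)
  qed
  have "integral\<^sup>L lborel h = exp (s * of_real (ln t)) * (\<integral>x. exp (s * of_real x) * besselK \<nu> (of_real t * of_real (exp x)) \<partial>lborel)"
    by (subst lborel_integral_real_affine[of 1 _ "ln t"]) (simp_all only: e, simp_all)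
  then show ?thesis unfolding h by (simp add: exp_minus field_simps)
qed

text \<open>At the argument w = zu the equation of K turns the Bessel operator into multiplication
  by w^2 + z^2 = z^2 (1 + u^2). This cancels the denominator and leaves a plain Mellin moment of K,
  the inhomogeneity of the Lommel equation up to a constant.\<close>

lemma lommelW_ode:
  fixes t :: real
  assumes "Re \<mu> + \<bar>Re \<nu>\<bar> < 1" "t > 0"
  defines "z \<equiv> of_real t :: complex"
  shows "z\<^sup>2 * lommelW 2 \<mu> \<nu> z - z * lommelW 1 \<mu> \<nu> z + (z\<^sup>2 - \<nu>\<^sup>2) * lommelW 0 \<mu> \<nu> z =
    exp ((\<mu> + 1) * of_real (ln t)) * (exp (- (\<mu> + 1) * of_real (ln 2)) * Gamma ((1 - \<mu> - \<nu>) / 2) * Gamma ((1 - \<mu> + \<nu>) / 2))"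
proof -
  have z: "Re z > 0" using assms by (simp add: z_def)
  note i = integrable_lommelW[OF assms(1) z]
  have pw: "z\<^sup>2 * (exp ((1 - \<mu> + of_nat 2) * of_real x) / of_real (1 + exp (2 * x)) * besselK_mom 2 \<nu> (z * of_real (exp x)))
     - z * (exp ((1 - \<mu> + of_nat 1) * of_real x) / of_real (1 + exp (2 * x)) * besselK_mom 1 \<nu> (z * of_real (exp x)))
     + (z\<^sup>2 - \<nu>\<^sup>2) * (exp ((1 - \<mu> + of_nat 0) * of_real x) / of_real (1 + exp (2 * x)) * besselK_mom 0 \<nu> (z * of_real (exp x)))
    = z\<^sup>2 * (exp ((1 - \<mu>) * of_real x) * besselK \<nu> (z * of_real (exp x)))" (is "?L = _") for x
  proof -
    define w where "w = z * of_real (exp x)"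
    define E where "E = exp ((1 - \<mu>) * of_real x)"
    define D where "D = complex_of_real (1 + exp (2 * x))"
    have D: "D \<noteq> 0" unfolding D_def by (rule one_plus_exp_nonzero)
    have "Re w > 0" using z by (simp add: w_def)
    from besselK_ode[OF this, of \<nu>]
    have ode: "w\<^sup>2 * besselK_mom 2 \<nu> w - w * besselK_mom 1 \<nu> w = (w\<^sup>2 + \<nu>\<^sup>2) * besselK \<nu> w" by simp
    have e1: "exp ((1 - \<mu> + of_nat 1) * of_real x) = E * of_real (exp x)"
      by (simp add: E_def exp_of_real[symmetric] exp_add[symmetric] algebra_simps)
    have e2: "exp ((1 - \<mu> + of_nat 2) * of_real x) = E * (of_real (exp x))\<^sup>2"
      by (simp add: E_def exp_of_real[symmetric] exp_add[symmetric] power2_eq_square algebra_simps)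
    have e0: "exp ((1 - \<mu> + of_nat 0) * of_real x) = E" by (simp add: E_def)
    have "?L = E / D * (w\<^sup>2 * besselK_mom 2 \<nu> w - w * besselK_mom 1 \<nu> w + (z\<^sup>2 - \<nu>\<^sup>2) * besselK \<nu> w)"
      unfolding e0 e1 e2 D_def[symmetric] w_def[symmetric]
      by (simp add: w_def power_mult_distrib algebra_simps add_divide_distrib diff_divide_distrib)
    also have "\<dots> = E / D * ((w\<^sup>2 + z\<^sup>2) * besselK \<nu> w)" unfolding ode by (simp add: algebra_simps)
    also have "w\<^sup>2 + z\<^sup>2 = z\<^sup>2 * D"
      by (simp add: w_def D_def power_mult_distrib algebra_simps exp_double[symmetric] flip: of_real_power exp_of_real)
    finally show ?thesis using D by (simp add: E_def w_def)
  qed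
  have "z\<^sup>2 * lommelW 2 \<mu> \<nu> z - z * lommelW 1 \<mu> \<nu> z + (z\<^sup>2 - \<nu>\<^sup>2) * lommelW 0 \<mu> \<nu> z
    = (\<integral>x. z\<^sup>2 * (exp ((1 - \<mu>) * of_real x) * besselK \<nu> (z * of_real (exp x))) \<partial>lborel)"
    unfolding pw[symmetric] lommelW_def
    by (subst Bochner_Integration.integral_add, (intro Bochner_Integration.integrable_diff integrable_mult_right i)+,
        subst Bochner_Integration.integral_diff, (intro integrable_mult_right i)+) 
       (simp only: integral_mult_right_zero)
  also have "\<dots> = z\<^sup>2 * (exp (- (1 - \<mu>) * of_real (ln t)) * (exp (((1 - \<mu>) - 2) * of_real (ln 2)) * Gamma (((1 - \<mu>) - \<nu>) / 2) * Gamma (((1 - \<mu>) + \<nu>) / 2)))"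
    unfolding z_def integral_mult_right_zero
    by (subst besselK_moment_scaled) (use assms in auto)
  also have "\<dots> = (exp (2 * of_real (ln t)) * exp (- (1 - \<mu>) * of_real (ln t))) * (exp (((1 - \<mu>) - 2) * of_real (ln 2)) * Gamma (((1 - \<mu>) - \<nu>) / 2) * Gamma (((1 - \<mu>) + \<nu>) / 2))"
    using assms(2) by (simp add: z_def exp_double exp_of_real)
  also have "exp (2 * of_real (ln t)) * exp (- (1 - \<mu>) * of_real (ln t)) = exp ((\<mu> + 1) * of_real (ln t))"
    unfolding exp_add[symmetric] by (simp add: algebra_simps)
  also have "((1 - \<mu>) - 2) = - (\<mu> + 1)" by simp
  finally show ?thesis .
qed

text \<open>As \<open>z = e\<^sup>-\<^sup>n\<close> tends to zero, only the dominant branch \<open>z\<^sup>-\<^sup>\<nu>\<close> of the Bessel function survives.\<close>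

lemma lommelW_at_zero:
  assumes nu: "Re \<nu> > 0" and mu: "\<bar>Re (\<mu> + \<nu>)\<bar> < 1" and mu2: "Re \<mu> + \<bar>Re \<nu>\<bar> < 1"
  shows "(\<lambda>n. exp (- \<nu> * of_nat n) * lommelW 0 \<mu> \<nu> (of_real (exp (- real n)))) \<longlonglongrightarrow>
     exp (\<nu> * of_real (ln 2)) / 2 * Gamma \<nu> * (Gamma ((1 - \<mu> - \<nu>) / 2) * Gamma ((1 + \<mu> + \<nu>) / 2) / 2)"
proof -
  define P where "P = (\<lambda>x. exp (\<nu> * of_real x) * besselK \<nu> (of_real (exp x)))"
  \<comment> \<open>\<open>R\<close> is K with its singular factor at zero removed. It is bounded by
    \<Gamma>(Re \<nu>) uniformly and tends to \<Gamma>(\<nu>), which is what dominated convergence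
    needs.\<close>
  define R where "R = (\<lambda>x. \<integral>u. exp (\<nu> * of_real u - of_real (exp u + exp (2 * x - u) / 4)) \<partial>lborel)"
  have P_eq: "P x = exp (\<nu> * of_real (ln 2)) / 2 * R x" for x
    unfolding P_def besselK_exp_arg R_def by (simp add: exp_add[symmetric] algebra_simps exp_diff)
  have gi: "integrable lborel (\<lambda>u. exp (Re \<nu> * u - 1 * exp u))"
    by (rule Gamma_exp_integral_real(1)) (use nu in auto)
  have nR: "norm (exp (\<nu> * of_real u - of_real (exp u + exp (2 * x - u) / 4))) \<le> exp (Re \<nu> * u - 1 * exp u)" for x u
    by simp
  have Rb: "norm (R x) \<le> Gamma (Re \<nu>)" for x
  proof -
    have "integrable lborel (\<lambda>u. exp (\<nu> * of_real u - of_real (exp u + exp (2 * x - u) / 4)))"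
    proof (rule Bochner_Integration.integrable_bound[OF gi])
      show "(\<lambda>u. exp (\<nu> * of_real u - of_real (exp u + exp (2 * x - u) / 4))) \<in> borel_measurable lborel"
        by measurable
    qed (use nR in auto)
    then have "norm (R x) \<le> (\<integral>u. exp (Re \<nu> * u - 1 * exp u) \<partial>lborel)"
      unfolding R_def by (rule Bochner_Integration.integral_norm_bound_integral[OF _ gi nR])
    also have "\<dots> = Gamma (Re \<nu>)" using Gamma_exp_integral_real(2)[of "Re \<nu>" 1] nu by simp
    finally show ?thesis .
  qed
  have Rlim: "(\<lambda>n. R (y - real n)) \<longlonglongrightarrow> Gamma \<nu>" for y
  proof -
    have "(\<lambda>n. R (y - real n)) \<longlonglongrightarrow> (\<integral>u. exp (\<nu> * of_real u - of_real (1 * exp u)) \<partial>lborel)"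
      unfolding R_def
    proof (rule integral_dominated_convergence[OF _ _ gi])
      show "AE u in lborel. (\<lambda>n. exp (\<nu> * of_real u - of_real (exp u + exp (2 * (y - real n) - u) / 4))) \<longlonglongrightarrow> exp (\<nu> * of_real u - of_real (1 * exp u))"
      proof (intro AE_I2 tendsto_intros)
        fix u
        have "(\<lambda>n. exp u + exp (2 * (y - real n) - u) / 4) \<longlonglongrightarrow> exp u + 0" by real_asymp
        then show "(\<lambda>n. exp u + exp (2 * (y - real n) - u) / 4) \<longlonglongrightarrow> 1 * exp u" by simp
      qed
    qed (use nR in auto)
    then show ?thesis using Gamma_exp_integral(2)[of \<nu> 1] nu by simp
  qed
  \<comment> \<open>The limit integral is half a Beta integral with parameters \<open>a\<close> and
    \<open>1 - a\<close>, half because the exponent is 2x. Both parameters have positive real part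
    exactly when |Re (\<mu> + \<nu>)| < 1.\<close>
  define a where "a = (1 - \<mu> - \<nu>) / 2"
  have a: "Re a > 0" "Re (1 - a) > 0" using mu by (auto simp: a_def)
  define Q where "Q = (\<lambda>x::real. exp ((1 - \<mu> - \<nu>) * of_real x) / of_real (1 + exp (2 * x)))"
  have Q_eq: "Q x = exp (a * of_real (0 + 2 * x) - (a + (1 - a)) * of_real (ln (1 + exp (0 + 2 * x))))" for x
  proof -
    have "of_real (1 + exp (2 * x)) = exp (complex_of_real (ln (1 + exp (2 * x))))"
      unfolding exp_of_real using add_pos_pos[OF zero_less_one exp_gt_zero, of "2 * x"] by simp
    then show ?thesis unfolding Q_def by (simp add: a_def exp_diff)
  qed
  have Qi: "integrable lborel Q" "integral\<^sup>L lborel Q = Gamma a * Gamma (1 - a) / 2"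
  proof -
    note B = Beta_exp_integral[OF a]
    show "integrable lborel Q"
      unfolding Q_eq by (rule lborel_integrable_real_affine[OF B(1)]) simp
    have "Gamma a * Gamma (1 - a) = 2 * integral\<^sup>L lborel Q"
      using B(2) lborel_integral_real_affine[of 2 "\<lambda>x. exp (a * of_real x - (a + (1 - a)) * of_real (ln (1 + exp x)))" 0]
      unfolding Q_eq[symmetric] by (simp add: scaleR_conv_of_real)
    then show "integral\<^sup>L lborel Q = Gamma a * Gamma (1 - a) / 2" by simp
  qed
  have W: "exp (- \<nu> * of_nat n) * lommelW 0 \<mu> \<nu> (of_real (exp (- real n))) = exp (\<nu> * of_real (ln 2)) / 2 * (\<integral>x. Q x * R (x - real n) \<partial>lborel)" for n
  proof -
    have "exp (- \<nu> * of_nat n) * (exp ((1 - \<mu> + of_nat 0) * of_real x) / of_real (1 + exp (2 * x)) * besselK_mom 0 \<nu> (of_real (exp (- real n)) * of_real (exp x)))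
       = exp (\<nu> * of_real (ln 2)) / 2 * (Q x * R (x - real n))" for x
    proof -
      have "of_real (exp (- real n)) * of_real (exp x) = complex_of_real (exp (x - real n))"
        by (simp add: exp_diff exp_minus field_simps)
      moreover have "exp (- \<nu> * of_nat n) * exp ((1 - \<mu> + of_nat 0) * of_real x) = exp ((1 - \<mu> - \<nu>) * of_real x) * exp (\<nu> * of_real (x - real n))"
        by (simp add: exp_add[symmetric] algebra_simps)
      ultimately have "exp (- \<nu> * of_nat n) * (exp ((1 - \<mu> + of_nat 0) * of_real x) / of_real (1 + exp (2 * x)) * besselK_mom 0 \<nu> (of_real (exp (- real n)) * of_real (exp x)))
        = Q x * P (x - real n)"
        unfolding Q_def P_def by (simp only: times_divide_eq_left times_divide_eq_right mult.assoc[symmetric])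
      then show ?thesis unfolding P_eq by (simp only: mult_ac)
    qed
    then show ?thesis unfolding lommelW_def by (simp only: flip: integral_mult_right_zero)
  qed
  have "(\<lambda>n. \<integral>x. Q x * R (x - real n) \<partial>lborel) \<longlonglongrightarrow> (\<integral>x. Q x * Gamma \<nu> \<partial>lborel)"
  proof (rule integral_dominated_convergence)
    show "integrable lborel (\<lambda>x. norm (Q x) * Gamma (Re \<nu>))" using Qi(1) by simp
    show "AE x in lborel. norm (Q x * R (x - real n)) \<le> norm (Q x) * Gamma (Re \<nu>)" for n
      using Rb by (auto simp: norm_mult intro!: mult_left_mono)
    show "AE x in lborel. (\<lambda>n. Q x * R (x - real n)) \<longlonglongrightarrow> Q x * Gamma \<nu>"
      by (intro AE_I2 tendsto_intros Rlim)
    show "(\<lambda>x. Q x * Gamma \<nu>) \<in> borel_measurable lborel" using Qi(1) by simp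
    show "(\<lambda>x. Q x * R (x - real n)) \<in> borel_measurable lborel" for n
    proof -
      have "R = (\<lambda>x. P x * (2 / exp (\<nu> * of_real (ln 2))))" using P_eq by (auto simp: field_simps)
      moreover have "P \<in> borel_measurable borel"
        unfolding P_def using besselK_mom_continuous_exp[of 1 0 \<nu>]
        by (intro borel_measurable_continuous_onI continuous_intros) simp
      ultimately have [measurable]: "R \<in> borel_measurable borel" by simp
      show ?thesis using Qi(1) by measurable
    qed
  qed
  from tendsto_mult_left[OF this, of "exp (\<nu> * of_real (ln 2)) / 2"]
  have lim: "(\<lambda>n. exp (- \<nu> * of_nat n) * lommelW 0 \<mu> \<nu> (of_real (exp (- real n)))) \<longlonglongrightarrow> exp (\<nu> * of_real (ln 2)) / 2 * ((Gamma a * Gamma (1 - a) / 2) * Gamma \<nu>)"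
    unfolding W by (simp add: Qi(2))
  have "1 - a = (1 + \<mu> + \<nu>) / 2" by (simp add: a_def field_simps)
  then have "exp (\<nu> * of_real (ln 2)) / 2 * ((Gamma a * Gamma (1 - a) / 2) * Gamma \<nu>) =
      exp (\<nu> * of_real (ln 2)) / 2 * Gamma \<nu> * (Gamma ((1 - \<mu> - \<nu>) / 2) * Gamma ((1 + \<mu> + \<nu>) / 2) / 2)"
    by (simp only: a_def mult_ac times_divide_eq_left times_divide_eq_right divide_divide_eq_left)
  then show ?thesis using lim by metis
qed

section \<open>Lommel and Bessel series\<close>

text \<open>Reciprocal Gamma factors make the series entire in all three arguments. The Lommel and
  Bessel series can then be continued through the parameters at which their usual normalisations
  have poles.\<close>

definition rGamma_sum :: "complex \<Rightarrow> complex \<Rightarrow> complex \<Rightarrow> complex" where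
  "rGamma_sum a b x = (\<Sum>k. x ^ k * rGamma (a + of_nat k) * rGamma (b + of_nat k))"

text \<open>\<open>B k\<close> is the supremum of |1/\<Gamma>(a + k)| over the disc |a| \<le> R. The
  functional equation divides by a + k, of modulus at least k - R, when passing to k + 1; this gives
  the decay needed by the ratio test, uniformly in \<open>a\<close>.\<close>

lemma rGamma_bound:
  fixes R :: real
  assumes R: "R > 0"
  obtains B :: "nat \<Rightarrow> real" where "\<And>k. B k \<ge> 0"
    "\<And>a k. norm a \<le> R \<Longrightarrow> norm (rGamma (a + of_nat k) :: complex) \<le> B k"
    "\<And>k. real k > R \<Longrightarrow> B (Suc k) * (real k - R) \<le> B k"
proof -
  define F where "F = (\<lambda>k. (\<lambda>a. norm (rGamma (a + of_nat k) :: complex)) ` cball 0 R)"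
  define B where "B = (\<lambda>k. Sup (F k))"
  have comp: "compact (F k)" for k
    unfolding F_def
    by (intro compact_continuous_image compact_cball continuous_on_norm holomorphic_on_imp_continuous_on holomorphic_intros)
  have bdd: "bdd_above (F k)" for k
    by (rule bounded_imp_bdd_above[OF compact_imp_bounded[OF comp]])
  have le: "norm (rGamma (a + of_nat k)) \<le> B k" if "norm a \<le> R" for a :: complex and k
    unfolding B_def by (rule cSup_upper[OF _ bdd]) (use that in \<open>auto simp: F_def\<close>)
  have nonneg: "B k \<ge> 0" for k
    by (rule order_trans[OF norm_ge_zero le[of 0 k]]) (use R in simp)
  have step: "B (Suc k) * (real k - R) \<le> B k" if k: "real k > R" for k
  proof -
    have "Sup (F (Suc k)) \<le> B k / (real k - R)"
    proof (rule cSup_least)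
      show "F (Suc k) \<noteq> {}" using R by (auto simp: F_def)
      fix y assume "y \<in> F (Suc k)"
      then obtain a :: complex where a: "norm a \<le> R" "y = norm (rGamma (a + of_nat (Suc k)))" by (auto simp: F_def)
      have "rGamma (a + of_nat k) = (a + of_nat k) * rGamma (a + of_nat k + 1)"
        by (rule rGamma_plus1[symmetric])
      then have eq: "norm (rGamma (a + of_nat k)) = norm (a + of_nat k) * y"
        unfolding a(2) by (simp add: norm_mult add_ac)
      have "real k - R \<le> norm (a + of_nat k)"
        using norm_diff_ineq[of "of_nat k :: complex" a] a(1) by (simp add: add_ac)
      then have "(real k - R) * y \<le> norm (a + of_nat k) * y"
        using a(2) by (intro mult_right_mono) auto
      also have "\<dots> \<le> B k" using le[OF a(1), of k] eq by simp
      finally show "y \<le> B k / (real k - R)" using k by (simp add: field_simps)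
    qed
    then show ?thesis using k by (simp add: B_def field_simps)
  qed
  show ?thesis by (rule that[OF nonneg le step])
qed

lemma rGamma_sum_dominated:
  fixes R :: real
  assumes R: "R > 0"
  obtains g :: "nat \<Rightarrow> real" where "summable g"
    "\<And>a b x k. norm a \<le> R \<Longrightarrow> norm b \<le> R \<Longrightarrow> norm x \<le> R \<Longrightarrow>
       norm (x ^ k * rGamma (a + of_nat k) * rGamma (b + of_nat k) :: complex) \<le> g k"
proof -
  obtain B :: "nat \<Rightarrow> real" where B: "\<And>k. B k \<ge> 0"
    "\<And>a k. norm a \<le> R \<Longrightarrow> norm (rGamma (a + of_nat k) :: complex) \<le> B k"
    "\<And>k. real k > R \<Longrightarrow> B (Suc k) * (real k - R) \<le> B k"
    using rGamma_bound[OF R] by metis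
  define g where "g = (\<lambda>k. R ^ k * B k * B k)"
  \<comment> \<open>From n \<ge> 3R + 2 on, n - R is at least 2R + 2. One factor B(n+1) then absorbs
    R and a factor 1/2, and the other is at most B(n).\<close>
  define N where "N = nat \<lceil>3 * R + 2\<rceil>"
  have "norm (g (Suc n)) \<le> 1/2 * norm (g n)" if "n \<ge> N" for n
  proof -
    have n: "real n - R \<ge> 2 * R + 2" using that unfolding N_def by linarith
    define d where "d = real n - R"
    have d: "d \<ge> 2 * R" "d \<ge> 1" using n R by (auto simp: d_def)
    have st: "B (Suc n) * d \<le> B n" unfolding d_def by (rule B(3)) (use n R in linarith)
    have st1: "B (Suc n) \<le> B n" using st d mult_left_mono[OF d(2) B(1)[of "Suc n"]] by simp
    have "2 * R * B (Suc n) \<le> d * B (Suc n)" using d B(1) by (intro mult_right_mono) auto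
    also have "\<dots> \<le> B n" using st by (simp add: mult.commute)
    finally have "R * B (Suc n) \<le> B n / 2" by simp
    then have "(R * B (Suc n)) * B (Suc n) \<le> B n / 2 * B n"
      using st1 B(1) by (intro mult_mono) auto
    then have "R ^ n * ((R * B (Suc n)) * B (Suc n)) \<le> R ^ n * (B n / 2 * B n)"
      using R by (intro mult_left_mono) auto
    then show ?thesis using R B(1) by (simp add: g_def abs_mult mult_ac)
  qed
  then have "summable g" by (intro summable_ratio_test[of "1/2" N]) auto
  moreover have "norm (x ^ k * rGamma (a + of_nat k) * rGamma (b + of_nat k)) \<le> g k"
    if "norm a \<le> R" "norm b \<le> R" "norm x \<le> R" for a b x :: complex and k
    unfolding norm_mult norm_power g_def using that B(1,2) R
    by (intro mult_mono power_mono mult_nonneg_nonneg zero_le_power) auto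
  ultimately show ?thesis by (rule that)
qed

lemma summable_norm_rGamma_sum: "summable (\<lambda>k. norm (x ^ k * rGamma (a + of_nat k) * rGamma (b + of_nat k) :: complex))"
proof -
  define R where "R = norm a + norm b + norm x + 1"
  have R: "R > 0" by (simp add: R_def add_nonneg_pos)
  from rGamma_sum_dominated[OF R] obtain g where g: "summable g"
    "\<And>a b x k. norm a \<le> R \<Longrightarrow> norm b \<le> R \<Longrightarrow> norm x \<le> R \<Longrightarrow>
       norm (x ^ k * rGamma (a + of_nat k) * rGamma (b + of_nat k) :: complex) \<le> g k" by metis
  show ?thesis
    by (rule summable_comparison_test'[OF g(1), of 0]) (use g(2)[of a b x] in \<open>auto simp: R_def\<close>)
qed

lemma summable_rGamma_sum: "summable (\<lambda>k. x ^ k * rGamma (a + of_nat k) * rGamma (b + of_nat k) :: complex)"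
  using summable_norm_cancel[OF summable_norm_rGamma_sum] .

lemma rGamma_sum_commute: "rGamma_sum a b x = rGamma_sum b a x"
  by (simp add: rGamma_sum_def mult_ac)

lemma rGamma_sum_head: "rGamma_sum a b x = rGamma a * rGamma b + x * rGamma_sum (a + 1) (b + 1) x"
proof -
  have "rGamma_sum a b x = (\<Sum>k. x ^ Suc k * rGamma (a + of_nat (Suc k)) * rGamma (b + of_nat (Suc k))) + rGamma a * rGamma b"
    unfolding rGamma_sum_def using suminf_split_head[OF summable_rGamma_sum[of x a b]] by simp
  also have "(\<Sum>k. x ^ Suc k * rGamma (a + of_nat (Suc k)) * rGamma (b + of_nat (Suc k))) = x * rGamma_sum (a + 1) (b + 1) x"
    unfolding rGamma_sum_def suminf_mult[OF summable_rGamma_sum, symmetric] by (simp add: mult_ac add_ac)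
  finally show ?thesis by simp
qed

text \<open>The series is an integral against counting measure, so the theorem on holomorphic
  parameter integrals covers it.\<close>

lemma rGamma_sum_holomorphic:
  assumes "open U" "f holomorphic_on U" "g holomorphic_on U" "h holomorphic_on U"
  shows "(\<lambda>z. rGamma_sum (f z) (g z) (h z)) holomorphic_on U"
proof -
  define F where "F = (\<lambda>z k. h z ^ k * rGamma (f z + of_nat k) * rGamma (g z + of_nat k) :: complex)"
  have eq: "rGamma_sum (f z) (g z) (h z) = (\<integral>k. F z k \<partial>count_space UNIV)" for z
    unfolding rGamma_sum_def F_def
    by (rule integral_count_space_nat[symmetric]) (simp add: integrable_count_space_nat_iff summable_norm_rGamma_sum)
  have "(\<lambda>z. \<integral>k. F z k \<partial>count_space UNIV) holomorphic_on U"
  proof (rule holomorphic_on_integral[OF assms(1)])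
    show "locally_dominated (count_space UNIV) U F"
    proof (rule locally_dominatedI)
      fix z assume z: "z \<in> U"
      define R where "R = norm (f z) + norm (g z) + norm (h z) + 1"
      have R: "R > 0" by (simp add: R_def add_nonneg_pos)
      from rGamma_sum_dominated[OF R] obtain B where B: "summable B"
        "\<And>a b x k. norm a \<le> R \<Longrightarrow> norm b \<le> R \<Longrightarrow> norm x \<le> R \<Longrightarrow>
           norm (x ^ k * rGamma (a + of_nat k) * rGamma (b + of_nat k) :: complex) \<le> B k" by metis
      have ev: "eventually (\<lambda>w. norm (q w) < norm (q z) + 1) (nhds z)" if "q holomorphic_on U" for q :: "complex \<Rightarrow> complex"
      proof -
        have "isCont q z" using that z assms(1) holomorphic_on_imp_continuous_on continuous_on_eq_continuous_at by blast
        then have "((\<lambda>w. norm (q w)) \<longlongrightarrow> norm (q z)) (nhds z)"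
          by (intro tendsto_norm) (simp add: continuous_within tendsto_at_iff_tendsto_nhds)
        then show ?thesis by (rule order_tendstoD) simp
      qed
      have "eventually (\<lambda>w. w \<in> U \<and> norm (f w) \<le> R \<and> norm (g w) \<le> R \<and> norm (h w) \<le> R) (nhds z)"
        using eventually_nhds_in_open[OF assms(1) z] ev[OF assms(2)] ev[OF assms(3)] ev[OF assms(4)]
        by eventually_elim
          (use norm_ge_zero[of "f z"] norm_ge_zero[of "g z"] norm_ge_zero[of "h z"] in \<open>simp add: R_def; linarith\<close>)
      then obtain e where e: "e > 0"
        "\<And>w. dist w z < e \<Longrightarrow> w \<in> U \<and> norm (f w) \<le> R \<and> norm (g w) \<le> R \<and> norm (h w) \<le> R"
        unfolding eventually_nhds_metric by blast
      have Bn: "B k \<ge> 0" for k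
        by (rule order_trans[OF norm_ge_zero B(2)[of 0 0 0 k]]) (use R in auto)
      show "\<exists>e>0. \<exists>b. ball z e \<subseteq> U \<and> integrable (count_space UNIV) b \<and>
          (\<forall>w\<in>ball z e. \<forall>k\<in>space (count_space UNIV). norm (F w k) \<le> b k)"
      proof (intro exI[of _ e] exI[of _ B] conjI ballI)
        show "integrable (count_space UNIV) B"
          using B(1) Bn by (simp add: integrable_count_space_nat_iff)
        show "norm (F w k) \<le> B k" if "w \<in> ball z e" for w k
          unfolding F_def using e(2)[of w] that by (intro B(2)) (auto simp: dist_commute)
      qed (use e in \<open>auto simp: dist_commute\<close>)
    qed
    show "(\<lambda>z. F z k) holomorphic_on U" for k
      unfolding F_def using assms(2-4) by (intro holomorphic_intros) auto
  qed simp
  then show ?thesis unfolding eq .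
qed

text \<open>x d/dx multiplies the k-th term by k = (a + k - 1) - (a - 1), and the factor a + k - 1
  lowers the Gamma argument from a + k to a + k - 1.\<close>

lemma rGamma_sum_deriv:
  "((\<lambda>x. rGamma_sum a b x) has_field_derivative (deriv (rGamma_sum a b) x)) (at x)"
  "x * deriv (rGamma_sum a b) x = rGamma_sum (a - 1) b x - (a - 1) * rGamma_sum a b x"
proof -
  define c where "c = (\<lambda>k. rGamma (a + of_nat k) * rGamma (b + of_nat k))"
  have s: "summable (\<lambda>n. c n * y ^ n)" for y
    using summable_rGamma_sum[of y a b] by (simp add: c_def mult_ac)
  have eq: "rGamma_sum a b = (\<lambda>x. \<Sum>n. c n * x ^ n)"
    by (rule ext) (simp add: rGamma_sum_def c_def mult_ac)
  have D: "(rGamma_sum a b has_field_derivative (\<Sum>n. diffs c n * x ^ n)) (at x)"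
    unfolding eq by (rule termdiffs_strong_converges_everywhere[OF s])
  then show "((\<lambda>x. rGamma_sum a b x) has_field_derivative (deriv (rGamma_sum a b) x)) (at x)"
    using DERIV_imp_deriv by metis
  have "summable (\<lambda>n. diffs c n * x ^ n)" by (rule termdiff_converges_all[OF s])
  then have "(\<lambda>n. of_nat n * c n * x ^ (n - Suc 0)) sums (\<Sum>n. diffs c n * x ^ n)" by (rule diffs_equiv)
  then have "(\<lambda>n. x * (of_nat n * c n * x ^ (n - Suc 0))) sums (x * (\<Sum>n. diffs c n * x ^ n))" by (rule sums_mult)
  moreover have "x * (of_nat n * c n * x ^ (n - Suc 0)) = x ^ n * rGamma (a - 1 + of_nat n) * rGamma (b + of_nat n) -
      (a - 1) * (x ^ n * rGamma (a + of_nat n) * rGamma (b + of_nat n))" for n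
  proof -
    have "rGamma (a - 1 + of_nat n) = (a - 1 + of_nat n) * rGamma (a + of_nat n)"
      using rGamma_plus1[of "a - 1 + of_nat n"] by (simp add: algebra_simps)
    moreover have "x * (of_nat n * c n * x ^ (n - Suc 0)) = of_nat n * c n * x ^ n" by (cases n) auto
    ultimately show ?thesis by (simp only:) (simp add: c_def algebra_simps)
  qed
  moreover have "(\<lambda>n. x ^ n * rGamma (a - 1 + of_nat n) * rGamma (b + of_nat n) -
      (a - 1) * (x ^ n * rGamma (a + of_nat n) * rGamma (b + of_nat n))) sums
      (rGamma_sum (a - 1) b x - (a - 1) * rGamma_sum a b x)"
    unfolding rGamma_sum_def by (intro sums_diff sums_mult summable_sums summable_rGamma_sum)
  ultimately have "x * (\<Sum>n. diffs c n * x ^ n) = rGamma_sum (a - 1) b x - (a - 1) * rGamma_sum a b x"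
    using sums_unique2 by simp
  then show "x * deriv (rGamma_sum a b) x = rGamma_sum (a - 1) b x - (a - 1) * rGamma_sum a b x"
    using DERIV_imp_deriv[OF D] by simp
qed

text \<open>\<open>lommel_series a b \<mu> \<nu>\<close> is \<open>(z/2)\<^sup>\<mu>\<^sup>+\<^sup>1\<close> times the series with shifts \<open>a\<close>, \<open>b\<close>; the case \<open>a = b = 3\<close> is a
  multiple of the Lommel function \<open>s\<close>, and \<open>\<mu> = \<plusminus>\<nu> - 1\<close> gives the Bessel functions.\<close>

definition lommel_series :: "complex \<Rightarrow> complex \<Rightarrow> complex \<Rightarrow> complex \<Rightarrow> complex \<Rightarrow> complex" where
  "lommel_series a b \<mu> \<nu> z = (z / 2) powr (\<mu> + 1) * rGamma_sum ((\<mu> + \<nu> + a) / 2) ((\<mu> - \<nu> + b) / 2) (- (z\<^sup>2 / 4))"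

lemma lommel_series_deriv_aux:
  assumes z: "Re z > 0"
  shows "((\<lambda>z. (z / 2) powr \<alpha> * rGamma_sum a b (- (z\<^sup>2 / 4))) has_field_derivative
     (z / 2) powr \<alpha> * ((\<alpha> - 2 * (a - 1)) * rGamma_sum a b (- (z\<^sup>2 / 4)) + 2 * rGamma_sum (a - 1) b (- (z\<^sup>2 / 4))) / z) (at z)"
proof -
  define x where "x = - (z\<^sup>2 / 4)"
  have z0: "z \<noteq> 0" and zn: "z / 2 \<notin> \<real>\<^sub>\<le>\<^sub>0" using z by (auto simp: complex_nonpos_Reals_iff)
  have 1: "((\<lambda>z. (z / 2) powr \<alpha>) has_field_derivative (\<alpha> * (z / 2) powr (\<alpha> - 1) * (1 / 2))) (at z)"
    by (rule DERIV_chain2[where f = "\<lambda>z. z powr \<alpha>" and g = "\<lambda>z. z / 2", OF has_field_derivative_powr[OF zn]]) (auto intro!: derivative_eq_intros)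
  have pw: "\<alpha> * (z / 2) powr (\<alpha> - 1) * (1 / 2) = \<alpha> * (z / 2) powr \<alpha> / z"
    using z0 by (simp add: powr_diff field_simps)
  have 2: "((\<lambda>z. rGamma_sum a b (- (z\<^sup>2 / 4))) has_field_derivative (deriv (rGamma_sum a b) x * (2 * x / z))) (at z)"
    unfolding x_def
    by (rule DERIV_chain2[OF rGamma_sum_deriv(1)])
       (use z0 in \<open>auto intro!: derivative_eq_intros simp: power2_eq_square\<close>)
  have d: "deriv (rGamma_sum a b) x * (2 * x / z) = 2 * (rGamma_sum (a - 1) b x - (a - 1) * rGamma_sum a b x) / z"
    unfolding rGamma_sum_deriv(2)[of x a b, symmetric] by simp
  show ?thesis
    using DERIV_mult[OF 1 2] unfolding pw d x_def[symmetric]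
    by (rule DERIV_cong) (use z0 in \<open>simp add: field_simps\<close>)
qed

text \<open>Put \<theta> = z d/dz. Then \<theta> + \<nu> lowers the first shift from 3 to 1 and
  \<theta> - \<nu> the second, each up to a factor 2, so the Bessel operator \<theta>^2 - \<nu>^2
  lowers both.\<close>

lemma lommel_series_deriv:
  assumes z: "Re z > 0"
  shows "(lommel_series 3 3 \<mu> \<nu> has_field_derivative (2 * lommel_series 1 3 \<mu> \<nu> z - \<nu> * lommel_series 3 3 \<mu> \<nu> z) / z) (at z)"
    and "(lommel_series 1 3 \<mu> \<nu> has_field_derivative (2 * lommel_series 1 1 \<mu> \<nu> z + \<nu> * lommel_series 1 3 \<mu> \<nu> z) / z) (at z)"
proof -
  have e1: "(\<mu> + \<nu> + 3) / 2 - 1 = (\<mu> + \<nu> + 1) / 2" "(\<mu> - \<nu> + 3) / 2 - 1 = (\<mu> - \<nu> + 1) / 2" by (simp_all add: field_simps)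
  show "(lommel_series 3 3 \<mu> \<nu> has_field_derivative (2 * lommel_series 1 3 \<mu> \<nu> z - \<nu> * lommel_series 3 3 \<mu> \<nu> z) / z) (at z)"
    using lommel_series_deriv_aux[OF z, of "\<mu> + 1" "(\<mu> + \<nu> + 3) / 2" "(\<mu> - \<nu> + 3) / 2"]
    unfolding lommel_series_def[abs_def] e1 by (rule DERIV_cong) (simp add: field_simps)
  show "(lommel_series 1 3 \<mu> \<nu> has_field_derivative (2 * lommel_series 1 1 \<mu> \<nu> z + \<nu> * lommel_series 1 3 \<mu> \<nu> z) / z) (at z)"
    using lommel_series_deriv_aux[OF z, of "\<mu> + 1" "(\<mu> - \<nu> + 3) / 2" "(\<mu> + \<nu> + 1) / 2"]
    unfolding lommel_series_def[abs_def] e1 rGamma_sum_commute[of "(\<mu> + \<nu> + 1) / 2"]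
    by (rule DERIV_cong) (simp add: field_simps)
qed

text \<open>Lowering both shifts only prepends one term to the series. That term is the
  inhomogeneity of the Lommel equation; it vanishes for \<mu> = \<plusminus>\<nu> - 1, which gives
  the Bessel functions.\<close>

lemma lommel_series_11:
  assumes "z \<noteq> 0"
  shows "4 * lommel_series 1 1 \<mu> \<nu> z = 4 * (z / 2) powr (\<mu> + 1) * rGamma ((\<mu> + \<nu> + 1) / 2) * rGamma ((\<mu> - \<nu> + 1) / 2) - z\<^sup>2 * lommel_series 3 3 \<mu> \<nu> z"
proof -
  have e: "(\<mu> + \<nu> + 1) / 2 + 1 = (\<mu> + \<nu> + 3) / 2" "(\<mu> - \<nu> + 1) / 2 + 1 = (\<mu> - \<nu> + 3) / 2" by (simp_all add: field_simps)
  show ?thesis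
    unfolding lommel_series_def rGamma_sum_head[of "(\<mu> + \<nu> + 1) / 2"] e by (simp add: algebra_simps)
qed

lemma lommel_series_minus_order: "lommel_series 3 3 \<mu> (- \<nu>) z = lommel_series 3 3 \<mu> \<nu> z"
  unfolding lommel_series_def by (simp add: rGamma_sum_commute)

lemma lommel_series_holomorphic_z: "lommel_series a b \<mu> \<nu> holomorphic_on {z. Re z > 0}"
  unfolding lommel_series_def[abs_def]
  by (intro holomorphic_intros rGamma_sum_holomorphic open_Re_pos) (auto simp: complex_nonpos_Reals_iff)

lemma lommel_series_holomorphic:
  assumes "open U" "f holomorphic_on U" "g holomorphic_on U" "z \<noteq> 0"
  shows "(\<lambda>w. lommel_series a b (f w) (g w) z) holomorphic_on U"
  unfolding lommel_series_def using assms
  by (intro holomorphic_intros rGamma_sum_holomorphic) auto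

section \<open>The connection formula\<close>

lemma exp_abs_le: "exp (c * \<bar>y\<bar> - d) \<le> exp (c * y - d) + exp ((- c) * y - d :: real)"
  by (cases "y \<ge> 0") simp_all

text \<open>A majorant uniform over a strip of orders, for continuation in \<nu>. Both signs of the
  order occur because \<nu>y may grow at either end of the line.\<close>

lemma norm_besselK_mom_le:
  assumes "Re z > 0" "\<bar>Re \<nu>\<bar> \<le> \<sigma>"
  shows "norm (besselK_mom n \<nu> z) \<le> besselKr (\<sigma> + real n) (Re z) + besselKr (- (\<sigma> + real n)) (Re z)"
proof -
  have le: "norm (besselK_int n \<nu> z y) \<le> exp ((\<sigma> + real n) * y - Re z * cosh y) + exp ((- (\<sigma> + real n)) * y - Re z * cosh y)" for y
  proof -
    have "norm (besselK_int n \<nu> z y) \<le> exp ((\<bar>Re \<nu>\<bar> + real n) * \<bar>y\<bar> - Re z * cosh y)" by (rule norm_besselK_int_le)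
    also have "\<dots> \<le> exp ((\<sigma> + real n) * \<bar>y\<bar> - Re z * cosh y)"
      using mult_right_mono[of "\<bar>Re \<nu>\<bar> + real n" "\<sigma> + real n" "\<bar>y\<bar>"] assms by simp
    also have "\<dots> \<le> exp ((\<sigma> + real n) * y - Re z * cosh y) + exp ((- (\<sigma> + real n)) * y - Re z * cosh y)"
      by (rule exp_abs_le)
    finally show ?thesis .
  qed
  have "norm (\<integral>y. besselK_int n \<nu> z y \<partial>lborel) \<le> (\<integral>y. exp ((\<sigma> + real n) * y - Re z * cosh y) + exp ((- (\<sigma> + real n)) * y - Re z * cosh y) \<partial>lborel)"
    by (rule Bochner_Integration.integral_norm_bound_integral[OF integrable_besselK_int[OF assms(1)] _ le])
       (intro Bochner_Integration.integrable_add integrable_besselKr assms(1))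
  also have "\<dots> = (\<integral>y. exp ((\<sigma> + real n) * y - Re z * cosh y) \<partial>lborel) + (\<integral>y. exp ((- (\<sigma> + real n)) * y - Re z * cosh y) \<partial>lborel)"
    by (intro Bochner_Integration.integral_add integrable_besselKr assms(1))
  finally show ?thesis
    by (simp add: besselK_mom_def besselKr_def norm_divide)
qed

lemma open_strip: "open {\<nu>::complex. \<bar>Re \<nu>\<bar> < \<sigma>}"
  by (intro open_Collect_less continuous_intros)

lemma convex_strip: "convex {\<nu>::complex. \<bar>Re \<nu>\<bar> < \<sigma>}"
proof -
  have "{\<nu>::complex. \<bar>Re \<nu>\<bar> < \<sigma>} = {\<nu>. Re \<nu> > - \<sigma>} \<inter> {\<nu>. Re \<nu> < \<sigma>}" by auto
  then show ?thesis by (simp add: convex_Int convex_halfspace_Re_gt convex_halfspace_Re_lt)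
qed

lemma locally_dominatedI_global:
  assumes "open U" "integrable M g" "\<And>w t. w \<in> U \<Longrightarrow> t \<in> space M \<Longrightarrow> norm (f w t) \<le> g t"
  shows "locally_dominated M U f"
proof (rule locally_dominatedI)
  fix z assume "z \<in> U"
  then obtain e where "e > 0" "ball z e \<subseteq> U" using assms(1) open_contains_ball by blast
  then show "\<exists>e>0. \<exists>g. ball z e \<subseteq> U \<and> integrable M g \<and> (\<forall>w\<in>ball z e. \<forall>t\<in>space M. norm (f w t) \<le> g t)"
    using assms(2,3) by (intro exI[of _ e] conjI exI[of _ g]) auto
qed

lemma lommelW_holomorphic_order:
  assumes z: "Re z > 0" and "Re \<mu> + \<sigma> < 1" "\<sigma> > 0"
  shows "(\<lambda>\<nu>. lommelW n \<mu> \<nu> z) holomorphic_on {\<nu>. \<bar>Re \<nu>\<bar> < \<sigma>}"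
  unfolding lommelW_def
proof (rule holomorphic_on_integral[OF open_strip])
  show "(\<lambda>x. exp ((1 - \<mu> + of_nat n) * of_real x) / of_real (1 + exp (2 * x)) * besselK_mom n \<nu> (z * of_real (exp x))) \<in> borel_measurable lborel"
    for \<nu> using lommelW_measurable[OF z] by simp
  show "(\<lambda>\<nu>. exp ((1 - \<mu> + of_nat n) * of_real x) / of_real (1 + exp (2 * x)) * besselK_mom n \<nu> (z * of_real (exp x))) holomorphic_on {\<nu>. \<bar>Re \<nu>\<bar> < \<sigma>}" for x
    using z by (intro holomorphic_intros holomorphic_on_subset[OF besselK_order_holomorphic]) (auto simp: one_plus_exp_nonzero simp del: of_real_add of_real_exp)
  define g where "g = (\<lambda>x. exp ((1 - Re \<mu> + real n) * x) * besselKr (\<sigma> + real n) (Re z * exp x) + exp ((1 - Re \<mu> + real n) * x) * besselKr (- (\<sigma> + real n)) (Re z * exp x))"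
  show "locally_dominated lborel {\<nu>. \<bar>Re \<nu>\<bar> < \<sigma>} (\<lambda>\<nu> x. exp ((1 - \<mu> + of_nat n) * of_real x) / of_real (1 + exp (2 * x)) * besselK_mom n \<nu> (z * of_real (exp x)))"
  proof (rule locally_dominatedI_global[OF open_strip])
    show "integrable lborel g"
      unfolding g_def using assms by (intro Bochner_Integration.integrable_add integrable_besselKr_moment) auto
    fix \<nu> x assume "\<nu> \<in> {\<nu>. \<bar>Re \<nu>\<bar> < \<sigma>}"
    then have nu: "\<bar>Re \<nu>\<bar> \<le> \<sigma>" by simp
    have "norm (exp ((1 - \<mu> + of_nat n) * of_real x) / of_real (1 + exp (2 * x)) * besselK_mom n \<nu> (z * of_real (exp x)))
       = exp ((1 - Re \<mu> + real n) * x) / (1 + exp (2 * x)) * norm (besselK_mom n \<nu> (z * of_real (exp x)))"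
      using add_pos_pos[OF zero_less_one exp_gt_zero, of "2 * x"]
      by (simp add: norm_mult norm_divide del: of_real_add)
    also have "\<dots> \<le> exp ((1 - Re \<mu> + real n) * x) / 1 * (besselKr (\<sigma> + real n) (Re z * exp x) + besselKr (- (\<sigma> + real n)) (Re z * exp x))"
      using norm_besselK_mom_le[of "z * of_real (exp x)" \<nu> \<sigma> n] z nu
      by (intro mult_mono frac_le) auto
    also have "\<dots> = g x" by (simp add: g_def algebra_simps)
    finally show "norm (exp ((1 - \<mu> + of_nat n) * of_real x) / of_real (1 + exp (2 * x)) * besselK_mom n \<nu> (z * of_real (exp x))) \<le> g x" .
  qed
qed

lemma rGamma_half_reflection: "rGamma (1/2 + y) * rGamma (1/2 - y) = cos (of_real pi * y) / of_real pi" for y :: complex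
proof -
  have "rGamma (1/2 + y) * rGamma (1 - (1/2 + y)) = sin (of_real pi * (1/2 + y)) / of_real pi"
    by (rule rGamma_reflection_complex)
  moreover have "1 - (1/2 + y) = 1/2 - y" by simp
  moreover have "sin (of_real pi * (1/2 + y)) = cos (of_real pi * y)"
    using sin_cos_eq[of "of_real pi * (1/2 + y)"] cos_minus[of "of_real pi * y"] by (simp add: algebra_simps)
  ultimately show ?thesis by simp
qed

text \<open>\<open>fd\<close> and \<open>gd\<close> stand for t times the derivative. With this
  operator Bessel's equation has no first-order term, so the Wronskian formed with \<open>fd\<close>
  and \<open>gd\<close> has derivative zero, without the usual factor 1/t.\<close>

lemma wronskian_const:
  fixes f fd fdd g gd gdd :: "complex \<Rightarrow> complex"
  assumes f: "\<And>t::real. t > 0 \<Longrightarrow> (f has_field_derivative fd (of_real t) / of_real t) (at (of_real t))"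
    "\<And>t::real. t > 0 \<Longrightarrow> (fd has_field_derivative fdd (of_real t) / of_real t) (at (of_real t))"
    "\<And>t::real. t > 0 \<Longrightarrow> fdd (of_real t) = (\<nu>\<^sup>2 - (of_real t)\<^sup>2) * f (of_real t)"
    and g: "\<And>t::real. t > 0 \<Longrightarrow> (g has_field_derivative gd (of_real t) / of_real t) (at (of_real t))"
    "\<And>t::real. t > 0 \<Longrightarrow> (gd has_field_derivative gdd (of_real t) / of_real t) (at (of_real t))"
    "\<And>t::real. t > 0 \<Longrightarrow> gdd (of_real t) = (\<nu>\<^sup>2 - (of_real t)\<^sup>2) * g (of_real t)"
    and "(t::real) > 0"
  shows "f (of_real t) * gd (of_real t) - fd (of_real t) * g (of_real t) = f 1 * gd 1 - fd 1 * g 1"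
proof -
  define h where "h = (\<lambda>z. f z * gd z - fd z * g z)"
  have d: "((\<lambda>x. h (of_real x)) has_vector_derivative 0) (at x within {0<..})" if "x \<in> {0<..}" for x :: real
  proof -
    have x: "x > 0" using that by simp
    have "(h has_field_derivative 0) (at (of_real x))"
      unfolding h_def
      by (rule DERIV_cong[OF DERIV_diff[OF DERIV_mult[OF f(1)[OF x] g(2)[OF x]] DERIV_mult[OF f(2)[OF x] g(1)[OF x]]]])
         (simp add: f(3)[OF x] g(3)[OF x])
    then show ?thesis by (rule has_vector_derivative_real_field)
  qed
  obtain c where c: "\<And>x. x \<in> {0<..} \<Longrightarrow> h (of_real x) = c"
    using has_vector_derivative_zero_constant[OF convex_real_interval(3) d] by blast
  show ?thesis using c[of t] c[of 1] \<open>t > 0\<close> unfolding h_def by simp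
qed

lemma besselJ_eq: "besselJ \<nu> z = lommel_series 3 3 (\<nu> - 1) \<nu> z"
proof -
  have e: "(\<nu> - 1 + \<nu> + 3) / 2 = \<nu> + 1" "(\<nu> - 1 - \<nu> + 3) / 2 = 1" by (simp_all add: field_simps)
  have "rGamma (1 + of_nat k :: complex) = 1 / fact k" for k
    by (simp add: rGamma_inverse_Gamma Gamma_fact field_simps)
  then show ?thesis unfolding besselJ_def lommel_series_def e rGamma_sum_def by (simp add: add_ac)
qed

text \<open>z times the derivative of J, written as a shifted series so that its leading behaviour
  at zero is visible.\<close>

definition besselJ_theta :: "complex \<Rightarrow> complex \<Rightarrow> complex" where "besselJ_theta \<nu> z = 2 * lommel_series 1 3 (\<nu> - 1) \<nu> z - \<nu> * besselJ \<nu> z"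

lemma besselJ_ode:
  assumes "t > 0"
  shows "(besselJ \<nu> has_field_derivative besselJ_theta \<nu> (of_real t) / of_real t) (at (of_real t))"
    "(besselJ_theta \<nu> has_field_derivative ((\<nu>\<^sup>2 - (of_real t)\<^sup>2) * besselJ \<nu> (of_real t)) / of_real t) (at (of_real t))"
proof -
  have t: "Re (of_real t) > 0" "complex_of_real t \<noteq> 0" using assms by auto
  show 1: "(besselJ \<nu> has_field_derivative besselJ_theta \<nu> (of_real t) / of_real t) (at (of_real t))"
    unfolding besselJ_eq[abs_def] besselJ_theta_def using lommel_series_deriv(1)[OF t(1)] by simp
  have e: "4 * lommel_series 1 1 (\<nu> - 1) \<nu> (of_real t) = - ((of_real t)\<^sup>2 * besselJ \<nu> (of_real t))"
    using lommel_series_11[OF t(2), of "\<nu> - 1" \<nu>] by (simp add: besselJ_eq)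
  show "(besselJ_theta \<nu> has_field_derivative ((\<nu>\<^sup>2 - (of_real t)\<^sup>2) * besselJ \<nu> (of_real t)) / of_real t) (at (of_real t))"
    unfolding besselJ_theta_def[abs_def]
  proof (rule DERIV_cong[OF DERIV_diff[OF DERIV_cmult[OF lommel_series_deriv(2)[OF t(1)]] DERIV_cmult[OF 1]]])
    show "2 * ((2 * lommel_series 1 1 (\<nu> - 1) \<nu> (of_real t) + \<nu> * lommel_series 1 3 (\<nu> - 1) \<nu> (of_real t)) / of_real t) - \<nu> * (besselJ_theta \<nu> (of_real t) / of_real t)
       = (\<nu>\<^sup>2 - (of_real t)\<^sup>2) * besselJ \<nu> (of_real t) / of_real t"
      using t(2) e unfolding besselJ_theta_def by (simp add: field_simps power2_eq_square)
  qed
qed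

lemma rGamma_sum_zero: "rGamma_sum a b 0 = rGamma a * rGamma b"
  using rGamma_sum_head[of a b 0] by simp

lemma rGamma_sum_lim: "(\<lambda>n. rGamma_sum a b (- ((of_real (exp (- real n)))\<^sup>2 / 4))) \<longlonglongrightarrow> rGamma a * rGamma b"
proof -
  have "isCont (rGamma_sum a b) 0" using rGamma_sum_deriv(1)[of a b 0] DERIV_isCont by blast
  moreover have "(\<lambda>n. - ((complex_of_real (exp (- real n)))\<^sup>2 / 4)) \<longlonglongrightarrow> - ((of_real 0)\<^sup>2 / 4)"
    by (intro tendsto_intros) (real_asymp | simp)+
  ultimately show ?thesis
    using isCont_tendsto_compose[of 0 "rGamma_sum a b"] by (simp add: rGamma_sum_zero)
qed

lemma lommel_series_exp:
  "lommel_series a b \<mu> \<nu> (of_real (exp x)) = exp ((\<mu> + 1) * of_real (x - ln 2)) * rGamma_sum ((\<mu> + \<nu> + a) / 2) ((\<mu> - \<nu> + b) / 2) (- ((of_real (exp x))\<^sup>2 / 4))"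
proof -
  have "complex_of_real (exp x) / 2 = of_real (exp (x - ln 2))" by (simp add: exp_diff)
  moreover have "complex_of_real (exp (x - ln 2)) powr (\<mu> + 1) = exp ((\<mu> + 1) * of_real (x - ln 2))"
    by (simp add: powr_def Ln_of_real del: of_real_exp of_real_diff)
  ultimately show ?thesis unfolding lommel_series_def by simp
qed

text \<open>The Wronskian is constant, so it may be evaluated along t = e^(-n). The powers t^\<nu>
  and t^(-\<nu>) cancel exactly, only the leading coefficients survive in the limit, and the
  reflection formula turns them into the sine.\<close>

lemma besselJ_wronskian:
  assumes "t > 0"
  shows "besselJ \<nu> (of_real t) * besselJ_theta (- \<nu>) (of_real t) - besselJ_theta \<nu> (of_real t) * besselJ (- \<nu>) (of_real t) = - 2 * sin (of_real pi * \<nu>) / of_real pi"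
proof -
  define w where "w = (\<lambda>z. besselJ \<nu> z * besselJ_theta (- \<nu>) z - besselJ_theta \<nu> z * besselJ (- \<nu>) z)"
  have const: "w (of_real t) = w 1" if "t > 0" for t :: real
    unfolding w_def
    by (rule wronskian_const[where \<nu> = \<nu> and fdd = "\<lambda>z. (\<nu>\<^sup>2 - z\<^sup>2) * besselJ \<nu> z" and gdd = "\<lambda>z. (\<nu>\<^sup>2 - z\<^sup>2) * besselJ (- \<nu>) z"])
       (use that besselJ_ode[of _ \<nu>] besselJ_ode[of _ "- \<nu>"] in auto)
  define S where "S = (\<lambda>(\<nu>::complex) (n::nat). rGamma_sum (\<nu> + 1) 1 (- ((of_real (exp (- real n)))\<^sup>2 / 4)))"
  define Q where "Q = (\<lambda>(\<nu>::complex) (n::nat). rGamma_sum \<nu> 1 (- ((of_real (exp (- real n)))\<^sup>2 / 4)))"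
  define A where "A = (\<lambda>(\<nu>::complex) (n::nat). exp (\<nu> * of_real (- real n - ln 2)))"
  have J: "besselJ \<nu> (of_real (exp (- real n))) = A \<nu> n * S \<nu> n"
    "besselJ_theta \<nu> (of_real (exp (- real n))) = A \<nu> n * (2 * Q \<nu> n - \<nu> * S \<nu> n)" for \<nu> n
  proof -
    have e: "(\<nu> - 1 + \<nu> + 3) / 2 = \<nu> + 1" "(\<nu> - 1 - \<nu> + 3) / 2 = 1" "(\<nu> - 1 + \<nu> + 1) / 2 = \<nu>" by (simp_all add: field_simps)
    show "besselJ \<nu> (of_real (exp (- real n))) = A \<nu> n * S \<nu> n"
      unfolding besselJ_eq lommel_series_exp e A_def S_def Q_def by simp
    then show "besselJ_theta \<nu> (of_real (exp (- real n))) = A \<nu> n * (2 * Q \<nu> n - \<nu> * S \<nu> n)"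
      unfolding besselJ_theta_def unfolding lommel_series_exp e A_def Q_def by (simp add: right_diff_distrib)
  qed
  have AA: "A \<nu> n * A (- \<nu>) n = 1" for n by (simp add: A_def exp_add[symmetric])
  have "w (of_real (exp (- real n))) = (A \<nu> n * A (- \<nu>) n) * (S \<nu> n * (2 * Q (- \<nu>) n + \<nu> * S (- \<nu>) n) - (2 * Q \<nu> n - \<nu> * S \<nu> n) * S (- \<nu>) n)" for n
    unfolding w_def J by (simp add: algebra_simps)
  then have W1: "w 1 = S \<nu> n * (2 * Q (- \<nu>) n + \<nu> * S (- \<nu>) n) - (2 * Q \<nu> n - \<nu> * S \<nu> n) * S (- \<nu>) n" for n
    using const[of "exp (- real n)"] AA by simp
  have lim: "(\<lambda>n. S \<nu> n * (2 * Q (- \<nu>) n + \<nu> * S (- \<nu>) n) - (2 * Q \<nu> n - \<nu> * S \<nu> n) * S (- \<nu>) n) \<longlonglongrightarrow>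
     (rGamma (\<nu> + 1) * rGamma 1) * (2 * (rGamma (- \<nu>) * rGamma 1) + \<nu> * (rGamma (- \<nu> + 1) * rGamma 1)) - (2 * (rGamma \<nu> * rGamma 1) - \<nu> * (rGamma (\<nu> + 1) * rGamma 1)) * (rGamma (- \<nu> + 1) * rGamma 1)"
    unfolding S_def Q_def by (intro tendsto_intros rGamma_sum_lim)
  have "w 1 = (rGamma (\<nu> + 1) * rGamma 1) * (2 * (rGamma (- \<nu>) * rGamma 1) + \<nu> * (rGamma (- \<nu> + 1) * rGamma 1)) - (2 * (rGamma \<nu> * rGamma 1) - \<nu> * (rGamma (\<nu> + 1) * rGamma 1)) * (rGamma (- \<nu> + 1) * rGamma 1)"
    by (rule LIMSEQ_unique[OF tendsto_const lim[folded W1]])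
  also have "\<dots> = - 2 * (rGamma \<nu> * rGamma (1 - \<nu>))"
  proof -
    have a: "rGamma \<nu> = \<nu> * rGamma (\<nu> + 1)" by (simp add: rGamma_plus1)
    have b: "rGamma (- \<nu>) = - \<nu> * rGamma (1 - \<nu>)" using rGamma_plus1[of "- \<nu>"] by simp
    have c: "- \<nu> + 1 = 1 - \<nu>" by simp
    have alg: "(p * e) * (2 * ((- \<nu> * q) * e) + \<nu> * (q * e)) - (2 * ((\<nu> * p) * e) - \<nu> * (p * e)) * (q * e) = - 2 * ((\<nu> * p) * q)"
      if "e = 1" for p q e :: complex
      using that by (simp add: algebra_simps)
    show ?thesis unfolding a b c by (rule alg) simp
  qed
  also have "\<dots> = - 2 * sin (of_real pi * \<nu>) / of_real pi"
    unfolding rGamma_reflection_complex by simp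
  finally show ?thesis using const[OF assms] unfolding w_def by simp
qed

section \<open>The difference of the integral and the Lommel series\<close>

definition lommel_cc :: "complex \<Rightarrow> complex \<Rightarrow> complex" where
  "lommel_cc \<mu> \<nu> = 4 / of_real pi ^ 2 * cos (of_real pi * (\<mu> - \<nu>) / 2) * cos (of_real pi * (\<mu> + \<nu>) / 2)"

text \<open>\<open>lommel_cc\<close> rescales the integral so that both terms satisfy Bessel's
  equation with the same inhomogeneity; the difference therefore solves the homogeneous
  equation.\<close>

definition lommel_defect :: "complex \<Rightarrow> complex \<Rightarrow> complex \<Rightarrow> complex" where
  "lommel_defect \<mu> \<nu> z = lommel_cc \<mu> \<nu> * lommelW 0 \<mu> \<nu> z - lommel_series 3 3 \<mu> \<nu> z"

definition lommel_defect_theta :: "complex \<Rightarrow> complex \<Rightarrow> complex \<Rightarrow> complex" where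
  "lommel_defect_theta \<mu> \<nu> z = lommel_cc \<mu> \<nu> * (- z * lommelW 1 \<mu> \<nu> z) - (2 * lommel_series 1 3 \<mu> \<nu> z - \<nu> * lommel_series 3 3 \<mu> \<nu> z)"

lemma lommelW_minus_order: "lommelW 0 \<mu> (- \<nu>) z = lommelW 0 \<mu> \<nu> z"
  unfolding lommelW_def by (simp only: besselK_minus_order)

lemma lommel_defect_minus_order: "lommel_defect \<mu> (- \<nu>) z = lommel_defect \<mu> \<nu> z"
  unfolding lommel_defect_def lommel_cc_def by (simp add: lommel_series_minus_order lommelW_minus_order)

text \<open>Each cosine, divided by \<pi>, is a product of two reciprocal Gamma values. One of them
  cancels the Gamma factor coming from the moment of K, the other is the factor in the leading term
  of the Lommel series.\<close>

lemma lommel_cc_Gamma: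
  assumes "Re (1 - \<mu> - \<nu>) > 0" "Re (1 - \<mu> + \<nu>) > 0"
  shows "lommel_cc \<mu> \<nu> * (Gamma ((1 - \<mu> - \<nu>) / 2) * Gamma ((1 - \<mu> + \<nu>) / 2)) = 4 * (rGamma ((\<mu> + \<nu> + 1) / 2) * rGamma ((\<mu> - \<nu> + 1) / 2))"
proof -
  have r: "cos (of_real pi * y) / of_real pi * Gamma (1/2 - y) = rGamma (1/2 + y)" if "Re (1/2 - y) > 0" for y :: complex
    unfolding rGamma_half_reflection[symmetric] using Gamma_nonzero_Re_pos[OF that]
    by (simp add: rGamma_inverse_Gamma)
  have e: "1/2 - (\<mu> + \<nu>) / 2 = (1 - \<mu> - \<nu>) / 2" "1/2 - (\<mu> - \<nu>) / 2 = (1 - \<mu> + \<nu>) / 2"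
     "1/2 + (\<mu> + \<nu>) / 2 = (\<mu> + \<nu> + 1) / 2" "1/2 + (\<mu> - \<nu>) / 2 = (\<mu> - \<nu> + 1) / 2" by (simp_all add: field_simps)
  have 1: "cos (of_real pi * (\<mu> + \<nu>) / 2) / of_real pi * Gamma ((1 - \<mu> - \<nu>) / 2) = rGamma ((\<mu> + \<nu> + 1) / 2)"
    using r[of "(\<mu> + \<nu>) / 2"] assms unfolding e by simp
  have 2: "cos (of_real pi * (\<mu> - \<nu>) / 2) / of_real pi * Gamma ((1 - \<mu> + \<nu>) / 2) = rGamma ((\<mu> - \<nu> + 1) / 2)"
    using r[of "(\<mu> - \<nu>) / 2"] assms unfolding e by simp
  show ?thesis unfolding 1[symmetric] 2[symmetric] lommel_cc_def by (simp add: power2_eq_square)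
qed

lemma lommel_defect_ode:
  assumes mn: "Re \<mu> + \<bar>Re \<nu>\<bar> < 1" and t: "t > 0"
  shows "(lommel_defect \<mu> \<nu> has_field_derivative lommel_defect_theta \<mu> \<nu> (of_real t) / of_real t) (at (of_real t))"
    "(lommel_defect_theta \<mu> \<nu> has_field_derivative ((\<nu>\<^sup>2 - (of_real t)\<^sup>2) * lommel_defect \<mu> \<nu> (of_real t)) / of_real t) (at (of_real t))"
proof -
  define z where "z = complex_of_real t"
  have z: "Re z > 0" "z \<noteq> 0" using t by (auto simp: z_def)
  have "(lommel_defect \<mu> \<nu> has_field_derivative (lommel_cc \<mu> \<nu> * - lommelW (Suc 0) \<mu> \<nu> z - (2 * lommel_series 1 3 \<mu> \<nu> z - \<nu> * lommel_series 3 3 \<mu> \<nu> z) / z)) (at z)"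
    unfolding lommel_defect_def[abs_def]
    by (intro DERIV_diff DERIV_cmult has_field_derivative_lommelW mn z lommel_series_deriv)
  then show "(lommel_defect \<mu> \<nu> has_field_derivative lommel_defect_theta \<mu> \<nu> (of_real t) / of_real t) (at (of_real t))"
    unfolding z_def[symmetric] by (rule DERIV_cong) (use z in \<open>simp add: lommel_defect_theta_def field_simps\<close>)
  have d: "(lommel_defect_theta \<mu> \<nu> has_field_derivative (lommel_cc \<mu> \<nu> * (- z * - lommelW (Suc 1) \<mu> \<nu> z + - 1 * lommelW 1 \<mu> \<nu> z)
      - (2 * ((2 * lommel_series 1 1 \<mu> \<nu> z + \<nu> * lommel_series 1 3 \<mu> \<nu> z) / z) - \<nu> * ((2 * lommel_series 1 3 \<mu> \<nu> z - \<nu> * lommel_series 3 3 \<mu> \<nu> z) / z)))) (at z)"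
    unfolding lommel_defect_theta_def[abs_def]
    by (intro DERIV_diff DERIV_cmult DERIV_mult' has_field_derivative_lommelW mn z lommel_series_deriv) (auto intro!: derivative_eq_intros)
  have pw: "(z / 2) powr (\<mu> + 1) = exp ((\<mu> + 1) * of_real (ln t)) * exp (- (\<mu> + 1) * of_real (ln 2))"
  proof -
    have "z / 2 = of_real (exp (ln t - ln 2))" using t by (simp add: z_def exp_diff)
    then show ?thesis by (simp add: powr_def Ln_of_real exp_add[symmetric] algebra_simps del: of_real_exp of_real_diff) 
        (simp add: algebra_simps)
  qed
  have W: "lommel_cc \<mu> \<nu> * (z\<^sup>2 * lommelW 2 \<mu> \<nu> z - z * lommelW 1 \<mu> \<nu> z + (z\<^sup>2 - \<nu>\<^sup>2) * lommelW 0 \<mu> \<nu> z) = 4 * (z / 2) powr (\<mu> + 1) * rGamma ((\<mu> + \<nu> + 1) / 2) * rGamma ((\<mu> - \<nu> + 1) / 2)"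
  proof -
    have "lommel_cc \<mu> \<nu> * (z\<^sup>2 * lommelW 2 \<mu> \<nu> z - z * lommelW 1 \<mu> \<nu> z + (z\<^sup>2 - \<nu>\<^sup>2) * lommelW 0 \<mu> \<nu> z)
      = (z / 2) powr (\<mu> + 1) * (lommel_cc \<mu> \<nu> * (Gamma ((1 - \<mu> - \<nu>) / 2) * Gamma ((1 - \<mu> + \<nu>) / 2)))"
      unfolding pw using lommelW_ode[OF mn t] by (simp add: z_def)
    also have "lommel_cc \<mu> \<nu> * (Gamma ((1 - \<mu> - \<nu>) / 2) * Gamma ((1 - \<mu> + \<nu>) / 2)) = 4 * (rGamma ((\<mu> + \<nu> + 1) / 2) * rGamma ((\<mu> - \<nu> + 1) / 2))"
      by (rule lommel_cc_Gamma) (use mn in auto)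
    finally show ?thesis by simp
  qed
  have "lommel_cc \<mu> \<nu> * (z\<^sup>2 * lommelW 2 \<mu> \<nu> z - z * lommelW 1 \<mu> \<nu> z) - (4 * lommel_series 1 1 \<mu> \<nu> z + \<nu>\<^sup>2 * lommel_series 3 3 \<mu> \<nu> z) = (\<nu>\<^sup>2 - z\<^sup>2) * lommel_defect \<mu> \<nu> z"
    using W unfolding lommel_series_11[OF z(2)] lommel_defect_def by (simp add: algebra_simps)
  moreover have aux: "lommel_cc \<mu> \<nu> * (- z * - lommelW (Suc 1) \<mu> \<nu> z + - 1 * lommelW 1 \<mu> \<nu> z)
      - (2 * ((2 * lommel_series 1 1 \<mu> \<nu> z + \<nu> * lommel_series 1 3 \<mu> \<nu> z) / z) - \<nu> * ((2 * lommel_series 1 3 \<mu> \<nu> z - \<nu> * lommel_series 3 3 \<mu> \<nu> z) / z))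
      = (lommel_cc \<mu> \<nu> * (z\<^sup>2 * lommelW 2 \<mu> \<nu> z - z * lommelW 1 \<mu> \<nu> z) - (4 * lommel_series 1 1 \<mu> \<nu> z + \<nu>\<^sup>2 * lommel_series 3 3 \<mu> \<nu> z)) / z"
    using z(2) by (simp add: field_simps power2_eq_square numeral_2_eq_2)
  ultimately have "lommel_cc \<mu> \<nu> * (- z * - lommelW (Suc 1) \<mu> \<nu> z + - 1 * lommelW 1 \<mu> \<nu> z)
      - (2 * ((2 * lommel_series 1 1 \<mu> \<nu> z + \<nu> * lommel_series 1 3 \<mu> \<nu> z) / z) - \<nu> * ((2 * lommel_series 1 3 \<mu> \<nu> z - \<nu> * lommel_series 3 3 \<mu> \<nu> z) / z)) = (\<nu>\<^sup>2 - z\<^sup>2) * lommel_defect \<mu> \<nu> z / z"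
    by (simp only:)
  then show "(lommel_defect_theta \<mu> \<nu> has_field_derivative ((\<nu>\<^sup>2 - (of_real t)\<^sup>2) * lommel_defect \<mu> \<nu> (of_real t)) / of_real t) (at (of_real t))"
    using d unfolding z_def[symmetric] by simp
qed

definition lommel_defect_wronskian :: "complex \<Rightarrow> complex \<Rightarrow> complex" where
  "lommel_defect_wronskian \<mu> \<nu> = lommel_defect \<mu> \<nu> 1 * besselJ_theta \<nu> 1 - lommel_defect_theta \<mu> \<nu> 1 * besselJ \<nu> 1"

lemma lommel_defect_wronskian_const:
  assumes mn: "Re \<mu> + \<bar>Re \<nu>\<bar> < 1" and t: "t > 0"
  shows "lommel_defect \<mu> \<nu> (of_real t) * besselJ_theta \<nu> (of_real t) - lommel_defect_theta \<mu> \<nu> (of_real t) * besselJ \<nu> (of_real t) = lommel_defect_wronskian \<mu> \<nu>"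
  unfolding lommel_defect_wronskian_def
  by (rule wronskian_const[where \<nu> = \<nu> and fdd = "\<lambda>z. (\<nu>\<^sup>2 - z\<^sup>2) * lommel_defect \<mu> \<nu> z" and gdd = "\<lambda>z. (\<nu>\<^sup>2 - z\<^sup>2) * besselJ \<nu> z"])
     (use t lommel_defect_ode[OF mn] besselJ_ode[of _ \<nu>] in auto)

text \<open>The defining formula is not visibly even in \<nu>. It is t times the derivative of
  \<open>lommel_defect\<close>, which is even, and derivatives are unique.\<close>

lemma lommel_defect_theta_minus_order:
  assumes mn: "Re \<mu> + \<bar>Re \<nu>\<bar> < 1" and t: "t > 0"
  shows "lommel_defect_theta \<mu> (- \<nu>) (of_real t) = lommel_defect_theta \<mu> \<nu> (of_real t)"
proof -
  have e: "lommel_defect \<mu> (- \<nu>) = lommel_defect \<mu> \<nu>" by (rule ext) (rule lommel_defect_minus_order)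
  have "lommel_defect_theta \<mu> (- \<nu>) (of_real t) / of_real t = lommel_defect_theta \<mu> \<nu> (of_real t) / of_real t"
    by (rule DERIV_unique[OF lommel_defect_ode(1)[of \<mu> "- \<nu>" t, unfolded e] lommel_defect_ode(1)[of \<mu> \<nu> t]]) (use mn t in auto)
  then show ?thesis using t by simp
qed

text \<open>Cramer's rule for a solution in terms of J of orders \<nu> and -\<nu>. The Wronskian of
  these two, a multiple of sin(\<pi>\<nu>), is kept on the left, so integer orders are
  included.\<close>

lemma lommel_defect_combination:
  assumes mn: "Re \<mu> + \<bar>Re \<nu>\<bar> < 1" and t: "t > 0"
  shows "lommel_defect \<mu> \<nu> (of_real t) * (- 2 * sin (of_real pi * \<nu>) / of_real pi) = lommel_defect_wronskian \<mu> (- \<nu>) * besselJ \<nu> (of_real t) - lommel_defect_wronskian \<mu> \<nu> * besselJ (- \<nu>) (of_real t)"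
proof -
  have 1: "lommel_defect \<mu> \<nu> (of_real t) * besselJ_theta (- \<nu>) (of_real t) - lommel_defect_theta \<mu> \<nu> (of_real t) * besselJ (- \<nu>) (of_real t) = lommel_defect_wronskian \<mu> (- \<nu>)"
    using lommel_defect_wronskian_const[of \<mu> "- \<nu>" t] mn t lommel_defect_theta_minus_order[OF mn t] lommel_defect_minus_order[of \<mu> \<nu> "of_real t"] by simp
  show ?thesis
    unfolding lommel_defect_wronskian_const[OF mn t, symmetric] 1[symmetric] besselJ_wronskian[OF t, symmetric]
    by (simp add: algebra_simps)
qed

lemma lommel_defect_wronskian_holomorphic:
  assumes "Re \<mu> + \<sigma> < 1" "\<sigma> > 0"
  shows "(\<lambda>\<nu>. lommel_defect_wronskian \<mu> \<nu>) holomorphic_on {\<nu>. \<bar>Re \<nu>\<bar> < \<sigma>}"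
  unfolding lommel_defect_wronskian_def lommel_defect_def lommel_defect_theta_def besselJ_theta_def besselJ_eq lommel_cc_def
  using assms by (intro holomorphic_intros lommel_series_holomorphic lommelW_holomorphic_order open_strip) auto

text \<open>For Re \<nu> > 0 the Wronskian with J of order \<nu> is the coefficient of the dominant
  solution J of order -\<nu>. Comparing the coefficients of t^(-\<nu>) as t tends to zero determines
  it.\<close>

lemma lommel_defect_wronskian_right:
  assumes mn: "Re \<mu> + \<bar>Re \<nu>\<bar> < 1" "\<bar>Re (\<mu> + \<nu>)\<bar> < 1" and nu: "0 < Re \<nu>" "Re \<nu> < 1"
  shows "lommel_defect_wronskian \<mu> \<nu> = 2 / of_real pi * cos (of_real pi * (\<mu> - \<nu>) / 2)"
proof -
  define G where "G = Gamma ((1 - \<mu> - \<nu>) / 2) * Gamma ((1 + \<mu> + \<nu>) / 2)"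
  define K2 where "K2 = exp (\<nu> * of_real (ln 2))"
  have K20: "K2 \<noteq> 0" by (simp add: K2_def)
  \<comment> \<open>This is t^\<nu> at t = e^(-n). It normalises J of order -\<nu> to a finite limit
    and makes J of order \<nu> and the Lommel series vanish, the latter because Re (\<mu> + \<nu> +
    1) > 0.\<close>
  define X where "X = (\<lambda>n. exp (- \<nu> * of_nat n))"
  have small: "(\<lambda>n. exp (- s * of_nat n)) \<longlonglongrightarrow> 0" if "Re s > 0" for s :: complex
  proof (rule tendsto_norm_zero_cancel)
    define a where "a = Re s"
    have "a > 0" using that by (simp add: a_def)
    then have "(\<lambda>n. exp (- a * real n)) \<longlonglongrightarrow> 0" by real_asymp
    then show "(\<lambda>n. norm (exp (- s * of_nat n))) \<longlonglongrightarrow> 0" by (simp add: a_def)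
  qed
  have limJ: "(\<lambda>n. X n * besselJ \<nu> (of_real (exp (- real n)))) \<longlonglongrightarrow> 0"
  proof -
    have "(\<lambda>n. exp (- (2 * \<nu>) * of_nat n) * (exp (- \<nu> * of_real (ln 2)) * rGamma_sum ((\<nu> - 1 + \<nu> + 3) / 2) ((\<nu> - 1 - \<nu> + 3) / 2) (- ((of_real (exp (- real n)))\<^sup>2 / 4))))
      \<longlonglongrightarrow> 0 * (exp (- \<nu> * of_real (ln 2)) * (rGamma ((\<nu> - 1 + \<nu> + 3) / 2) * rGamma ((\<nu> - 1 - \<nu> + 3) / 2)))"
      using nu by (intro tendsto_intros rGamma_sum_lim small) auto
    moreover have "X n * exp ((\<nu> - 1 + 1) * of_real (- real n - ln 2)) = exp (- (2 * \<nu>) * of_nat n) * exp (- \<nu> * of_real (ln 2))" for n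
      unfolding X_def exp_add[symmetric] by (rule arg_cong[where f = exp]) (simp add: algebra_simps)
    then have "X n * besselJ \<nu> (of_real (exp (- real n))) = exp (- (2 * \<nu>) * of_nat n) * (exp (- \<nu> * of_real (ln 2)) * rGamma_sum ((\<nu> - 1 + \<nu> + 3) / 2) ((\<nu> - 1 - \<nu> + 3) / 2) (- ((of_real (exp (- real n)))\<^sup>2 / 4)))" for n
      unfolding besselJ_eq lommel_series_exp mult.assoc[symmetric] by (simp only:)
    ultimately show ?thesis by simp
  qed
  have limJm: "(\<lambda>n. X n * besselJ (- \<nu>) (of_real (exp (- real n)))) \<longlonglongrightarrow> K2 * rGamma (1 - \<nu>)"
  proof -
    have e: "(- \<nu> - 1 + - \<nu> + 3) / 2 = 1 - \<nu>" "(- \<nu> - 1 - - \<nu> + 3) / 2 = 1" by (simp_all add: field_simps)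
    have "(\<lambda>n. K2 * rGamma_sum (1 - \<nu>) 1 (- ((of_real (exp (- real n)))\<^sup>2 / 4))) \<longlonglongrightarrow> K2 * (rGamma (1 - \<nu>) * rGamma 1)"
      by (intro tendsto_intros rGamma_sum_lim)
    moreover have "X n * besselJ (- \<nu>) (of_real (exp (- real n))) = K2 * rGamma_sum (1 - \<nu>) 1 (- ((of_real (exp (- real n)))\<^sup>2 / 4))" for n
      unfolding X_def besselJ_eq lommel_series_exp e K2_def mult.assoc[symmetric] exp_add[symmetric]
      by (simp add: algebra_simps)
    ultimately show ?thesis by simp
  qed
  have limT: "(\<lambda>n. X n * lommel_defect \<mu> \<nu> (of_real (exp (- real n)))) \<longlonglongrightarrow> lommel_cc \<mu> \<nu> * (K2 / 2 * Gamma \<nu> * (G / 2)) - 0"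
  proof -
    have "(\<lambda>n. exp (- (\<mu> + \<nu> + 1) * of_nat n) * (exp (- (\<mu> + 1) * of_real (ln 2)) * rGamma_sum ((\<mu> + \<nu> + 3) / 2) ((\<mu> - \<nu> + 3) / 2) (- ((of_real (exp (- real n)))\<^sup>2 / 4))))
      \<longlonglongrightarrow> 0 * (exp (- (\<mu> + 1) * of_real (ln 2)) * (rGamma ((\<mu> + \<nu> + 3) / 2) * rGamma ((\<mu> - \<nu> + 3) / 2)))"
      using mn by (intro tendsto_intros rGamma_sum_lim small) auto
    moreover have "X n * lommel_series 3 3 \<mu> \<nu> (of_real (exp (- real n))) = exp (- (\<mu> + \<nu> + 1) * of_nat n) * (exp (- (\<mu> + 1) * of_real (ln 2)) * rGamma_sum ((\<mu> + \<nu> + 3) / 2) ((\<mu> - \<nu> + 3) / 2) (- ((of_real (exp (- real n)))\<^sup>2 / 4)))" for n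
      unfolding X_def lommel_series_exp mult.assoc[symmetric] exp_add[symmetric]
      by (simp add: algebra_simps)
    ultimately have "(\<lambda>n. X n * lommel_series 3 3 \<mu> \<nu> (of_real (exp (- real n)))) \<longlonglongrightarrow> 0" by simp
    from tendsto_diff[OF tendsto_mult_left[OF lommelW_at_zero[OF nu(1) mn(2,1)], of "lommel_cc \<mu> \<nu>"] this]
    show ?thesis unfolding lommel_defect_def X_def K2_def G_def by (simp add: algebra_simps)
  qed
  define s where "s = sin (of_real pi * \<nu>)"
  have L1: "(\<lambda>n. X n * lommel_defect \<mu> \<nu> (of_real (exp (- real n))) * (- 2 * s / of_real pi)) \<longlonglongrightarrow> (lommel_cc \<mu> \<nu> * (K2 / 2 * Gamma \<nu> * (G / 2)) - 0) * (- 2 * s / of_real pi)"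
    by (intro tendsto_intros limT) simp
  have L2: "(\<lambda>n. lommel_defect_wronskian \<mu> (- \<nu>) * (X n * besselJ \<nu> (of_real (exp (- real n)))) - lommel_defect_wronskian \<mu> \<nu> * (X n * besselJ (- \<nu>) (of_real (exp (- real n))))) \<longlonglongrightarrow> lommel_defect_wronskian \<mu> (- \<nu>) * 0 - lommel_defect_wronskian \<mu> \<nu> * (K2 * rGamma (1 - \<nu>))"
    by (intro tendsto_intros limJ limJm)
  have eqX: "X n * lommel_defect \<mu> \<nu> (of_real (exp (- real n))) * (- 2 * s / of_real pi) = lommel_defect_wronskian \<mu> (- \<nu>) * (X n * besselJ \<nu> (of_real (exp (- real n)))) - lommel_defect_wronskian \<mu> \<nu> * (X n * besselJ (- \<nu>) (of_real (exp (- real n))))" for n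
    using arg_cong[OF lommel_defect_combination[OF mn(1), of "exp (- real n)"], of "\<lambda>x. X n * x"] unfolding s_def by (simp add: algebra_simps)
  have key: "(lommel_cc \<mu> \<nu> * (K2 / 2 * Gamma \<nu> * (G / 2)) - 0) * (- 2 * s / of_real pi) = lommel_defect_wronskian \<mu> (- \<nu>) * 0 - lommel_defect_wronskian \<mu> \<nu> * (K2 * rGamma (1 - \<nu>))"
    by (rule LIMSEQ_unique[OF L1[unfolded eqX] L2])
  have r: "rGamma (1 - \<nu>) \<noteq> 0" "Gamma \<nu> \<noteq> 0"
    using Gamma_nonzero_Re_pos[of "1 - \<nu>"] Gamma_nonzero_Re_pos[of \<nu>] nu by (auto simp: rGamma_inverse_Gamma)
  have s: "s = of_real pi * (rGamma \<nu> * rGamma (1 - \<nu>))"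
    unfolding s_def rGamma_reflection_complex by simp
  have G: "cos (of_real pi * (\<mu> + \<nu>) / 2) * G = of_real pi"
  proof -
    have e: "1/2 - (\<mu> + \<nu>) / 2 = (1 - \<mu> - \<nu>) / 2" "1/2 + (\<mu> + \<nu>) / 2 = (1 + \<mu> + \<nu>) / 2" by (simp_all add: field_simps)
    have "Gamma ((1 - \<mu> - \<nu>) / 2) \<noteq> 0" "Gamma ((1 + \<mu> + \<nu>) / 2) \<noteq> 0"
      using mn by (intro Gamma_nonzero_Re_pos; simp)+
    moreover have "rGamma ((1 + \<mu> + \<nu>) / 2) * rGamma ((1 - \<mu> - \<nu>) / 2) = cos (of_real pi * (\<mu> + \<nu>) / 2) / of_real pi"
      using rGamma_half_reflection[of "(\<mu> + \<nu>) / 2"] unfolding e by simp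
    ultimately show ?thesis unfolding G_def by (simp add: rGamma_inverse_Gamma field_simps)
  qed
  have "lommel_defect_wronskian \<mu> \<nu> * (K2 * rGamma (1 - \<nu>)) = lommel_cc \<mu> \<nu> * G * K2 * Gamma \<nu> * s / (2 * of_real pi)"
    using key[symmetric] by (simp add: field_simps)
  also have "lommel_cc \<mu> \<nu> * G = 4 / of_real pi ^ 2 * cos (of_real pi * (\<mu> - \<nu>) / 2) * (cos (of_real pi * (\<mu> + \<nu>) / 2) * G)"
    by (simp add: lommel_cc_def)
  also have "\<dots> = 4 / of_real pi * cos (of_real pi * (\<mu> - \<nu>) / 2)"
    unfolding G by (simp add: power2_eq_square)
  also have "4 / of_real pi * cos (of_real pi * (\<mu> - \<nu>) / 2) * K2 * Gamma \<nu> * s / (2 * of_real pi) = (2 / of_real pi * cos (of_real pi * (\<mu> - \<nu>) / 2)) * (K2 * rGamma (1 - \<nu>))"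
    unfolding s using r by (simp add: rGamma_inverse_Gamma field_simps)
  finally show ?thesis using r K20 mult_right_cancel[of "K2 * rGamma (1 - \<nu>)"] by (metis mult_eq_0_iff)
qed

text \<open>The limit argument reaches only Re \<nu> > 0, where J of order -\<nu> dominates. The
  coefficient of the other solution is the same function at -\<nu>, and it becomes accessible
  because both sides are holomorphic in the whole strip.\<close>

lemma lommel_defect_wronskian_eq:
  assumes mu: "\<bar>Re \<mu>\<bar> < 1/4" and nu: "\<bar>Re \<nu>\<bar> < 1/2"
  shows "lommel_defect_wronskian \<mu> \<nu> = 2 / of_real pi * cos (of_real pi * (\<mu> - \<nu>) / 2)"
proof (rule analytic_continuation_open[where s = "{\<nu>. \<bar>Re \<nu>\<bar> < 1/2} \<inter> {\<nu>. Re \<nu> > 0}" and s' = "{\<nu>. \<bar>Re \<nu>\<bar> < 1/2}"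
    and f = "\<lambda>\<nu>. lommel_defect_wronskian \<mu> \<nu>" and g = "\<lambda>\<nu>. 2 / of_real pi * cos (of_real pi * (\<mu> - \<nu>) / 2)" and z = \<nu>])
  show "(\<lambda>\<nu>. lommel_defect_wronskian \<mu> \<nu>) holomorphic_on {\<nu>. \<bar>Re \<nu>\<bar> < 1/2}" using mu by (intro lommel_defect_wronskian_holomorphic) auto
  show "lommel_defect_wronskian \<mu> z = 2 / of_real pi * cos (of_real pi * (\<mu> - z) / 2)" if "z \<in> {\<nu>. \<bar>Re \<nu>\<bar> < 1/2} \<inter> {\<nu>. Re \<nu> > 0}" for z
    using that mu by (intro lommel_defect_wronskian_right) auto
  have "1/4 \<in> {\<nu>. \<bar>Re \<nu>\<bar> < 1/2} \<inter> {\<nu>. Re \<nu> > 0}" by simp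
  then show "{\<nu>. \<bar>Re \<nu>\<bar> < 1/2} \<inter> {\<nu>. Re \<nu> > 0} \<noteq> {}" by blast
  show "open ({\<nu>. \<bar>Re \<nu>\<bar> < 1/2} \<inter> {\<nu>::complex. Re \<nu> > 0})" by (intro open_Int open_strip open_Re_pos)
  show "open {\<nu>::complex. \<bar>Re \<nu>\<bar> < 1/2}" by (rule open_strip)
  show "connected {\<nu>::complex. \<bar>Re \<nu>\<bar> < 1/2}" by (rule convex_connected[OF convex_strip])
  show "(\<lambda>\<nu>. 2 / of_real pi * cos (of_real pi * (\<mu> - \<nu>) / 2)) holomorphic_on {\<nu>. \<bar>Re \<nu>\<bar> < 1/2}"
    by (intro holomorphic_intros) auto
  show "{\<nu>. \<bar>Re \<nu>\<bar> < 1/2} \<inter> {\<nu>. Re \<nu> > 0} \<subseteq> {\<nu>::complex. \<bar>Re \<nu>\<bar> < 1/2}" by blast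
  show "\<nu> \<in> {\<nu>. \<bar>Re \<nu>\<bar> < 1/2}" using nu by simp
qed

lemma lommel_base_identity:
  assumes mu: "\<bar>Re \<mu>\<bar> < 1/4" and nu: "\<bar>Re \<nu>\<bar> < 1/2" and t: "t > 0"
  shows "sin (of_real pi * \<nu>) * lommel_defect \<mu> \<nu> (of_real t) = cos (of_real pi * (\<mu> - \<nu>) / 2) * besselJ (- \<nu>) (of_real t) - cos (of_real pi * (\<mu> + \<nu>) / 2) * besselJ \<nu> (of_real t)"
proof -
  have mn: "Re \<mu> + \<bar>Re \<nu>\<bar> < 1" using mu nu by auto
  have "lommel_defect_wronskian \<mu> (- \<nu>) = 2 / of_real pi * cos (of_real pi * (\<mu> + \<nu>) / 2)" using lommel_defect_wronskian_eq[OF mu, of "- \<nu>"] nu by simp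
  note eqs = this lommel_defect_wronskian_eq[OF mu nu]
  have alg: "s * T = b * y - a * x" if 1: "T * (- 2 * s / p) = 2 / p * a * x - 2 / p * b * y" and p: "p \<noteq> 0" for s T a b x y p :: complex
  proof -
    have "- 2 * (s * T) = T * (- 2 * s / p) * p" using p by simp
    also have "\<dots> = 2 * (a * x) - 2 * (b * y)" unfolding 1 using p by (simp add: field_simps)
    finally have 2: "- 2 * (s * T) = 2 * (a * x) - 2 * (b * y)" .
    have "s * T = (- 2 * (s * T)) / (- 2)" by simp
    also have "\<dots> = b * y - a * x" unfolding 2 by (simp add: diff_divide_distrib)
    finally show ?thesis .
  qed
  show ?thesis
    by (rule alg[OF lommel_defect_combination[OF mn t, unfolded eqs]]) simp
qed

text \<open>The integral of \<open>t\<^sup>2\<^sup>N\<^sup>-\<^sup>\<mu> K\<^sub>\<nu>(t) / (1 + (t/z)\<^sup>2)\<close> over \<open>t > 0\<close>, in the variable \<open>x = ln t\<close>.\<close>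

definition lommelI :: "nat \<Rightarrow> complex \<Rightarrow> complex \<Rightarrow> complex \<Rightarrow> complex" where
  "lommelI N \<mu> \<nu> z = (\<integral>x. exp ((2 * of_nat N - \<mu> + 1) * of_real x) * besselK \<nu> (of_real (exp x)) / (1 + (of_real (exp x) / z)\<^sup>2) \<partial>lborel)"

lemma one_plus_sq_nonzero:
  assumes "Re z > 0"
  shows "1 + (complex_of_real t / z)\<^sup>2 \<noteq> 0"
proof
  assume "1 + (complex_of_real t / z)\<^sup>2 = 0"
  moreover have "z \<noteq> 0" using assms by auto
  ultimately have "z\<^sup>2 = - (of_real t)\<^sup>2" by (simp add: field_simps add_eq_0_iff)
  then have "z\<^sup>2 = (\<i> * of_real t)\<^sup>2" by (simp add: power_mult_distrib)
  then have "z = \<i> * of_real t \<or> z = - (\<i> * of_real t)" by (simp add: power2_eq_iff)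
  then show False using assms by auto
qed

text \<open>w^2 + t^2 factors as (w + it)(w - it), and each factor has modulus at least Re w. Hence
  the bound is uniform in t and locally uniform in w, but only inside the open right
  half-plane.\<close>

lemma kernel_bound:
  assumes z: "Re z > 0"
  obtains e C where "e > 0" "C > 0" "ball z e \<subseteq> {z. Re z > 0}"
    "\<And>w t. w \<in> ball z e \<Longrightarrow> t \<ge> 0 \<Longrightarrow> norm (1 / (1 + (complex_of_real t / w)\<^sup>2)) \<le> C"
proof -
  define e where "e = Re z / 2"
  define C where "C = (norm z + e)\<^sup>2 / e\<^sup>2"
  have e: "e > 0" using z by (simp add: e_def)
  have 1: "ball z e \<subseteq> {z. Re z > 0}" using Re_ball_half z unfolding e_def by fastforce
  have 2: "norm (1 / (1 + (complex_of_real t / w)\<^sup>2)) \<le> C" if "w \<in> ball z e" "t \<ge> 0" for w t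
  proof -
    have Rw: "Re w \<ge> e" using Re_ball_half that(1) unfolding e_def by blast
    then have w0: "w \<noteq> 0" and Rw0: "Re w > 0" using e by auto
    have nw: "norm w \<le> norm z + e"
      using that(1) norm_triangle_ineq[of z "w - z"] by (simp add: dist_norm norm_minus_commute)
    have "w\<^sup>2 + (of_real t)\<^sup>2 = (w + \<i> * of_real t) * (w - \<i> * of_real t)" by (simp add: algebra_simps power2_eq_square)
    then have n: "norm (w\<^sup>2 + (of_real t)\<^sup>2) = norm (w + \<i> * of_real t) * norm (w - \<i> * of_real t)" by (simp add: norm_mult)
    have a: "norm (w + \<i> * of_real t) \<ge> e" "norm (w - \<i> * of_real t) \<ge> e"
      using complex_Re_le_cmod[of "w + \<i> * of_real t"] complex_Re_le_cmod[of "w - \<i> * of_real t"] Rw by auto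
    have b: "norm (w\<^sup>2 + (of_real t)\<^sup>2) \<ge> e * e" unfolding n using a e by (intro mult_mono) auto
    have "1 / (1 + (complex_of_real t / w)\<^sup>2) = w\<^sup>2 / (w\<^sup>2 + (of_real t)\<^sup>2)"
      using w0 by (simp add: power_divide field_simps)
    then have "norm (1 / (1 + (complex_of_real t / w)\<^sup>2)) = (norm w)\<^sup>2 / norm (w\<^sup>2 + (of_real t)\<^sup>2)" by (simp add: norm_divide norm_power)
    also have "\<dots> \<le> (norm z + e)\<^sup>2 / (e * e)"
      using b e nw by (intro frac_le power_mono) auto
    finally show ?thesis by (simp add: C_def power2_eq_square)
  qed
  have "norm z + e > 0" using e by (simp add: add_nonneg_pos)
  then have "C > 0" using e by (simp add: C_def)
  from that[OF e this 1 2] show ?thesis .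
qed

lemma lommelI_measurable:
  assumes "Re z > 0"
  shows "(\<lambda>x. exp ((2 * of_nat N - \<mu> + 1) * of_real x) * besselK \<nu> (of_real (exp x)) / (1 + (of_real (exp x) / z)\<^sup>2)) \<in> borel_measurable borel"
proof (intro borel_measurable_continuous_onI continuous_intros)
  show "continuous_on UNIV (\<lambda>x. besselK \<nu> (of_real (exp x)))" using besselK_mom_continuous_exp[of 1 0 \<nu>] by simp
qed (use assms one_plus_sq_nonzero in \<open>auto simp del: of_real_exp\<close>)

text \<open>Two exponents enclose the actual one, since e^(sx) is largest at one end of the
  enclosing interval for x \<ge> 0 and at the other for x < 0. The majorant is thus uniform when
  \<mu> varies, and \<open>\<sigma>\<close> plays the same role for \<nu>.\<close>

lemma norm_lommelI_integrand:
  assumes "norm (1 / (1 + (complex_of_real (exp x) / w)\<^sup>2)) \<le> C"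
    and "\<bar>Re \<nu>\<bar> \<le> \<sigma>" "s1 \<le> 2 * real N - Re \<mu> + 1" "2 * real N - Re \<mu> + 1 \<le> s2"
  shows "norm (exp ((2 * of_nat N - \<mu> + 1) * of_real x) * besselK \<nu> (of_real (exp x)) / (1 + (of_real (exp x) / w)\<^sup>2))
    \<le> C * ((exp (s1 * x) + exp (s2 * x)) * (besselKr \<sigma> (1 * exp x) + besselKr (- \<sigma>) (1 * exp x)))"
proof -
  have E: "norm (exp ((2 * of_nat N - \<mu> + 1) * of_real x)) \<le> exp (s1 * x) + exp (s2 * x)"
  proof (cases "x \<ge> 0")
    case True
    then have "(2 * real N - Re \<mu> + 1) * x \<le> s2 * x" using assms by (intro mult_right_mono) auto
    then have "exp ((2 * real N - Re \<mu> + 1) * x) \<le> exp (s2 * x)" by simp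
    moreover have "exp (s1 * x) \<ge> 0" by simp
    moreover have "norm (exp ((2 * of_nat N - \<mu> + 1) * of_real x)) = exp ((2 * real N - Re \<mu> + 1) * x)" by simp
    ultimately show ?thesis by linarith
  next
    case False
    then have "(2 * real N - Re \<mu> + 1) * x \<le> s1 * x" using assms by (intro mult_right_mono_neg) auto
    then have "exp ((2 * real N - Re \<mu> + 1) * x) \<le> exp (s1 * x)" by simp
    moreover have "exp (s2 * x) \<ge> 0" by simp
    moreover have "norm (exp ((2 * of_nat N - \<mu> + 1) * of_real x)) = exp ((2 * real N - Re \<mu> + 1) * x)" by simp
    ultimately show ?thesis by linarith
  qed
  have K: "norm (besselK \<nu> (of_real (exp x))) \<le> besselKr \<sigma> (1 * exp x) + besselKr (- \<sigma>) (1 * exp x)"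
    using norm_besselK_mom_le[of "of_real (exp x)" \<nu> \<sigma> 0] assms(2) by simp
  have "norm (exp ((2 * of_nat N - \<mu> + 1) * of_real x) * besselK \<nu> (of_real (exp x)) / (1 + (of_real (exp x) / w)\<^sup>2))
     = norm (1 / (1 + (complex_of_real (exp x) / w)\<^sup>2)) * (norm (exp ((2 * of_nat N - \<mu> + 1) * of_real x)) * norm (besselK \<nu> (of_real (exp x))))"
    by (simp add: norm_mult norm_divide)
  also have "\<dots> \<le> C * ((exp (s1 * x) + exp (s2 * x)) * (besselKr \<sigma> (1 * exp x) + besselKr (- \<sigma>) (1 * exp x)))"
    using order_trans[OF norm_ge_zero assms(1)] by (intro mult_mono assms(1) E K) auto
  finally show ?thesis .
qed

lemma integrable_lommelI_bound:
  assumes "s1 > \<sigma>" "s2 > \<sigma>" "\<sigma> \<ge> 0"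
  shows "integrable lborel (\<lambda>x. C * ((exp (s1 * x) + exp (s2 * x)) * (besselKr \<sigma> (1 * exp x) + besselKr (- \<sigma>) (1 * exp x))) :: real)"
proof -
  have "integrable lborel (\<lambda>x. exp (s1 * x) * besselKr \<sigma> (1 * exp x) + exp (s1 * x) * besselKr (- \<sigma>) (1 * exp x)
     + (exp (s2 * x) * besselKr \<sigma> (1 * exp x) + exp (s2 * x) * besselKr (- \<sigma>) (1 * exp x)))"
    using assms by (intro Bochner_Integration.integrable_add integrable_besselKr_moment) auto
  then have "integrable lborel (\<lambda>x. C * (exp (s1 * x) * besselKr \<sigma> (1 * exp x) + exp (s1 * x) * besselKr (- \<sigma>) (1 * exp x)
     + (exp (s2 * x) * besselKr \<sigma> (1 * exp x) + exp (s2 * x) * besselKr (- \<sigma>) (1 * exp x))))"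
    by (rule integrable_mult_right)
  then show ?thesis by (simp only: distrib_left distrib_right add_ac mult.assoc)
qed

lemma integrable_lommelI:
  assumes z: "Re z > 0" and "Re \<mu> + \<bar>Re \<nu>\<bar> < 2 * real N + 1"
  shows "integrable lborel (\<lambda>x. exp ((2 * of_nat N - \<mu> + 1) * of_real x) * besselK \<nu> (of_real (exp x)) / (1 + (of_real (exp x) / z)\<^sup>2))"
proof -
  obtain e C where e: "e > 0" "\<And>w t. w \<in> ball z e \<Longrightarrow> t \<ge> 0 \<Longrightarrow> norm (1 / (1 + (complex_of_real t / w)\<^sup>2)) \<le> C"
    using kernel_bound[OF z] by metis
  define s where "s = 2 * real N - Re \<mu> + 1"
  show ?thesis
  proof (rule Bochner_Integration.integrable_bound)
    show "integrable lborel (\<lambda>x. C * ((exp (s * x) + exp (s * x)) * (besselKr \<bar>Re \<nu>\<bar> (1 * exp x) + besselKr (- \<bar>Re \<nu>\<bar>) (1 * exp x))))"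
      by (rule integrable_lommelI_bound) (use assms in \<open>auto simp: s_def\<close>)
    show "AE x in lborel. norm (exp ((2 * of_nat N - \<mu> + 1) * of_real x) * besselK \<nu> (of_real (exp x)) / (1 + (of_real (exp x) / z)\<^sup>2))
       \<le> norm (C * ((exp (s * x) + exp (s * x)) * (besselKr \<bar>Re \<nu>\<bar> (1 * exp x) + besselKr (- \<bar>Re \<nu>\<bar>) (1 * exp x))))"
    proof (intro AE_I2)
      fix x
      have "norm (exp ((2 * of_nat N - \<mu> + 1) * of_real x) * besselK \<nu> (of_real (exp x)) / (1 + (of_real (exp x) / z)\<^sup>2))
       \<le> C * ((exp (s * x) + exp (s * x)) * (besselKr \<bar>Re \<nu>\<bar> (1 * exp x) + besselKr (- \<bar>Re \<nu>\<bar>) (1 * exp x)))"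
        by (rule norm_lommelI_integrand[OF e(2)]) (use e in \<open>auto simp: s_def\<close>)
      then show "norm (exp ((2 * of_nat N - \<mu> + 1) * of_real x) * besselK \<nu> (of_real (exp x)) / (1 + (of_real (exp x) / z)\<^sup>2))
       \<le> norm (C * ((exp (s * x) + exp (s * x)) * (besselKr \<bar>Re \<nu>\<bar> (1 * exp x) + besselKr (- \<bar>Re \<nu>\<bar>) (1 * exp x))))"
        by (rule order_trans) (simp only: real_norm_def abs_ge_self)
    qed
    show "(\<lambda>x. exp ((2 * of_nat N - \<mu> + 1) * of_real x) * besselK \<nu> (of_real (exp x)) / (1 + (of_real (exp x) / z)\<^sup>2)) \<in> borel_measurable lborel"
      using lommelI_measurable[OF z] by simp
  qed
qed

lemma lommelI_holomorphic_z:
  assumes "Re \<mu> + \<bar>Re \<nu>\<bar> < 2 * real N + 1"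
  shows "lommelI N \<mu> \<nu> holomorphic_on {z. Re z > 0}"
  unfolding lommelI_def[abs_def]
proof (rule holomorphic_on_integral[OF open_Re_pos])
  show "locally_dominated lborel {z. Re z > 0} (\<lambda>z x. exp ((2 * of_nat N - \<mu> + 1) * of_real x) * besselK \<nu> (of_real (exp x)) / (1 + (of_real (exp x) / z)\<^sup>2))"
  proof (rule locally_dominatedI)
    fix z :: complex assume "z \<in> {z. Re z > 0}"
    then have z: "Re z > 0" by simp
    obtain e C where e: "e > 0" "ball z e \<subseteq> {z. Re z > 0}" "\<And>w t. w \<in> ball z e \<Longrightarrow> t \<ge> 0 \<Longrightarrow> norm (1 / (1 + (complex_of_real t / w)\<^sup>2)) \<le> C"
      using kernel_bound[OF z] by metis
    define s where "s = 2 * real N - Re \<mu> + 1"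
    show "\<exists>e>0. \<exists>g. ball z e \<subseteq> {z. Re z > 0} \<and> integrable lborel g \<and> (\<forall>w\<in>ball z e. \<forall>x\<in>space lborel.
       norm (exp ((2 * of_nat N - \<mu> + 1) * of_real x) * besselK \<nu> (of_real (exp x)) / (1 + (of_real (exp x) / w)\<^sup>2)) \<le> g x)"
    proof (intro exI[of _ e] exI[of _ "\<lambda>x. C * ((exp (s * x) + exp (s * x)) * (besselKr \<bar>Re \<nu>\<bar> (1 * exp x) + besselKr (- \<bar>Re \<nu>\<bar>) (1 * exp x)))"] conjI ballI)
      show "integrable lborel (\<lambda>x. C * ((exp (s * x) + exp (s * x)) * (besselKr \<bar>Re \<nu>\<bar> (1 * exp x) + besselKr (- \<bar>Re \<nu>\<bar>) (1 * exp x))))"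
        by (rule integrable_lommelI_bound) (use assms in \<open>auto simp: s_def\<close>)
      show "norm (exp ((2 * of_nat N - \<mu> + 1) * of_real x) * besselK \<nu> (of_real (exp x)) / (1 + (of_real (exp x) / w)\<^sup>2))
         \<le> C * ((exp (s * x) + exp (s * x)) * (besselKr \<bar>Re \<nu>\<bar> (1 * exp x) + besselKr (- \<bar>Re \<nu>\<bar>) (1 * exp x)))"
        if "w \<in> ball z e" for w x
        by (rule norm_lommelI_integrand[OF e(3)[OF that]]) (auto simp: s_def)
    qed (use e in auto)
  qed
  show "(\<lambda>z. exp ((2 * of_nat N - \<mu> + 1) * of_real x) * besselK \<nu> (of_real (exp x)) / (1 + (of_real (exp x) / z)\<^sup>2)) holomorphic_on {z. Re z > 0}" for x
    by (intro holomorphic_intros) (use one_plus_sq_nonzero in \<open>auto simp del: of_real_exp\<close>)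
qed (use lommelI_measurable in auto)

lemma lommelI_holomorphic_mu:
  assumes z: "Re z > 0"
  shows "(\<lambda>\<mu>. lommelI N \<mu> \<nu> z) holomorphic_on {\<mu>. Re \<mu> < 2 * real N + 1 - \<bar>Re \<nu>\<bar>}"
  unfolding lommelI_def
proof (rule holomorphic_on_integral[OF open_halfspace_Re_lt])
  obtain e' C where C: "e' > 0" "\<And>w t. w \<in> ball z e' \<Longrightarrow> t \<ge> 0 \<Longrightarrow> norm (1 / (1 + (complex_of_real t / w)\<^sup>2)) \<le> C"
    using kernel_bound[OF z] by metis
  show "locally_dominated lborel {\<mu>. Re \<mu> < 2 * real N + 1 - \<bar>Re \<nu>\<bar>} (\<lambda>\<mu> x. exp ((2 * of_nat N - \<mu> + 1) * of_real x) * besselK \<nu> (of_real (exp x)) / (1 + (of_real (exp x) / z)\<^sup>2))"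
  proof (rule locally_dominatedI)
    fix \<mu> assume mu: "\<mu> \<in> {\<mu>. Re \<mu> < 2 * real N + 1 - \<bar>Re \<nu>\<bar>}"
    \<comment> \<open>Half the distance to the boundary of the half-plane, so that the smaller
      exponent \<open>s1\<close> equals |Re \<nu>| + e and its moment still converges.\<close>
    define e where "e = (2 * real N + 1 - \<bar>Re \<nu>\<bar> - Re \<mu>) / 2"
    define s1 where "s1 = 2 * real N - Re \<mu> + 1 - e"
    define s2 where "s2 = 2 * real N - Re \<mu> + 1 + e"
    have e: "e > 0" using mu by (simp add: e_def)
    have s: "s1 > \<bar>Re \<nu>\<bar>" "s2 > \<bar>Re \<nu>\<bar>" using mu by (auto simp: s1_def s2_def e_def field_simps)
    have Re_w: "\<bar>Re w - Re \<mu>\<bar> < e" if "w \<in> ball \<mu> e" for w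
      using that abs_Re_le_cmod[of "w - \<mu>"] by (simp add: dist_norm norm_minus_commute)
    show "\<exists>e>0. \<exists>g. ball \<mu> e \<subseteq> {\<mu>. Re \<mu> < 2 * real N + 1 - \<bar>Re \<nu>\<bar>} \<and> integrable lborel g \<and> (\<forall>w\<in>ball \<mu> e. \<forall>x\<in>space lborel.
       norm (exp ((2 * of_nat N - w + 1) * of_real x) * besselK \<nu> (of_real (exp x)) / (1 + (of_real (exp x) / z)\<^sup>2)) \<le> g x)"
    proof (intro exI[of _ e] exI[of _ "\<lambda>x. C * ((exp (s1 * x) + exp (s2 * x)) * (besselKr \<bar>Re \<nu>\<bar> (1 * exp x) + besselKr (- \<bar>Re \<nu>\<bar>) (1 * exp x)))"] conjI ballI)
      show "integrable lborel (\<lambda>x. C * ((exp (s1 * x) + exp (s2 * x)) * (besselKr \<bar>Re \<nu>\<bar> (1 * exp x) + besselKr (- \<bar>Re \<nu>\<bar>) (1 * exp x))))"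
        by (rule integrable_lommelI_bound) (use s in auto)
      show "norm (exp ((2 * of_nat N - w + 1) * of_real x) * besselK \<nu> (of_real (exp x)) / (1 + (of_real (exp x) / z)\<^sup>2))
         \<le> C * ((exp (s1 * x) + exp (s2 * x)) * (besselKr \<bar>Re \<nu>\<bar> (1 * exp x) + besselKr (- \<bar>Re \<nu>\<bar>) (1 * exp x)))"
        if "w \<in> ball \<mu> e" for w x
        by (rule norm_lommelI_integrand[OF C(2)]) (use Re_w[OF that] C(1) in \<open>auto simp: s1_def s2_def\<close>)
      show "ball \<mu> e \<subseteq> {\<mu>. Re \<mu> < 2 * real N + 1 - \<bar>Re \<nu>\<bar>}"
      proof
        fix w assume "w \<in> ball \<mu> e"
        then have "\<bar>Re w - Re \<mu>\<bar> < e" by (rule Re_w)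
        moreover have "2 * e = 2 * real N + 1 - \<bar>Re \<nu>\<bar> - Re \<mu>" by (simp add: e_def)
        ultimately show "w \<in> {\<mu>. Re \<mu> < 2 * real N + 1 - \<bar>Re \<nu>\<bar>}" using e by simp
      qed
    qed (use e in auto)
  qed
  show "(\<lambda>\<mu>. exp ((2 * of_nat N - \<mu> + 1) * of_real x) * besselK \<nu> (of_real (exp x)) / (1 + (of_real (exp x) / z)\<^sup>2)) holomorphic_on {\<mu>. Re \<mu> < 2 * real N + 1 - \<bar>Re \<nu>\<bar>}" for x
    by (intro holomorphic_intros) (use one_plus_sq_nonzero[OF z] in \<open>auto simp del: of_real_exp\<close>)
qed (use lommelI_measurable[OF z] in auto)

lemma lommelI_holomorphic_nu:
  assumes z: "Re z > 0" and s: "Re \<mu> + \<sigma> < 2 * real N + 1" "\<sigma> > 0"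
  shows "(\<lambda>\<nu>. lommelI N \<mu> \<nu> z) holomorphic_on {\<nu>. \<bar>Re \<nu>\<bar> < \<sigma>}"
  unfolding lommelI_def
proof (rule holomorphic_on_integral[OF open_strip])
  obtain e' C where C: "e' > 0" "\<And>w t. w \<in> ball z e' \<Longrightarrow> t \<ge> 0 \<Longrightarrow> norm (1 / (1 + (complex_of_real t / w)\<^sup>2)) \<le> C"
    using kernel_bound[OF z] by metis
  define s1 where "s1 = 2 * real N - Re \<mu> + 1"
  show "locally_dominated lborel {\<nu>. \<bar>Re \<nu>\<bar> < \<sigma>} (\<lambda>\<nu> x. exp ((2 * of_nat N - \<mu> + 1) * of_real x) * besselK \<nu> (of_real (exp x)) / (1 + (of_real (exp x) / z)\<^sup>2))"
  proof (rule locally_dominatedI_global[OF open_strip])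
    show "integrable lborel (\<lambda>x. C * ((exp (s1 * x) + exp (s1 * x)) * (besselKr \<sigma> (1 * exp x) + besselKr (- \<sigma>) (1 * exp x))))"
      by (rule integrable_lommelI_bound) (use s in \<open>auto simp: s1_def\<close>)
    show "norm (exp ((2 * of_nat N - \<mu> + 1) * of_real x) * besselK \<nu> (of_real (exp x)) / (1 + (of_real (exp x) / z)\<^sup>2))
         \<le> C * ((exp (s1 * x) + exp (s1 * x)) * (besselKr \<sigma> (1 * exp x) + besselKr (- \<sigma>) (1 * exp x)))"
      if "\<nu> \<in> {\<nu>. \<bar>Re \<nu>\<bar> < \<sigma>}" for \<nu> x
      by (rule norm_lommelI_integrand[OF C(2)]) (use that C(1) in \<open>auto simp: s1_def\<close>)
  qed
  show "(\<lambda>\<nu>. exp ((2 * of_nat N - \<mu> + 1) * of_real x) * besselK \<nu> (of_real (exp x)) / (1 + (of_real (exp x) / z)\<^sup>2)) holomorphic_on {\<nu>. \<bar>Re \<nu>\<bar> < \<sigma>}" for x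
    by (intro holomorphic_intros holomorphic_on_subset[OF besselK_order_holomorphic]) (use one_plus_sq_nonzero[OF z] in \<open>auto simp del: of_real_exp\<close>)
qed (use lommelI_measurable[OF z] in auto)

text \<open>1/(1 + \<tau>^2) = 1 - \<tau>^2/(1 + \<tau>^2) with \<tau> = t/z. The 1 contributes a
  moment of K, which is the next term of the asymptotic series; the rest converges for larger Re
  \<mu>.\<close>

lemma lommelI_Suc:
  assumes z: "Re z > 0" and mn: "Re \<mu> + \<bar>Re \<nu>\<bar> < 2 * real N + 1"
  shows "lommelI N \<mu> \<nu> z = exp ((2 * of_nat N - \<mu> - 1) * of_real (ln 2)) * Gamma ((2 * of_nat N - \<mu> + 1 - \<nu>) / 2) * Gamma ((2 * of_nat N - \<mu> + 1 + \<nu>) / 2)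
     - lommelI (Suc N) \<mu> \<nu> z / z\<^sup>2"
proof -
  have z0: "z \<noteq> 0" using z by auto
  define s where "s = 2 * of_nat N - \<mu> + 1"
  have pw: "exp ((2 * of_nat N - \<mu> + 1) * of_real x) * besselK \<nu> (of_real (exp x)) / (1 + (of_real (exp x) / z)\<^sup>2)
     = exp (s * of_real x) * besselK \<nu> (of_real (exp x)) - exp ((2 * of_nat (Suc N) - \<mu> + 1) * of_real x) * besselK \<nu> (of_real (exp x)) / (1 + (of_real (exp x) / z)\<^sup>2) / z\<^sup>2" for x
  proof -
    have e: "exp ((2 * of_nat (Suc N) - \<mu> + 1) * of_real x) = exp (s * of_real x) * (of_real (exp x))\<^sup>2"
      by (simp add: s_def exp_of_real[symmetric] exp_double[symmetric] exp_add[symmetric] algebra_simps)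
    have alg: "E * K / (1 + (u / z)\<^sup>2) = E * K - E * u\<^sup>2 * K / (1 + (u / z)\<^sup>2) / z\<^sup>2" if "1 + (u / z)\<^sup>2 \<noteq> 0" for E K u
    proof -
      have "E * K - E * u\<^sup>2 * K / (1 + (u / z)\<^sup>2) / z\<^sup>2 = E * K - E * K * (u / z)\<^sup>2 / (1 + (u / z)\<^sup>2)"
        by (simp add: power_divide mult_ac)
      also have "\<dots> = E * K / (1 + (u / z)\<^sup>2)" using that by (simp add: field_simps del: power_divide)
      finally show ?thesis by simp
    qed
    show ?thesis unfolding e unfolding s_def by (rule alg[OF one_plus_sq_nonzero[OF z]])
  qed
  have "lommelI N \<mu> \<nu> z = (\<integral>x. exp (s * of_real x) * besselK \<nu> (of_real (exp x)) \<partial>lborel) - lommelI (Suc N) \<mu> \<nu> z / z\<^sup>2"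
  proof -
    have i1: "integrable lborel (\<lambda>x. exp (s * of_real x) * besselK \<nu> (of_real (exp x)))"
      by (rule besselK_moment(1)) (use mn in \<open>simp add: s_def\<close>)
    have i2: "integrable lborel (\<lambda>x. exp ((2 * of_nat (Suc N) - \<mu> + 1) * of_real x) * besselK \<nu> (of_real (exp x)) / (1 + (of_real (exp x) / z)\<^sup>2))"
      by (rule integrable_lommelI[OF z]) (use mn in simp)
    show ?thesis
      unfolding lommelI_def pw Bochner_Integration.integral_diff[OF i1 integrable_divide[OF i2]] integral_divide_zero ..
  qed
  also have "(\<integral>x. exp (s * of_real x) * besselK \<nu> (of_real (exp x)) \<partial>lborel) = exp ((s - 2) * of_real (ln 2)) * Gamma ((s - \<nu>) / 2) * Gamma ((s + \<nu>) / 2)"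
    by (rule besselK_moment(2)) (use mn in \<open>simp add: s_def\<close>)
  also have "s - 2 = 2 * of_nat N - \<mu> - 1" by (simp add: s_def)
  finally show ?thesis by (simp add: s_def)
qed

lemma lommelW_eq_lommelI:
  fixes t :: real
  assumes "t > 0"
  shows "lommelW 0 \<mu> \<nu> (of_real t) = exp ((\<mu> - 1) * of_real (ln t)) * lommelI 0 \<mu> \<nu> (of_real t)"
proof -
  define h where "h = (\<lambda>x. exp ((2 * of_nat 0 - \<mu> + 1) * of_real x) * besselK \<nu> (of_real (exp x)) / (1 + (of_real (exp x) / complex_of_real t)\<^sup>2))"
  have e: "h (ln t + 1 * x) = exp ((1 - \<mu>) * of_real (ln t)) * (exp ((1 - \<mu> + of_nat 0) * of_real x) / of_real (1 + exp (2 * x)) * besselK \<nu> (of_real t * of_real (exp x)))" for x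
  proof -
    have "exp (ln t + x) = t * exp x" using assms by (simp add: exp_add)
    then have "complex_of_real (exp (ln t + 1 * x)) = of_real t * of_real (exp x)" by simp
    moreover have "1 + (of_real t * of_real (exp x) / complex_of_real t)\<^sup>2 = of_real (1 + exp (2 * x))"
      using assms by (simp add: exp_double)
    moreover have "exp ((2 * of_nat 0 - \<mu> + 1) * of_real (ln t + 1 * x)) = exp ((1 - \<mu>) * of_real (ln t)) * exp ((1 - \<mu> + of_nat 0) * of_real x)"
      by (simp add: exp_add[symmetric] algebra_simps)
    ultimately show ?thesis unfolding h_def by (simp only: times_divide_eq_left times_divide_eq_right mult_ac)
  qed
  have "integral\<^sup>L lborel h = exp ((1 - \<mu>) * of_real (ln t)) * lommelW 0 \<mu> \<nu> (of_real t)"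
    unfolding lommelW_def by (subst lborel_integral_real_affine[of 1 _ "ln t"]) (simp_all only: e integral_mult_right_zero, simp_all)
  then have "exp ((\<mu> - 1) * of_real (ln t)) * lommelI 0 \<mu> \<nu> (of_real t) = exp ((\<mu> - 1) * of_real (ln t)) * exp ((1 - \<mu>) * of_real (ln t)) * lommelW 0 \<mu> \<nu> (of_real t)"
    unfolding lommelI_def h_def by simp
  also have "exp ((\<mu> - 1) * of_real (ln t)) * exp ((1 - \<mu>) * of_real (ln t)) = 1"
    unfolding exp_add[symmetric] by (simp add: algebra_simps)
  finally show ?thesis by simp
qed

section \<open>Continuation of the connection formula in z, \<mu> and \<nu>\<close>

definition lommel_sumN :: "nat \<Rightarrow> complex \<Rightarrow> complex \<Rightarrow> complex \<Rightarrow> complex" where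
  "lommel_sumN N \<mu> \<nu> z = (\<Sum>n<N. (-1) ^ n * (2 ^ (2 * n) * pochhammer ((- \<mu> - \<nu> + 1) / 2) n * pochhammer ((- \<mu> + \<nu> + 1) / 2) n) / z ^ (2 * n))"

text \<open>The connection formula times \<open>sin(\<pi>\<nu>)/(2\<^sup>\<mu>\<^sup>-\<^sup>1 \<Gamma>(a) \<Gamma>(b))\<close>, which makes both sides entire in \<open>\<mu>\<close> and \<open>\<nu>\<close>.\<close>

definition lommel_lhs :: "complex \<Rightarrow> complex \<Rightarrow> complex \<Rightarrow> complex" where
  "lommel_lhs \<mu> \<nu> z = sin (of_real pi * \<nu>) * lommel_series 3 3 \<mu> \<nu> z + cos (of_real pi * (\<mu> - \<nu>) / 2) * besselJ (- \<nu>) z - cos (of_real pi * (\<mu> + \<nu>) / 2) * besselJ \<nu> z"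

definition lommel_rhs :: "nat \<Rightarrow> complex \<Rightarrow> complex \<Rightarrow> complex \<Rightarrow> complex" where
  "lommel_rhs N \<mu> \<nu> z = sin (of_real pi * \<nu>) * z powr (\<mu> - 1) * (exp ((1 - \<mu>) * of_real (ln 2)) * rGamma ((\<mu> + \<nu> + 1) / 2) * rGamma ((\<mu> - \<nu> + 1) / 2) * lommel_sumN N \<mu> \<nu> z
     + (-1) ^ N * lommel_cc \<mu> \<nu> * lommelI N \<mu> \<nu> z / z ^ (2 * N))"

text \<open>One application of \<open>lommelI_Suc\<close> moves a term from the integral to the sum,
  the Gamma quotients becoming Pochhammer symbols. On this common domain the right side does not
  depend on N, so the identity for N = 0 passes to an expression that continues further in
  \<mu>.\<close>

lemma lommel_rhs_Suc:
  assumes z: "Re z > 0" and mn: "Re \<mu> + \<bar>Re \<nu>\<bar> < 1"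
  shows "lommel_rhs (Suc N) \<mu> \<nu> z = lommel_rhs N \<mu> \<nu> z"
proof -
  have z0: "z \<noteq> 0" using z by auto
  define p where "p = pochhammer ((- \<mu> - \<nu> + 1) / 2) N"
  define q where "q = pochhammer ((- \<mu> + \<nu> + 1) / 2) N"
  define E where "E = exp ((1 - \<mu>) * of_real (ln 2)) * rGamma ((\<mu> + \<nu> + 1) / 2) * rGamma ((\<mu> - \<nu> + 1) / 2)"
  have G1: "Gamma ((2 * of_nat N - \<mu> + 1 - \<nu>) / 2) = p * Gamma ((1 - \<mu> - \<nu>) / 2)"
  proof -
    have "(1 - \<mu> - \<nu>) / 2 \<notin> \<int>\<^sub>\<le>\<^sub>0" using mn by (auto elim!: nonpos_Ints_cases simp: complex_eq_iff)
    moreover have "Gamma ((1 - \<mu> - \<nu>) / 2) \<noteq> 0" by (rule Gamma_nonzero_Re_pos) (use mn in simp)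
    moreover have "(1 - \<mu> - \<nu>) / 2 + of_nat N = (2 * of_nat N - \<mu> + 1 - \<nu>) / 2" "(1 - \<mu> - \<nu>) / 2 = (- \<mu> - \<nu> + 1) / 2" by (simp_all add: field_simps)
    ultimately show ?thesis using pochhammer_Gamma[of "(1 - \<mu> - \<nu>) / 2" N] unfolding p_def by (simp add: field_simps)
  qed
  have G2: "Gamma ((2 * of_nat N - \<mu> + 1 + \<nu>) / 2) = q * Gamma ((1 - \<mu> + \<nu>) / 2)"
  proof -
    have "(1 - \<mu> + \<nu>) / 2 \<notin> \<int>\<^sub>\<le>\<^sub>0" using mn by (auto elim!: nonpos_Ints_cases simp: complex_eq_iff)
    moreover have "Gamma ((1 - \<mu> + \<nu>) / 2) \<noteq> 0" by (rule Gamma_nonzero_Re_pos) (use mn in simp)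
    moreover have "(1 - \<mu> + \<nu>) / 2 + of_nat N = (2 * of_nat N - \<mu> + 1 + \<nu>) / 2" "(1 - \<mu> + \<nu>) / 2 = (- \<mu> + \<nu> + 1) / 2" by (simp_all add: field_simps)
    ultimately show ?thesis using pochhammer_Gamma[of "(1 - \<mu> + \<nu>) / 2" N] unfolding q_def by (simp add: field_simps)
  qed
  have pw: "exp ((2 * of_nat N - \<mu> - 1) * of_real (ln 2)) * 4 = 2 ^ (2 * N) * exp ((1 - \<mu>) * of_real (ln 2))"
  proof -
    have "(2::complex) ^ (2 * N) = exp (of_nat (2 * N) * of_real (ln 2))"
      unfolding exp_of_nat_mult by (simp add: exp_of_real)
    moreover have "(4::complex) = exp (2 * of_real (ln 2))" using exp_minus_2_ln_2(2) by (simp add: exp_minus field_simps)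
    moreover have "exp ((2 * of_nat N - \<mu> - 1) * of_real (ln 2)) * exp (2 * of_real (ln 2)) = exp (of_nat (2 * N) * of_real (ln 2)) * exp ((1 - \<mu>) * of_real (ln 2))"
      unfolding exp_add[symmetric] by (rule arg_cong[where f = exp]) (simp add: algebra_simps)
    ultimately show ?thesis by (simp only:)
  qed
  have I: "lommel_cc \<mu> \<nu> * lommelI N \<mu> \<nu> z = E * (2 ^ (2 * N) * p * q) - lommel_cc \<mu> \<nu> * lommelI (Suc N) \<mu> \<nu> z / z\<^sup>2"
  proof -
    have mn': "Re \<mu> + \<bar>Re \<nu>\<bar> < 2 * real N + 1" using mn by linarith
    have "lommel_cc \<mu> \<nu> * lommelI N \<mu> \<nu> z = exp ((2 * of_nat N - \<mu> - 1) * of_real (ln 2)) * p * q * (lommel_cc \<mu> \<nu> * (Gamma ((1 - \<mu> - \<nu>) / 2) * Gamma ((1 - \<mu> + \<nu>) / 2))) - lommel_cc \<mu> \<nu> * lommelI (Suc N) \<mu> \<nu> z / z\<^sup>2"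
      unfolding lommelI_Suc[OF z mn'] G1 G2 by (simp add: algebra_simps)
    also have "lommel_cc \<mu> \<nu> * (Gamma ((1 - \<mu> - \<nu>) / 2) * Gamma ((1 - \<mu> + \<nu>) / 2)) = 4 * (rGamma ((\<mu> + \<nu> + 1) / 2) * rGamma ((\<mu> - \<nu> + 1) / 2))"
      by (rule lommel_cc_Gamma) (use mn in auto)
    also have "exp ((2 * of_nat N - \<mu> - 1) * of_real (ln 2)) * p * q * (4 * (rGamma ((\<mu> + \<nu> + 1) / 2) * rGamma ((\<mu> - \<nu> + 1) / 2)))
      = (exp ((2 * of_nat N - \<mu> - 1) * of_real (ln 2)) * 4) * p * q * (rGamma ((\<mu> + \<nu> + 1) / 2) * rGamma ((\<mu> - \<nu> + 1) / 2))" by simp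
    also have "\<dots> = E * (2 ^ (2 * N) * p * q)" unfolding pw E_def by simp
    finally show ?thesis .
  qed
  have "E * lommel_sumN (Suc N) \<mu> \<nu> z + (-1) ^ Suc N * lommel_cc \<mu> \<nu> * lommelI (Suc N) \<mu> \<nu> z / z ^ (2 * Suc N)
    = E * lommel_sumN N \<mu> \<nu> z + (-1) ^ N * (lommel_cc \<mu> \<nu> * lommelI N \<mu> \<nu> z) / z ^ (2 * N)"
    unfolding I lommel_sumN_def p_def q_def using z0
    by (simp add: field_simps power2_eq_square)
  then show ?thesis unfolding lommel_rhs_def E_def by (simp add: mult.assoc)
qed

lemma lommel_connection_base:
  assumes mu: "\<bar>Re \<mu>\<bar> < 1/4" and nu: "\<bar>Re \<nu>\<bar> < 1/2" and t: "t > 0"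
  shows "lommel_lhs \<mu> \<nu> (of_real t) = lommel_rhs N \<mu> \<nu> (of_real t)"
proof (induction N)
  case 0
  have "of_real t powr (\<mu> - 1) = exp ((\<mu> - 1) * of_real (ln t))" using t by (simp add: powr_def Ln_of_real)
  then have "lommel_rhs 0 \<mu> \<nu> (of_real t) = sin (of_real pi * \<nu>) * (lommel_cc \<mu> \<nu> * lommelW 0 \<mu> \<nu> (of_real t))"
    unfolding lommel_rhs_def lommel_sumN_def lommelW_eq_lommelI[OF t] by simp
  then show ?case
    using lommel_base_identity[OF mu nu t] unfolding lommel_lhs_def lommel_defect_def by (simp add: algebra_simps)
next
  case (Suc N)
  have "lommel_rhs (Suc N) \<mu> \<nu> (of_real t) = lommel_rhs N \<mu> \<nu> (of_real t)"
    by (rule lommel_rhs_Suc) (use mu nu t in auto)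
  then show ?case using Suc by simp
qed

lemma lommel_lhs_holomorphic:
  assumes "open U" "f holomorphic_on U" "g holomorphic_on U" "z \<noteq> 0"
  shows "(\<lambda>w. lommel_lhs (f w) (g w) z) holomorphic_on U"
  unfolding lommel_lhs_def besselJ_eq using assms
  by (intro holomorphic_intros lommel_series_holomorphic) auto

lemma lommel_sumN_holomorphic:
  assumes "f holomorphic_on U" "g holomorphic_on U"
  shows "(\<lambda>w. lommel_sumN N (f w) (g w) z) holomorphic_on U"
  unfolding lommel_sumN_def pochhammer_prod using assms
  by (intro holomorphic_intros) (auto simp: divide_inverse intro!: holomorphic_intros)

lemma lommel_cc_holomorphic:
  assumes "f holomorphic_on U" "g holomorphic_on U"
  shows "(\<lambda>w. lommel_cc (f w) (g w)) holomorphic_on U"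
  unfolding lommel_cc_def using assms by (intro holomorphic_intros) auto

lemma lommel_rhs_holomorphic_mu:
  assumes z: "Re z > 0"
  shows "(\<lambda>\<mu>. lommel_rhs N \<mu> \<nu> z) holomorphic_on {\<mu>. Re \<mu> < 2 * real N + 1 - \<bar>Re \<nu>\<bar>}"
proof -
  have "z \<noteq> 0" using z by auto
  then show ?thesis unfolding lommel_rhs_def using z
    by (intro holomorphic_intros lommelI_holomorphic_mu lommel_sumN_holomorphic lommel_cc_holomorphic) auto
qed

lemma lommel_rhs_holomorphic_nu:
  assumes z: "Re z > 0" "Re \<mu> + \<sigma> < 2 * real N + 1" "\<sigma> > 0"
  shows "(\<lambda>\<nu>. lommel_rhs N \<mu> \<nu> z) holomorphic_on {\<nu>. \<bar>Re \<nu>\<bar> < \<sigma>}"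
proof -
  have "z \<noteq> 0" using z by auto
  then show ?thesis unfolding lommel_rhs_def using z
    by (intro holomorphic_intros lommelI_holomorphic_nu lommel_sumN_holomorphic lommel_cc_holomorphic) auto
qed

lemma lommel_rhs_holomorphic_z:
  assumes "Re \<mu> + \<bar>Re \<nu>\<bar> < 2 * real N + 1"
  shows "(\<lambda>z. lommel_rhs N \<mu> \<nu> z) holomorphic_on {z. Re z > 0}"
  unfolding lommel_rhs_def lommel_sumN_def
  by (intro holomorphic_intros lommelI_holomorphic_z assms) (auto simp: complex_nonpos_Reals_iff)

lemma lommel_lhs_holomorphic_z: "lommel_lhs \<mu> \<nu> holomorphic_on {z. Re z > 0}"
  unfolding lommel_lhs_def[abs_def] besselJ_eq
  by (intro holomorphic_intros lommel_series_holomorphic_z) auto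

text \<open>The base case holds for positive real z and small Re \<mu>, Re \<nu>. It spreads first
  to complex z, then in \<mu> from a strip to a half-plane, then in \<nu> to the full strip; each
  time both sides are holomorphic in the variable that moves.\<close>

theorem lommel_connection:
  assumes z: "Re z > 0" and mn: "Re \<mu> + \<bar>Re \<nu>\<bar> < 2 * real N + 1"
  shows "lommel_lhs \<mu> \<nu> z = lommel_rhs N \<mu> \<nu> z"
proof -
  have z0: "z \<noteq> 0" using z by auto
  have 1: "lommel_lhs \<mu> \<nu> z = lommel_rhs N \<mu> \<nu> z" if mu: "\<bar>Re \<mu>\<bar> < 1/4" and nu: "\<bar>Re \<nu>\<bar> < 1/2" for \<mu> \<nu>
  proof -
    have mn': "Re \<mu> + \<bar>Re \<nu>\<bar> < 2 * real N + 1" using mu nu by linarith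
    have "lommel_lhs \<mu> \<nu> z - lommel_rhs N \<mu> \<nu> z = 0"
    proof (rule analytic_continuation[where f = "\<lambda>z. lommel_lhs \<mu> \<nu> z - lommel_rhs N \<mu> \<nu> z" and w = z and S = "{z. Re z > 0}" and U = "of_real ` {0<..}" and \<xi> = 1])
      show "(\<lambda>z. lommel_lhs \<mu> \<nu> z - lommel_rhs N \<mu> \<nu> z) holomorphic_on {z. Re z > 0}"
        by (intro holomorphic_on_diff lommel_lhs_holomorphic_z lommel_rhs_holomorphic_z mn')
      show "connected {z::complex. Re z > 0}" by (rule convex_connected[OF convex_halfspace_Re_gt])
      show "(1::complex) islimpt (of_real ` {0<..})"
      proof -
        have "(1::real) islimpt {0<..}"
          by (metis islimpt_greaterThanLessThan1 interior_limit_point interior_open open_greaterThan greaterThan_iff zero_less_one)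
        then show ?thesis
          unfolding islimpt_approachable by (auto simp: dist_of_real[of _ 1, where 'a=complex, simplified])
      qed
      show "lommel_lhs \<mu> \<nu> w - lommel_rhs N \<mu> \<nu> w = 0" if "w \<in> of_real ` {0<..}" for w
        using that lommel_connection_base[OF mu nu] by auto
    qed (use z in \<open>auto simp: open_Re_pos\<close>)
    then show ?thesis by simp
  qed
  have 2: "lommel_lhs \<mu> \<nu> z = lommel_rhs N \<mu> \<nu> z" if mu: "Re \<mu> < 2 * real N + 1 - \<bar>Re \<nu>\<bar>" and nu: "\<bar>Re \<nu>\<bar> < 1/2" for \<mu> \<nu>
  proof (rule analytic_continuation_open[where s = "{\<mu>. \<bar>Re \<mu>\<bar> < 1/4}" and s' = "{\<mu>. Re \<mu> < 2 * real N + 1 - \<bar>Re \<nu>\<bar>}"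
      and f = "\<lambda>\<mu>. lommel_lhs \<mu> \<nu> z" and g = "\<lambda>\<mu>. lommel_rhs N \<mu> \<nu> z" and z = \<mu>])
    show "open {\<mu>::complex. \<bar>Re \<mu>\<bar> < 1/4}" by (rule open_strip)
    show "open {\<mu>. Re \<mu> < 2 * real N + 1 - \<bar>Re \<nu>\<bar>}" by (rule open_halfspace_Re_lt)
    show "{\<mu>::complex. \<bar>Re \<mu>\<bar> < 1/4} \<noteq> {}" by (auto intro!: exI[of _ 0])
    show "connected {\<mu>. Re \<mu> < 2 * real N + 1 - \<bar>Re \<nu>\<bar>}" by (rule convex_connected[OF convex_halfspace_Re_lt])
    show "{\<mu>. \<bar>Re \<mu>\<bar> < 1/4} \<subseteq> {\<mu>. Re \<mu> < 2 * real N + 1 - \<bar>Re \<nu>\<bar>}" using nu by auto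
    show "(\<lambda>\<mu>. lommel_lhs \<mu> \<nu> z) holomorphic_on {\<mu>. Re \<mu> < 2 * real N + 1 - \<bar>Re \<nu>\<bar>}"
      by (intro lommel_lhs_holomorphic open_halfspace_Re_lt holomorphic_intros z0)
    show "(\<lambda>\<mu>. lommel_rhs N \<mu> \<nu> z) holomorphic_on {\<mu>. Re \<mu> < 2 * real N + 1 - \<bar>Re \<nu>\<bar>}"
      by (rule lommel_rhs_holomorphic_mu[OF z])
    show "lommel_lhs w \<nu> z = lommel_rhs N w \<nu> z" if "w \<in> {\<mu>. \<bar>Re \<mu>\<bar> < 1/4}" for w
      using 1[of w \<nu>] that nu by simp
    show "\<mu> \<in> {\<mu>. Re \<mu> < 2 * real N + 1 - \<bar>Re \<nu>\<bar>}" using mu by simp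
  qed
  \<comment> \<open>The midpoint between |Re \<nu>| and 2N + 1 - Re \<mu>: the strip of this width
    contains \<nu>, and the integral is holomorphic on all of it.\<close>
  define \<sigma> where "\<sigma> = (\<bar>Re \<nu>\<bar> + (2 * real N + 1 - Re \<mu>)) / 2"
  have s: "\<bar>Re \<nu>\<bar> < \<sigma>" "Re \<mu> + \<sigma> < 2 * real N + 1" using mn by (auto simp: \<sigma>_def field_simps)
  then have s0: "\<sigma> > 0" by linarith
  define \<tau> where "\<tau> = min \<sigma> (1/2)"
  have t: "\<tau> > 0" "\<tau> \<le> \<sigma>" "\<tau> \<le> 1/2" using s0 by (auto simp: \<tau>_def)
  show ?thesis
  proof (rule analytic_continuation_open[where s = "{\<nu>. \<bar>Re \<nu>\<bar> < \<tau>}" and s' = "{\<nu>. \<bar>Re \<nu>\<bar> < \<sigma>}"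
      and f = "\<lambda>\<nu>. lommel_lhs \<mu> \<nu> z" and g = "\<lambda>\<nu>. lommel_rhs N \<mu> \<nu> z" and z = \<nu>])
    show "open {\<nu>::complex. \<bar>Re \<nu>\<bar> < \<tau>}" "open {\<nu>::complex. \<bar>Re \<nu>\<bar> < \<sigma>}" by (rule open_strip)+
    show "{\<nu>::complex. \<bar>Re \<nu>\<bar> < \<tau>} \<noteq> {}" using t by (auto intro!: exI[of _ 0])
    show "connected {\<nu>::complex. \<bar>Re \<nu>\<bar> < \<sigma>}" by (rule convex_connected[OF convex_strip])
    show "{\<nu>::complex. \<bar>Re \<nu>\<bar> < \<tau>} \<subseteq> {\<nu>. \<bar>Re \<nu>\<bar> < \<sigma>}" using t by auto
    show "(\<lambda>\<nu>. lommel_lhs \<mu> \<nu> z) holomorphic_on {\<nu>. \<bar>Re \<nu>\<bar> < \<sigma>}"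
      by (intro lommel_lhs_holomorphic open_strip holomorphic_intros z0)
    show "(\<lambda>\<nu>. lommel_rhs N \<mu> \<nu> z) holomorphic_on {\<nu>. \<bar>Re \<nu>\<bar> < \<sigma>}"
      by (rule lommel_rhs_holomorphic_nu[OF z s(2) s0])
    show "lommel_lhs \<mu> w z = lommel_rhs N \<mu> w z" if "w \<in> {\<nu>. \<bar>Re \<nu>\<bar> < \<tau>}" for w
      by (rule 2) (use that t s in auto)
    show "\<nu> \<in> {\<nu>. \<bar>Re \<nu>\<bar> < \<sigma>}" using s by simp
  qed
qed

section \<open>Stieltjes representation of \<open>K\<close>\<close>

lemma even_integral:
  fixes f :: "real \<Rightarrow> complex"
  assumes "integrable lborel f" "\<And>x. f (- x) = f x"
  shows "(\<integral>x. f x \<partial>lborel) = 2 * (LBINT x:{0<..}. f x)"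
proof -
  have i: "set_integrable lborel A f" if "A \<in> sets borel" for A
    using assms(1) that unfolding set_integrable_def by (intro integrable_mult_indicator) auto
  have "(\<integral>x. f x \<partial>lborel) = (\<integral>x. indicator {0<..} x *\<^sub>R f x + indicator {..<0} x *\<^sub>R f x \<partial>lborel)"
  proof (rule integral_cong_AE)
    show "AE x in lborel. f x = indicator {0<..} x *\<^sub>R f x + indicator {..<0} x *\<^sub>R f x"
      using AE_lborel_singleton[of "0::real"] by eventually_elim (auto simp: indicator_def)
    show "f \<in> borel_measurable lborel" using assms(1) by simp
    then show "(\<lambda>x. indicator {0<..} x *\<^sub>R f x + indicator {..<0} x *\<^sub>R f x) \<in> borel_measurable lborel"
      by measurable
  qed
  also have "\<dots> = (LBINT x:{0<..}. f x) + (LBINT x:{..<0}. f x)"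
    unfolding set_lebesgue_integral_def
    using i[of "{0<..}"] i[of "{..<0}"] unfolding set_integrable_def by (intro Bochner_Integration.integral_add) auto
  also have "(LBINT x:{..<0}. f x) = (LBINT x:{0<..}. f x)"
    unfolding set_lebesgue_integral_def
    by (subst lborel_integral_real_affine[of "-1" _ 0]) (simp_all add: assms(2) indicator_def)
  finally show ?thesis by simp
qed

lemma cos_pi_nonzero:
  assumes "\<bar>Re \<nu>\<bar> < 1/2"
  shows "cos (of_real pi * \<nu>) \<noteq> 0"
proof -
  have "rGamma (1/2 + \<nu>) \<noteq> 0" "rGamma (1/2 - \<nu>) \<noteq> 0"
    using Gamma_nonzero_Re_pos[of "1/2 + \<nu>"] Gamma_nonzero_Re_pos[of "1/2 - \<nu>"] assms by (auto simp: rGamma_inverse_Gamma)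
  then show ?thesis using rGamma_half_reflection[of \<nu>] by auto
qed

text \<open>The Beta integral with parameters 1/2 + \<nu> and 1/2 - \<nu>, evaluated by reflection.
  Positivity of their real parts is the source of the restriction |Re \<nu>| < 1/2 in the Stieltjes
  representation.\<close>

lemma sech_integral:
  assumes nu: "\<bar>Re \<nu>\<bar> < 1/2"
  shows "integrable lborel (\<lambda>x. exp (\<nu> * of_real x) / of_real (2 * cosh (x / 2)))"
    and "(\<integral>x. exp (\<nu> * of_real x) / of_real (2 * cosh (x / 2)) \<partial>lborel) = of_real pi / cos (of_real pi * \<nu>)"
proof -
  have e: "exp ((1/2 + \<nu>) * of_real x - ((1/2 + \<nu>) + (1/2 - \<nu>)) * of_real (ln (1 + exp x))) = exp (\<nu> * of_real x) / of_real (2 * cosh (x / 2))" for x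
  proof -
    have "complex_of_real (1 + exp x) = exp (of_real (ln (1 + exp x)))"
      unfolding exp_of_real using add_pos_pos[OF zero_less_one exp_gt_zero, of x] by simp
    moreover have "2 * cosh (x / 2) = (1 + exp x) / exp (x / 2)"
      by (simp add: cosh_field_def exp_minus field_simps flip: exp_double) (simp add: mult_exp_exp)
    then have "complex_of_real (2 * cosh (x / 2)) = of_real (1 + exp x) / of_real (exp (x / 2))"
      by (metis of_real_divide)
    moreover have "exp ((1/2 + \<nu>) * of_real x) = exp (\<nu> * of_real x) * of_real (exp (x / 2))"
      by (simp add: exp_of_real[symmetric] exp_add[symmetric] algebra_simps)
    ultimately show ?thesis by (simp add: exp_diff)
  qed
  have p: "Re (1/2 + \<nu>) > 0" "Re (1/2 - \<nu>) > 0" using nu by auto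
  show "integrable lborel (\<lambda>x. exp (\<nu> * of_real x) / of_real (2 * cosh (x / 2)))"
    using Beta_exp_integral(1)[OF p] unfolding e .
  have g: "Gamma (1/2 + \<nu>) \<noteq> 0" "Gamma (1/2 - \<nu>) \<noteq> 0" using Gamma_nonzero_Re_pos[OF p(1)] Gamma_nonzero_Re_pos[OF p(2)] by auto
  have "(\<integral>x. exp (\<nu> * of_real x) / of_real (2 * cosh (x / 2)) \<partial>lborel) = Gamma (1/2 + \<nu>) * Gamma (1/2 - \<nu>)"
    using Beta_exp_integral(2)[OF p] unfolding e by simp
  also have "\<dots> = of_real pi / cos (of_real pi * \<nu>)"
    using rGamma_half_reflection[of \<nu>] g cos_pi_nonzero[OF nu] by (simp add: rGamma_inverse_Gamma field_simps)
  finally show "(\<integral>x. exp (\<nu> * of_real x) / of_real (2 * cosh (x / 2)) \<partial>lborel) = of_real pi / cos (of_real pi * \<nu>)" .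
qed

lemma sech_sum:
  "1 / cosh ((x - w) / 2) + 1 / cosh ((x + w) / 2) = 4 * cosh (x / 2) * cosh (w / 2) / (cosh x + cosh (w::real))"
proof -
  define a where "a = (x - w) / 2"
  define b where "b = (x + w) / 2"
  have "cosh a * cosh b * 2 = cosh (a + b) + cosh (a - b)" by (simp add: cosh_add cosh_diff)
  moreover have "a + b = x" "a - b = - w" by (simp_all add: a_def b_def field_simps)
  ultimately have 1: "cosh x + cosh w = 2 * (cosh a * cosh b)" by simp
  have "cosh (x / 2) * cosh (w / 2) * 2 = cosh (x / 2 + w / 2) + cosh (x / 2 - w / 2)" by (simp add: cosh_add cosh_diff)
  moreover have "x / 2 + w / 2 = b" "x / 2 - w / 2 = a" by (simp_all add: a_def b_def field_simps)
  ultimately have 2: "cosh a + cosh b = 2 * (cosh (x / 2) * cosh (w / 2))" by simp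
  have "1 / cosh a + 1 / cosh b = (cosh a + cosh b) / (cosh a * cosh b)" by (simp add: field_simps)
  also have "\<dots> = 4 * cosh (x / 2) * cosh (w / 2) / (cosh x + cosh w)" unfolding 1 unfolding 2 by simp
  finally show ?thesis unfolding a_def b_def .
qed

text \<open>Both sides become \<open>e\<^sup>-\<^sup>t\<close> times the integral of \<open>e\<^sup>-\<^sup>2\<^sup>t\<^sup>c\<^sup>2\<^sup>p\<^sup>2 / (1 + p\<^sup>2)\<close> over the reals, where \<open>c = cosh (x/2)\<close>,
  by the substitutions \<open>p = sinh (w/2) / c\<close> and \<open>p\<^sup>2 = s/t\<close>.\<close>

lemma sech_laplace_transform:
  fixes t x :: real
  assumes t: "t > 0"
  shows "(\<integral>w. of_real (exp (- t * cosh w) / (2 * cosh ((x - w) / 2))) \<partial>lborel) =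
    of_real (exp (- t) * sqrt t) * (\<integral>y. complex_of_real (exp (y / 2 - exp y * (1 + cosh x)) / (exp y + t)) \<partial>lborel)"
proof -
  define c where "c = cosh (x / 2)"
  have c: "c > 0" by (simp add: c_def)
  define \<phi> where "\<phi> = (\<lambda>p. complex_of_real (exp (- 2 * t * c\<^sup>2 * p\<^sup>2) / (1 + p\<^sup>2)))"
  define b where "b = (\<lambda>w. complex_of_real (exp (- t * cosh w) / (2 * cosh ((x - w) / 2))))"
  have \<phi>m [measurable]: "\<phi> \<in> borel_measurable borel" unfolding \<phi>_def by measurable
  have chx: "cosh x = 2 * c\<^sup>2 - 1" using cosh_double_cosh[of "x / 2"] by (simp add: c_def)
  have bi: "integrable lborel b"
  proof (rule Bochner_Integration.integrable_bound)
    show "integrable lborel (\<lambda>w. exp (0 * w - t * cosh w))" by (rule integrable_besselKr[OF t])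
    show "b \<in> borel_measurable lborel" unfolding b_def by measurable
    have "norm (b w) \<le> exp (- t * cosh w)" for w
    proof -
      have "exp (- t * cosh w) / (2 * cosh ((x - w) / 2)) \<le> exp (- t * cosh w) / 1"
        using cosh_real_ge_1[of "(x - w) / 2"] by (intro frac_le) auto
      then show ?thesis unfolding b_def by (simp add: norm_divide)
    qed
    then show "AE w in lborel. norm (b w) \<le> norm (exp (0 * w - t * cosh w))" by simp
  qed
  have bi': "integrable lborel (\<lambda>w. b (0 + (-1) * w))" by (rule lborel_integrable_real_affine[OF bi]) simp
  have b': "integral\<^sup>L lborel b = (\<integral>w. b (0 + (-1) * w) \<partial>lborel)"
    by (subst lborel_integral_real_affine[of "-1" _ 0]) simp_all
  define g where "g = (\<lambda>w. sinh (w / 2) / c)"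
  define g' where "g' = (\<lambda>w. cosh (w / 2) / (2 * c))"
  \<comment> \<open>A single kernel 1/cosh((x - w)/2) is not even in \<open>w\<close> and cannot be
    expressed through p. Averaging over \<open>w\<close> and \<open>-w\<close> leaves the integral
    unchanged, and \<open>sech_sum\<close> turns the average into a function of p times
    dp/dw.\<close>
  have sym: "(b w + b (0 + (-1) * w)) / 2 = of_real (exp (- t)) * (of_real \<bar>g' w\<bar> * \<phi> (g w))" for w
  proof -
    have s2: "(sinh (w / 2))\<^sup>2 = (cosh w - 1) / 2" using cosh_double_cosh[of "w / 2"] sinh_square_eq[of "w / 2"] by simp
    have "c\<^sup>2 * (g w)\<^sup>2 = (cosh w - 1) / 2" using c s2 by (simp add: g_def power_divide)
    then have "- 2 * t * (c\<^sup>2 * (g w)\<^sup>2) = t - t * cosh w" by (simp only:) (simp add: field_simps)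
    then have A: "- 2 * t * c\<^sup>2 * (g w)\<^sup>2 = t - t * cosh w" by (simp only: mult.assoc)
    have chw: "cosh w = 1 + 2 * (sinh (w / 2))\<^sup>2" using s2 by simp
    have B: "1 + (g w)\<^sup>2 = (cosh x + cosh w) / (2 * c\<^sup>2)"
      using c unfolding chx chw by (simp add: g_def power_divide field_simps)
    have pos: "cosh x + cosh w > 0" by (simp add: add_pos_pos)
    have "1 / cosh ((x - w) / 2) + 1 / cosh ((x + w) / 2) = 4 * c * cosh (w / 2) / (cosh x + cosh w)"
      unfolding c_def by (rule sech_sum)
    then have "(exp (- t * cosh w) / (2 * cosh ((x - w) / 2)) + exp (- t * cosh (- w)) / (2 * cosh ((x - - w) / 2))) / 2
      = exp (- t * cosh w) * (4 * c * cosh (w / 2) / (cosh x + cosh w)) / 4"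
    proof -
      assume *: "1 / cosh ((x - w) / 2) + 1 / cosh ((x + w) / 2) = 4 * c * cosh (w / 2) / (cosh x + cosh w)"
      have gen: "(E / (2 * a) + E / (2 * b)) / 2 = E * (1 / a + 1 / b) / 4" for E a b :: real
        by (simp add: add_divide_distrib distrib_left)
      have "cosh (- w) = cosh w" "x - - w = x + w" by simp_all
      then show ?thesis by (simp only: gen *)
    qed
    also have "\<dots> = exp (- t) * (\<bar>g' w\<bar> * (exp (- 2 * t * c\<^sup>2 * (g w)\<^sup>2) / (1 + (g w)\<^sup>2)))"
    proof -
      have gw: "\<bar>g' w\<bar> = cosh (w / 2) / (2 * c)" using c by (simp add: g'_def)
      have e12: "exp (- t) * exp (t - t * cosh w) = exp (- t * cosh w)" by (simp add: exp_add[symmetric])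
      have gen: "e1 * (C / (2 * c) * (e2 / (d / (2 * c\<^sup>2)))) = (e1 * e2) * (4 * c * C / d) / 4" for e1 e2 C d :: real
        using c by (simp add: power2_eq_square)
      show ?thesis unfolding A B gw gen e12 ..
    qed
    finally have "(exp (- t * cosh w) / (2 * cosh ((x - w) / 2)) + exp (- t * cosh (- w)) / (2 * cosh ((x - - w) / 2))) / 2
      = exp (- t) * (\<bar>g' w\<bar> * (exp (- 2 * t * c\<^sup>2 * (g w)\<^sup>2) / (1 + (g w)\<^sup>2)))" .
    note key = this
    have l: "(b w + b (0 + (-1) * w)) / 2 = complex_of_real ((exp (- t * cosh w) / (2 * cosh ((x - w) / 2)) + exp (- t * cosh (- w)) / (2 * cosh ((x - - w) / 2))) / 2)"
      unfolding b_def by simp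
    show ?thesis unfolding l key \<phi>_def of_real_mult ..
  qed
  have range_g: "range g = UNIV"
  proof -
    have "p = g (2 * arsinh (c * p))" for p using c by (simp add: g_def)
    then show ?thesis by (metis UNIV_eq_I rangeI)
  qed
  have inj_g: "inj g" unfolding g_def using c by (auto intro!: injI)
  have dg: "(g has_field_derivative g' w) (at w)" for w
    unfolding g_def g'_def using c by (auto intro!: derivative_eq_intros simp: field_simps)
  have mg: "g \<in> borel_measurable borel" "g' \<in> borel_measurable borel"
    unfolding g_def g'_def using c by (auto intro!: borel_measurable_continuous_onI continuous_intros)
  note sub = lborel_substitution[of UNIV g g' \<phi>, unfolded range_g, OF _ _ dg inj_g mg \<phi>m]
  have "integrable lborel (\<lambda>w. (b w + b (0 + (-1) * w)) / 2)"
    by (intro integrable_divide Bochner_Integration.integrable_add bi bi')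
  then have ig: "integrable lborel (\<lambda>w. of_real \<bar>g' w\<bar> * \<phi> (g w))"
    unfolding sym by (rule integrable_cmult_cancel) simp
  then have i\<phi>: "integrable lborel \<phi>" using sub(1) by (simp add: set_integrable_def)
  have "integral\<^sup>L lborel b = (\<integral>w. (b w + b (0 + (-1) * w)) / 2 \<partial>lborel)"
    unfolding integral_divide_zero Bochner_Integration.integral_add[OF bi bi'] using b' by simp
  also have "\<dots> = of_real (exp (- t)) * (\<integral>w. of_real \<bar>g' w\<bar> * \<phi> (g w) \<partial>lborel)"
    unfolding sym integral_mult_right_zero ..
  also have "(\<integral>w. of_real \<bar>g' w\<bar> * \<phi> (g w) \<partial>lborel) = integral\<^sup>L lborel \<phi>"
    using sub(2) by (simp add: set_lebesgue_integral_def)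
  finally have L: "integral\<^sup>L lborel b = of_real (exp (- t)) * integral\<^sup>L lborel \<phi>" .
  define h where "h = (\<lambda>y. exp ((y - ln t) / 2))"
  define h' where "h' = (\<lambda>y. exp ((y - ln t) / 2) / 2)"
  have range_h: "range h = {0<..}"
  proof -
    have "p = h (ln t + 2 * ln p)" if "p > 0" for p using that by (simp add: h_def)
    then have "{0<..} \<subseteq> range h" by blast
    moreover have "range h \<subseteq> {0<..}" by (auto simp: h_def)
    ultimately show ?thesis by blast
  qed
  have inj_h: "inj h" unfolding h_def by (auto intro!: injI)
  have dh: "(h has_field_derivative h' y) (at y)" for y
    unfolding h_def h'_def by (auto intro!: derivative_eq_intros)
  have mh: "h \<in> borel_measurable borel" "h' \<in> borel_measurable borel" unfolding h_def h'_def by measurable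
  have hint: "of_real \<bar>h' y\<bar> * \<phi> (h y) = of_real (sqrt t / 2) * complex_of_real (exp (y / 2 - exp y * (1 + cosh x)) / (exp y + t))" for y
  proof -
    have "(h y)\<^sup>2 = exp (2 * ((y - ln t) / 2))" by (simp only: h_def exp_double)
    also have "2 * ((y - ln t) / 2) = y - ln t" by simp
    finally have h2: "(h y)\<^sup>2 = exp y / t" using t by (simp add: exp_diff)
    have st: "exp (ln t / 2) = sqrt t" using t by (simp add: ln_sqrt[symmetric])
    have A: "- 2 * t * c\<^sup>2 * (h y)\<^sup>2 = - exp y * (1 + cosh x)" unfolding h2 chx using t by (simp add: field_simps)
    have B: "1 + (h y)\<^sup>2 = (exp y + t) / t" unfolding h2 using t by (simp add: field_simps)
    have C: "h' y = exp (y / 2) / (2 * sqrt t)" unfolding h'_def diff_divide_distrib exp_diff st by simp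
    have pos: "exp y + t > 0" using t by (simp add: add_pos_pos)
    have "\<bar>h' y\<bar> * (exp (- 2 * t * c\<^sup>2 * (h y)\<^sup>2) / (1 + (h y)\<^sup>2)) = exp (y / 2) / (2 * sqrt t) * (exp (- exp y * (1 + cosh x)) / ((exp y + t) / t))"
      unfolding A B C using t by simp
    also have "\<dots> = (t / sqrt t) / 2 * (exp (y / 2) * exp (- exp y * (1 + cosh x)) / (exp y + t))" using pos by (simp add: mult_ac)
    also have "t / sqrt t = sqrt t" using t by (simp add: real_div_sqrt)
    finally have "\<bar>h' y\<bar> * (exp (- 2 * t * c\<^sup>2 * (h y)\<^sup>2) / (1 + (h y)\<^sup>2)) = sqrt t / 2 * (exp (y / 2 - exp y * (1 + cosh x)) / (exp y + t))"
      by (simp add: exp_add[symmetric])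
    from arg_cong[OF this, of complex_of_real] show ?thesis unfolding \<phi>_def by simp
  qed
  note subh = lborel_substitution[of UNIV h h' \<phi>, unfolded range_h, OF _ _ dh inj_h mh \<phi>m]
  have "integral\<^sup>L lborel \<phi> = 2 * (LBINT p:{0<..}. \<phi> p)"
    by (rule even_integral[OF i\<phi>]) (simp add: \<phi>_def)
  also have "(LBINT p:{0<..}. \<phi> p) = of_real (sqrt t / 2) * (\<integral>y. complex_of_real (exp (y / 2 - exp y * (1 + cosh x)) / (exp y + t)) \<partial>lborel)"
  proof -
    have "(LBINT p:{0<..}. \<phi> p) = (LBINT y:UNIV. of_real \<bar>h' y\<bar> * \<phi> (h y))" by (rule subh(2)) simp_all
    also have "\<dots> = (\<integral>y. of_real \<bar>h' y\<bar> * \<phi> (h y) \<partial>lborel)" by (simp add: set_lebesgue_integral_def)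
    finally show ?thesis unfolding hint integral_mult_right_zero .
  qed
  finally have P: "integral\<^sup>L lborel \<phi> = 2 * (of_real (sqrt t / 2) * (\<integral>y. complex_of_real (exp (y / 2 - exp y * (1 + cosh x)) / (exp y + t)) \<partial>lborel))" .
  have gen: "of_real (exp (- t)) * (2 * (of_real (sqrt t / 2) * I)) = of_real (exp (- t) * sqrt t) * I" for I :: complex
    by simp
  show ?thesis using L unfolding P gen b_def .
qed

text \<open>Inside the integral for K, the factor e^(\<nu>w) is replaced by its sech integral over
  x. Exchanging the order and applying \<open>sech_laplace_transform\<close> moves the dependence on
  t into 1/(e^y + t); a second exchange recognises the integral over x as K at e^y.\<close>

theorem besselK_stieltjes:
  fixes t :: real
  assumes nu: "\<bar>Re \<nu>\<bar> < 1/2" and t: "t > 0"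
  shows "besselK \<nu> (of_real t) = cos (of_real pi * \<nu>) / of_real pi * of_real (exp (- t) * sqrt t) *
    (\<integral>y. exp (of_real (y / 2 - exp y)) * besselK \<nu> (of_real (exp y)) / of_real (exp y + t) \<partial>lborel)"
proof -
  define f where "f = (\<lambda>w x. of_real (exp (- t * cosh w)) * (exp (\<nu> * of_real x) / of_real (2 * cosh ((x - w) / 2))))"
  have sh: "exp (\<nu> * of_real (w + 1 * u)) / of_real (2 * cosh ((w + 1 * u - w) / 2)) = exp (\<nu> * of_real w) * (exp (\<nu> * of_real u) / of_real (2 * cosh (u / 2)))" for \<nu> :: complex and w u
    by (simp add: distrib_left exp_add)
  have inner: "integrable lborel (\<lambda>x. exp (\<nu> * of_real x) / of_real (2 * cosh ((x - w) / 2)))"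
    "(\<integral>x. exp (\<nu> * of_real x) / of_real (2 * cosh ((x - w) / 2)) \<partial>lborel) = exp (\<nu> * of_real w) * (of_real pi / cos (of_real pi * \<nu>))"
    if "\<bar>Re \<nu>\<bar> < 1/2" for \<nu> :: complex and w
  proof -
    have "integrable lborel (\<lambda>u. exp (\<nu> * of_real (w + 1 * u)) / of_real (2 * cosh ((w + 1 * u - w) / 2)))"
      unfolding sh using sech_integral(1)[OF that] by (rule integrable_mult_right)
    then show "integrable lborel (\<lambda>x. exp (\<nu> * of_real x) / of_real (2 * cosh ((x - w) / 2)))"
      using lborel_integrable_real_affine_iff[of 1 "\<lambda>x. exp (\<nu> * of_real x) / of_real (2 * cosh ((x - w) / 2))" w] by simp
    show "(\<integral>x. exp (\<nu> * of_real x) / of_real (2 * cosh ((x - w) / 2)) \<partial>lborel) = exp (\<nu> * of_real w) * (of_real pi / cos (of_real pi * \<nu>))"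
      by (subst lborel_integral_real_affine[of 1 _ w]) (simp, simp only: sh integral_mult_right_zero sech_integral(2)[OF that], simp)
  qed
  have m: "case_prod f \<in> borel_measurable (borel \<Otimes>\<^sub>M borel)" unfolding f_def by measurable
  have i1: "integrable lborel (f w)" for w unfolding f_def by (intro integrable_mult_right inner nu)
  define S where "S = (\<integral>x. exp (Re \<nu> * x) / (2 * cosh (x / 2)) \<partial>lborel)"
  have nf: "(\<integral>x. norm (f w x) \<partial>lborel) = S * exp (Re \<nu> * w - t * cosh w)" for w
  proof -
    have "norm (f w x) = exp (- t * cosh w) * (exp (Re \<nu> * x) / (2 * cosh ((x - w) / 2)))" for x
      by (simp add: f_def norm_mult norm_divide)
    then have "(\<integral>x. norm (f w x) \<partial>lborel) = exp (- t * cosh w) * (\<integral>x. exp (Re \<nu> * x) / (2 * cosh ((x - w) / 2)) \<partial>lborel)"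
      by (simp only: integral_mult_right_zero)
    also have "(\<integral>x. exp (Re \<nu> * x) / (2 * cosh ((x - w) / 2)) \<partial>lborel) = (\<integral>u. exp (Re \<nu> * w) * (exp (Re \<nu> * u) / (2 * cosh (u / 2))) \<partial>lborel)"
      by (subst lborel_integral_real_affine[of 1 _ w]) (simp_all add: distrib_left exp_add)
    finally show ?thesis unfolding integral_mult_right_zero S_def by (simp add: exp_diff exp_minus field_simps)
  qed
  have i2: "integrable lborel (\<lambda>w. \<integral>x. norm (f w x) \<partial>lborel)"
    unfolding nf using integrable_besselKr[OF t] by (rule integrable_mult_right)
  have inx: "(\<integral>x. f w x \<partial>lborel) = of_real pi / cos (of_real pi * \<nu>) * besselK_int 0 \<nu> (of_real t) w" for w
    unfolding f_def integral_mult_right_zero inner(2)[OF nu] besselK_int_def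
    by (simp add: exp_of_real[symmetric] exp_diff exp_minus field_simps)
  define D where "D = (\<lambda>x. \<integral>y. complex_of_real (exp (y / 2 - exp y * (1 + cosh x)) / (exp y + t)) \<partial>lborel)"
  have inw: "(\<integral>w. f w x \<partial>lborel) = exp (\<nu> * of_real x) * (of_real (exp (- t) * sqrt t) * D x)" for x
  proof -
    have "f w x = exp (\<nu> * of_real x) * of_real (exp (- t * cosh w) / (2 * cosh ((x - w) / 2)))" for w
      by (simp add: f_def)
    then show ?thesis unfolding D_def sech_laplace_transform[OF t, symmetric] by (simp only: integral_mult_right_zero)
  qed
  have 1: "of_real pi / cos (of_real pi * \<nu>) * (2 * besselK \<nu> (of_real t)) = of_real (exp (- t) * sqrt t) * (\<integral>x. exp (\<nu> * of_real x) * D x \<partial>lborel)"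
  proof -
    have "of_real pi / cos (of_real pi * \<nu>) * (2 * besselK \<nu> (of_real t)) = (\<integral>w. (\<integral>x. f w x \<partial>lborel) \<partial>lborel)"
      unfolding inx integral_mult_right_zero besselK_mom_def by simp
    also have "\<dots> = (\<integral>x. (\<integral>w. f w x \<partial>lborel) \<partial>lborel)" by (rule Fubini_lborel(1)[OF m i1 i2])
    also have "\<dots> = (\<integral>x. of_real (exp (- t) * sqrt t) * (exp (\<nu> * of_real x) * D x) \<partial>lborel)"
      unfolding inw by (simp only: mult_ac)
    finally show ?thesis by (simp only: integral_mult_right_zero)
  qed
  define k where "k = (\<lambda>y x. exp (of_real (y / 2 - exp y)) / of_real (exp y + t) * besselK_int 0 \<nu> (of_real (exp y)) x)"
  have mk: "case_prod k \<in> borel_measurable (borel \<Otimes>\<^sub>M borel)" unfolding k_def besselK_int_def by measurable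
  have k1: "integrable lborel (k y)" for y
    unfolding k_def by (intro integrable_mult_right integrable_besselK_int) simp
  have nk: "(\<integral>x. norm (k y x) \<partial>lborel) = 2 * (exp (1/2 * y - exp y) * besselKr (Re \<nu>) (exp y)) / (exp y + t)" for y
  proof -
    have "exp y + t > 0" using t by (simp add: add_pos_pos)
    then have "norm (k y x) = exp (y / 2 - exp y) / (exp y + t) * exp (Re \<nu> * x - exp y * cosh x)" for x
      by (simp add: k_def besselK_int_def norm_mult norm_divide del: of_real_add)
    then show ?thesis unfolding besselKr_def by simp
  qed
  have ik: "integrable lborel (\<lambda>y. exp (1/2 * y - exp y) * besselKr (Re \<nu>) (exp y))"
  proof -
    have "integrable lborel (\<lambda>x. exp (of_real (1/2 * x - exp x)) * besselK (of_real (Re \<nu>)) (of_real (exp x)))"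
      by (rule besselK_exp_moment(1)) (use nu in simp)
    moreover have "exp (of_real (1/2 * x - exp x)) * besselK (of_real (Re \<nu>)) (of_real (exp x)) = complex_of_real (exp (1/2 * x - exp x) * besselKr (Re \<nu>) (exp x))" for x
      unfolding besselK_of_real exp_of_real by simp
    ultimately show ?thesis by (intro complex_of_real_integrable_eq[THEN iffD1]) (simp only:)
  qed
  have k2: "integrable lborel (\<lambda>y. \<integral>x. norm (k y x) \<partial>lborel)"
  proof (rule Bochner_Integration.integrable_bound)
    show "integrable lborel (\<lambda>y. 2 * (exp (1/2 * y - exp y) * besselKr (Re \<nu>) (exp y)) / t)"
      using ik by (intro integrable_divide integrable_mult_right)
    show "(\<lambda>y. \<integral>x. norm (k y x) \<partial>lborel) \<in> borel_measurable lborel"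
      unfolding nk using ik by measurable
    show "AE y in lborel. norm (\<integral>x. norm (k y x) \<partial>lborel) \<le> norm (2 * (exp (1/2 * y - exp y) * besselKr (Re \<nu>) (exp y)) / t)"
    proof (intro AE_I2)
      fix y
      have "2 * (exp (1/2 * y - exp y) * besselKr (Re \<nu>) (exp y)) / (exp y + t) \<le> 2 * (exp (1/2 * y - exp y) * besselKr (Re \<nu>) (exp y)) / t"
        using t besselKr_nonneg[of "Re \<nu>" "exp y"] by (intro divide_left_mono) (auto intro!: mult_pos_pos add_pos_pos)
      then show "norm (\<integral>x. norm (k y x) \<partial>lborel) \<le> norm (2 * (exp (1/2 * y - exp y) * besselKr (Re \<nu>) (exp y)) / t)"
        unfolding nk using t besselKr_nonneg[of "Re \<nu>" "exp y"] by (simp add: abs_of_nonneg add_nonneg_nonneg)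
    qed
  qed
  have kx: "(\<integral>x. k y x \<partial>lborel) = 2 * (exp (of_real (y / 2 - exp y)) * besselK \<nu> (of_real (exp y)) / of_real (exp y + t))" for y
  proof -
    have gen: "E / D * I = 2 * (E * (I / 2) / D)" for E D I :: complex by simp
    show ?thesis unfolding k_def integral_mult_right_zero besselK_mom_def by (rule gen)
  qed
  have ky: "(\<integral>y. k y x \<partial>lborel) = exp (\<nu> * of_real x) * D x" for x
  proof -
    have "k y x = exp (\<nu> * of_real x) * complex_of_real (exp (y / 2 - exp y * (1 + cosh x)) / (exp y + t))" for y
      by (simp add: k_def besselK_int_def exp_of_real[symmetric] exp_add[symmetric] algebra_simps)
    then show ?thesis unfolding D_def by (simp only: integral_mult_right_zero)
  qed
  have 2: "(\<integral>x. exp (\<nu> * of_real x) * D x \<partial>lborel) = 2 * (\<integral>y. exp (of_real (y / 2 - exp y)) * besselK \<nu> (of_real (exp y)) / of_real (exp y + t) \<partial>lborel)"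
    using Fubini_lborel(1)[OF mk k1 k2] unfolding kx ky integral_mult_right_zero by simp
  show ?thesis
    using 1 cos_pi_nonzero[OF nu] unfolding 2 by (simp add: field_simps)
qed

text \<open>With s = e^y the integrand is s^(M - 1/2) e^(-s) K(s) t/(t + s) ds. Without the
  fraction, which lies between 0 and 1, the expression has the value (-1)^M a_M(\<nu>) for |Re
  \<nu>| < 1/2; this fixes the constants in front.\<close>

definition stieltjesG :: "nat \<Rightarrow> complex \<Rightarrow> real \<Rightarrow> complex" where
  "stieltjesG M \<nu> t = cos (of_real pi * \<nu>) / of_real pi * of_real (sqrt (2 / pi)) *
    (\<integral>y. exp (of_real ((real M + 1/2) * y - exp y)) * besselK \<nu> (of_real (exp y)) * of_real (t / (t + exp y)) \<partial>lborel)"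

text \<open>On |\<sigma>| < M + 1/2 this is |a_M(\<sigma>)| / |cos(\<pi>\<sigma>)| with the zeros of
  the cosine cancelled, hence continuous also at half-odd \<open>\<sigma>\<close>.\<close>

definition stieltjesB :: "nat \<Rightarrow> real \<Rightarrow> real" where
  "stieltjesB M \<sigma> = Gamma (real M + 1/2 + \<sigma>) * Gamma (real M + 1/2 - \<sigma>) / (pi * 2 ^ M * fact M)"

text \<open>Legendre's duplication formula at q = M + 1/2, where \<Gamma>(q + 1/2) = M!. It reduces
  the constant of \<open>besselK_exp_moment\<close> to the denominator of the coefficient
  a_M.\<close>

lemma Gamma_half_constant:
  "sqrt (2 / pi) * (Gamma (real M + 1/2) * exp ((real M + 1/2) * ln 2) / 2 / Gamma (2 * (real M + 1/2))) = 1 / (2 ^ M * fact M)"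
proof -
  define q where "q = real M + 1/2"
  have q: "q > 0" by (simp add: q_def)
  have "Gamma q * Gamma (q + 1/2) = 2 powr (1 - 2 * q) * sqrt pi * Gamma (2 * q)"
  proof -
    have n: "z \<notin> \<int>\<^sub>\<le>\<^sub>0" if "Re z > 0" for z :: complex using that by (auto elim!: nonpos_Ints_cases)
    have e: "complex_of_real q + 1/2 = of_real (q + 1/2)" "2 * complex_of_real q = of_real (2 * q)"
      "exp ((1 - complex_of_real (2 * q)) * of_real (ln 2)) = of_real (2 powr (1 - 2 * q))"
      by (simp_all add: powr_def exp_of_real[symmetric])
    have "Gamma (complex_of_real q) * Gamma (complex_of_real q + 1/2) = exp ((1 - 2 * complex_of_real q) * of_real (ln 2)) * of_real (sqrt pi) * Gamma (2 * complex_of_real q)"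
      by (rule Gamma_legendre_duplication) (use q in \<open>auto intro!: n\<close>)
    then have "complex_of_real (Gamma q * Gamma (q + 1/2)) = of_real (2 powr (1 - 2 * q) * sqrt pi * Gamma (2 * q))"
      unfolding e Gamma_complex_of_real by (simp only: of_real_mult)
    then show ?thesis using of_real_eq_iff by blast
  qed
  moreover have "Gamma (q + 1/2) = fact M" using Gamma_fact[of M, where 'a=real] by (simp add: q_def add_ac)
  moreover have "Gamma (2 * q) > 0" using q by (intro Gamma_real_pos) auto
  ultimately have 1: "Gamma q / Gamma (2 * q) = 2 powr (1 - 2 * q) * sqrt pi / fact M" by (simp add: field_simps)
  have e: "exp (q * ln 2) = 2 powr q" by (simp add: powr_def)
  have "sqrt (2 / pi) * (Gamma q * exp (q * ln 2) / 2 / Gamma (2 * q)) = sqrt (2 / pi) * exp (q * ln 2) / 2 * (Gamma q / Gamma (2 * q))" by simp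
  also have "\<dots> = (sqrt (2 / pi) * sqrt pi) * (2 powr q * 2 powr (1 - 2 * q)) / 2 / fact M" unfolding 1 e by simp
  also have "sqrt (2 / pi) * sqrt pi = 2 powr (1/2)" by (simp add: real_sqrt_divide powr_half_sqrt)
  also have "2 powr q * 2 powr (1 - 2 * q) = 2 powr (1/2 - real M :: real)" by (simp add: powr_add[symmetric] q_def algebra_simps)
  also have "2 powr (1/2) * 2 powr (1/2 - real M) / 2 / fact M = 2 powr (1 - real M) / 2 / (fact M :: real)" by (simp add: powr_add[symmetric])
  also have "2 powr (1 - real M) = 2 / (2 ^ M :: real)" by (simp add: powr_diff powr_realpow)
  finally show ?thesis unfolding q_def by simp
qed

lemma abs_frac_le_one:
  fixes t y :: real
  assumes "t > 0"
  shows "\<bar>t / (t + exp y)\<bar> \<le> 1"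
  using add_pos_pos[OF assms exp_gt_zero[of y]] assms by (simp add: abs_of_pos field_simps)

text \<open>Written so that t/r - 1 appears as a factor. For positive t, r and u the remaining two
  fractions lie between 0 and 1, which makes the difference estimate for \<open>stieltjesG\<close>
  no worse than |t/r - 1| times the bound for G itself.\<close>

lemma frac_diff_eq:
  fixes t r u X Y :: real
  assumes "X = t + u" "Y = r + u" "X \<noteq> 0" "Y \<noteq> 0" "r \<noteq> 0"
  shows "t / X - r / Y = (t / r - 1) * ((u / X) * (r / Y))"
proof -
  have n: "t * Y - r * X = (t - r) * u" unfolding assms(1,2) by (simp add: algebra_simps)
  have "t / X - r / Y = (t * Y - r * X) / (X * Y)" using assms(3,4) by (simp add: diff_frac_eq)
  also have "\<dots> = (t / r - 1) * ((u / X) * (r / Y))" unfolding n using assms(3-5) by (simp add: divide_simps)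
  finally show ?thesis .
qed

lemma stieltjes_integrable:
  fixes t :: real
  assumes nu: "\<bar>Re \<nu>\<bar> < real M + 1/2" and t: "t > 0"
  shows "integrable lborel (\<lambda>y. exp (of_real ((real M + 1/2) * y - exp y)) * besselK \<nu> (of_real (exp y)) * of_real (t / (t + exp y)))"
proof (rule Bochner_Integration.integrable_bound)
  show "integrable lborel (\<lambda>y. exp (of_real ((real M + 1/2) * y - exp y)) * besselK \<nu> (of_real (exp y)))"
    by (rule besselK_exp_moment(1)[OF nu])
  then have "(\<lambda>y. exp (of_real ((real M + 1/2) * y - exp y)) * besselK \<nu> (of_real (exp y))) \<in> borel_measurable lborel" by simp
  then show "(\<lambda>y. exp (of_real ((real M + 1/2) * y - exp y)) * besselK \<nu> (of_real (exp y)) * of_real (t / (t + exp y))) \<in> borel_measurable lborel"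
    by measurable
  show "AE y in lborel. norm (exp (of_real ((real M + 1/2) * y - exp y)) * besselK \<nu> (of_real (exp y)) * of_real (t / (t + exp y)))
     \<le> norm (exp (of_real ((real M + 1/2) * y - exp y)) * besselK \<nu> (of_real (exp y)))"
  proof (intro AE_I2)
    fix y
    have "\<bar>t / (t + exp y)\<bar> \<le> 1" by (rule abs_frac_le_one[OF t])
    then show "norm (exp (of_real ((real M + 1/2) * y - exp y)) * besselK \<nu> (of_real (exp y)) * of_real (t / (t + exp y)))
     \<le> norm (exp (of_real ((real M + 1/2) * y - exp y)) * besselK \<nu> (of_real (exp y)))"
      unfolding norm_mult[of _ "of_real (t / (t + exp y))"] norm_of_real by (intro mult_left_le) auto
  qed
qed

lemma integrable_stieltjes_bound:
  assumes "\<bar>\<sigma>\<bar> < real M + 1/2"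
  shows "integrable lborel (\<lambda>y. exp ((real M + 1/2) * y - exp y) * besselKr \<sigma> (exp y))"
    and "\<bar>sqrt (2 / pi)\<bar> * (\<integral>y. exp ((real M + 1/2) * y - exp y) * besselKr \<sigma> (exp y) \<partial>lborel) = pi * stieltjesB M \<sigma>"
proof -
  have eq: "exp (of_real ((real M + 1/2) * x - exp x)) * besselK (of_real \<sigma>) (of_real (exp x)) = complex_of_real (exp ((real M + 1/2) * x - exp x) * besselKr \<sigma> (exp x))" for x
    unfolding besselK_of_real exp_of_real by simp
  note m = besselK_exp_moment[of "of_real \<sigma>" "real M + 1/2", unfolded eq]
  show i: "integrable lborel (\<lambda>y. exp ((real M + 1/2) * y - exp y) * besselKr \<sigma> (exp y))"
    using m(1) assms unfolding complex_of_real_integrable_eq by simp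
  have "complex_of_real (\<integral>y. exp ((real M + 1/2) * y - exp y) * besselKr \<sigma> (exp y) \<partial>lborel) =
      of_real (Gamma (real M + 1/2) * exp ((real M + 1/2) * ln 2) / 2 * (Gamma (real M + 1/2 + \<sigma>) * Gamma (real M + 1/2 - \<sigma>) / Gamma (2 * (real M + 1/2))))"
    using m(2) assms unfolding integral_complex_of_real
    by (simp add: Gamma_complex_of_real flip: of_real_add of_real_diff)
  then have e: "(\<integral>y. exp ((real M + 1/2) * y - exp y) * besselKr \<sigma> (exp y) \<partial>lborel) =
      Gamma (real M + 1/2) * exp ((real M + 1/2) * ln 2) / 2 * (Gamma (real M + 1/2 + \<sigma>) * Gamma (real M + 1/2 - \<sigma>) / Gamma (2 * (real M + 1/2)))"
    using of_real_eq_iff by blast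
  have "\<bar>sqrt (2 / pi)\<bar> * (\<integral>y. exp ((real M + 1/2) * y - exp y) * besselKr \<sigma> (exp y) \<partial>lborel) =
    sqrt (2 / pi) * (Gamma (real M + 1/2) * exp ((real M + 1/2) * ln 2) / 2 / Gamma (2 * (real M + 1/2))) * (Gamma (real M + 1/2 + \<sigma>) * Gamma (real M + 1/2 - \<sigma>))"
    unfolding e by simp
  then show "\<bar>sqrt (2 / pi)\<bar> * (\<integral>y. exp ((real M + 1/2) * y - exp y) * besselKr \<sigma> (exp y) \<partial>lborel) = pi * stieltjesB M \<sigma>"
    unfolding Gamma_half_constant stieltjesB_def by simp
qed

text \<open>The weight \<open>k\<close> is left open so that one estimate serves both for t/(t + s)
  and for the difference of two such weights. Replacing K by K of order Re \<nu> is what produces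
  the real order in the constant.\<close>

lemma norm_stieltjes_integral_le:
  fixes k :: "real \<Rightarrow> real"
  assumes nu: "\<bar>Re \<nu>\<bar> < real M + 1/2" and k: "\<And>y. \<bar>k y\<bar> \<le> C" and C: "C \<ge> 0"
  shows "norm (cos (of_real pi * \<nu>) / of_real pi * of_real (sqrt (2 / pi)) *
    (\<integral>y. exp (of_real ((real M + 1/2) * y - exp y)) * besselK \<nu> (of_real (exp y)) * of_real (k y) \<partial>lborel))
    \<le> C * (norm (cos (of_real pi * \<nu>)) * stieltjesB M (Re \<nu>))"
proof -
  have p: "norm (exp (of_real ((real M + 1/2) * y - exp y)) * besselK \<nu> (of_real (exp y)) * of_real (k y)) \<le> C * (exp ((real M + 1/2) * y - exp y) * besselKr (Re \<nu>) (exp y))" for y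
  proof -
    have "norm (exp (of_real ((real M + 1/2) * y - exp y)) * besselK \<nu> (of_real (exp y)) * of_real (k y)) = exp ((real M + 1/2) * y - exp y) * norm (besselK \<nu> (of_real (exp y))) * \<bar>k y\<bar>"
      unfolding norm_mult norm_of_real norm_exp_eq_Re Re_complex_of_real ..
    also have "\<dots> \<le> exp ((real M + 1/2) * y - exp y) * besselKr (Re \<nu>) (exp y) * C"
      using norm_besselK_le[of "of_real (exp y)" \<nu>] k[of y] besselKr_nonneg[of "Re \<nu>" "exp y"] by (intro mult_mono) auto
    finally show ?thesis by (simp add: mult_ac)
  qed
  have "norm (\<integral>y. exp (of_real ((real M + 1/2) * y - exp y)) * besselK \<nu> (of_real (exp y)) * of_real (k y) \<partial>lborel)
     \<le> (\<integral>y. C * (exp ((real M + 1/2) * y - exp y) * besselKr (Re \<nu>) (exp y)) \<partial>lborel)"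
  proof (cases "integrable lborel (\<lambda>y. exp (of_real ((real M + 1/2) * y - exp y)) * besselK \<nu> (of_real (exp y)) * of_real (k y))")
    case True
    then show ?thesis
      by (rule Bochner_Integration.integral_norm_bound_integral[OF _ integrable_mult_right[OF integrable_stieltjes_bound(1)[OF nu]] p])
  next
    \<comment> \<open>The integral is then 0 by convention, and the bound is nonnegative.\<close>
    case False
    then show ?thesis using C by (simp add: not_integrable_integral_eq besselKr_nonneg integral_nonneg_AE)
  qed
  then have "norm (cos (of_real pi * \<nu>) / of_real pi * of_real (sqrt (2 / pi))) * norm (\<integral>y. exp (of_real ((real M + 1/2) * y - exp y)) * besselK \<nu> (of_real (exp y)) * of_real (k y) \<partial>lborel)
    \<le> norm (cos (of_real pi * \<nu>) / of_real pi * of_real (sqrt (2 / pi))) * (\<integral>y. C * (exp ((real M + 1/2) * y - exp y) * besselKr (Re \<nu>) (exp y)) \<partial>lborel)"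
    by (rule mult_left_mono) simp
  also have "\<dots> = C * (norm (cos (of_real pi * \<nu>)) / pi * (\<bar>sqrt (2 / pi)\<bar> * (\<integral>y. exp ((real M + 1/2) * y - exp y) * besselKr (Re \<nu>) (exp y) \<partial>lborel)))"
    unfolding norm_mult norm_divide norm_of_real integral_mult_right_zero by simp
  also have "\<dots> = C * (norm (cos (of_real pi * \<nu>)) * stieltjesB M (Re \<nu>))"
    unfolding integrable_stieltjes_bound(2)[OF nu] by simp
  finally show ?thesis by (simp only: norm_mult)
qed

lemma norm_stieltjesG_le:
  assumes "\<bar>Re \<nu>\<bar> < real M + 1/2" "t > 0"
  shows "norm (stieltjesG M \<nu> t) \<le> norm (cos (of_real pi * \<nu>)) * stieltjesB M (Re \<nu>)"
proof -
  have k: "\<bar>t / (t + exp y)\<bar> \<le> 1" for y by (rule abs_frac_le_one[OF assms(2)])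
  show ?thesis unfolding stieltjesG_def using norm_stieltjes_integral_le[OF assms(1) k] by simp
qed

lemma norm_stieltjesG_diff_le:
  assumes nu: "\<bar>Re \<nu>\<bar> < real M + 1/2" and t: "t > 0" "r > 0"
  shows "norm (stieltjesG M \<nu> t - stieltjesG M \<nu> r) \<le> \<bar>t / r - 1\<bar> * (norm (cos (of_real pi * \<nu>)) * stieltjesB M (Re \<nu>))"
proof -
  have k: "\<bar>t / (t + exp y) - r / (r + exp y)\<bar> \<le> \<bar>t / r - 1\<bar>" for y
  proof -
    have p: "t + exp y > 0" "r + exp y > 0" using t by (auto intro: add_pos_pos)
    have eq: "t / (t + exp y) - r / (r + exp y) = (t / r - 1) * ((exp y / (t + exp y)) * (r / (r + exp y)))"
      by (rule frac_diff_eq) (use p t in auto)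
    have "\<bar>(exp y / (t + exp y)) * (r / (r + exp y))\<bar> \<le> 1"
      unfolding abs_mult using p t by (intro mult_le_one) (auto simp: field_simps)
    then show ?thesis unfolding eq abs_mult[of "t / r - 1"] by (rule mult_left_le) simp
  qed
  define g where "g = (\<lambda>t y. exp (of_real ((real M + 1/2) * y - exp y)) * besselK \<nu> (of_real (exp y)) * of_real (t / (t + exp y)))"
  have "(\<integral>y. g t y \<partial>lborel) - (\<integral>y. g r y \<partial>lborel) = (\<integral>y. g t y - g r y \<partial>lborel)"
    unfolding g_def by (rule Bochner_Integration.integral_diff[symmetric]) (intro stieltjes_integrable nu t)+
  also have "\<dots> = (\<integral>y. exp (of_real ((real M + 1/2) * y - exp y)) * besselK \<nu> (of_real (exp y)) * of_real (t / (t + exp y) - r / (r + exp y)) \<partial>lborel)"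
    unfolding g_def of_real_diff right_diff_distrib ..
  finally have "stieltjesG M \<nu> t - stieltjesG M \<nu> r = cos (of_real pi * \<nu>) / of_real pi * of_real (sqrt (2 / pi)) *
    (\<integral>y. exp (of_real ((real M + 1/2) * y - exp y)) * besselK \<nu> (of_real (exp y)) * of_real (t / (t + exp y) - r / (r + exp y)) \<partial>lborel)"
    unfolding stieltjesG_def g_def by (simp only: right_diff_distrib[symmetric])
  then show ?thesis using norm_stieltjes_integral_le[OF nu k] by simp
qed

lemma stieltjesG_holomorphic:
  fixes t :: real
  assumes t: "t > 0"
  shows "(\<lambda>\<nu>. stieltjesG M \<nu> t) holomorphic_on {\<nu>. \<bar>Re \<nu>\<bar> < real M + 1/2}"
proof -
  have "(\<lambda>\<nu>. \<integral>y. exp (of_real ((real M + 1/2) * y - exp y)) * besselK \<nu> (of_real (exp y)) * of_real (t / (t + exp y)) \<partial>lborel) holomorphic_on {\<nu>. \<bar>Re \<nu>\<bar> < real M + 1/2}"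
  proof (rule holomorphic_on_integral[OF open_strip])
  show "(\<lambda>y. exp (of_real ((real M + 1/2) * y - exp y)) * besselK \<nu> (of_real (exp y)) * of_real (t / (t + exp y))) \<in> borel_measurable lborel"
    if "\<nu> \<in> {\<nu>. \<bar>Re \<nu>\<bar> < real M + 1/2}" for \<nu>
    using stieltjes_integrable[of \<nu> M t] that t by simp
  show "(\<lambda>\<nu>. exp (of_real ((real M + 1/2) * y - exp y)) * besselK \<nu> (of_real (exp y)) * of_real (t / (t + exp y))) holomorphic_on {\<nu>. \<bar>Re \<nu>\<bar> < real M + 1/2}" for y
    by (intro holomorphic_intros holomorphic_on_subset[OF besselK_order_holomorphic]) auto
  show "locally_dominated lborel {\<nu>. \<bar>Re \<nu>\<bar> < real M + 1/2} (\<lambda>\<nu> y. exp (of_real ((real M + 1/2) * y - exp y)) * besselK \<nu> (of_real (exp y)) * of_real (t / (t + exp y)))"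
  proof (rule locally_dominatedI)
    fix \<nu> :: complex assume nu: "\<nu> \<in> {\<nu>. \<bar>Re \<nu>\<bar> < real M + 1/2}"
    define e where "e = (real M + 1/2 - \<bar>Re \<nu>\<bar>) / 2"
    define \<sigma> where "\<sigma> = \<bar>Re \<nu>\<bar> + e"
    have e: "e > 0" and s: "\<bar>\<sigma>\<bar> < real M + 1/2" "\<bar>- \<sigma>\<bar> < real M + 1/2" using nu by (auto simp: e_def \<sigma>_def field_simps)
    have Re_w: "\<bar>Re w\<bar> \<le> \<sigma>" if "w \<in> ball \<nu> e" for w
      using that abs_Re_le_cmod[of "w - \<nu>"] by (simp add: \<sigma>_def dist_norm norm_minus_commute)
    show "\<exists>e>0. \<exists>g. ball \<nu> e \<subseteq> {\<nu>. \<bar>Re \<nu>\<bar> < real M + 1/2} \<and> integrable lborel g \<and> (\<forall>w\<in>ball \<nu> e. \<forall>y\<in>space lborel.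
       norm (exp (of_real ((real M + 1/2) * y - exp y)) * besselK w (of_real (exp y)) * of_real (t / (t + exp y))) \<le> g y)"
    proof (intro exI[of _ e] exI[of _ "\<lambda>y. exp ((real M + 1/2) * y - exp y) * besselKr \<sigma> (exp y) + exp ((real M + 1/2) * y - exp y) * besselKr (- \<sigma>) (exp y)"] conjI ballI)
      show "ball \<nu> e \<subseteq> {\<nu>. \<bar>Re \<nu>\<bar> < real M + 1/2}" using Re_w s by force
      show "integrable lborel (\<lambda>y. exp ((real M + 1/2) * y - exp y) * besselKr \<sigma> (exp y) + exp ((real M + 1/2) * y - exp y) * besselKr (- \<sigma>) (exp y))"
        by (intro Bochner_Integration.integrable_add integrable_stieltjes_bound s)
      fix w y assume w: "w \<in> ball \<nu> e"
      have k: "\<bar>t / (t + exp y)\<bar> \<le> 1" by (rule abs_frac_le_one[OF t])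
      have K: "norm (besselK w (of_real (exp y))) \<le> besselKr \<sigma> (exp y) + besselKr (- \<sigma>) (exp y)"
        using norm_besselK_mom_le[of "of_real (exp y)" w \<sigma> 0] Re_w[OF w] by simp
      have "norm (exp (of_real ((real M + 1/2) * y - exp y)) * besselK w (of_real (exp y)) * of_real (t / (t + exp y)))
        = exp ((real M + 1/2) * y - exp y) * norm (besselK w (of_real (exp y))) * \<bar>t / (t + exp y)\<bar>"
        unfolding norm_mult norm_of_real norm_exp_eq_Re Re_complex_of_real ..
      also have "\<dots> \<le> exp ((real M + 1/2) * y - exp y) * (besselKr \<sigma> (exp y) + besselKr (- \<sigma>) (exp y)) * 1"
        using k K by (intro mult_mono) (auto simp: besselKr_nonneg)
      finally show "norm (exp (of_real ((real M + 1/2) * y - exp y)) * besselK w (of_real (exp y)) * of_real (t / (t + exp y)))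
        \<le> exp ((real M + 1/2) * y - exp y) * besselKr \<sigma> (exp y) + exp ((real M + 1/2) * y - exp y) * besselKr (- \<sigma>) (exp y)"
        by (simp add: distrib_left)
    qed (use e in auto)
  qed
  qed
  then show ?thesis unfolding stieltjesG_def by (intro holomorphic_intros) auto
qed

lemma stieltjesG_0:
  fixes t :: real
  assumes nu: "\<bar>Re \<nu>\<bar> < 1/2" and t: "t > 0"
  shows "stieltjesG 0 \<nu> t = of_real (sqrt (2 * t / pi) * exp t) * besselK \<nu> (of_real t)"
proof -
  define I where "I = (\<integral>y. exp (of_real (y / 2 - exp y)) * besselK \<nu> (of_real (exp y)) / of_real (exp y + t) \<partial>lborel)"
  have "exp (of_real ((real 0 + 1/2) * y - exp y)) * besselK \<nu> (of_real (exp y)) * of_real (t / (t + exp y)) = of_real t * (exp (of_real (y / 2 - exp y)) * besselK \<nu> (of_real (exp y)) / of_real (exp y + t))" for y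
    by (simp add: add_ac)
  then have 1: "stieltjesG 0 \<nu> t = cos (of_real pi * \<nu>) / of_real pi * of_real (sqrt (2 / pi)) * (of_real t * I)"
    unfolding stieltjesG_def I_def by (simp only: integral_mult_right_zero)
  have "sqrt (2 * t / pi) * exp t * (exp (- t) * sqrt t) = sqrt (2 / pi) * (sqrt t * sqrt t) * (exp t * exp (- t))"
    by (simp only: real_sqrt_mult real_sqrt_divide) simp
  also have "\<dots> = sqrt (2 / pi) * (sqrt t * sqrt t)" by (simp add: exp_add[symmetric])
  also have "\<dots> = sqrt (2 / pi) * t" using t by simp
  finally have "complex_of_real (sqrt (2 * t / pi) * exp t) * of_real (exp (- t) * sqrt t) = of_real (sqrt (2 / pi) * t)"
    unfolding of_real_mult[symmetric] by simp
  then show ?thesis unfolding 1 besselK_stieltjes[OF nu t] I_def[symmetric] by (simp add: algebra_simps)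
qed

text \<open>The factor cos(\<pi>\<nu>)/\<pi> cancels \<Gamma>(1/2 + \<nu>)\<Gamma>(1/2 - \<nu>), so
  only the Pochhammer symbols remain of the moment: up to sign, the coefficient a_M.\<close>

lemma stieltjes_moment:
  assumes nu: "\<bar>Re \<nu>\<bar> < 1/2"
  shows "cos (of_real pi * \<nu>) / of_real pi * of_real (sqrt (2 / pi)) * (\<integral>y. exp (of_real ((real M + 1/2) * y - exp y)) * besselK \<nu> (of_real (exp y)) \<partial>lborel)
    = pochhammer (1/2 + \<nu>) M * pochhammer (1/2 - \<nu>) M / (2 ^ M * fact M)"
proof -
  define q where "q = real M + 1/2"
  have nuM: "\<bar>Re \<nu>\<bar> < real M + 1/2" using nu by linarith
  have p: "Re (1/2 + \<nu>) > 0" "Re (1/2 - \<nu>) > 0" using nu by auto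
  have g: "Gamma (1/2 + \<nu>) \<noteq> 0" "Gamma (1/2 - \<nu>) \<noteq> 0" using Gamma_nonzero_Re_pos[OF p(1)] Gamma_nonzero_Re_pos[OF p(2)] by auto
  have n: "1/2 + \<nu> \<notin> \<int>\<^sub>\<le>\<^sub>0" "1/2 - \<nu> \<notin> \<int>\<^sub>\<le>\<^sub>0" using g by (auto simp: Gamma_eq_zero_iff)
  have G1: "Gamma (of_real q + \<nu>) = pochhammer (1/2 + \<nu>) M * Gamma (1/2 + \<nu>)"
    using pochhammer_Gamma[OF n(1), of M] g by (simp add: q_def add_ac)
  have G2: "Gamma (of_real q - \<nu>) = pochhammer (1/2 - \<nu>) M * Gamma (1/2 - \<nu>)"
  proof -
    have eq: "1/2 - \<nu> + of_nat M = of_real q - \<nu>" by (simp add: q_def)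
    show ?thesis using pochhammer_Gamma[OF n(2), of M, unfolded eq] g by simp
  qed
  have GG: "cos (of_real pi * \<nu>) / of_real pi * (Gamma (1/2 + \<nu>) * Gamma (1/2 - \<nu>)) = 1"
    unfolding rGamma_half_reflection[symmetric] using g by (simp add: rGamma_inverse_Gamma field_simps)
  have "cos (of_real pi * \<nu>) / of_real pi * of_real (sqrt (2 / pi)) * (\<integral>y. exp (of_real ((real M + 1/2) * y - exp y)) * besselK \<nu> (of_real (exp y)) \<partial>lborel)
    = cos (of_real pi * \<nu>) / of_real pi * of_real (sqrt (2 / pi)) * (of_real (Gamma q * exp (q * ln 2) / 2) * (Gamma (q + \<nu>) * Gamma (q - \<nu>) / of_real (Gamma (2 * q))))"
    by (simp only: q_def besselK_exp_moment(2)[OF nuM])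
  also have "\<dots> = of_real (sqrt (2 / pi) * (Gamma q * exp (q * ln 2) / 2 / Gamma (2 * q))) * (cos (of_real pi * \<nu>) / of_real pi * (Gamma (1/2 + \<nu>) * Gamma (1/2 - \<nu>))) * (pochhammer (1/2 + \<nu>) M * pochhammer (1/2 - \<nu>) M)"
  proof -
    have gen: "C * S * (A * ((P1 * g1) * (P2 * g2) / D)) = (S * (A / D)) * (C * (g1 * g2)) * (P1 * P2)" for C S A P1 g1 P2 g2 D :: complex
      by simp
    show ?thesis unfolding G1 G2 of_real_mult[of "sqrt (2 / pi)"] of_real_divide[of _ "Gamma (2 * q)"] by (rule gen)
  qed
  also have "\<dots> = pochhammer (1/2 + \<nu>) M * pochhammer (1/2 - \<nu>) M / (2 ^ M * fact M)"
    unfolding GG q_def Gamma_half_constant by simp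
  finally show ?thesis .
qed

text \<open>t/(t + s) = 1 - (s/t) t/(t + s): the 1 yields the next coefficient, and the factor s
  raises the exponent of the remaining integral by one.\<close>

lemma stieltjesG_Suc:
  fixes t :: real
  assumes nu: "\<bar>Re \<nu>\<bar> < 1/2" and t: "t > 0"
  shows "stieltjesG M \<nu> t = pochhammer (1/2 + \<nu>) M * pochhammer (1/2 - \<nu>) M / (2 ^ M * fact M) - stieltjesG (Suc M) \<nu> t / of_real t"
proof -
  have nuM: "\<bar>Re \<nu>\<bar> < real M + 1/2" "\<bar>Re \<nu>\<bar> < real (Suc M) + 1/2" using nu by auto
  define c where "c = cos (of_real pi * \<nu>) / of_real pi * of_real (sqrt (2 / pi))"
  have pw: "exp (of_real ((real M + 1/2) * y - exp y)) * besselK \<nu> (of_real (exp y)) * of_real (t / (t + exp y)) =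
     exp (of_real ((real M + 1/2) * y - exp y)) * besselK \<nu> (of_real (exp y)) - exp (of_real ((real (Suc M) + 1/2) * y - exp y)) * besselK \<nu> (of_real (exp y)) * of_real (t / (t + exp y)) / of_real t" for y
  proof -
    have e: "exp (complex_of_real ((real (Suc M) + 1/2) * y - exp y)) = exp (of_real ((real M + 1/2) * y - exp y)) * of_real (exp y)"
      unfolding exp_of_real of_real_mult[symmetric] exp_add[symmetric] by (simp add: algebra_simps)
    have "t + exp y > 0" using t by (simp add: add_pos_pos)
    then have "1 - exp y * (t / (t + exp y)) / t = ((t + exp y) - exp y) / (t + exp y)"
      using t unfolding diff_divide_distrib by simp
    then have "t / (t + exp y) = 1 - exp y * (t / (t + exp y)) / t" by simp
    then have "complex_of_real (t / (t + exp y)) = 1 - of_real (exp y) * of_real (t / (t + exp y)) / of_real t"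
      by (metis of_real_1 of_real_diff of_real_divide of_real_mult)
    moreover have "A * K * F = A * K - A * E * K * F / T" if "F = 1 - E * F / T" for A K F E T :: complex
    proof -
      have "A * K * F = A * K * (1 - E * F / T)" by (rule arg_cong[OF that])
      then show ?thesis by (simp add: right_diff_distrib mult_ac)
    qed
    ultimately show ?thesis unfolding e by blast
  qed
  have "stieltjesG M \<nu> t = c * ((\<integral>y. exp (of_real ((real M + 1/2) * y - exp y)) * besselK \<nu> (of_real (exp y)) \<partial>lborel)
     - (\<integral>y. exp (of_real ((real (Suc M) + 1/2) * y - exp y)) * besselK \<nu> (of_real (exp y)) * of_real (t / (t + exp y)) \<partial>lborel) / of_real t)"
    unfolding stieltjesG_def c_def[symmetric] pw
    unfolding Bochner_Integration.integral_diff[OF besselK_exp_moment(1)[OF nuM(1)] integrable_divide[OF stieltjes_integrable[OF nuM(2) t]]] integral_divide_zero ..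
  also have "\<dots> = c * (\<integral>y. exp (of_real ((real M + 1/2) * y - exp y)) * besselK \<nu> (of_real (exp y)) \<partial>lborel) - stieltjesG (Suc M) \<nu> t / of_real t"
    unfolding stieltjesG_def c_def[symmetric] by (simp add: right_diff_distrib)
  finally show ?thesis using stieltjes_moment[OF nu, of M] by (simp add: c_def)
qed

text \<open>For |Re \<nu>| < 1/2 it is an induction on M starting from the Stieltjes representation,
  which is the case M = 0. The last integral converges in the wider strip, and there both sides are
  holomorphic.\<close>

theorem besselK_expansion:
  fixes t :: real
  assumes nu: "\<bar>Re \<nu>\<bar> < real M + 1/2" and t: "t > 0"
  shows "of_real (sqrt (2 * t / pi) * exp t) * besselK \<nu> (of_real t) = (\<Sum>m<M. hankel_a m \<nu> / of_real t ^ m) + (-1) ^ M * stieltjesG M \<nu> t / of_real t ^ M"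
proof -
  have t0: "complex_of_real t \<noteq> 0" using t by simp
  have 1: "of_real (sqrt (2 * t / pi) * exp t) * besselK \<nu> (of_real t) = (\<Sum>m<M. hankel_a m \<nu> / of_real t ^ m) + (-1) ^ M * stieltjesG M \<nu> t / of_real t ^ M"
    if nu: "\<bar>Re \<nu>\<bar> < 1/2" for \<nu>
  proof (induction M)
    case 0
    show ?case using stieltjesG_0[OF nu t] by simp
  next
    case (Suc M)
    have "(-1) ^ M * stieltjesG M \<nu> t / of_real t ^ M = hankel_a M \<nu> / of_real t ^ M + (-1) ^ Suc M * stieltjesG (Suc M) \<nu> t / of_real t ^ Suc M"
      unfolding stieltjesG_Suc[OF nu t, of M] hankel_a_def using t0 by (simp add: field_simps)
    then show ?case using Suc by simp
  qed
  show ?thesis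
  proof (rule analytic_continuation_open[where s = "{\<nu>. \<bar>Re \<nu>\<bar> < 1/2}" and s' = "{\<nu>. \<bar>Re \<nu>\<bar> < real M + 1/2}" and z = \<nu>
       and f = "\<lambda>\<nu>. of_real (sqrt (2 * t / pi) * exp t) * besselK \<nu> (of_real t)"
       and g = "\<lambda>\<nu>. (\<Sum>m<M. hankel_a m \<nu> / of_real t ^ m) + (-1) ^ M * stieltjesG M \<nu> t / of_real t ^ M"])
    show "open {\<nu>::complex. \<bar>Re \<nu>\<bar> < 1/2}" "open {\<nu>::complex. \<bar>Re \<nu>\<bar> < real M + 1/2}" by (rule open_strip)+
    show "connected {\<nu>::complex. \<bar>Re \<nu>\<bar> < real M + 1/2}" by (rule convex_connected[OF convex_strip])
    show "{\<nu>::complex. \<bar>Re \<nu>\<bar> < 1/2} \<noteq> {}" by (auto intro!: exI[of _ 0])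
    show "{\<nu>::complex. \<bar>Re \<nu>\<bar> < 1/2} \<subseteq> {\<nu>. \<bar>Re \<nu>\<bar> < real M + 1/2}" by auto
    show "(\<lambda>\<nu>. of_real (sqrt (2 * t / pi) * exp t) * besselK \<nu> (of_real t)) holomorphic_on {\<nu>. \<bar>Re \<nu>\<bar> < real M + 1/2}"
      using t by (intro holomorphic_intros holomorphic_on_subset[OF besselK_order_holomorphic]) auto
    show "(\<lambda>\<nu>. (\<Sum>m<M. hankel_a m \<nu> / of_real t ^ m) + (-1) ^ M * stieltjesG M \<nu> t / of_real t ^ M) holomorphic_on {\<nu>. \<bar>Re \<nu>\<bar> < real M + 1/2}"
      unfolding hankel_a_def pochhammer_prod using t0 by (intro holomorphic_intros stieltjesG_holomorphic t) auto
    show "\<nu> \<in> {\<nu>. \<bar>Re \<nu>\<bar> < real M + 1/2}" using nu by simp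
  qed (use 1 in simp)
qed

section \<open>Terminants up to the boundary rays\<close>

text \<open>The integral in \<open>terminant\<close> after t = e^x, without its prefactor. It is
  holomorphic off the negative real axis, so the only obstacle to boundary values is the
  cut.\<close>

definition terminant_integral :: "complex \<Rightarrow> complex \<Rightarrow> complex" where
  "terminant_integral p w = (\<integral>x. exp (p * of_real x - of_real (exp x)) / (w + of_real (exp x)) \<partial>lborel)"

lemma slit_bound:
  fixes w :: complex
  assumes "w \<notin> \<real>\<^sub>\<le>\<^sub>0"
  obtains \<delta> where "\<delta> > 0" "ball w \<delta> \<subseteq> - \<real>\<^sub>\<le>\<^sub>0" "\<And>v x. v \<in> ball w \<delta> \<Longrightarrow> norm (v + of_real (exp x)) \<ge> \<delta>"
proof -
  have "open (- \<real>\<^sub>\<le>\<^sub>0 :: complex set)" using closed_nonpos_Reals_complex by blast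
  moreover have "w \<in> - \<real>\<^sub>\<le>\<^sub>0" using assms by simp
  ultimately obtain d where d: "0 < d" "ball w d \<subseteq> - \<real>\<^sub>\<le>\<^sub>0" by (meson openE)
  have "norm (v + of_real (exp x)) \<ge> d / 2" if "v \<in> ball w (d / 2)" for v x
  proof -
    have "- complex_of_real (exp x) \<in> \<real>\<^sub>\<le>\<^sub>0" by (simp add: complex_nonpos_Reals_iff del: of_real_exp)
    then have "- complex_of_real (exp x) \<notin> ball w d" using d(2) by blast
    then have "d \<le> dist w (- complex_of_real (exp x))" by simp
    also have "\<dots> \<le> dist w v + dist v (- complex_of_real (exp x))" by (rule dist_triangle)
    also have "dist v (- complex_of_real (exp x)) = norm (v + of_real (exp x))" by (simp add: dist_norm)
    finally show ?thesis using that by simp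
  qed
  moreover have "ball w (d / 2) \<subseteq> - \<real>\<^sub>\<le>\<^sub>0" using d by (force simp: subset_iff)
  ultimately show ?thesis using that[of "d / 2"] d by simp
qed

lemma slit_nonzero:
  assumes "w \<notin> \<real>\<^sub>\<le>\<^sub>0"
  shows "w + complex_of_real (exp x) \<noteq> 0"
  using slit_bound[OF assms] by (metis centre_in_ball norm_zero not_le)

lemma norm_terminant_integral_integrand:
  assumes "norm (v + complex_of_real (exp x)) \<ge> \<delta>" "\<delta> > 0" "s1 \<le> Re p" "Re p \<le> s2"
  shows "norm (exp (p * of_real x - of_real (exp x)) / (v + of_real (exp x))) \<le> (exp (s1 * x - 1 * exp x) + exp (s2 * x - 1 * exp x)) / \<delta>"
proof -
  have "Re p * x \<le> s2 * x \<or> Re p * x \<le> s1 * x"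
    using assms(3,4) by (cases "x \<ge> 0") (auto intro: mult_right_mono mult_right_mono_neg)
  then have "exp (Re p * x - exp x) \<le> exp (s1 * x - 1 * exp x) \<or> exp (Re p * x - exp x) \<le> exp (s2 * x - 1 * exp x)" by auto
  then have "exp (Re p * x - exp x) \<le> exp (s1 * x - 1 * exp x) + exp (s2 * x - 1 * exp x)"
    using exp_ge_zero[of "s1 * x - 1 * exp x"] exp_ge_zero[of "s2 * x - 1 * exp x"] by linarith
  then have "exp (Re p * x - exp x) / norm (v + of_real (exp x)) \<le> (exp (s1 * x - 1 * exp x) + exp (s2 * x - 1 * exp x)) / \<delta>"
    using assms(1,2) by (intro frac_le) auto
  then show ?thesis by (simp add: norm_divide)
qed

lemma integrable_terminant_integral_bound:
  assumes "s1 > 0" "s2 > 0"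
  shows "integrable lborel (\<lambda>x. (exp (s1 * x - 1 * exp x) + exp (s2 * x - 1 * exp x)) / \<delta> :: real)"
  using assms by (intro integrable_divide Bochner_Integration.integrable_add Gamma_exp_integral_real) auto

lemma locally_dominated_terminant_integral:
  assumes "Re p > 0"
  shows "locally_dominated lborel (- \<real>\<^sub>\<le>\<^sub>0) (\<lambda>w x. exp (p * of_real x - of_real (exp x)) / (w + of_real (exp x)))"
proof (rule locally_dominatedI)
  fix w :: complex assume "w \<in> - \<real>\<^sub>\<le>\<^sub>0"
  then obtain \<delta> where d: "\<delta> > 0" "ball w \<delta> \<subseteq> - \<real>\<^sub>\<le>\<^sub>0" "\<And>v x. v \<in> ball w \<delta> \<Longrightarrow> norm (v + of_real (exp x)) \<ge> \<delta>"
    using slit_bound[of w] by auto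
  show "\<exists>e>0. \<exists>g. ball w e \<subseteq> - \<real>\<^sub>\<le>\<^sub>0 \<and> integrable lborel g \<and> (\<forall>v\<in>ball w e. \<forall>x\<in>space lborel. norm (exp (p * of_real x - of_real (exp x)) / (v + of_real (exp x))) \<le> g x)"
    using d norm_terminant_integral_integrand[OF d(3) d(1), of _ "Re p" p "Re p"] integrable_terminant_integral_bound[OF assms assms, of \<delta>]
    by (intro exI[of _ \<delta>] exI[of _ "\<lambda>x. (exp (Re p * x - 1 * exp x) + exp (Re p * x - 1 * exp x)) / \<delta>"] conjI ballI) blast+
qed

lemma open_slit: "open (- \<real>\<^sub>\<le>\<^sub>0 :: complex set)"
  using closed_nonpos_Reals_complex by blast

lemma terminant_integral_integrand_holomorphic:
  "(\<lambda>w. exp (p * of_real x - of_real (exp x)) / (w + complex_of_real (exp x))) holomorphic_on (- \<real>\<^sub>\<le>\<^sub>0)"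
  using slit_nonzero by (intro holomorphic_intros) (auto simp del: of_real_exp)

lemma integrable_terminant_integral:
  assumes "Re p > 0" "w \<notin> \<real>\<^sub>\<le>\<^sub>0"
  shows "integrable lborel (\<lambda>x. exp (p * of_real x - of_real (exp x)) / (w + complex_of_real (exp x)))"
  by (rule integrable_locally_dominated[OF locally_dominated_terminant_integral[OF assms(1)]]) (use assms in auto)

lemma terminant_integral_holomorphic:
  assumes "Re p > 0"
  shows "terminant_integral p holomorphic_on (- \<real>\<^sub>\<le>\<^sub>0)"
  unfolding terminant_integral_def[abs_def]
  by (rule holomorphic_on_integral[OF open_slit _ terminant_integral_integrand_holomorphic locally_dominated_terminant_integral[OF assms]]) simp

lemma terminant_integral_holomorphic_p:
  assumes w: "w \<notin> \<real>\<^sub>\<le>\<^sub>0"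
  shows "(\<lambda>p. terminant_integral p w) holomorphic_on {p. Re p > 0}"
  unfolding terminant_integral_def
proof (rule holomorphic_on_integral[OF open_Re_pos])
  obtain \<delta> where d: "\<delta> > 0" "\<And>v x. v \<in> ball w \<delta> \<Longrightarrow> norm (v + of_real (exp x)) \<ge> \<delta>"
    using slit_bound[OF w] by metis
  show "locally_dominated lborel {p. Re p > 0} (\<lambda>p x. exp (p * of_real x - of_real (exp x)) / (w + of_real (exp x)))"
  proof (rule locally_dominatedI)
    fix p :: complex assume "p \<in> {p. Re p > 0}"
    then have p: "Re p > 0" by simp
    have b: "Re p / 2 \<le> Re v" "Re v \<le> 2 * Re p" if "v \<in> ball p (Re p / 2)" for v
      using that abs_Re_le_cmod[of "p - v"] p by (auto simp: dist_norm abs_le_iff)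
    show "\<exists>e>0. \<exists>g. ball p e \<subseteq> {p. Re p > 0} \<and> integrable lborel g \<and> (\<forall>v\<in>ball p e. \<forall>x\<in>space lborel. norm (exp (v * of_real x - of_real (exp x)) / (w + of_real (exp x))) \<le> g x)"
    proof (intro exI[of _ "Re p / 2"] exI[of _ "\<lambda>x. (exp (Re p / 2 * x - 1 * exp x) + exp (2 * Re p * x - 1 * exp x)) / \<delta>"] conjI ballI)
      show "ball p (Re p / 2) \<subseteq> {p. Re p > 0}" using b(1) p by fastforce
      show "integrable lborel (\<lambda>x. (exp (Re p / 2 * x - 1 * exp x) + exp (2 * Re p * x - 1 * exp x)) / \<delta>)"
        by (rule integrable_terminant_integral_bound) (use p in auto)
      show "norm (exp (v * of_real x - of_real (exp x)) / (w + of_real (exp x))) \<le> (exp (Re p / 2 * x - 1 * exp x) + exp (2 * Re p * x - 1 * exp x)) / \<delta>"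
        if "v \<in> ball p (Re p / 2)" for v x
        by (rule norm_terminant_integral_integrand) (use d b[OF that] in auto)
    qed (use p in auto)
  qed
  show "(\<lambda>p. exp (p * of_real x - of_real (exp x)) / (w + of_real (exp x))) holomorphic_on {p. Re p > 0}" for x
    using slit_nonzero[OF w] by (intro holomorphic_intros) (auto simp del: of_real_exp)
qed simp

text \<open>Integrating the derivative of e^(px - e^x)/(w + e^x) over the line gives zero, and its
  terms are F, F' and \<Gamma>(p). Equivalently, w^(1-p) e^(-w) F(w) has the derivative -\<Gamma>(p)
  w^(-p) e^(-w), from which the integral has disappeared.\<close>

lemma terminant_integral_ode:
  assumes p: "Re p > 0" and w: "w \<notin> \<real>\<^sub>\<le>\<^sub>0"
  shows "w * deriv (terminant_integral p) w + (1 - p - w) * terminant_integral p w = - Gamma p"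
proof -
  define g where "g = (\<lambda>x. exp (p * of_real x - of_real (exp x)))"
  define u where "u = (\<lambda>x. complex_of_real (exp x))"
  have nz: "w + u x \<noteq> 0" for x unfolding u_def by (rule slit_nonzero[OF w])
  have wm: "w \<in> - \<real>\<^sub>\<le>\<^sub>0" using w by simp
  note D = has_field_derivative_integral[OF open_slit wm _ terminant_integral_integrand_holomorphic locally_dominated_terminant_integral[OF p]]
  have dd: "deriv (\<lambda>w. exp (p * of_real x - of_real (exp x)) / (w + complex_of_real (exp x))) w = - g x / (w + u x)\<^sup>2" for x
    using nz[of x] unfolding g_def u_def
    by (intro DERIV_imp_deriv) (auto intro!: derivative_eq_intros simp: power2_eq_square simp del: of_real_exp)
  have D1: "deriv (terminant_integral p) w = (\<integral>x. - g x / (w + u x)\<^sup>2 \<partial>lborel)"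
    using D(1) unfolding dd terminant_integral_def[symmetric] by (intro DERIV_imp_deriv) simp
  have D2: "integrable lborel (\<lambda>x. - g x / (w + u x)\<^sup>2)" using D(2) unfolding dd by simp
  have I1: "integrable lborel (\<lambda>x. g x / (w + u x))" using integrable_terminant_integral[OF p w] by (simp add: g_def u_def)
  have I0: "integrable lborel g" "integral\<^sup>L lborel g = Gamma p"
    using Gamma_exp_integral[OF p, of 1] by (simp_all add: g_def[abs_def])
  define H where "H = (\<lambda>x. g x / (w + u x))"
  define h where "h = (\<lambda>x. (p - u x) * g x / (w + u x) - g x * u x / (w + u x)\<^sup>2)"
  have alg: "h x = - (w * (- g x / (w + u x)\<^sup>2) + (1 - p - w) * (g x / (w + u x)) + g x)" for x
    unfolding h_def using nz[of x] by (simp add: divide_simps) (simp add: algebra_simps power2_eq_square)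
  have ih: "integrable lborel h"
    unfolding alg by (intro integrable_minus Bochner_Integration.integrable_add integrable_mult_right D2 I1 I0)
  have eu: "(u has_vector_derivative u x) (at x)" for x
    unfolding u_def by (auto intro!: derivative_eq_intros has_vector_derivative_of_real DERIV_exp simp: has_real_derivative_iff_has_vector_derivative[symmetric])
  have eg: "(g has_vector_derivative (p - u x) * g x) (at x)" for x
  proof -
    have "((\<lambda>x. p * of_real x - u x) has_vector_derivative p - u x) (at x)"
      using eu[of x] by (auto intro!: derivative_eq_intros)
    from field_vector_diff_chain_at[OF this DERIV_exp] show ?thesis by (simp add: o_def g_def[abs_def] u_def)
  qed
  have der: "(H has_vector_derivative h x) (at x)" for x
  proof -
    have "((\<lambda>x. inverse (w + u x)) has_vector_derivative u x * (- inverse ((w + u x)\<^sup>2))) (at x)"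
    proof -
      have 1: "((\<lambda>x. w + u x) has_vector_derivative u x) (at x)" using eu[of x] by (auto intro!: derivative_eq_intros)
      have 2: "(inverse has_field_derivative - inverse ((w + u x)\<^sup>2)) (at (w + u x))"
        using DERIV_inverse[OF nz[of x], of UNIV] by (simp add: numeral_2_eq_2)
      from field_vector_diff_chain_at[OF 1 2] show ?thesis by (simp add: o_def)
    qed
    from has_vector_derivative_mult[OF eg[of x] this]
    show ?thesis unfolding H_def h_def divide_inverse by (simp add: algebra_simps)
  qed
  obtain \<delta> where d: "\<delta> > 0" "\<And>x. norm (w + of_real (exp x)) \<ge> \<delta>"
    using slit_bound[OF w] by (metis centre_in_ball)
  have bd: "norm (H x) \<le> exp (Re p * x - exp x) / \<delta>" for x
    unfolding H_def g_def u_def norm_divide using d by (intro frac_le) auto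
  define a where "a = Re p"
  have a: "a > 0" using p by (simp add: a_def)
  have T: "(H \<longlongrightarrow> 0) at_top"
  proof (rule Lim_null_comparison[OF always_eventually[OF allI[OF bd]]])
    have "((\<lambda>x. exp (a * x - exp x) / \<delta>) \<longlongrightarrow> 0) at_top" using a d(1) by real_asymp
    then show "((\<lambda>x. exp (Re p * x - exp x) / \<delta>) \<longlongrightarrow> 0) at_top" by (simp add: a_def)
  qed
  have B: "(H \<longlongrightarrow> 0) at_bot"
  proof (rule Lim_null_comparison[OF always_eventually[OF allI[OF bd]]])
    have "((\<lambda>x. exp (a * x - exp x) / \<delta>) \<longlongrightarrow> 0) at_bot" using a d(1) by real_asymp
    then show "((\<lambda>x. exp (Re p * x - exp x) / \<delta>) \<longlongrightarrow> 0) at_bot" by (simp add: a_def)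
  qed
  have cont: "isCont h x" for x
  proof -
    have "continuous_on UNIV h" unfolding h_def g_def u_def
      by (intro continuous_intros) (use nz in \<open>auto simp: u_def\<close>)
    then show ?thesis by (simp add: continuous_on_eq_continuous_at)
  qed
  have "(LBINT y=-\<infinity>..\<infinity>. h y) = 0 - 0"
    by (rule interval_integral_FTC_integrable[where F=H])
       (use der cont ih T B in \<open>auto simp: ereal_tendsto_simps set_integrable_def\<close>)
  then have "integral\<^sup>L lborel h = 0"
    by (simp add: interval_lebesgue_integral_def set_lebesgue_integral_def)
  moreover have "integral\<^sup>L lborel h = - (w * (\<integral>x. - g x / (w + u x)\<^sup>2 \<partial>lborel) + (1 - p - w) * (\<integral>x. g x / (w + u x) \<partial>lborel) + integral\<^sup>L lborel g)"
    unfolding alg Bochner_Integration.integral_minus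
    by (subst Bochner_Integration.integral_add, intro Bochner_Integration.integrable_add integrable_mult_right D2 I1, rule I0,
        subst Bochner_Integration.integral_add, intro integrable_mult_right D2, intro integrable_mult_right I1)
       (simp only: integral_mult_right_zero)
  ultimately have "- (w * (\<integral>x. - g x / (w + u x)\<^sup>2 \<partial>lborel) + (1 - p - w) * (\<integral>x. g x / (w + u x) \<partial>lborel) + integral\<^sup>L lborel g) = 0"
    by (simp only:)
  then have "w * (\<integral>x. - g x / (w + u x)\<^sup>2 \<partial>lborel) + (1 - p - w) * (\<integral>x. g x / (w + u x) \<partial>lborel) + integral\<^sup>L lborel g = 0"
    by (simp only: neg_equal_0_iff_equal)
  moreover have "terminant_integral p w = (\<integral>x. g x / (w + u x) \<partial>lborel)" by (simp only: terminant_integral_def g_def u_def)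
  ultimately have "w * deriv (terminant_integral p) w + (1 - p - w) * terminant_integral p w + Gamma p = 0"
    by (simp only: D1 I0(2))
  then show ?thesis by (simp only: add_eq_0_iff2)
qed

text \<open>The function \<Gamma>(p) \<Gamma>(1 - p, w) on the circle |w| = r. The logarithm is
  written as ln r + i\<phi>, so the branch follows \<open>\<phi>\<close> continuously instead of
  jumping at the cut.\<close>

definition terminant_ray :: "complex \<Rightarrow> real \<Rightarrow> real \<Rightarrow> complex" where
  "terminant_ray p r \<phi> = exp ((1 - p) * (of_real (ln r) + \<i> * of_real \<phi>) - of_real r * cis \<phi>) * terminant_integral p (of_real r * cis \<phi>)"

lemma polar_slit:
  assumes "r > 0" "\<bar>\<phi>\<bar> < pi"
  shows "of_real r * cis \<phi> \<notin> \<real>\<^sub>\<le>\<^sub>0" "Ln (of_real r * cis \<phi>) = of_real (ln r) + \<i> * of_real \<phi>"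
proof -
  have e: "of_real r * cis \<phi> = exp (of_real (ln r) + \<i> * of_real \<phi>)"
    using assms by (simp add: exp_add cis_conv_exp exp_of_real)
  show L: "Ln (of_real r * cis \<phi>) = of_real (ln r) + \<i> * of_real \<phi>"
    unfolding e by (rule Ln_exp) (use assms in auto)
  show "of_real r * cis \<phi> \<notin> \<real>\<^sub>\<le>\<^sub>0"
  proof
    assume "of_real r * cis \<phi> \<in> \<real>\<^sub>\<le>\<^sub>0"
    then have "Re (of_real r * cis \<phi>) \<le> 0" "Im (of_real r * cis \<phi>) = 0" by (auto simp: complex_nonpos_Reals_iff)
    then have "cos \<phi> \<le> 0" "sin \<phi> = 0" using assms by (auto simp: mult_le_0_iff)
    then show False using assms sin_zero_pi_iff[of \<phi>] by auto
  qed
qed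

lemma terminant_eq:
  assumes p: "Re p > 0" and r: "r > 0" "\<bar>\<phi>\<bar> < pi"
  shows "terminant p (of_real r * cis \<phi>) = exp (pi * \<i> * p) / (2 * pi * \<i>) * terminant_ray p r \<phi>"
proof -
  define w where "w = of_real r * cis \<phi>"
  have w: "w \<notin> \<real>\<^sub>\<le>\<^sub>0" "Ln w = of_real (ln r) + \<i> * of_real \<phi>" using polar_slit[OF r] by (simp_all add: w_def)
  have w0: "w \<noteq> 0" using w(1) by auto
  define f where "f = (\<lambda>t::real. if t > 0 then exp ((p - 1) * of_real (ln t)) * exp (- of_real t) / (w + of_real t) else 0)"
  have fm: "f \<in> borel_measurable borel" unfolding f_def by measurable
  have fe: "of_real \<bar>exp x\<bar> * f (exp x) = exp (p * of_real x - of_real (exp x)) / (w + of_real (exp x))" for x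
  proof -
    have gen: "exp X * (exp ((p - 1) * X) * exp (- E) / D) = exp (p * X - E) / D" for X E D :: complex
    proof -
      have "exp X * (exp ((p - 1) * X) * exp (- E)) = exp (p * X - E)"
        unfolding exp_add[symmetric] by (rule arg_cong[where f = exp]) (simp add: algebra_simps)
      then show ?thesis by simp
    qed
    have "of_real \<bar>exp x\<bar> = exp (complex_of_real x)" by (simp add: exp_of_real)
    moreover have "f (exp x) = exp ((p - 1) * of_real x) * exp (- of_real (exp x)) / (w + of_real (exp x))"
      by (simp add: f_def)
    ultimately show ?thesis by (simp only: gen)
  qed
  have "(LBINT t:{0<..}. of_real t powr (p - 1) * exp (- of_real t) / (w + of_real t)) = (LBINT t:{0<..}. f t)"
    by (rule set_lebesgue_integral_cong) (auto simp: f_def powr_def Ln_of_real)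
  also have "\<dots> = (LBINT x:UNIV. of_real \<bar>exp x\<bar> * f (exp x))"
    using lborel_substitution(2)[of UNIV exp exp f, simplified range_exp_real] inj_exp_real fm by (auto intro: DERIV_exp)
  also have "\<dots> = terminant_integral p w" unfolding fe terminant_integral_def by (simp add: set_lebesgue_integral_def)
  finally have I: "(LBINT t:{0<..}. of_real t powr (p - 1) * exp (- of_real t) / (w + of_real t)) = terminant_integral p w" .
  show ?thesis
  proof -
    have E: "w powr (1 - p) * exp (- w) = exp ((1 - p) * (of_real (ln r) + \<i> * of_real \<phi>) - w)"
      using w0 w(2) by (simp add: powr_def exp_add[symmetric])
    have gen: "a * b * c / d * e = a / d * ((b * c) * e)" for a b c d e :: complex by simp
    show ?thesis unfolding terminant_def w_def[symmetric] I terminant_ray_def gen E ..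
  qed
qed

text \<open>By \<open>terminant_integral_ode\<close> the integral cancels from the derivative. What
  is left is elementary and bounded up to \<phi> = \<plusminus>\<pi>, which is how boundary values
  on the cut are obtained without deforming contours.\<close>

lemma terminant_ray_deriv:
  assumes p: "Re p > 0" and r: "r > 0" "\<bar>\<phi>\<bar> < pi"
  shows "((\<lambda>\<phi>. terminant_ray p r \<phi>) has_vector_derivative (- \<i> * Gamma p * exp ((1 - p) * (of_real (ln r) + \<i> * of_real \<phi>) - of_real r * cis \<phi>))) (at \<phi>)"
proof -
  define w where "w = (\<lambda>\<phi>. of_real r * cis \<phi>)"
  define E where "E = (\<lambda>\<phi>. exp ((1 - p) * (of_real (ln r) + \<i> * of_real \<phi>) - w \<phi>))"
  have wd: "(w has_vector_derivative \<i> * w \<phi>) (at \<phi>)"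
  proof -
    have "((\<lambda>b. \<i> * complex_of_real b) has_vector_derivative \<i> * 1) (at \<phi>)"
      by (intro has_vector_derivative_mult_right)
         (auto intro!: derivative_eq_intros simp: has_vector_derivative_def bounded_linear_of_real scaleR_conv_of_real)
    from field_vector_diff_chain_at[OF this DERIV_exp]
    have "(cis has_vector_derivative \<i> * cis \<phi>) (at \<phi>)"
      unfolding cis_conv_exp[abs_def] by (simp add: o_def)
    then have "((\<lambda>\<phi>. of_real r * cis \<phi>) has_vector_derivative of_real r * (\<i> * cis \<phi>)) (at \<phi>)"
      by (rule has_vector_derivative_mult_right)
    then show ?thesis unfolding w_def by (simp add: mult_ac)
  qed
  have Ed: "(E has_vector_derivative ((1 - p) * \<i> - \<i> * w \<phi>) * E \<phi>) (at \<phi>)"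
  proof -
    have "((\<lambda>\<phi>. (1 - p) * (of_real (ln r) + \<i> * of_real \<phi>) - w \<phi>) has_vector_derivative ((1 - p) * \<i> - \<i> * w \<phi>)) (at \<phi>)"
      by (rule has_vector_derivative_diff[OF _ wd]) (auto intro!: derivative_eq_intros)
    from field_vector_diff_chain_at[OF this DERIV_exp] show ?thesis by (simp add: o_def E_def[abs_def])
  qed
  have w: "w \<phi> \<notin> \<real>\<^sub>\<le>\<^sub>0" unfolding w_def by (rule polar_slit(1)[OF r])
  have "(terminant_integral p has_field_derivative deriv (terminant_integral p) (w \<phi>)) (at (w \<phi>))"
    by (rule holomorphic_derivI[OF terminant_integral_holomorphic[OF p] open_slit]) (use w in simp)
  from field_vector_diff_chain_at[OF wd this]
  have Fd: "((\<lambda>\<phi>. terminant_integral p (w \<phi>)) has_vector_derivative \<i> * w \<phi> * deriv (terminant_integral p) (w \<phi>)) (at \<phi>)" by (simp add: o_def)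
  have "E \<phi> * (\<i> * w \<phi> * deriv (terminant_integral p) (w \<phi>)) + ((1 - p) * \<i> - \<i> * w \<phi>) * E \<phi> * terminant_integral p (w \<phi>) = \<i> * E \<phi> * (w \<phi> * deriv (terminant_integral p) (w \<phi>) + (1 - p - w \<phi>) * terminant_integral p (w \<phi>))"
    by (simp add: algebra_simps)
  also have "\<dots> = - \<i> * Gamma p * E \<phi>" unfolding terminant_integral_ode[OF p w] by simp
  finally show ?thesis
    using has_vector_derivative_mult[OF Ed Fd] unfolding terminant_ray_def E_def w_def by simp
qed

text \<open>The derivative in \<open>\<phi>\<close> is continuous on the compact set of all p near
  \<open>p0\<close> and all angles in [-\<pi>, \<pi>]. Uniformity in p is what later makes the
  boundary values continuous in p.\<close>

lemma terminant_ray_lipschitz: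
  assumes p0: "Re p0 > 0" and r: "r > 0"
  obtains C d where "C \<ge> 0" "d > 0" "\<And>p. p \<in> ball p0 d \<Longrightarrow> Re p > 0"
    "\<And>p \<phi> \<psi>. p \<in> ball p0 d \<Longrightarrow> \<bar>\<phi>\<bar> < pi \<Longrightarrow> \<bar>\<psi>\<bar> < pi \<Longrightarrow> norm (terminant_ray p r \<phi> - terminant_ray p r \<psi>) \<le> C * \<bar>\<phi> - \<psi>\<bar>"
proof -
  define d where "d = Re p0 / 2"
  have d: "d > 0" using p0 by (simp add: d_def)
  have Rp: "Re p > 0" if "p \<in> cball p0 d" for p
    using that abs_Re_le_cmod[of "p0 - p"] p0 by (simp add: d_def dist_norm)
  define h where "h = (\<lambda>x :: complex \<times> real. norm (- \<i> * Gamma (fst x) * exp ((1 - fst x) * (of_real (ln r) + \<i> * of_real (snd x)) - of_real r * cis (snd x))))"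
  have Gc: "continuous_on (cball p0 d) Gamma"
  proof (rule holomorphic_on_imp_continuous_on[OF holomorphic_Gamma])
    show "cball p0 d \<inter> \<int>\<^sub>\<le>\<^sub>0 = {}" using Rp by (force elim!: nonpos_Ints_cases)
  qed
  have "compact (h ` (cball p0 d \<times> {-pi..pi}))"
    unfolding h_def
    by (intro compact_continuous_image continuous_intros continuous_on_compose2[OF Gc] compact_Times compact_cball compact_Icc) auto
  then obtain C where C: "\<And>x. x \<in> cball p0 d \<times> {-pi..pi} \<Longrightarrow> h x \<le> C"
    using compact_imp_bounded bounded_imp_bdd_above by (metis bdd_above.E image_eqI)
  have "h (p0, 0) \<le> C" by (rule C) (use d in auto)
  then have "C \<ge> 0" using norm_ge_zero order_trans unfolding h_def by blast
  moreover have "norm (terminant_ray p r \<phi> - terminant_ray p r \<psi>) \<le> C * \<bar>\<phi> - \<psi>\<bar>" if p: "p \<in> ball p0 d" and f: "\<bar>\<phi>\<bar> < pi" "\<bar>\<psi>\<bar> < pi" for p \<phi> \<psi>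
  proof -
    define D where "D = (\<lambda>x. - \<i> * Gamma p * exp ((1 - p) * (of_real (ln r) + \<i> * of_real x) - of_real r * cis x))"
    have "norm (terminant_ray p r \<phi> - terminant_ray p r \<psi>) \<le> C * norm (\<phi> - \<psi>)"
    proof (rule differentiable_bound[where S = "{-pi<..<pi}" and f' = "\<lambda>x h. h *\<^sub>R D x"])
      fix x :: real assume x: "x \<in> {-pi<..<pi}"
      then have "((\<lambda>\<phi>. terminant_ray p r \<phi>) has_vector_derivative D x) (at x)"
        unfolding D_def using Rp[of p] p r by (intro terminant_ray_deriv) auto
      then show "((\<lambda>\<phi>. terminant_ray p r \<phi>) has_derivative (\<lambda>h. h *\<^sub>R D x)) (at x within {-pi<..<pi})"
        unfolding has_vector_derivative_def by (rule has_derivative_at_withinI)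
      have "norm (D x) \<le> C" unfolding D_def using C[of "(p, x)"] p x by (simp add: h_def)
      then show "onorm (\<lambda>h. h *\<^sub>R D x) \<le> C"
      proof (intro onorm_le)
        fix h :: real
        show "norm (h *\<^sub>R D x) \<le> C * norm h"
          using mult_right_mono[OF \<open>norm (D x) \<le> C\<close>, of "\<bar>h\<bar>"] by (simp add: mult.commute)
      qed
    qed (use f in auto)
    then show ?thesis by simp
  qed
  ultimately show ?thesis using that[of C d] d Rp by simp
qed

lemma terminant_ray_limit:
  assumes p: "Re p > 0" and r: "r > 0" and s: "\<bar>s\<bar> \<le> pi"
  shows "\<exists>L. ((\<lambda>\<phi>. terminant_ray p r \<phi>) \<longlongrightarrow> L) (at s within {-pi<..<pi})"
proof -
  obtain C d where C0: "C \<ge> 0" "d > 0"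
    "\<And>q \<phi> \<psi>. q \<in> ball p d \<Longrightarrow> \<bar>\<phi>\<bar> < pi \<Longrightarrow> \<bar>\<psi>\<bar> < pi \<Longrightarrow> norm (terminant_ray q r \<phi> - terminant_ray q r \<psi>) \<le> C * \<bar>\<phi> - \<psi>\<bar>"
    by (rule terminant_ray_lipschitz[OF p r]) blast
  have C: "norm (terminant_ray p r \<phi> - terminant_ray p r \<psi>) \<le> C * \<bar>\<phi> - \<psi>\<bar>" if "\<bar>\<phi>\<bar> < pi" "\<bar>\<psi>\<bar> < pi" for \<phi> \<psi>
    by (rule C0(3)) (use C0 that in auto)
  have "uniformly_continuous_on {-pi<..<pi} (\<lambda>\<phi>. terminant_ray p r \<phi>)"
  proof (rule lipschitz_on_uniformly_continuous[of C])
    show "C-lipschitz_on {-pi<..<pi} (\<lambda>\<phi>. terminant_ray p r \<phi>)"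
      unfolding lipschitz_on_def using C C0(1) by (auto simp: dist_norm)
  qed
  moreover have "- pi \<le> s" "s \<le> pi" using s by linarith+
  then have "s \<in> closure {-pi<..<pi}" by (simp add: closure_greaterThanLessThan)
  ultimately show ?thesis using uniformly_continuous_on_extension_at_closure by metis
qed

lemma polar_trivial_limit: "\<bar>s\<bar> \<le> pi \<Longrightarrow> at s within {-pi<..<pi} \<noteq> bot"
proof -
  assume "\<bar>s\<bar> \<le> pi"
  then have "- pi \<le> s" "s \<le> pi" by linarith+
  then consider "s = - pi" | "s = pi" | "s \<in> {-pi<..<pi}" by atomize_elim (auto simp: less_le)
  then have "s islimpt {-pi<..<pi}"
  proof cases
    case 1
    then show ?thesis using islimpt_greaterThanLessThan1[of "-pi" pi] by simp
  next
    case 2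
    then show ?thesis using islimpt_greaterThanLessThan2[of "-pi" pi] by simp
  next
    case 3
    then show ?thesis by (intro interior_limit_point) (simp add: interior_open)
  qed
  then show "at s within {-pi<..<pi} \<noteq> bot" by (simp add: trivial_limit_within)
qed

lemma terminant_polar_tendsto:
  assumes p: "Re p > 0" and r: "r > 0" and s: "\<bar>s\<bar> \<le> pi"
  shows "((\<lambda>\<phi>. exp (pi * \<i> * p) / (2 * pi * \<i>) * terminant_ray p r \<phi>) \<longlongrightarrow> terminant_polar p r s) (at s within {-pi<..<pi})"
proof (cases "\<bar>s\<bar> < pi")
  case True
  have "continuous (at s) (\<lambda>\<phi>. terminant_ray p r \<phi>)"
    by (rule has_vector_derivative_continuous[OF terminant_ray_deriv[OF p r True]])
  then have "((\<lambda>\<phi>. terminant_ray p r \<phi>) \<longlongrightarrow> terminant_ray p r s) (at s within {-pi<..<pi})"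
    by (metis continuous_at_imp_continuous_within continuous_within)
  moreover have "terminant_polar p r s = exp (pi * \<i> * p) / (2 * pi * \<i>) * terminant_ray p r s"
    using True by (simp only: terminant_polar_def terminant_eq[OF p r True] if_True)
  ultimately show ?thesis by (simp only: tendsto_mult_left)
next
  case False
  obtain L where "((\<lambda>\<phi>. terminant_ray p r \<phi>) \<longlongrightarrow> L) (at s within {-pi<..<pi})" using terminant_ray_limit[OF assms] by blast
  then have L: "((\<lambda>\<phi>. exp (pi * \<i> * p) / (2 * pi * \<i>) * terminant_ray p r \<phi>) \<longlongrightarrow> exp (pi * \<i> * p) / (2 * pi * \<i>) * L) (at s within {-pi<..<pi})"
    by (rule tendsto_mult_left)
  have "eventually (\<lambda>\<phi>. exp (pi * \<i> * p) / (2 * pi * \<i>) * terminant_ray p r \<phi> = terminant p (of_real r * cis \<phi>)) (at s within {-pi<..<pi})"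
    unfolding eventually_at_filter using terminant_eq[OF p r] by (intro always_eventually) auto
  then have "((\<lambda>\<phi>. terminant p (of_real r * cis \<phi>)) \<longlongrightarrow> exp (pi * \<i> * p) / (2 * pi * \<i>) * L) (at s within {-pi<..<pi})"
    by (rule Lim_transform_eventually[OF L])
  then have "terminant_polar p r s = exp (pi * \<i> * p) / (2 * pi * \<i>) * L"
    unfolding terminant_polar_def using False tendsto_Lim[OF polar_trivial_limit[OF s]] by simp
  then show ?thesis using L by simp
qed

lemma terminant_polar_eq:
  assumes "Re p > 0" "r > 0" "\<bar>s\<bar> < pi"
  shows "terminant_polar p r s = exp (pi * \<i> * p) / (2 * pi * \<i>) * terminant_ray p r s"
  using terminant_eq[OF assms] assms(3) by (simp add: terminant_polar_def)

text \<open>Up to an entire nonvanishing factor, the boundary value is a limit of the values at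
  interior angles, uniform for p near \<open>p0\<close> by the Lipschitz bound. Each of those is
  continuous in p, hence so is the limit.\<close>

lemma terminant_polar_isCont:
  assumes p0: "Re p0 > 0" and r: "r > 0" and s: "\<bar>s\<bar> \<le> pi"
  shows "isCont (\<lambda>p. terminant_polar p r s) p0"
proof -
  obtain C d where C: "C \<ge> 0" "d > 0" "\<And>p. p \<in> ball p0 d \<Longrightarrow> Re p > 0"
    "\<And>p \<phi> \<psi>. p \<in> ball p0 d \<Longrightarrow> \<bar>\<phi>\<bar> < pi \<Longrightarrow> \<bar>\<psi>\<bar> < pi \<Longrightarrow> norm (terminant_ray p r \<phi> - terminant_ray p r \<psi>) \<le> C * \<bar>\<phi> - \<psi>\<bar>"
    using terminant_ray_lipschitz[OF p0 r] by metis
  define K where "K = (\<lambda>p. exp (pi * \<i> * p) / (2 * pi * \<i>))"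
  have K0: "K p \<noteq> 0" for p by (simp add: K_def)
  define L where "L = (\<lambda>p. terminant_polar p r s / K p)"
  have lim: "((\<lambda>\<phi>. terminant_ray p r \<phi>) \<longlongrightarrow> L p) (at s within {-pi<..<pi})" if "p \<in> ball p0 d" for p
    using tendsto_divide[OF terminant_polar_tendsto[OF C(3)[OF that] r s] tendsto_const K0[of p]] K0[of p]
    unfolding L_def K_def by simp
  have bd: "norm (terminant_ray p r \<phi> - L p) \<le> C * \<bar>\<phi> - s\<bar>" if p: "p \<in> ball p0 d" and f: "\<bar>\<phi>\<bar> < pi" for p \<phi>
  proof (rule tendsto_le[OF polar_trivial_limit[OF s]])
    show "((\<lambda>\<psi>. norm (terminant_ray p r \<phi> - terminant_ray p r \<psi>)) \<longlongrightarrow> norm (terminant_ray p r \<phi> - L p)) (at s within {-pi<..<pi})"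
      by (intro tendsto_intros lim p)
    show "((\<lambda>\<psi>. C * \<bar>\<phi> - \<psi>\<bar>) \<longlongrightarrow> C * \<bar>\<phi> - s\<bar>) (at s within {-pi<..<pi})"
      by (intro tendsto_intros)
    show "eventually (\<lambda>\<psi>. norm (terminant_ray p r \<phi> - terminant_ray p r \<psi>) \<le> C * \<bar>\<phi> - \<psi>\<bar>) (at s within {-pi<..<pi})"
      unfolding eventually_at_filter using C(4)[OF p f] by (intro always_eventually) auto
  qed
  have "isCont L p0"
    unfolding continuous_at_eps_delta
  proof (intro allI impI)
    fix \<epsilon> :: real assume e: "\<epsilon> > 0"
    \<comment> \<open>An angle within this distance of \<open>s\<close> costs at most \<epsilon>/4.
      Dividing by C + 1 instead of C covers C = 0.\<close>
    define \<eta> where "\<eta> = \<epsilon> / 4 / (C + 1)"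
    have eta: "\<eta> > 0" using e C(1) by (simp add: \<eta>_def)
    have "s islimpt {-pi<..<pi}" using polar_trivial_limit[OF s] by (simp add: trivial_limit_within)
    then obtain \<phi> where f: "\<phi> \<in> {-pi<..<pi}" "dist \<phi> s < \<eta>" using eta unfolding islimpt_approachable by blast
    then have f': "\<bar>\<phi>\<bar> < pi" by auto
    have "C * \<bar>\<phi> - s\<bar> \<le> (C + 1) * \<eta>" using f C(1) by (intro mult_mono) (auto simp: dist_real_def)
    also have "\<dots> = \<epsilon> / 4"
    proof -
      have "C + 1 \<noteq> 0" using C(1) by linarith
      moreover have "x * (y / x) = y" if "x \<noteq> 0" for x y :: real using that by simp
      ultimately show ?thesis unfolding \<eta>_def by blast
    qed
    finally have small: "C * \<bar>\<phi> - s\<bar> \<le> \<epsilon> / 4" .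
    have "(\<lambda>p. terminant_ray p r \<phi>) holomorphic_on {p. Re p > 0}"
      unfolding terminant_ray_def by (intro holomorphic_intros terminant_integral_holomorphic_p polar_slit(1) r f')
    then have "isCont (\<lambda>p. terminant_ray p r \<phi>) p0"
      using p0 holomorphic_on_imp_continuous_on[of _ "{p. Re p > 0}"] continuous_on_eq_continuous_at[OF open_Re_pos] by blast
    then obtain d' where d': "d' > 0" "\<And>p. dist p p0 < d' \<Longrightarrow> dist (terminant_ray p r \<phi>) (terminant_ray p0 r \<phi>) < \<epsilon> / 4"
      unfolding continuous_at_eps_delta using e by (metis zero_less_divide_iff zero_less_numeral)
    show "\<exists>d>0. \<forall>p. dist p p0 < d \<longrightarrow> dist (L p) (L p0) < \<epsilon>"
    proof (intro exI[of _ "min d d'"] conjI allI impI)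
      fix p assume p: "dist p p0 < min d d'"
      then have pb: "p \<in> ball p0 d" "p0 \<in> ball p0 d" using C(2) by (auto simp: dist_commute)
      have "dist (L p) (L p0) \<le> dist (L p) (terminant_ray p r \<phi>) + dist (terminant_ray p r \<phi>) (terminant_ray p0 r \<phi>) + dist (terminant_ray p0 r \<phi>) (L p0)"
        by (meson add_mono dist_triangle dist_triangle_le order_refl order_trans)
      also have "\<dots> < \<epsilon> / 4 + \<epsilon> / 4 + \<epsilon> / 4 + \<epsilon> / 4"
        using bd[OF pb(1) f'] bd[OF pb(2) f'] small d'(2)[of p] p e by (simp add: dist_norm norm_minus_commute)
      finally show "dist (L p) (L p0) < \<epsilon>" by simp
    qed (use C d' in auto)
  qed
  moreover have "isCont K p0" unfolding K_def by (intro continuous_intros) simp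
  ultimately have "isCont (\<lambda>p. K p * L p) p0" by (intro continuous_intros)
  then show ?thesis using K0 by (simp add: L_def)
qed

section \<open>The re-expanded remainder\<close>

definition remainder_exponent :: "nat \<Rightarrow> nat \<Rightarrow> complex \<Rightarrow> complex" where
  "remainder_exponent N m \<mu> = of_nat (2 * N) - of_nat m - \<mu> + 1/2"

text \<open>The m-th summand of the first sum in the definition of the remainder, without its
  coefficient a_m. The same expression at m = M gives the first term of the bound.\<close>

definition exp_term_plus :: "nat \<Rightarrow> nat \<Rightarrow> complex \<Rightarrow> real \<Rightarrow> real \<Rightarrow> complex" where
  "exp_term_plus N m \<mu> r \<theta> = pi * exp (pi / 2 * \<i> * \<mu>) * (of_real (sqrt (pi / (2 * r))) * cis (- (\<theta> - pi / 2) / 2)) * exp (\<i> * (of_real r * cis \<theta>))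
     / (- \<i> * (of_real r * cis \<theta>)) ^ m * terminant_polar (remainder_exponent N m \<mu>) r (\<theta> + pi / 2)"

definition exp_term_minus :: "nat \<Rightarrow> nat \<Rightarrow> complex \<Rightarrow> real \<Rightarrow> real \<Rightarrow> complex" where
  "exp_term_minus N m \<mu> r \<theta> = pi * exp (- pi / 2 * \<i> * \<mu>) * (of_real (sqrt (pi / (2 * r))) * cis (- (\<theta> + pi / 2) / 2)) * exp (- \<i> * (of_real r * cis \<theta>))
     / (\<i> * (of_real r * cis \<theta>)) ^ m * exp (2 * pi * \<i> * \<mu>) * terminant_polar (remainder_exponent N m \<mu>) r (\<theta> - pi / 2)"

lemma RNM_gen_eq:
  "RNM_gen N M \<mu> \<nu> r \<theta> = lommel_RN N (of_real r * cis \<theta>) \<mu> \<nu> / RNM_prefactor \<mu> \<nu> - (\<Sum>m<M. hankel_a m \<nu> * (exp_term_plus N m \<mu> r \<theta> + exp_term_minus N m \<mu> r \<theta>))"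
  unfolding RNM_gen_def Let_def exp_term_plus_def exp_term_minus_def remainder_exponent_def distrib_left sum.distrib sum_distrib_left
  by (simp add: mult_ac)

lemma polar_exp:
  assumes "r > 0"
  shows "of_real r * cis \<theta> = exp (of_real (ln r) + \<i> * of_real \<theta>)"
  using assms by (simp add: exp_add cis_conv_exp exp_of_real)

lemma i_polar:
  "of_real r * cis (\<theta> + pi / 2) = \<i> * (of_real r * cis \<theta>)"
  "of_real r * cis (\<theta> - pi / 2) = - \<i> * (of_real r * cis \<theta>)"
proof -
  have "cis (\<theta> + pi / 2) = cis \<theta> * \<i>" by (simp add: cis_mult[symmetric])
  then show "of_real r * cis (\<theta> + pi / 2) = \<i> * (of_real r * cis \<theta>)" by simp
  have "cis (\<theta> - pi / 2) = cis \<theta> * cis (- (pi / 2))" unfolding cis_mult by (rule arg_cong[where f = cis]) simp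
  also have "cis (- (pi / 2)) = - \<i>" by (simp add: complex_eq_iff)
  finally show "of_real r * cis (\<theta> - pi / 2) = - \<i> * (of_real r * cis \<theta>)" by simp
qed

lemma sqrt_polar:
  assumes "r > 0"
  shows "of_real (sqrt (pi / (2 * r))) = of_real (sqrt (pi / 2)) * exp (- of_real (ln r) / 2 :: complex)"
proof -
  have "sqrt (pi / (2 * r)) = sqrt (pi / 2) / sqrt r" by (simp add: real_sqrt_divide real_sqrt_mult)
  also have "sqrt r = exp (ln r / 2)" using assms by (simp add: ln_sqrt[symmetric])
  also have "sqrt (pi / 2) / exp (ln r / 2) = sqrt (pi / 2) * exp (- ln r / 2)"
    unfolding minus_divide_left[symmetric] exp_minus by (rule divide_inverse)
  finally have "sqrt (pi / (2 * r)) = sqrt (pi / 2) * exp (- ln r / 2)" .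
  then show ?thesis by (simp add: exp_of_real[symmetric])
qed

lemma terminant_integral_polar:
  assumes q: "Re q > 0" and r: "r > 0" "\<bar>\<phi>\<bar> < pi"
  shows "terminant_integral q (of_real r * cis \<phi>) = 2 * pi * \<i> * exp (- (pi * \<i> * q)) * exp ((q - 1) * (of_real (ln r) + \<i> * of_real \<phi>) + of_real r * cis \<phi>) * terminant_polar q r \<phi>"
proof -
  define E where "E = (1 - q) * (of_real (ln r) + \<i> * of_real \<phi>) - of_real r * cis \<phi>"
  have "(q - 1) * (of_real (ln r) + \<i> * of_real \<phi>) + of_real r * cis \<phi> = - E" by (simp add: E_def algebra_simps)
  moreover have "terminant_polar q r \<phi> = exp (pi * \<i> * q) / (2 * pi * \<i>) * (exp E * terminant_integral q (of_real r * cis \<phi>))"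
    unfolding terminant_polar_eq[OF q r] terminant_ray_def E_def ..
  moreover have "2 * pi * \<i> * inverse a * inverse b * (a / (2 * pi * \<i>) * (b * c)) = c" if "a \<noteq> 0" "b \<noteq> 0" for a b c :: complex
    using that by (simp add: field_simps)
  ultimately show ?thesis by (simp only: exp_minus) simp
qed

lemma kernel_partial_fractions:
  assumes z: "Re z > 0"
  shows "1 / (1 + (of_real t / z)\<^sup>2) = z / (2 * \<i>) * (1 / (- \<i> * z + of_real t) - 1 / (\<i> * z + of_real t))"
proof -
  have z0: "z \<noteq> 0" using z by auto
  have n: "- \<i> * z + of_real t \<noteq> 0" "\<i> * z + of_real t \<noteq> 0" using z by (auto simp: complex_eq_iff)
  have "(- \<i> * z + of_real t) * (\<i> * z + of_real t) = z\<^sup>2 + (of_real t)\<^sup>2" by (simp add: algebra_simps power2_eq_square)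
  moreover have "1 / (- \<i> * z + of_real t) - 1 / (\<i> * z + of_real t) = (2 * \<i> * z) / ((- \<i> * z + of_real t) * (\<i> * z + of_real t))"
    using n by (simp add: diff_frac_eq)
  ultimately have 1: "1 / (- \<i> * z + of_real t) - 1 / (\<i> * z + of_real t) = (2 * \<i> * z) / (z\<^sup>2 + (of_real t)\<^sup>2)" by simp
  have "1 + (of_real t / z)\<^sup>2 = (z\<^sup>2 + (of_real t)\<^sup>2) / z\<^sup>2" using z0 by (simp add: field_simps)
  moreover have "1 / (S / z\<^sup>2) = z / (2 * \<i>) * (2 * \<i> * z / S)" for S
    using z0 by (cases "S = 0") (simp_all add: field_simps power2_eq_square)
  ultimately show ?thesis unfolding 1 by (simp only:)
qed

lemma Re_polar_pos:
  assumes "r > 0" "\<bar>\<theta>\<bar> < pi / 2"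
  shows "Re (of_real r * cis \<theta>) > 0"
  using assms cos_gt_zero_pi[of \<theta>] by auto

text \<open>Partial fractions split the kernel into poles at iz and -iz, each giving a terminant.
  Every power is expressed as the exponential of a multiple of l = ln r + i\<theta>, so matching the
  branches becomes an equality of exponents.\<close>

lemma remainder_term_integral:
  assumes r: "r > 0" and th: "\<bar>\<theta>\<bar> < pi / 2" and q: "Re (remainder_exponent N m \<mu>) > 0"
  defines "z \<equiv> of_real r * cis \<theta>" and "q \<equiv> remainder_exponent N m \<mu>"
  shows "integrable lborel (\<lambda>x. exp (q * of_real x - of_real (exp x)) / (1 + (of_real (exp x) / z)\<^sup>2))"
    and "(-1) ^ N * exp ((\<mu> - 1 - 2 * of_nat N) * (of_real (ln r) + \<i> * of_real \<theta>)) * of_real (sqrt (pi / 2)) *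
      (\<integral>x. exp (q * of_real x - of_real (exp x)) / (1 + (of_real (exp x) / z)\<^sup>2) \<partial>lborel) = exp_term_plus N m \<mu> r \<theta> + exp_term_minus N m \<mu> r \<theta>"
proof -
  have z: "Re z > 0" unfolding z_def by (rule Re_polar_pos[OF r th])
  have ph: "\<bar>\<theta> + pi / 2\<bar> < pi" "\<bar>\<theta> - pi / 2\<bar> < pi" using th by auto
  have q0: "Re q > 0" using q by (simp add: q_def)
  have sl: "\<i> * z \<notin> \<real>\<^sub>\<le>\<^sub>0" "- \<i> * z \<notin> \<real>\<^sub>\<le>\<^sub>0"
    using polar_slit(1)[OF r ph(1)] polar_slit(1)[OF r ph(2)] unfolding i_polar z_def by auto
  have pw: "exp (q * of_real x - of_real (exp x)) / (1 + (of_real (exp x) / z)\<^sup>2) =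
     z / (2 * \<i>) * (exp (q * of_real x - of_real (exp x)) / (- \<i> * z + of_real (exp x)) - exp (q * of_real x - of_real (exp x)) / (\<i> * z + of_real (exp x)))" for x
  proof -
    have "exp (q * of_real x - of_real (exp x)) / (1 + (of_real (exp x) / z)\<^sup>2) = exp (q * of_real x - of_real (exp x)) * (1 / (1 + (of_real (exp x) / z)\<^sup>2))" by simp
    then show ?thesis unfolding kernel_partial_fractions[OF z] by (simp add: right_diff_distrib mult_ac)
  qed
  note i = integrable_terminant_integral[OF q0 sl(2)] integrable_terminant_integral[OF q0 sl(1)]
  show "integrable lborel (\<lambda>x. exp (q * of_real x - of_real (exp x)) / (1 + (of_real (exp x) / z)\<^sup>2))"
    unfolding pw by (intro integrable_mult_right Bochner_Integration.integrable_diff i)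
  have I: "(\<integral>x. exp (q * of_real x - of_real (exp x)) / (1 + (of_real (exp x) / z)\<^sup>2) \<partial>lborel) = z / (2 * \<i>) * (terminant_integral q (- \<i> * z) - terminant_integral q (\<i> * z))"
    unfolding pw integral_mult_right_zero Bochner_Integration.integral_diff[OF i] terminant_integral_def ..
  define l where "l = of_real (ln r) + \<i> * of_real \<theta>"
  have zl: "z = exp l" unfolding z_def l_def by (rule polar_exp[OF r])
  define TA where "TA = terminant_polar q r (\<theta> + pi / 2)"
  define TB where "TB = terminant_polar q r (\<theta> - pi / 2)"
  have FA: "terminant_integral q (\<i> * z) = 2 * pi * \<i> * exp (- (pi * \<i> * q)) * exp ((q - 1) * (l + \<i> * (pi / 2)) + \<i> * z) * TA"
    using terminant_integral_polar[OF q0 r ph(1)] unfolding i_polar z_def[symmetric] TA_def[symmetric] l_def by (simp add: distrib_left add.assoc)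
  have FB: "terminant_integral q (- \<i> * z) = 2 * pi * \<i> * exp (- (pi * \<i> * q)) * exp ((q - 1) * (l - \<i> * (pi / 2)) + - \<i> * z) * TB"
    using terminant_integral_polar[OF q0 r ph(2)] unfolding i_polar z_def[symmetric] TB_def[symmetric] l_def by (simp add: right_diff_distrib add_diff_eq)
  have m1: "(-1) ^ N = exp (of_nat N * (\<i> * pi))" unfolding exp_of_nat_mult by simp
  have iz: "- \<i> * z = exp (l - \<i> * (pi / 2))" "\<i> * z = exp (l + \<i> * (pi / 2))"
  proof -
    have "exp (\<i> * (pi / 2)) = \<i>" unfolding cis_conv_exp[symmetric] by simp
    then show "- \<i> * z = exp (l - \<i> * (pi / 2))" "\<i> * z = exp (l + \<i> * (pi / 2))"
      unfolding zl exp_add exp_diff by simp_all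
  qed
  have c1: "cis (- (\<theta> - pi / 2) / 2) = exp (\<i> * of_real (- (\<theta> - pi / 2) / 2))" "cis (- (\<theta> + pi / 2) / 2) = exp (\<i> * of_real (- (\<theta> + pi / 2) / 2))"
    by (simp_all only: cis_conv_exp)
  have izm: "(- \<i> * z) ^ m = exp (of_nat m * (l - \<i> * (pi / 2)))" "(\<i> * z) ^ m = exp (of_nat m * (l + \<i> * (pi / 2)))"
    unfolding iz exp_of_nat_mult by (rule refl)+
  define C where "C = complex_of_real (sqrt (pi / 2)) * pi"
  have qd: "q = 2 * of_nat N - of_nat m - \<mu> + 1/2" by (simp add: q_def remainder_exponent_def)
  have A: "exp_term_plus N m \<mu> r \<theta> = C * exp (pi / 2 * \<i> * \<mu> + - of_real (ln r) / 2 + \<i> * of_real (- (\<theta> - pi / 2) / 2) + \<i> * z - of_nat m * (l - \<i> * (pi / 2))) * TA"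
    unfolding exp_term_plus_def z_def[symmetric] q_def[symmetric] TA_def[symmetric] sqrt_polar[OF r] c1 C_def
      izm exp_add exp_diff by simp
  have B: "exp_term_minus N m \<mu> r \<theta> = C * exp (- pi / 2 * \<i> * \<mu> + - of_real (ln r) / 2 + \<i> * of_real (- (\<theta> + pi / 2) / 2) + - \<i> * z - of_nat m * (l + \<i> * (pi / 2)) + 2 * pi * \<i> * \<mu>) * TB"
    unfolding exp_term_minus_def z_def[symmetric] q_def[symmetric] TB_def[symmetric] sqrt_polar[OF r] c1 C_def
      izm exp_add exp_diff by simp
  \<comment> \<open>The extra factor e^(i\<pi>) absorbs the minus sign of this pole in the partial
    fractions. In \<open>eB\<close> the exponents agree only up to integer multiples of 2\<pi>i,
    which are written out on both sides.\<close>
  have eA: "exp (of_nat N * (\<i> * pi)) * exp ((\<mu> - 1 - 2 * of_nat N) * l) * exp l * exp (- (pi * \<i> * q)) * exp ((q - 1) * (l + \<i> * (pi / 2)) + \<i> * z) * exp (\<i> * pi)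
     = exp (pi / 2 * \<i> * \<mu> + - of_real (ln r) / 2 + \<i> * of_real (- (\<theta> - pi / 2) / 2) + \<i> * z - of_nat m * (l - \<i> * (pi / 2)))"
    unfolding exp_add[symmetric] by (rule arg_cong[where f = exp]) (simp add: qd l_def field_simps)
  have eB: "exp (of_nat N * (\<i> * pi)) * exp ((\<mu> - 1 - 2 * of_nat N) * l) * exp l * exp (- (pi * \<i> * q)) * exp ((q - 1) * (l - \<i> * (pi / 2)) + - \<i> * z) * exp (of_nat N * (2 * pi * \<i>))
     = exp (- pi / 2 * \<i> * \<mu> + - of_real (ln r) / 2 + \<i> * of_real (- (\<theta> + pi / 2) / 2) + - \<i> * z - of_nat m * (l + \<i> * (pi / 2)) + 2 * pi * \<i> * \<mu>) * exp (of_nat m * (2 * pi * \<i>))"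
    unfolding exp_add[symmetric] by (rule arg_cong[where f = exp]) (simp add: qd l_def field_simps)
  have one: "exp (\<i> * pi) = - 1" "exp (of_nat k * (2 * pi * \<i>)) = 1" for k
    unfolding exp_of_nat_mult by (simp_all add: exp_two_pi_i')
  have gen: "a * b * s * (x / (2 * \<i>) * ((2 * pi * \<i> * e * fB * TB) - (2 * pi * \<i> * e * fA * TA))) = (s * pi) * (a * b * x * e * fA * (- 1)) * TA + (s * pi) * (a * b * x * e * fB * 1) * TB"
    for a b s x e fA fB TA TB :: complex
    by (simp add: field_simps)
  show "(-1) ^ N * exp ((\<mu> - 1 - 2 * of_nat N) * (of_real (ln r) + \<i> * of_real \<theta>)) * of_real (sqrt (pi / 2)) *
      (\<integral>x. exp (q * of_real x - of_real (exp x)) / (1 + (of_real (exp x) / z)\<^sup>2) \<partial>lborel) = exp_term_plus N m \<mu> r \<theta> + exp_term_minus N m \<mu> r \<theta>"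
    unfolding I FA FB unfolding l_def[symmetric] gen m1
    unfolding A B C_def eA[unfolded one(1) zl[symmetric], symmetric] eB[unfolded one(2) mult_1_right zl[symmetric], symmetric]
    by simp
qed

text \<open>With \<tau> = t/r the square has modulus \<tau>^2, whatever the angle; the reverse
  triangle inequality gives |\<tau>^2 - 1|, which is (\<tau> + 1)|\<tau> - 1|. So the lower bound is
  uniform in \<open>\<theta>\<close> and vanishes only at t = r.\<close>

lemma kernel_tau_bound:
  assumes r: "r > 0" and t: "t > 0"
  shows "\<bar>t / r - 1\<bar> \<le> norm (1 + (complex_of_real t / (of_real r * cis \<theta>))\<^sup>2)"
proof -
  define \<tau> where "\<tau> = t / r"
  have tau: "\<tau> > 0" using assms by (simp add: \<tau>_def)
  define w where "w = (complex_of_real t / (of_real r * cis \<theta>))\<^sup>2"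
  have nw: "norm w = \<tau>\<^sup>2" using assms by (simp add: w_def \<tau>_def norm_power norm_divide norm_mult)
  have "\<bar>\<tau> - 1\<bar> * 1 \<le> \<bar>\<tau> - 1\<bar> * (\<tau> + 1)" using tau by (intro mult_left_mono) auto
  also have "\<dots> = \<bar>(\<tau> - 1) * (\<tau> + 1)\<bar>" using tau by (simp add: abs_mult)
  also have "(\<tau> - 1) * (\<tau> + 1) = \<tau>\<^sup>2 - 1" by (simp add: algebra_simps power2_eq_square)
  also have "\<bar>\<tau>\<^sup>2 - 1\<bar> \<le> norm (1 + w)"
    using norm_triangle_ineq3[of w "- 1"] unfolding nw by (simp add: add.commute)
  finally show ?thesis by (simp add: \<tau>_def w_def)
qed

text \<open>Solving the expansion of K for its remainder exhibits G through K and elementary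
  functions, where measurability is immediate.\<close>

lemma stieltjesG_measurable:
  assumes nu: "\<bar>Re \<nu>\<bar> < real M + 1/2"
  shows "(\<lambda>x. stieltjesG M \<nu> (exp x)) \<in> borel_measurable borel"
proof -
  have e: "stieltjesG M \<nu> (exp x) = (-1) ^ M * of_real (exp x) ^ M * (of_real (sqrt (2 * exp x / pi) * exp (exp x)) * besselK \<nu> (of_real (exp x)) - (\<Sum>m<M. hankel_a m \<nu> / of_real (exp x) ^ m))" for x
  proof -
    have "of_real (sqrt (2 * exp x / pi) * exp (exp x)) * besselK \<nu> (of_real (exp x)) - (\<Sum>m<M. hankel_a m \<nu> / of_real (exp x) ^ m) = (-1) ^ M * stieltjesG M \<nu> (exp x) / of_real (exp x) ^ M"
      unfolding besselK_expansion[OF nu exp_gt_zero] by simp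
    moreover have "((-1) ^ M * (-1) ^ M :: complex) = 1" by (simp add: power_mult_distrib[symmetric])
    ultimately show ?thesis by (simp del: of_real_exp)
  qed
  have c: "(\<lambda>x. besselK \<nu> (of_real (exp x))) \<in> borel_measurable borel"
    using besselK_mom_continuous_exp[of 1 0 \<nu>] by (intro borel_measurable_continuous_onI) simp
  show ?thesis unfolding e using c by measurable
qed

text \<open>If \<open>|\<theta>| = \<pi>/2\<close>, the denominator vanishes at \<open>x = ln r\<close>; the zero of the numerator there compensates it.\<close>

definition kernel_remainder_integrand :: "nat \<Rightarrow> nat \<Rightarrow> complex \<Rightarrow> complex \<Rightarrow> real \<Rightarrow> real \<Rightarrow> real \<Rightarrow> complex" where
  "kernel_remainder_integrand N M \<mu> \<nu> r \<theta> x = exp (remainder_exponent N M \<mu> * of_real x - of_real (exp x)) * (stieltjesG M \<nu> (exp x) - stieltjesG M \<nu> r) / (1 + (of_real (exp x) / (of_real r * cis \<theta>))\<^sup>2)"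

definition kernel_remainder :: "nat \<Rightarrow> nat \<Rightarrow> complex \<Rightarrow> complex \<Rightarrow> real \<Rightarrow> real \<Rightarrow> complex" where
  "kernel_remainder N M \<mu> \<nu> r \<theta> = (-1) ^ N * exp ((\<mu> - 1 - 2 * of_nat N) * (of_real (ln r) + \<i> * of_real \<theta>)) * of_real (sqrt (pi / 2)) * ((-1) ^ M * (\<integral>x. kernel_remainder_integrand N M \<mu> \<nu> r \<theta> x \<partial>lborel))"

lemma kernel_remainder_integrand_measurable:
  assumes "\<bar>Re \<nu>\<bar> < real M + 1/2"
  shows "kernel_remainder_integrand N M \<mu> \<nu> r \<theta> \<in> borel_measurable lborel"
  unfolding kernel_remainder_integrand_def[abs_def] using stieltjesG_measurable[OF assms] by measurable

lemma norm_kernel_remainder_integrand_le: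
  assumes nu: "\<bar>Re \<nu>\<bar> < real M + 1/2" and r: "r > 0"
  shows "norm (kernel_remainder_integrand N M \<mu> \<nu> r \<theta> x) \<le> (norm (cos (of_real pi * \<nu>)) * stieltjesB M (Re \<nu>)) * exp (Re (remainder_exponent N M \<mu>) * x - 1 * exp x)"
proof -
  define D where "D = norm (1 + (complex_of_real (exp x) / (of_real r * cis \<theta>))\<^sup>2)"
  define B where "B = norm (cos (of_real pi * \<nu>)) * stieltjesB M (Re \<nu>)"
  have B0: "B \<ge> 0" using order_trans[OF norm_ge_zero norm_stieltjesG_le[OF nu r]] by (simp add: B_def)
  have k: "\<bar>exp x / r - 1\<bar> \<le> D" unfolding D_def by (rule kernel_tau_bound[OF r exp_gt_zero])
  have G: "norm (stieltjesG M \<nu> (exp x) - stieltjesG M \<nu> r) \<le> \<bar>exp x / r - 1\<bar> * B"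
    unfolding B_def by (rule norm_stieltjesG_diff_le[OF nu exp_gt_zero r])
  \<comment> \<open>If \<open>D\<close> is zero the quotient is zero by the convention for division,
    and the bound is nonnegative.\<close>
  have GD: "norm (stieltjesG M \<nu> (exp x) - stieltjesG M \<nu> r) / D \<le> B"
  proof (cases "D = 0")
    case False
    then have "D > 0" by (simp add: D_def)
    have "norm (stieltjesG M \<nu> (exp x) - stieltjesG M \<nu> r) \<le> D * B"
      using G mult_right_mono[OF k B0] by linarith
    then show ?thesis using \<open>D > 0\<close> by (simp add: field_simps)
  qed (simp add: B0)
  have "norm (kernel_remainder_integrand N M \<mu> \<nu> r \<theta> x) = exp (Re (remainder_exponent N M \<mu>) * x - exp x) * (norm (stieltjesG M \<nu> (exp x) - stieltjesG M \<nu> r) / D)"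
    unfolding kernel_remainder_integrand_def D_def norm_divide norm_mult by simp
  also have "\<dots> \<le> exp (Re (remainder_exponent N M \<mu>) * x - exp x) * B" by (rule mult_left_mono[OF GD]) simp
  finally show ?thesis by (simp add: B_def mult_ac)
qed

lemma integrable_kernel_remainder_bound:
  assumes "Re (remainder_exponent N M \<mu>) > 0"
  shows "integrable lborel (\<lambda>x. B * exp (Re (remainder_exponent N M \<mu>) * x - 1 * exp x) :: real)"
  by (intro integrable_mult_right Gamma_exp_integral_real(1) assms) simp

lemma integrable_kernel_remainder_integrand:
  assumes nu: "\<bar>Re \<nu>\<bar> < real M + 1/2" and r: "r > 0" and q: "Re (remainder_exponent N M \<mu>) > 0"
  shows "integrable lborel (kernel_remainder_integrand N M \<mu> \<nu> r \<theta>)"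
proof (rule Bochner_Integration.integrable_bound[OF integrable_kernel_remainder_bound[OF q] kernel_remainder_integrand_measurable[OF nu]])
  show "AE x in lborel. norm (kernel_remainder_integrand N M \<mu> \<nu> r \<theta> x) \<le> norm ((norm (cos (of_real pi * \<nu>)) * stieltjesB M (Re \<nu>)) * exp (Re (remainder_exponent N M \<mu>) * x - 1 * exp x))"
    by (intro AE_I2 order_trans[OF norm_kernel_remainder_integrand_le[OF nu r]]) (simp only: real_norm_def abs_ge_self)
qed

lemma norm_kernel_remainder_le:
  assumes nu: "\<bar>Re \<nu>\<bar> < real M + 1/2" and r: "r > 0" and q: "Re (remainder_exponent N M \<mu>) > 0"
  shows "norm (kernel_remainder N M \<mu> \<nu> r \<theta>) \<le> norm (exp ((\<mu> - 1 - 2 * of_nat N) * (of_real (ln r) + \<i> * of_real \<theta>))) * sqrt (pi / 2) *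
     ((norm (cos (of_real pi * \<nu>)) * stieltjesB M (Re \<nu>)) * Gamma (Re (remainder_exponent N M \<mu>)))"
proof -
  have "norm (\<integral>x. kernel_remainder_integrand N M \<mu> \<nu> r \<theta> x \<partial>lborel) \<le> (\<integral>x. (norm (cos (of_real pi * \<nu>)) * stieltjesB M (Re \<nu>)) * exp (Re (remainder_exponent N M \<mu>) * x - 1 * exp x) \<partial>lborel)"
    by (rule Bochner_Integration.integral_norm_bound_integral[OF integrable_kernel_remainder_integrand[OF nu r q] integrable_kernel_remainder_bound[OF q] norm_kernel_remainder_integrand_le[OF nu r]])
  also have "\<dots> = (norm (cos (of_real pi * \<nu>)) * stieltjesB M (Re \<nu>)) * Gamma (Re (remainder_exponent N M \<mu>))"
    unfolding integral_mult_right_zero using Gamma_exp_integral_real(2)[OF q, of 1] by simp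
  finally have "norm (\<integral>x. kernel_remainder_integrand N M \<mu> \<nu> r \<theta> x \<partial>lborel) \<le> (norm (cos (of_real pi * \<nu>)) * stieltjesB M (Re \<nu>)) * Gamma (Re (remainder_exponent N M \<mu>))" .
  then have "norm (exp ((\<mu> - 1 - 2 * of_nat N) * (of_real (ln r) + \<i> * of_real \<theta>))) * sqrt (pi / 2) * norm (\<integral>x. kernel_remainder_integrand N M \<mu> \<nu> r \<theta> x \<partial>lborel) \<le>
     norm (exp ((\<mu> - 1 - 2 * of_nat N) * (of_real (ln r) + \<i> * of_real \<theta>))) * sqrt (pi / 2) * ((norm (cos (of_real pi * \<nu>)) * stieltjesB M (Re \<nu>)) * Gamma (Re (remainder_exponent N M \<mu>)))"
    by (rule mult_left_mono) simp
  moreover have "norm (kernel_remainder N M \<mu> \<nu> r \<theta>) = norm (exp ((\<mu> - 1 - 2 * of_nat N) * (of_real (ln r) + \<i> * of_real \<theta>))) * sqrt (pi / 2) * norm (\<integral>x. kernel_remainder_integrand N M \<mu> \<nu> r \<theta> x \<partial>lborel)"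
    unfolding kernel_remainder_def norm_mult norm_power by simp
  ultimately show ?thesis by (simp only:)
qed

text \<open>An expression for the re-expanded remainder without division by the prefactor. It
  remains meaningful and continuous on the boundary rays and where the prefactor vanishes, and the
  estimate is proved for it.\<close>

definition RNM_value :: "nat \<Rightarrow> nat \<Rightarrow> complex \<Rightarrow> complex \<Rightarrow> real \<Rightarrow> real \<Rightarrow> complex" where
  "RNM_value N M \<mu> \<nu> r \<theta> = (-1) ^ M * stieltjesG M \<nu> r * (exp_term_plus N M \<mu> r \<theta> + exp_term_minus N M \<mu> r \<theta>) + kernel_remainder N M \<mu> \<nu> r \<theta>"

text \<open>The remainder of the Lommel function divided by the prefactor, in the form obtained by
  re-expansion. Inside the sector it is the Lommel integral up to its elementary factor.\<close>

definition RN_quot :: "nat \<Rightarrow> nat \<Rightarrow> complex \<Rightarrow> complex \<Rightarrow> real \<Rightarrow> real \<Rightarrow> complex" where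
  "RN_quot N M \<mu> \<nu> r \<theta> = (\<Sum>m<M. hankel_a m \<nu> * (exp_term_plus N m \<mu> r \<theta> + exp_term_minus N m \<mu> r \<theta>)) + RNM_value N M \<mu> \<nu> r \<theta>"

lemma Re_remainder_exponent_pos:
  assumes "Re \<mu> < 2 * real N - real M + 1/2" "m \<le> M"
  shows "Re (remainder_exponent N m \<mu>) > 0"
proof -
  have "real m \<le> real M" using assms(2) by simp
  then show ?thesis using assms(1) by (simp add: remainder_exponent_def)
qed

text \<open>The expansion of K carries the factor (\<pi>/(2t))^(1/2) e^(-t). The square root and the
  powers t^(-m) shift the exponent to \<open>remainder_exponent\<close>, and e^(-t) supplies the
  decay in the terminant integrals.\<close>

lemma lommelI_expansion:
  assumes nu: "\<bar>Re \<nu>\<bar> < real M + 1/2" and mu: "Re \<mu> < 2 * real N - real M + 1/2" and r: "r > 0" and th: "\<bar>\<theta>\<bar> < pi / 2"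
  defines "z \<equiv> of_real r * cis \<theta>"
  shows "(-1) ^ N * exp ((\<mu> - 1 - 2 * of_nat N) * (of_real (ln r) + \<i> * of_real \<theta>)) * lommelI N \<mu> \<nu> z = RN_quot N M \<mu> \<nu> r \<theta>"
proof -
  define D where "D = (\<lambda>x::real. 1 + (complex_of_real (exp x) / z)\<^sup>2)"
  define E where "E = (\<lambda>m x. exp (remainder_exponent N m \<mu> * of_real x - of_real (exp x)))"
  define s where "s = complex_of_real (sqrt (pi / 2))"
  define P where "P = (-1) ^ N * exp ((\<mu> - 1 - 2 * of_nat N) * (of_real (ln r) + \<i> * of_real \<theta>))"
  have iE: "integrable lborel (\<lambda>x. E m x / D x)" "P * s * (\<integral>x. E m x / D x \<partial>lborel) = exp_term_plus N m \<mu> r \<theta> + exp_term_minus N m \<mu> r \<theta>" if "m \<le> M" for m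
    using remainder_term_integral[OF r th Re_remainder_exponent_pos[OF mu that]] unfolding E_def D_def z_def P_def s_def by simp_all
  have q: "Re (remainder_exponent N M \<mu>) > 0" by (rule Re_remainder_exponent_pos[OF mu]) simp
  have pw: "exp ((2 * of_nat N - \<mu> + 1) * of_real x) * besselK \<nu> (of_real (exp x)) / (1 + (of_real (exp x) / z)\<^sup>2) =
     s * ((\<Sum>m<M. hankel_a m \<nu> * (E m x / D x)) + (-1) ^ M * stieltjesG M \<nu> r * (E M x / D x) + (-1) ^ M * kernel_remainder_integrand N M \<mu> \<nu> r \<theta> x)" for x
  proof -
    define t where "t = exp x"
    define y where "y = complex_of_real t"
    have t: "t > 0" and y: "y \<noteq> 0" by (auto simp: t_def y_def)
    define S where "S = (\<Sum>m<M. hankel_a m \<nu> / y ^ m) + (-1) ^ M * stieltjesG M \<nu> t / y ^ M"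
    have K: "of_real (sqrt (2 * t / pi) * exp t) * besselK \<nu> y = S"
      using besselK_expansion[OF nu t] unfolding S_def y_def .
    have "sqrt (pi / 2) * exp (- x / 2) * exp (- t) * (sqrt (2 * t / pi) * exp t) = (sqrt (pi / 2) * sqrt (2 / pi)) * (exp (- x / 2) * sqrt t) * (exp (- t) * exp t)"
      by (simp only: real_sqrt_mult real_sqrt_divide) simp
    also have "sqrt (pi / 2) * sqrt (2 / pi) = 1" by (simp add: real_sqrt_divide)
    also have "sqrt t = exp (x / 2)" unfolding t_def
      by (rule real_sqrt_unique) (simp_all add: power2_eq_square exp_add[symmetric])
    also have "exp (- x / 2) * exp (x / 2) = 1" by (simp add: exp_add[symmetric])
    finally have "sqrt (pi / 2) * exp (- x / 2) * exp (- t) * (sqrt (2 * t / pi) * exp t) = 1" by (simp add: exp_add[symmetric])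
    then have "complex_of_real (sqrt (pi / 2) * exp (- x / 2) * exp (- t)) * of_real (sqrt (2 * t / pi) * exp t) = 1"
      by (metis of_real_1 of_real_mult)
    then have K2: "besselK \<nu> y = of_real (sqrt (pi / 2) * exp (- x / 2) * exp (- t)) * S"
      unfolding K[symmetric] mult.assoc[symmetric] by simp
    have Em: "exp ((2 * of_nat N - \<mu> + 1) * of_real x) * of_real (exp (- x / 2) * exp (- t)) / y ^ m = E m x" for m
    proof -
      have "y ^ m = exp (of_nat m * of_real x)" unfolding exp_of_nat_mult by (simp add: y_def t_def exp_of_real)
      moreover have "complex_of_real (exp (- x / 2) * exp (- t)) = exp (- of_real x / 2 - of_real t)"
        by (simp add: exp_of_real[symmetric] exp_add[symmetric])
      ultimately have "exp ((2 * of_nat N - \<mu> + 1) * of_real x) * of_real (exp (- x / 2) * exp (- t)) / y ^ m = exp ((2 * of_nat N - \<mu> + 1) * of_real x + (- of_real x / 2 - of_real t) - of_nat m * of_real x)"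
        by (simp only: exp_add[symmetric] exp_diff[symmetric])
      also have "\<dots> = E m x" unfolding E_def remainder_exponent_def t_def[symmetric] by (rule arg_cong[where f = exp]) (simp add: field_simps)
      finally show ?thesis .
    qed
    have "exp ((2 * of_nat N - \<mu> + 1) * of_real x) * besselK \<nu> y = s * ((exp ((2 * of_nat N - \<mu> + 1) * of_real x) * of_real (exp (- x / 2) * exp (- t))) * S)"
      unfolding K2 s_def by simp
    also have "(exp ((2 * of_nat N - \<mu> + 1) * of_real x) * of_real (exp (- x / 2) * exp (- t))) * S = (\<Sum>m<M. hankel_a m \<nu> * E m x) + (-1) ^ M * stieltjesG M \<nu> t * E M x"
      unfolding S_def distrib_left sum_distrib_left Em[symmetric] by (simp add: mult_ac)
    finally have "exp ((2 * of_nat N - \<mu> + 1) * of_real x) * besselK \<nu> y / D x = s * ((\<Sum>m<M. hankel_a m \<nu> * E m x) / D x + (-1) ^ M * stieltjesG M \<nu> t * E M x / D x)"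
      unfolding add_divide_distrib[symmetric] times_divide_eq_right by (simp only:)
    also have "(\<Sum>m<M. hankel_a m \<nu> * E m x) / D x = (\<Sum>m<M. hankel_a m \<nu> * (E m x / D x))"
      by (simp add: sum_divide_distrib)
    also have "(-1) ^ M * stieltjesG M \<nu> t * E M x / D x = (-1) ^ M * stieltjesG M \<nu> r * (E M x / D x) + (-1) ^ M * kernel_remainder_integrand N M \<mu> \<nu> r \<theta> x"
    proof -
      have gen: "a * g * e / d = a * h * (e / d) + a * (e * (g - h) / d)" for a g h e d :: complex
        by (simp add: right_diff_distrib diff_divide_distrib mult_ac)
      show ?thesis unfolding kernel_remainder_integrand_def z_def[symmetric] t_def[symmetric] D_def E_def by (rule gen)
    qed
    finally show ?thesis by (simp only: D_def y_def t_def add.assoc)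
  qed
  have i1: "integrable lborel (\<lambda>x. \<Sum>m<M. hankel_a m \<nu> * (E m x / D x))"
    by (intro Bochner_Integration.integrable_sum integrable_mult_right iE(1)) simp
  have i2: "integrable lborel (\<lambda>x. (-1) ^ M * stieltjesG M \<nu> r * (E M x / D x))"
    by (intro integrable_mult_right iE(1)) simp
  have i3: "integrable lborel (\<lambda>x. (-1) ^ M * kernel_remainder_integrand N M \<mu> \<nu> r \<theta> x)"
    by (intro integrable_mult_right integrable_kernel_remainder_integrand nu r q)
  have "lommelI N \<mu> \<nu> z = s * ((\<Sum>m<M. hankel_a m \<nu> * (\<integral>x. E m x / D x \<partial>lborel)) + (-1) ^ M * stieltjesG M \<nu> r * (\<integral>x. E M x / D x \<partial>lborel) + (-1) ^ M * (\<integral>x. kernel_remainder_integrand N M \<mu> \<nu> r \<theta> x \<partial>lborel))"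
  proof -
    have "(\<integral>x. (\<Sum>m<M. hankel_a m \<nu> * (E m x / D x)) \<partial>lborel) = (\<Sum>m<M. hankel_a m \<nu> * (\<integral>x. E m x / D x \<partial>lborel))"
      unfolding integral_mult_right_zero[symmetric]
      by (rule Bochner_Integration.integral_sum) (intro integrable_mult_right iE(1), simp)
    then show ?thesis
      unfolding lommelI_def pw integral_mult_right_zero Bochner_Integration.integral_add[OF Bochner_Integration.integrable_add[OF i1 i2] i3]
        Bochner_Integration.integral_add[OF i1 i2] by simp
  qed
  then have "P * lommelI N \<mu> \<nu> z = (\<Sum>m<M. hankel_a m \<nu> * (P * s * (\<integral>x. E m x / D x \<partial>lborel))) + (-1) ^ M * stieltjesG M \<nu> r * (P * s * (\<integral>x. E M x / D x \<partial>lborel)) + P * s * ((-1) ^ M * (\<integral>x. kernel_remainder_integrand N M \<mu> \<nu> r \<theta> x \<partial>lborel))"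
    by (simp add: distrib_left sum_distrib_left mult_ac)
  also have "\<dots> = RN_quot N M \<mu> \<nu> r \<theta>"
    unfolding RN_quot_def RNM_value_def kernel_remainder_def P_def[symmetric] s_def[symmetric] iE(2)[OF order_refl] using iE(2) by simp
  finally show ?thesis unfolding P_def .
qed

text \<open>Each Pochhammer symbol of 1/2 \<plusminus> x is a quotient with numerator \<Gamma>(M +
  1/2 \<plusminus> x). By reflection the two denominators multiply to \<pi>/cos(\<pi>x).\<close>

lemma norm_hankel_a_real:
  assumes "\<bar>x\<bar> < real M + 1/2"
  shows "norm (hankel_a M (of_real x)) = \<bar>cos (pi * x)\<bar> * stieltjesB M x"
proof -
  define c d where "c = real M + 1/2 + x" and "d = real M + 1/2 - x"
  have cd: "c > 0" "d > 0" using assms by (auto simp: c_def d_def)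
  define P Q where "P = pochhammer (1/2 + complex_of_real x) M" and "Q = pochhammer (1/2 - complex_of_real x) M"
  have e: "1/2 + complex_of_real x + of_nat M = of_real c" "1/2 - complex_of_real x + of_nat M = of_real d"
    by (simp_all add: c_def d_def)
  have "(P * rGamma (of_real c)) * (Q * rGamma (of_real d)) = of_real (cos (pi * x)) / of_real pi"
    using rGamma_half_reflection[of "of_real x"] unfolding pochhammer_rGamma[where n = M and z = "1/2 + complex_of_real x"]
      pochhammer_rGamma[where n = M and z = "1/2 - complex_of_real x"] e P_def Q_def by (simp add: cos_of_real[symmetric])
  then have "P * Q * (rGamma (of_real c) * rGamma (of_real d)) = of_real (cos (pi * x) / pi)" by (simp add: mult_ac)
  moreover have "rGamma (of_real c :: complex) * rGamma (of_real d) = of_real (inverse (Gamma c * Gamma d))"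
    by (simp add: rGamma_inverse_Gamma Gamma_complex_of_real)
  ultimately have "P * Q * of_real (inverse (Gamma c * Gamma d)) = of_real (cos (pi * x) / pi)" by simp
  then have "P * Q = of_real (cos (pi * x) / pi * (Gamma c * Gamma d))"
    using Gamma_real_pos[OF cd(1)] Gamma_real_pos[OF cd(2)] by (simp add: field_simps)
  then have "norm (P * Q) = \<bar>cos (pi * x)\<bar> / pi * (Gamma c * Gamma d)"
    using cd Gamma_real_pos[of c] Gamma_real_pos[of d] by (simp only: norm_of_real) (simp add: abs_mult)
  moreover have "norm (hankel_a M (of_real x)) = norm (P * Q) / (2 ^ M * fact M)"
    by (simp add: hankel_a_def P_def Q_def norm_mult norm_divide norm_power)
  ultimately show ?thesis by (simp add: stieltjesB_def c_def d_def)
qed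

lemma stieltjesB_tendsto:
  assumes f: "(f \<longlongrightarrow> \<sigma>) F" and "\<bar>\<sigma>\<bar> < real M + 1/2"
  shows "((\<lambda>x. stieltjesB M (f x)) \<longlongrightarrow> stieltjesB M \<sigma>) F"
proof -
  have "real M + 1/2 + \<sigma> \<notin> \<int>\<^sub>\<le>\<^sub>0" "real M + 1/2 - \<sigma> \<notin> \<int>\<^sub>\<le>\<^sub>0"
    using assms(2) by (auto elim!: nonpos_Ints_cases)
  then show ?thesis unfolding stieltjesB_def by (intro tendsto_intros f) auto
qed

text \<open>Away from the zeros of the cosine this is \<open>norm_hankel_a_real\<close> after
  division; at a zero the quotient is replaced by its limit, and the Gamma product is continuous
  there.\<close>

lemma aM_over_cos_eq:
  assumes x: "\<bar>x\<bar> < real M + 1/2"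
  shows "aM_over_cos M x = stieltjesB M x"
proof (cases "cos (pi * x) = 0")
  case False
  then show ?thesis by (simp add: aM_over_cos_def norm_hankel_a_real[OF x])
next
  case True
  \<comment> \<open>Zeros of cos(\<pi>y) are multiples of 1/2, so no second one lies within distance
    1/2.\<close>
  have "eventually (\<lambda>y. cos (pi * y) \<noteq> 0) (at x)"
    unfolding eventually_at
  proof (intro exI[of _ "1/2"] conjI ballI impI notI)
    fix y :: real assume y: "y \<noteq> x \<and> dist y x < 1/2" "cos (pi * y) = 0"
    obtain i j :: int where ij: "pi * x = of_int i * (pi / 2)" "pi * y = of_int j * (pi / 2)"
      using True y(2) unfolding cos_zero_iff_int by blast
    then have xy: "x = of_int i / 2" "y = of_int j / 2" by (simp_all add: field_simps)
    have "\<bar>of_int j / 2 - of_int i / 2\<bar> < (1/2 :: real)" using y(1) unfolding dist_real_def xy by blast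
    then have "\<bar>of_int (j - i)\<bar> < (1::real)" unfolding of_int_diff by linarith
    then have "j = i" by linarith
    then show False using y(1) xy by simp
  qed simp
  moreover have "eventually (\<lambda>y. \<bar>y\<bar> < real M + 1/2) (at x)"
    by (rule order_tendstoD[OF _ x]) (intro tendsto_intros)
  ultimately have "eventually (\<lambda>y. stieltjesB M y = norm (hankel_a M (of_real y)) / \<bar>cos (pi * y)\<bar>) (at x)"
    by eventually_elim (simp add: norm_hankel_a_real)
  from Lim_transform_eventually[OF stieltjesB_tendsto[OF tendsto_ident_at x] this]
  show ?thesis unfolding aM_over_cos_def using True tendsto_Lim[OF at_neq_bot] by simp
qed

section \<open>Continuity of the remainder in \<mu>, \<nu> and arg z\<close>

lemma stieltjesG_tendsto:
  assumes f: "(f \<longlongrightarrow> \<nu>) F" and nu: "\<bar>Re \<nu>\<bar> < real M + 1/2" and t: "t > 0"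
  shows "((\<lambda>x. stieltjesG M (f x) t) \<longlongrightarrow> stieltjesG M \<nu> t) F"
proof (rule isCont_tendsto_compose[OF _ f])
  show "isCont (\<lambda>\<nu>. stieltjesG M \<nu> t) \<nu>"
    using holomorphic_on_imp_continuous_on[OF stieltjesG_holomorphic[OF t, of M]] nu
    by (simp add: continuous_on_eq_continuous_at[OF open_strip])
qed

text \<open>The pointwise bound of the integrand does not involve the angle, so dominated
  convergence works up to and on the rays. The three parameters move together because limits in each
  of them are needed later.\<close>

lemma kernel_remainder_tendsto:
  assumes m: "ms \<longlonglongrightarrow> \<mu>" and n: "ns \<longlonglongrightarrow> \<nu>" and t: "ts \<longlonglongrightarrow> \<theta>"
    and nu: "\<bar>Re \<nu>\<bar> < real M + 1/2" and r: "r > 0" and q: "Re (remainder_exponent N M \<mu>) > 0"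
  shows "(\<lambda>k. kernel_remainder N M (ms k) (ns k) r (ts k)) \<longlonglongrightarrow> kernel_remainder N M \<mu> \<nu> r \<theta>"
proof -
  define q where "q = Re (remainder_exponent N M \<mu>)"
  define B where "B = (\<lambda>\<nu>. norm (cos (of_real pi * \<nu>)) * stieltjesB M (Re \<nu>))"
  have qm: "(\<lambda>k. remainder_exponent N M (ms k)) \<longlonglongrightarrow> remainder_exponent N M \<mu>"
    unfolding remainder_exponent_def by (intro tendsto_intros m)
  have "(\<lambda>k. B (ns k)) \<longlonglongrightarrow> B \<nu>"
    unfolding B_def by (intro tendsto_intros stieltjesB_tendsto n nu)
  then have "eventually (\<lambda>k. B (ns k) < B \<nu> + 1) sequentially" by (rule order_tendstoD) simp
  moreover have "eventually (\<lambda>k. \<bar>Re (ns k)\<bar> < real M + 1/2) sequentially"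
    by (rule order_tendstoD[OF _ nu]) (intro tendsto_intros n)
  moreover have "eventually (\<lambda>k. q / 2 < Re (remainder_exponent N M (ms k))) sequentially"
    by (rule order_tendstoD[OF tendsto_Re[OF qm]]) (use q in \<open>simp add: q_def\<close>)
  moreover have "eventually (\<lambda>k. Re (remainder_exponent N M (ms k)) < 2 * q) sequentially"
    by (rule order_tendstoD[OF tendsto_Re[OF qm]]) (use q in \<open>simp add: q_def\<close>)
  ultimately have "eventually (\<lambda>k. B (ns k) < B \<nu> + 1 \<and> \<bar>Re (ns k)\<bar> < real M + 1/2 \<and> q / 2 < Re (remainder_exponent N M (ms k)) \<and> Re (remainder_exponent N M (ms k)) < 2 * q) sequentially"
    by eventually_elim auto
  \<comment> \<open>Dropping finitely many indices makes one majorant valid for all others: the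
    constant stays below its limit plus 1, and the exponent stays between q/2 and 2q.\<close>
  then obtain K where K: "\<And>k. k \<ge> K \<Longrightarrow> B (ns k) < B \<nu> + 1 \<and> \<bar>Re (ns k)\<bar> < real M + 1/2 \<and> q / 2 < Re (remainder_exponent N M (ms k)) \<and> Re (remainder_exponent N M (ms k)) < 2 * q"
    unfolding eventually_sequentially by blast
  have B0: "B \<nu> \<ge> 0" using order_trans[OF norm_ge_zero norm_stieltjesG_le[OF nu r]] by (simp add: B_def)
  have q0: "q > 0" using q by (simp add: q_def)
  have "(\<lambda>k. \<integral>x. kernel_remainder_integrand N M (ms (k + K)) (ns (k + K)) r (ts (k + K)) x \<partial>lborel) \<longlonglongrightarrow> (\<integral>x. kernel_remainder_integrand N M \<mu> \<nu> r \<theta> x \<partial>lborel)"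
  proof (rule integral_dominated_convergence)
    show "kernel_remainder_integrand N M \<mu> \<nu> r \<theta> \<in> borel_measurable lborel" by (rule kernel_remainder_integrand_measurable[OF nu])
    show "kernel_remainder_integrand N M (ms (k + K)) (ns (k + K)) r (ts (k + K)) \<in> borel_measurable lborel" for k
      by (rule kernel_remainder_integrand_measurable) (use K[of "k + K"] in simp)
    show "integrable lborel (\<lambda>x. (B \<nu> + 1) * (exp (q / 2 * x - 1 * exp x) + exp ((2 * q) * x - 1 * exp x)))"
      using q0 by (intro integrable_mult_right Bochner_Integration.integrable_add Gamma_exp_integral_real(1)) auto
    show "AE x in lborel. norm (kernel_remainder_integrand N M (ms (k + K)) (ns (k + K)) r (ts (k + K)) x) \<le> (B \<nu> + 1) * (exp (q / 2 * x - 1 * exp x) + exp ((2 * q) * x - 1 * exp x))" for k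
    proof (rule AE_I2)
      fix x :: real
      define p where "p = Re (remainder_exponent N M (ms (k + K)))"
      have k: "B (ns (k + K)) \<le> B \<nu> + 1" "\<bar>Re (ns (k + K))\<bar> < real M + 1/2" "q / 2 \<le> p" "p \<le> 2 * q" using K[of "k + K"] by (auto simp: p_def)
      have "exp (p * x - 1 * exp x) \<le> exp (q / 2 * x - 1 * exp x) + exp ((2 * q) * x - 1 * exp x)"
      proof (cases "x \<ge> 0")
        case True
        then have "p * x \<le> (2 * q) * x" using k by (intro mult_right_mono) auto
        then show ?thesis by (intro add_increasing) auto
      next
        case False
        then have "p * x \<le> q / 2 * x" using k by (intro mult_right_mono_neg) auto
        then show ?thesis by (intro add_increasing2) auto
      qed
      then have "B (ns (k + K)) * exp (p * x - 1 * exp x) \<le> (B \<nu> + 1) * (exp (q / 2 * x - 1 * exp x) + exp ((2 * q) * x - 1 * exp x))"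
        using k(1) B0 by (intro mult_mono) auto
      then show "norm (kernel_remainder_integrand N M (ms (k + K)) (ns (k + K)) r (ts (k + K)) x) \<le> (B \<nu> + 1) * (exp (q / 2 * x - 1 * exp x) + exp ((2 * q) * x - 1 * exp x))"
        using norm_kernel_remainder_integrand_le[OF k(2) r, of N "ms (k + K)" "ts (k + K)" x] unfolding B_def p_def by (rule order_trans[rotated])
    qed
    show "AE x in lborel. (\<lambda>k. kernel_remainder_integrand N M (ms (k + K)) (ns (k + K)) r (ts (k + K)) x) \<longlonglongrightarrow> kernel_remainder_integrand N M \<mu> \<nu> r \<theta> x"
      \<comment> \<open>On the rays the denominator of the limit vanishes at x = ln r, where
        pointwise convergence may fail. A single point is negligible.\<close>
      using AE_lborel_singleton[of "ln r"]
    proof eventually_elim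
      fix x assume x: "x \<noteq> ln r"
      have "exp x \<noteq> r" using x by auto
      then have "\<bar>exp x / r - 1\<bar> > 0" using r by (auto simp: field_simps)
      then have nz: "1 + (complex_of_real (exp x) / (of_real r * cis \<theta>))\<^sup>2 \<noteq> 0"
        using kernel_tau_bound[OF r exp_gt_zero, of x \<theta>] by auto
      have "(\<lambda>k. kernel_remainder_integrand N M (ms k) (ns k) r (ts k) x) \<longlonglongrightarrow> kernel_remainder_integrand N M \<mu> \<nu> r \<theta> x"
        unfolding kernel_remainder_integrand_def using r nz
        by (intro tendsto_intros qm stieltjesG_tendsto[OF n nu] t) auto
      then show "(\<lambda>k. kernel_remainder_integrand N M (ms (k + K)) (ns (k + K)) r (ts (k + K)) x) \<longlonglongrightarrow> kernel_remainder_integrand N M \<mu> \<nu> r \<theta> x"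
        by (rule LIMSEQ_ignore_initial_segment)
    qed
  qed
  then have "(\<lambda>k. \<integral>x. kernel_remainder_integrand N M (ms k) (ns k) r (ts k) x \<partial>lborel) \<longlonglongrightarrow> (\<integral>x. kernel_remainder_integrand N M \<mu> \<nu> r \<theta> x \<partial>lborel)"
    by (rule LIMSEQ_offset)
  then show ?thesis unfolding kernel_remainder_def by (intro tendsto_intros m t) auto
qed

lemma exp_terms_isCont_mu:
  assumes q: "Re (remainder_exponent N m \<mu>) > 0" and r: "r > 0" and th: "\<bar>\<theta>\<bar> \<le> pi / 2"
  shows "isCont (\<lambda>\<mu>. exp_term_plus N m \<mu> r \<theta> + exp_term_minus N m \<mu> r \<theta>) \<mu>"
proof -
  have "isCont (remainder_exponent N m) \<mu>" unfolding remainder_exponent_def[abs_def] by (intro continuous_intros)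
  from isCont_o2[OF this terminant_polar_isCont[OF q r]] th
  have "isCont (\<lambda>\<mu>. terminant_polar (remainder_exponent N m \<mu>) r (\<theta> + pi / 2)) \<mu>"
    "isCont (\<lambda>\<mu>. terminant_polar (remainder_exponent N m \<mu>) r (\<theta> - pi / 2)) \<mu>"
    by force+
  then show ?thesis unfolding exp_term_plus_def exp_term_minus_def using r by (intro continuous_intros) auto
qed

lemma terminant_polar_tendsto_seq:
  assumes p: "Re p > 0" and r: "r > 0" and s: "\<bar>s\<bar> \<le> pi" and lim: "ts \<longlonglongrightarrow> s" and ts: "\<And>n. \<bar>ts n\<bar> < pi" "\<And>n. ts n \<noteq> s"
  shows "(\<lambda>n. terminant_polar p r (ts n)) \<longlonglongrightarrow> terminant_polar p r s"
proof -
  have "filterlim ts (at s within {-pi<..<pi}) sequentially"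
    unfolding filterlim_at using lim ts by (auto simp: abs_less_iff intro!: always_eventually) (metis minus_less_iff)
  from filterlim_compose[OF terminant_polar_tendsto[OF p r s] this]
  show ?thesis using terminant_polar_eq[OF p r ts(1)] by simp
qed

lemma exp_terms_tendsto_arg:
  assumes q: "Re (remainder_exponent N m \<mu>) > 0" and r: "r > 0" and th: "\<bar>\<theta>\<bar> \<le> pi / 2"
    and lim: "ts \<longlonglongrightarrow> \<theta>" and ts: "\<And>n. \<bar>ts n\<bar> < pi / 2" "\<And>n. ts n \<noteq> \<theta>"
  shows "(\<lambda>n. exp_term_plus N m \<mu> r (ts n) + exp_term_minus N m \<mu> r (ts n)) \<longlonglongrightarrow> exp_term_plus N m \<mu> r \<theta> + exp_term_minus N m \<mu> r \<theta>"
proof -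
  have b: "\<bar>ts n + pi / 2\<bar> < pi" "\<bar>ts n - pi / 2\<bar> < pi" for n using ts(1)[of n] by auto
  have "(\<lambda>n. terminant_polar (remainder_exponent N m \<mu>) r (ts n + pi / 2)) \<longlonglongrightarrow> terminant_polar (remainder_exponent N m \<mu>) r (\<theta> + pi / 2)"
    by (rule terminant_polar_tendsto_seq[OF q r]) (use th b ts(2) in \<open>auto intro!: tendsto_intros lim\<close>)
  moreover have "(\<lambda>n. terminant_polar (remainder_exponent N m \<mu>) r (ts n - pi / 2)) \<longlonglongrightarrow> terminant_polar (remainder_exponent N m \<mu>) r (\<theta> - pi / 2)"
    by (rule terminant_polar_tendsto_seq[OF q r]) (use th b ts(2) in \<open>auto intro!: tendsto_intros lim\<close>)
  ultimately show ?thesis unfolding exp_term_plus_def exp_term_minus_def using r by (intro tendsto_intros lim) auto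
qed

context
  fixes N M :: nat and \<mu> \<nu> :: complex and r \<theta> :: real
  assumes nu: "\<bar>Re \<nu>\<bar> < real M + 1/2" and mu: "Re \<mu> < 2 * real N - real M + 1/2" and r: "r > 0" and th: "\<bar>\<theta>\<bar> \<le> pi / 2"
begin

lemma RNM_value_isCont_mu: "isCont (\<lambda>\<mu>. RNM_value N M \<mu> \<nu> r \<theta>) \<mu>"
proof -
  have "isCont (\<lambda>\<mu>. kernel_remainder N M \<mu> \<nu> r \<theta>) \<mu>"
    unfolding continuous_at_sequentially comp_def
    using kernel_remainder_tendsto[OF _ tendsto_const tendsto_const nu r Re_remainder_exponent_pos[OF mu order_refl]] by blast
  then show ?thesis
    unfolding RNM_value_def by (intro continuous_intros exp_terms_isCont_mu r th Re_remainder_exponent_pos[OF mu]) simp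
qed

lemma RN_quot_isCont_mu: "isCont (\<lambda>\<mu>. RN_quot N M \<mu> \<nu> r \<theta>) \<mu>"
  unfolding RN_quot_def
  by (intro continuous_intros RNM_value_isCont_mu exp_terms_isCont_mu r th Re_remainder_exponent_pos[OF mu]) auto

text \<open>Continuity in the order is required because Y at integer order is defined as a limit in
  \<nu>.\<close>

lemma RN_quot_isCont_nu: "isCont (\<lambda>\<nu>. RN_quot N M \<mu> \<nu> r \<theta>) \<nu>"
  unfolding continuous_at_sequentially comp_def
proof (intro allI impI)
  fix ns :: "nat \<Rightarrow> complex" assume n: "ns \<longlonglongrightarrow> \<nu>"
  have "(\<lambda>k. hankel_a m (ns k)) \<longlonglongrightarrow> hankel_a m \<nu>" for m
    unfolding hankel_a_def pochhammer_prod by (intro tendsto_intros n) auto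
  then show "(\<lambda>k. RN_quot N M \<mu> (ns k) r \<theta>) \<longlonglongrightarrow> RN_quot N M \<mu> \<nu> r \<theta>"
    unfolding RN_quot_def RNM_value_def
    by (intro tendsto_intros stieltjesG_tendsto[OF n nu r] kernel_remainder_tendsto[OF _ n] nu r Re_remainder_exponent_pos[OF mu]) auto
qed

lemma RN_quot_tendsto_arg:
  assumes "ts \<longlonglongrightarrow> \<theta>" "\<And>n. \<bar>ts n\<bar> < pi / 2" "\<And>n. ts n \<noteq> \<theta>"
  shows "(\<lambda>n. RN_quot N M \<mu> \<nu> r (ts n)) \<longlonglongrightarrow> RN_quot N M \<mu> \<nu> r \<theta>"
  unfolding RN_quot_def RNM_value_def
  by (intro tendsto_intros exp_terms_tendsto_arg kernel_remainder_tendsto assms nu r th Re_remainder_exponent_pos[OF mu]) auto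

lemma ln_polar: "Ln (of_real r * cis \<theta>) = of_real (ln r) + \<i> * of_real \<theta>"
proof -
  have "- pi < \<theta>" "\<theta> \<le> pi" using th pi_gt_zero by linarith+
  then show ?thesis unfolding polar_exp[OF r] by (intro Ln_exp) auto
qed

lemma norm_RNM_value_le:
  "norm (RNM_value N M \<mu> \<nu> r \<theta>)
    \<le> pi * norm (exp (pi / 2 * \<i> * \<mu>)) * sqrt (pi / (2 * r))
          * norm (cos (pi * \<nu>)) * aM_over_cos M (Re \<nu>) / r ^ M
          * norm (exp (\<i> * (of_real r * cis \<theta>))
                  * terminant_polar (of_nat (2 * N) - of_nat M - \<mu> + 1/2) r (\<theta> + pi / 2))
     + pi * norm (exp (- pi / 2 * \<i> * \<mu>)) * sqrt (pi / (2 * r))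
          * norm (cos (pi * \<nu>)) * aM_over_cos M (Re \<nu>) / r ^ M
          * norm (exp (2 * pi * \<i> * \<mu>) * exp (- \<i> * (of_real r * cis \<theta>))
                  * terminant_polar (of_nat (2 * N) - of_nat M - \<mu> + 1/2) r (\<theta> - pi / 2))
     + sqrt (pi / 2) * norm ((of_real r * cis \<theta>) powr \<mu>)
          * norm (cos (pi * \<nu>)) * aM_over_cos M (Re \<nu>)
          * Gamma (2 * real N - real M - Re \<mu> + 1/2) / r ^ (2 * N + 1)"
  (is "_ \<le> ?A + ?B + ?C")
proof -
  define b where "b = norm (cos (of_real pi * \<nu>)) * stieltjesB M (Re \<nu>)"
  have b: "b = norm (cos (of_real pi * \<nu>)) * aM_over_cos M (Re \<nu>)" by (simp add: b_def aM_over_cos_eq[OF nu])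
  have G: "norm (stieltjesG M \<nu> r) \<le> b" unfolding b_def by (rule norm_stieltjesG_le[OF nu r])
  have nA: "b * norm (exp_term_plus N M \<mu> r \<theta>) = ?A"
    unfolding exp_term_plus_def b norm_mult norm_divide norm_power remainder_exponent_def using r by (simp add: mult_ac)
  have nB: "b * norm (exp_term_minus N M \<mu> r \<theta>) = ?B"
    unfolding exp_term_minus_def b norm_mult norm_divide norm_power remainder_exponent_def using r by (simp add: mult_ac)
  have "norm (exp ((\<mu> - 1 - 2 * of_nat N) * (of_real (ln r) + \<i> * of_real \<theta>))) = norm ((of_real r * cis \<theta>) powr \<mu>) / r ^ (2 * N + 1)"
  proof -
    define l where "l = of_real (ln r) + \<i> * of_real \<theta>"
    have "(\<mu> - 1 - 2 * of_nat N) * l = \<mu> * l - of_nat (2 * N + 1) * l" by (simp add: algebra_simps)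
    then have "exp ((\<mu> - 1 - 2 * of_nat N) * l) = exp (\<mu> * l) / exp l ^ (2 * N + 1)" by (simp only: exp_diff exp_of_nat_mult)
    moreover have "exp l = of_real r * cis \<theta>" unfolding l_def polar_exp[OF r] ..
    moreover have "(of_real r * cis \<theta>) powr \<mu> = exp (\<mu> * l)" using r by (simp add: powr_def ln_polar l_def)
    ultimately show ?thesis using r unfolding l_def[symmetric] by (simp add: norm_divide norm_power norm_mult)
  qed
  moreover have "Re (remainder_exponent N M \<mu>) = 2 * real N - real M - Re \<mu> + 1/2" by (simp add: remainder_exponent_def)
  ultimately have C: "norm (kernel_remainder N M \<mu> \<nu> r \<theta>) \<le> ?C"
    using norm_kernel_remainder_le[OF nu r Re_remainder_exponent_pos[OF mu order_refl], of \<theta>] by (simp add: aM_over_cos_eq[OF nu] mult_ac)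
  have "norm (RNM_value N M \<mu> \<nu> r \<theta>) \<le> norm (stieltjesG M \<nu> r) * (norm (exp_term_plus N M \<mu> r \<theta>) + norm (exp_term_minus N M \<mu> r \<theta>)) + norm (kernel_remainder N M \<mu> \<nu> r \<theta>)"
    unfolding RNM_value_def
    by (rule order_trans[OF norm_triangle_ineq add_right_mono]) (simp add: norm_mult norm_power mult_left_mono norm_triangle_ineq)
  also have "\<dots> \<le> b * (norm (exp_term_plus N M \<mu> r \<theta>) + norm (exp_term_minus N M \<mu> r \<theta>)) + ?C"
    by (intro add_mono mult_right_mono G C) auto
  also have "\<dots> = ?A + ?B + ?C" unfolding distrib_left nA nB ..
  finally show ?thesis .
qed

end

section \<open>From the connection formula to the Lommel function S\<close>

lemma lommel_ak_eq: "lommel_ak k \<mu> \<nu> = 4 ^ k * pochhammer ((\<mu> + \<nu> + 1) / 2) k * pochhammer ((\<mu> - \<nu> + 1) / 2) k"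
proof (induction k)
  case (Suc k)
  have "(\<mu> + 2 * of_nat (Suc k) - 1)\<^sup>2 - \<nu>\<^sup>2 = 4 * (((\<mu> + \<nu> + 1) / 2 + of_nat k) * ((\<mu> - \<nu> + 1) / 2 + of_nat k))"
    by (simp add: field_simps power2_eq_square)
  moreover have "lommel_ak (Suc k) \<mu> \<nu> = lommel_ak k \<mu> \<nu> * ((\<mu> + 2 * of_nat (Suc k) - 1)\<^sup>2 - \<nu>\<^sup>2)"
    by (simp add: lommel_ak_def)
  ultimately show ?case using Suc by (simp only: pochhammer_Suc power_Suc mult_ac)
qed (simp add: lommel_ak_def)

lemma Ln_two: "Ln 2 = of_real (ln 2)"
  using Ln_of_real[of 2] by simp

lemma lommel_s_eq:
  assumes ab: "rGamma ((\<mu> + \<nu> + 1) / 2) \<noteq> 0" "rGamma ((\<mu> - \<nu> + 1) / 2) \<noteq> 0" and z: "z \<noteq> 0"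
  shows "lommel_s \<mu> \<nu> z = 2 powr (\<mu> - 1) * Gamma ((\<mu> + \<nu> + 1) / 2) * Gamma ((\<mu> - \<nu> + 1) / 2) * lommel_series 3 3 \<mu> \<nu> z"
proof -
  define a b where "a = (\<mu> + \<nu> + 1) / 2" and "b = (\<mu> - \<nu> + 1) / 2"
  define x where "x = - (z\<^sup>2 / 4)"
  have e: "(\<mu> + \<nu> + 3) / 2 = a + 1" "(\<mu> - \<nu> + 3) / 2 = b + 1" by (simp_all add: a_def b_def field_simps)
  have P: "1 / pochhammer c (Suc k) = Gamma c * rGamma (c + 1 + of_nat k)" if "rGamma c \<noteq> 0" for c :: complex and k
    using that pochhammer_rGamma[of c "Suc k"] by (auto simp: Gamma_def add_ac field_simps)
  have t: "(- (z\<^sup>2)) ^ k / lommel_ak (k + 1) \<mu> \<nu> = Gamma a * Gamma b / 4 * (x ^ k * rGamma (a + 1 + of_nat k) * rGamma (b + 1 + of_nat k))" for k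
  proof -
    have "(- (z\<^sup>2)) ^ k / lommel_ak (k + 1) \<mu> \<nu> = (- (z\<^sup>2)) ^ k / 4 ^ k / 4 * (1 / pochhammer a (Suc k)) * (1 / pochhammer b (Suc k))"
      by (simp add: lommel_ak_eq a_def b_def)
    also have "(- (z\<^sup>2)) ^ k / 4 ^ k = x ^ k" by (simp add: x_def power_divide[symmetric])
    finally show ?thesis unfolding P[OF ab(1)[folded a_def]] P[OF ab(2)[folded b_def]] by simp
  qed
  have "(\<Sum>k. (- (z\<^sup>2)) ^ k / lommel_ak (k + 1) \<mu> \<nu>) = Gamma a * Gamma b / 4 * rGamma_sum (a + 1) (b + 1) x"
    unfolding t rGamma_sum_def by (rule suminf_mult[OF summable_rGamma_sum])
  moreover have "z powr (\<mu> + 1) = 4 * 2 powr (\<mu> - 1) * (z / 2) powr (\<mu> + 1)"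
  proof -
    have "Ln z = Ln 2 + Ln (z / 2)" using Ln_times_of_real[of 2 "z / 2"] z by (simp add: Ln_two)
    then have "z powr (\<mu> + 1) = exp (2 * Ln 2 + (\<mu> - 1) * Ln 2 + (\<mu> + 1) * Ln (z / 2))"
      using z by (simp add: powr_def algebra_simps)
    then show ?thesis using z unfolding exp_add by (simp add: powr_def exp_double)
  qed
  moreover have "4 * p * w * (g * h / 4 * s) = p * g * h * (w * s)" for p w g h s :: complex by simp
  ultimately show ?thesis
    unfolding lommel_s_def lommel_series_def e x_def[symmetric] a_def[symmetric] b_def[symmetric] by (simp only:)
qed

text \<open>Reflection in both cosines. Two of the four reciprocal Gamma factors will cancel the
  Gamma factors in S; the other two form the prefactor of the remainder.\<close>

lemma lommel_cc_rGamma: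
  "lommel_cc \<mu> \<nu> = 4 * (rGamma ((\<mu> + \<nu> + 1) / 2) * rGamma ((\<mu> - \<nu> + 1) / 2)) * (rGamma ((\<nu> - \<mu> + 1) / 2) * rGamma ((1 - \<mu> - \<nu>) / 2))"
proof -
  have r: "cos (of_real pi * y / 2) / of_real pi = rGamma ((y + 1) / 2) * rGamma ((1 - y) / 2)" for y :: complex
    using rGamma_half_reflection[of "y / 2"] by (simp add: add_divide_distrib diff_divide_distrib add_ac)
  have "lommel_cc \<mu> \<nu> = 4 * (cos (of_real pi * (\<mu> - \<nu>) / 2) / of_real pi) * (cos (of_real pi * (\<mu> + \<nu>) / 2) / of_real pi)"
    by (simp add: lommel_cc_def power2_eq_square)
  then show ?thesis unfolding r by (simp add: mult_ac add_ac diff_diff_eq) (simp add: algebra_simps)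
qed

lemma eventually_cos_nonzero: "eventually (\<lambda>w. cos (of_real pi * (w - c) / 2) \<noteq> 0) (at (a::complex))"
proof -
  have "eventually (\<lambda>w. cos (of_real pi * (w - c) / 2) \<noteq> 0 \<and> w \<in> UNIV) (at a)"
    by (rule non_zero_neighbour_alt[where \<beta> = c]) (auto intro!: holomorphic_intros)
  then show ?thesis by simp
qed

lemma eventually_sin_nonzero: "eventually (\<lambda>w. sin (of_real pi * w) \<noteq> 0) (at (a::complex))"
proof -
  have "sin (complex_of_real pi * of_real (1/2)) = of_real (sin (pi * (1/2)))" by (simp only: sin_of_real of_real_mult[symmetric])
  then have "eventually (\<lambda>w. sin (of_real pi * w) \<noteq> 0 \<and> w \<in> UNIV) (at a)"
    by (intro non_zero_neighbour_alt[where \<beta> = "of_real (1/2)"]) (auto intro!: holomorphic_intros)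
  then show ?thesis by simp
qed

lemma lommel_cc_eventually: "eventually (\<lambda>w. lommel_cc w \<nu> \<noteq> 0) (at \<mu>)"
  using eventually_cos_nonzero[of \<nu> \<mu>] eventually_cos_nonzero[of "- \<nu>" \<mu>]
  by eventually_elim (simp add: lommel_cc_def)

lemma lommel_series_isCont:
  assumes z: "z \<notin> \<real>\<^sub>\<le>\<^sub>0"
  shows "isCont (lommel_series a b \<mu> \<nu>) z"
proof -
  have "(\<lambda>z. rGamma_sum ((\<mu> + \<nu> + a) / 2) ((\<mu> - \<nu> + b) / 2) (- (z\<^sup>2 / 4))) holomorphic_on UNIV"
    by (intro rGamma_sum_holomorphic holomorphic_intros) auto
  then have "isCont (\<lambda>z. rGamma_sum ((\<mu> + \<nu> + a) / 2) ((\<mu> - \<nu> + b) / 2) (- (z\<^sup>2 / 4))) z"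
    by (intro continuous_on_interior[OF holomorphic_on_imp_continuous_on]) auto
  moreover have "z / 2 \<notin> \<real>\<^sub>\<le>\<^sub>0" using z by (auto simp: complex_nonpos_Reals_iff)
  ultimately show ?thesis unfolding lommel_series_def[abs_def] by (intro continuous_intros) auto
qed

lemma entire_isCont:
  fixes f :: "complex \<Rightarrow> complex"
  shows "f holomorphic_on UNIV \<Longrightarrow> isCont f z"
  by (intro continuous_on_interior[OF holomorphic_on_imp_continuous_on]) auto

lemma lommel_sumN_an: "lommel_sumN N \<mu> \<nu> z = (\<Sum>n<N. (-1) ^ n * lommel_an n (- \<mu>) \<nu> / z ^ (2 * n))"
  unfolding lommel_sumN_def lommel_an_def ..

text \<open>Expressing J of order -\<nu> through Y, and cos(\<pi>(\<mu> + \<nu>)/2) by the addition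
  theorem with angles \<pi>(\<mu> - \<nu>)/2 and \<pi>\<nu>, gives the combination in the definition
  of S.\<close>

lemma lommel_lhs_eq:
  assumes "sin (of_real pi * \<nu>) \<noteq> 0"
  shows "lommel_lhs \<mu> \<nu> z = sin (of_real pi * \<nu>) * (lommel_series 3 3 \<mu> \<nu> z + sin ((\<mu> - \<nu>) * pi / 2) * besselJ \<nu> z - cos ((\<mu> - \<nu>) * pi / 2) * besselY_gen \<nu> z)"
proof -
  define u where "u = (\<mu> - \<nu>) * pi / 2"
  define v where "v = of_real pi * \<nu>"
  have e: "of_real pi * (\<mu> - \<nu>) / 2 = u" "of_real pi * (\<mu> + \<nu>) / 2 = u + v" "\<nu> * of_real pi = v"
    by (simp_all add: u_def v_def field_simps)
  have "sin v * (L + sin u * J - cos u * ((J * cos v - J') / sin v)) = sin v * L + cos u * J' - (cos u * cos v - sin u * sin v) * J" for L J J' :: complex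
    using assms by (simp add: field_simps v_def)
  then show ?thesis
    unfolding lommel_lhs_def besselY_gen_def e u_def[symmetric] v_def[symmetric] cos_add by simp
qed

text \<open>The right side of the connection formula without its factor sin(\<pi>\<nu>). The
  integral is replaced by \<open>RN_quot\<close>, which still makes sense on the rays |\<theta>| =
  \<pi>/2.\<close>

definition lommel_connection_value :: "nat \<Rightarrow> nat \<Rightarrow> complex \<Rightarrow> complex \<Rightarrow> real \<Rightarrow> real \<Rightarrow> complex" where
  "lommel_connection_value N M \<mu> \<nu> r \<theta> = (of_real r * cis \<theta>) powr (\<mu> - 1) * (exp ((1 - \<mu>) * of_real (ln 2)) * rGamma ((\<mu> + \<nu> + 1) / 2) * rGamma ((\<mu> - \<nu> + 1) / 2) * lommel_sumN N \<mu> \<nu> (of_real r * cis \<theta>))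
     + lommel_cc \<mu> \<nu> * RN_quot N M \<mu> \<nu> r \<theta>"

context
  fixes N M :: nat and r :: real
  assumes r: "r > 0"
begin

lemma connection_open:
  assumes nu: "\<bar>Re \<nu>\<bar> < real M + 1/2" and mu: "Re \<mu> < 2 * real N - real M + 1/2" and th: "\<bar>\<theta>\<bar> < pi / 2"
  shows "lommel_lhs \<mu> \<nu> (of_real r * cis \<theta>) = sin (of_real pi * \<nu>) * lommel_connection_value N M \<mu> \<nu> r \<theta>"
proof -
  define z where "z = of_real r * cis \<theta>"
  define l where "l = of_real (ln r) + \<i> * of_real \<theta>"
  have z: "Re z > 0" unfolding z_def by (rule Re_polar_pos[OF r th])
  have zl: "z = exp l" unfolding z_def l_def by (rule polar_exp[OF r])
  have "Ln z = l" unfolding z_def l_def using th by (intro ln_polar[OF nu mu r]) simp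
  then have zp: "z powr (\<mu> - 1) = exp ((\<mu> - 1) * l)" using z by (auto simp: powr_def)
  have "(\<mu> - 1 - 2 * of_nat N) * l = (\<mu> - 1) * l - of_nat (2 * N) * l" by (simp add: algebra_simps)
  then have "exp ((\<mu> - 1 - 2 * of_nat N) * l) = exp ((\<mu> - 1) * l) / z ^ (2 * N)"
    unfolding zl by (simp only: exp_diff exp_of_nat_mult)
  then have "exp ((\<mu> - 1 - 2 * of_nat N) * l) = z powr (\<mu> - 1) / z ^ (2 * N)" unfolding zp .
  then have R: "RN_quot N M \<mu> \<nu> r \<theta> = (-1) ^ N * (z powr (\<mu> - 1) / z ^ (2 * N)) * lommelI N \<mu> \<nu> z"
    using lommelI_expansion[OF nu mu r th] unfolding l_def[symmetric] z_def[symmetric] by simp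
  have "Re \<mu> + \<bar>Re \<nu>\<bar> < 2 * real N + 1" using nu mu by linarith
  from lommel_connection[OF z this]
  show ?thesis unfolding lommel_rhs_def lommel_connection_value_def R z_def[symmetric] by (simp add: algebra_simps)
qed

lemma connection_polar:
  assumes nu: "\<bar>Re \<nu>\<bar> < real M + 1/2" and mu: "Re \<mu> < 2 * real N - real M + 1/2" and th: "\<bar>\<theta>\<bar> \<le> pi / 2"
  shows "lommel_lhs \<mu> \<nu> (of_real r * cis \<theta>) = sin (of_real pi * \<nu>) * lommel_connection_value N M \<mu> \<nu> r \<theta>"
proof (cases "\<bar>\<theta>\<bar> < pi / 2")
  case False
  then have th2: "\<bar>\<theta>\<bar> = pi / 2" using th by simp
  define z where "z = of_real r * cis \<theta>"
  \<comment> \<open>Interior angles tending to the boundary angle. The shift by 2 keeps the factor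
    strictly between 0 and 1 from n = 0 on, so the boundary angle is never attained.\<close>
  define ts where "ts = (\<lambda>n. (1 - 1 / (real n + 2)) * \<theta>)"
  have "(\<lambda>n. 1 / (real n + 2)) \<longlonglongrightarrow> 0" by real_asymp
  then have "ts \<longlonglongrightarrow> (1 - 0) * \<theta>" unfolding ts_def by (intro tendsto_intros)
  then have ts: "ts \<longlonglongrightarrow> \<theta>" by simp
  have k: "0 < 1 - 1 / (real n + 2)" "1 - 1 / (real n + 2) < 1" for n by (auto simp: field_simps)
  have t1: "\<bar>ts n\<bar> < pi / 2" for n
    using mult_strict_right_mono[OF k(2), of "pi / 2"] k(1)[of n] by (simp add: ts_def abs_mult th2)
  then have t2: "ts n \<noteq> \<theta>" for n using th2 by (metis less_irrefl)
  have z: "z \<notin> \<real>\<^sub>\<le>\<^sub>0" "z \<noteq> 0"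
    using polar_slit(1)[OF r, of \<theta>] th2 pi_gt_zero r unfolding z_def by (linarith | simp)+
  have zt: "(\<lambda>n. of_real r * cis (ts n)) \<longlonglongrightarrow> z" unfolding z_def by (intro tendsto_intros ts)
  have "(\<lambda>n. lommel_connection_value N M \<mu> \<nu> r (ts n)) \<longlonglongrightarrow> lommel_connection_value N M \<mu> \<nu> r \<theta>"
    unfolding lommel_connection_value_def lommel_sumN_def z_def[symmetric]
    by (intro tendsto_intros zt RN_quot_tendsto_arg[OF nu mu r th ts t1 t2]) (use z in auto)
  then have "(\<lambda>n. sin (of_real pi * \<nu>) * lommel_connection_value N M \<mu> \<nu> r (ts n)) \<longlonglongrightarrow> sin (of_real pi * \<nu>) * lommel_connection_value N M \<mu> \<nu> r \<theta>"
    by (rule tendsto_mult_left)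
  moreover have "(\<lambda>n. lommel_lhs \<mu> \<nu> (of_real r * cis (ts n))) \<longlonglongrightarrow> lommel_lhs \<mu> \<nu> z"
    unfolding lommel_lhs_def besselJ_eq
    by (intro tendsto_intros isCont_tendsto_compose[OF lommel_series_isCont[OF z(1)] zt])
  ultimately show ?thesis
    unfolding connection_open[OF nu mu t1] z_def using LIMSEQ_unique by blast
qed (rule connection_open[OF nu mu])

lemma lommel_connection_value_isCont_nu:
  assumes nu: "\<bar>Re \<nu>\<bar> < real M + 1/2" and mu: "Re \<mu> < 2 * real N - real M + 1/2" and th: "\<bar>\<theta>\<bar> \<le> pi / 2"
  shows "isCont (\<lambda>\<nu>. lommel_connection_value N M \<mu> \<nu> r \<theta>) \<nu>"
  unfolding lommel_connection_value_def
  by (intro continuous_intros RN_quot_isCont_nu nu mu r th entire_isCont lommel_sumN_holomorphic lommel_cc_holomorphic holomorphic_intros) auto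

text \<open>At integer orders the connection formula degenerates to 0 = 0, since sin(\<pi>\<nu>)
  vanishes. Solving it for Y at nearby orders and letting \<nu> tend to the integer recovers the
  information.\<close>

lemma connection_besselY:
  assumes nu: "\<bar>Re \<nu>\<bar> < real M + 1/2" and mu: "Re \<mu> < 2 * real N - real M + 1/2" and th: "\<bar>\<theta>\<bar> \<le> pi / 2"
    and cc: "lommel_cc \<mu> \<nu> \<noteq> 0"
  defines "z \<equiv> of_real r * cis \<theta>"
  shows "lommel_series 3 3 \<mu> \<nu> z + sin ((\<mu> - \<nu>) * pi / 2) * besselJ \<nu> z - cos ((\<mu> - \<nu>) * pi / 2) * besselY \<nu> z = lommel_connection_value N M \<mu> \<nu> r \<theta>"
proof -
  have z: "z \<noteq> 0" using r by (simp add: z_def)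
  have g: "lommel_series 3 3 \<mu> \<nu> z + sin ((\<mu> - \<nu>) * pi / 2) * besselJ \<nu> z - cos ((\<mu> - \<nu>) * pi / 2) * besselY_gen \<nu> z = lommel_connection_value N M \<mu> \<nu> r \<theta>"
    if "sin (of_real pi * \<nu>) \<noteq> 0" "\<bar>Re \<nu>\<bar> < real M + 1/2" for \<nu>
    using connection_polar[OF that(2) mu th] that(1) unfolding lommel_lhs_eq[OF that(1)] z_def[symmetric] by simp
  have c0: "cos ((\<mu> - \<nu>) * pi / 2) \<noteq> 0" using cc by (auto simp: lommel_cc_def mult_ac)
  show ?thesis
  proof (cases "sin (of_real pi * \<nu>) = 0")
    case False
    then show ?thesis using g[OF _ nu] by (simp add: besselY_def mult.commute)
  next
    case True
    \<comment> \<open>The value of Y dictated by the identity. It is continuous at \<nu> because the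
      cosine is nonzero when \<open>lommel_cc\<close> is, and it agrees with
      \<open>besselY_gen\<close> near \<nu>, so it equals the limit defining Y.\<close>
    define H where "H = (\<lambda>\<nu>. (lommel_series 3 3 \<mu> \<nu> z + sin ((\<mu> - \<nu>) * pi / 2) * besselJ \<nu> z - lommel_connection_value N M \<mu> \<nu> r \<theta>) / cos ((\<mu> - \<nu>) * pi / 2))"
    have "isCont H \<nu>"
      unfolding H_def besselJ_eq
      by (intro continuous_intros lommel_connection_value_isCont_nu[OF nu mu th] entire_isCont lommel_series_holomorphic holomorphic_intros z c0) auto
    then have H: "(H \<longlongrightarrow> H \<nu>) (at \<nu>)" by (simp add: isCont_def)
    have "eventually (\<lambda>w. \<bar>Re w\<bar> < real M + 1/2) (at \<nu>)"
      by (rule order_tendstoD[OF _ nu]) (intro tendsto_intros)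
    then have "eventually (\<lambda>w. H w = besselY_gen w z) (at \<nu>)"
      using eventually_sin_nonzero[of \<nu>] eventually_cos_nonzero[of \<mu> \<nu>]
    proof eventually_elim
      case (elim w)
      have "(\<mu> - w) * pi / 2 = - (of_real pi * (w - \<mu>) / 2)" by (simp add: field_simps)
      then have "cos ((\<mu> - w) * pi / 2) = cos (of_real pi * (w - \<mu>) / 2)" by (simp only: cos_minus)
      then have "cos ((\<mu> - w) * pi / 2) \<noteq> 0" using elim by simp
      then show ?case using g[OF elim(2,1)] unfolding H_def by (simp add: field_simps)
    qed
    from tendsto_Lim[OF at_neq_bot Lim_transform_eventually[OF H this]]
    have "besselY \<nu> z = H \<nu>" using True by (simp add: besselY_def mult.commute)
    then show ?thesis using c0 by (simp add: H_def)
  qed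
qed

definition lommel_S_value :: "complex \<Rightarrow> complex \<Rightarrow> real \<Rightarrow> complex" where
  "lommel_S_value \<mu> \<nu> \<theta> = (of_real r * cis \<theta>) powr (\<mu> - 1) * lommel_sumN N \<mu> \<nu> (of_real r * cis \<theta>) + RNM_prefactor \<mu> \<nu> * RN_quot N M \<mu> \<nu> r \<theta>"

text \<open>Multiplying by 2^(\<mu>-1) and the two Gamma factors undoes the normalisation of the
  connection formula: the finite sum appears with coefficient one, and \<open>lommel_cc\<close> is
  reduced to the prefactor.\<close>

lemma lommel_S_gen_eq:
  assumes nu: "\<bar>Re \<nu>\<bar> < real M + 1/2" and mu: "Re \<mu> < 2 * real N - real M + 1/2" and th: "\<bar>\<theta>\<bar> \<le> pi / 2"
    and cc: "lommel_cc \<mu> \<nu> \<noteq> 0"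
  shows "lommel_S_gen \<mu> \<nu> (of_real r * cis \<theta>) = lommel_S_value \<mu> \<nu> \<theta>"
proof -
  define z where "z = of_real r * cis \<theta>"
  define a b where "a = (\<mu> + \<nu> + 1) / 2" and "b = (\<mu> - \<nu> + 1) / 2"
  have z: "z \<noteq> 0" using r by (simp add: z_def)
  have ab: "rGamma a \<noteq> 0" "rGamma b \<noteq> 0" using cc unfolding lommel_cc_rGamma a_def b_def by auto
  then have G: "Gamma a * rGamma a = 1" "Gamma b * rGamma b = 1" by (auto simp: Gamma_def)
  have E: "2 powr (\<mu> - 1) * exp ((1 - \<mu>) * of_real (ln 2)) = (1 :: complex)"
    by (simp add: powr_def Ln_two exp_add[symmetric] algebra_simps)
  have P: "2 powr (\<mu> + 1) = 4 * (2 powr (\<mu> - 1) :: complex)"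
  proof -
    have "2 powr (\<mu> + 1) = exp (2 * Ln 2 + (\<mu> - 1) * Ln 2)" by (simp add: powr_def algebra_simps)
    then show ?thesis unfolding exp_add by (simp add: powr_def exp_double)
  qed
  define c where "c = 2 powr (\<mu> - 1) * Gamma a * Gamma b"
  have "lommel_S_gen \<mu> \<nu> z = c * (lommel_series 3 3 \<mu> \<nu> z + sin ((\<mu> - \<nu>) * pi / 2) * besselJ \<nu> z - cos ((\<mu> - \<nu>) * pi / 2) * besselY \<nu> z)"
    unfolding lommel_S_gen_def lommel_s_eq[OF ab[unfolded a_def b_def] z] c_def a_def b_def by (simp add: algebra_simps)
  also have "\<dots> = c * lommel_connection_value N M \<mu> \<nu> r \<theta>"
    unfolding z_def using connection_besselY[OF nu mu th cc] by simp
  also have "\<dots> = (2 powr (\<mu> - 1) * exp ((1 - \<mu>) * of_real (ln 2))) * (Gamma a * rGamma a) * (Gamma b * rGamma b) * (z powr (\<mu> - 1) * lommel_sumN N \<mu> \<nu> z)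
     + c * lommel_cc \<mu> \<nu> * RN_quot N M \<mu> \<nu> r \<theta>"
    unfolding lommel_connection_value_def z_def[symmetric] a_def[symmetric] b_def[symmetric] c_def by (simp add: algebra_simps)
  also have "c * lommel_cc \<mu> \<nu> = (Gamma a * rGamma a) * (Gamma b * rGamma b) * RNM_prefactor \<mu> \<nu>"
    unfolding lommel_cc_rGamma RNM_prefactor_def P c_def a_def[symmetric] b_def[symmetric] by (simp add: mult_ac)
  finally show ?thesis unfolding G E lommel_S_value_def z_def by simp
qed

lemma lommel_S_value_isCont:
  assumes nu: "\<bar>Re \<nu>\<bar> < real M + 1/2" and mu: "Re \<mu> < 2 * real N - real M + 1/2" and th: "\<bar>\<theta>\<bar> \<le> pi / 2"
  shows "isCont (\<lambda>\<mu>. lommel_S_value \<mu> \<nu> \<theta>) \<mu>"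
proof -
  have "isCont (\<lambda>\<mu>. RNM_prefactor \<mu> \<nu>) \<mu>"
    unfolding RNM_prefactor_def by (intro entire_isCont holomorphic_intros) auto
  moreover have "isCont (\<lambda>\<mu>. (of_real r * cis \<theta>) powr (\<mu> - 1)) \<mu>"
    using r by (intro entire_isCont holomorphic_intros)
  moreover have "isCont (\<lambda>\<mu>. lommel_sumN N \<mu> \<nu> (of_real r * cis \<theta>)) \<mu>"
    by (intro entire_isCont lommel_sumN_holomorphic holomorphic_intros)
  ultimately show ?thesis unfolding lommel_S_value_def
    by (intro isCont_add isCont_mult RN_quot_isCont_mu[OF nu mu r th])
qed

lemma rGamma_zero_exceptional:
  assumes "rGamma ((w + 1) / 2 :: complex) = 0"
  shows "\<exists>k::nat. w = - (2 * of_nat k + 1)"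
proof -
  obtain n where n: "(w + 1) / 2 = - of_nat n"
    using assms by (auto simp: rGamma_eq_zero_iff elim!: nonpos_Ints_cases')
  have "w = 2 * ((w + 1) / 2) - 1" by (simp add: field_simps)
  also have "\<dots> = - (2 * of_nat n + 1)" unfolding n by simp
  finally show ?thesis by blast
qed

text \<open>At exceptional parameters S is a limit in \<mu>. The candidate value is continuous in
  \<mu> and agrees with S at all nearby points where \<open>lommel_cc\<close> is nonzero, that is,
  in a punctured neighbourhood.\<close>

lemma lommel_S_eq:
  assumes nu: "\<bar>Re \<nu>\<bar> < real M + 1/2" and mu: "Re \<mu> < 2 * real N - real M + 1/2" and th: "\<bar>\<theta>\<bar> \<le> pi / 2"
    and pref: "RNM_prefactor \<mu> \<nu> \<noteq> 0"
  shows "lommel_S \<mu> \<nu> (of_real r * cis \<theta>) = lommel_S_value \<mu> \<nu> \<theta>"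
proof (cases "\<exists>k::nat. \<mu> + \<nu> = - (2 * of_nat k + 1) \<or> \<mu> - \<nu> = - (2 * of_nat k + 1)")
  case True
  have "((\<lambda>\<mu>. lommel_S_value \<mu> \<nu> \<theta>) \<longlongrightarrow> lommel_S_value \<mu> \<nu> \<theta>) (at \<mu>)"
    using lommel_S_value_isCont[OF nu mu th] by (simp add: isCont_def)
  moreover have "eventually (\<lambda>w. Re w < 2 * real N - real M + 1/2) (at \<mu>)"
    by (rule order_tendstoD[OF _ mu]) (intro tendsto_intros)
  then have "eventually (\<lambda>w. lommel_S_value w \<nu> \<theta> = lommel_S_gen w \<nu> (of_real r * cis \<theta>)) (at \<mu>)"
    using lommel_cc_eventually[of \<nu> \<mu>] by eventually_elim (rule lommel_S_gen_eq[OF nu _ th, symmetric])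
  ultimately have "((\<lambda>w. lommel_S_gen w \<nu> (of_real r * cis \<theta>)) \<longlongrightarrow> lommel_S_value \<mu> \<nu> \<theta>) (at \<mu>)"
    by (rule Lim_transform_eventually)
  from tendsto_Lim[OF at_neq_bot this] show ?thesis using True by (simp add: lommel_S_def)
next
  case False
  then have "rGamma ((\<mu> + \<nu> + 1) / 2) \<noteq> 0" "rGamma ((\<mu> - \<nu> + 1) / 2) \<noteq> 0"
    using rGamma_zero_exceptional by blast+
  \<comment> \<open>All four reciprocal Gamma factors are nonzero: two because the parameters are
    not exceptional, two because the prefactor does not vanish.\<close>
  then have "lommel_cc \<mu> \<nu> \<noteq> 0" using pref by (simp add: lommel_cc_rGamma RNM_prefactor_def)
  from lommel_S_gen_eq[OF nu mu th this] show ?thesis unfolding lommel_S_def using False by (simp only: if_False)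
qed

lemma RNM_gen_value:
  assumes nu: "\<bar>Re \<nu>\<bar> < real M + 1/2" and mu: "Re \<mu> < 2 * real N - real M + 1/2" and th: "\<bar>\<theta>\<bar> \<le> pi / 2"
    and pref: "RNM_prefactor \<mu> \<nu> \<noteq> 0"
  shows "RNM_gen N M \<mu> \<nu> r \<theta> = RNM_value N M \<mu> \<nu> r \<theta>"
  unfolding RNM_gen_eq lommel_RN_def lommel_S_eq[OF assms] lommel_S_value_def lommel_sumN_an[symmetric]
  using pref by (simp add: RN_quot_def)

text \<open>Where the prefactor vanishes the remainder is a limit in \<mu>, and
  \<open>RNM_value\<close> is continuous there. Near \<mu> the factor \<open>lommel_cc\<close> is
  nonzero, hence so is the prefactor, and the two expressions agree.\<close>

lemma lommel_RNM_eq: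
  assumes nu: "\<bar>Re \<nu>\<bar> < real M + 1/2" and mu: "Re \<mu> < 2 * real N - real M + 1/2" and th: "\<bar>\<theta>\<bar> \<le> pi / 2"
  shows "lommel_RNM N M \<mu> \<nu> r \<theta> = RNM_value N M \<mu> \<nu> r \<theta>"
proof (cases "RNM_prefactor \<mu> \<nu> = 0")
  case True
  have "((\<lambda>\<mu>. RNM_value N M \<mu> \<nu> r \<theta>) \<longlongrightarrow> RNM_value N M \<mu> \<nu> r \<theta>) (at \<mu>)"
    using RNM_value_isCont_mu[OF nu mu r th] by (simp add: isCont_def)
  moreover have "eventually (\<lambda>w. Re w < 2 * real N - real M + 1/2) (at \<mu>)"
    by (rule order_tendstoD[OF _ mu]) (intro tendsto_intros)
  then have "eventually (\<lambda>w. RNM_value N M w \<nu> r \<theta> = RNM_gen N M w \<nu> r \<theta>) (at \<mu>)"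
    using lommel_cc_eventually[of \<nu> \<mu>]
    by eventually_elim (rule RNM_gen_value[OF nu _ th, symmetric], auto simp: lommel_cc_rGamma RNM_prefactor_def)
  ultimately have "((\<lambda>w. RNM_gen N M w \<nu> r \<theta>) \<longlongrightarrow> RNM_value N M \<mu> \<nu> r \<theta>) (at \<mu>)"
    by (rule Lim_transform_eventually)
  from tendsto_Lim[OF at_neq_bot this] show ?thesis using True by (simp add: lommel_RNM_def)
qed (simp add: lommel_RNM_def RNM_gen_value[OF assms])

end

theorem theorem3:
  fixes N M :: nat and \<mu> \<nu> :: complex and r \<theta> :: real
  assumes "\<bar>Re \<nu>\<bar> < real M + 1/2"
    and "Re \<mu> < 2 * real N - real M + 1/2"
    and "r > 0" and "\<bar>\<theta>\<bar> \<le> pi / 2"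
  shows "norm (lommel_RNM N M \<mu> \<nu> r \<theta>)
    \<le> pi * norm (exp (pi / 2 * \<i> * \<mu>)) * sqrt (pi / (2 * r))
          * norm (cos (pi * \<nu>)) * aM_over_cos M (Re \<nu>) / r ^ M
          * norm (exp (\<i> * (of_real r * cis \<theta>))
                  * terminant_polar (of_nat (2 * N) - of_nat M - \<mu> + 1/2) r (\<theta> + pi / 2))
     + pi * norm (exp (- pi / 2 * \<i> * \<mu>)) * sqrt (pi / (2 * r))
          * norm (cos (pi * \<nu>)) * aM_over_cos M (Re \<nu>) / r ^ M
          * norm (exp (2 * pi * \<i> * \<mu>) * exp (- \<i> * (of_real r * cis \<theta>))
                  * terminant_polar (of_nat (2 * N) - of_nat M - \<mu> + 1/2) r (\<theta> - pi / 2))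
     + sqrt (pi / 2) * norm ((of_real r * cis \<theta>) powr \<mu>)
          * norm (cos (pi * \<nu>)) * aM_over_cos M (Re \<nu>)
          * Gamma (2 * real N - real M - Re \<mu> + 1/2) / r ^ (2 * N + 1)"
  unfolding lommel_RNM_eq[OF assms(3,1,2,4)] by (rule norm_RNM_value_le[OF assms])

end
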